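(* Let $\mathbb{K}$ be a commutative superring and $\mathfrak{g}$ a Lie $\mathbb{K}$-superalgebra. Assume that $\frac12\in\mathbb{K}$, or that $\mathbb{K}=\mathbb{K}_0$ and $\mathfrak{g}=\mathfrak{g}_0$. Assume moreover that either $\mathbb{K}\supseteq\mathbb{Q}$, or $\mathfrak{g}$ is $N$-nilpotent for some $N\ge2$ with $\frac12,\dots,\frac1N\in\mathbb{K}$. Let $\sigma:U(\mathfrak{g})\to S(\mathfrak{g})$ be the symbol map. Then: (i) $\sigma$ is invertible; (ii) $\mathfrak{g}$ verifies the strong Poincaré–Birkhoff–Witt theorem with $\rho=\sigma^{-1}$.
   Context: Conventions. A commutative superring $\mathbb{K}=\mathbb{K}_0\oplus\mathbb{K}_1$ is a unital $\mathbb{Z}/2$-graded ring with $ab=(-1)^{p(a)p(b)}ba$ and $a^2=0$ for $a\in\mathbb{K}_1$; $p$ denotes parity, and formulas containing $p(\cdot)$ are written for nonzero homogeneous elements and extended by linearity. A $\mathbb{K}$-module $M=M_0\oplus M_1$ is a graded right module with $p(m\alpha)=p(m)+p(\alpha)$, and $\alpha m:=(-1)^{p(\alpha)p(m)}m\alpha$. $Hom(M,N)$ is the graded group of right $\mathbb{K}$-linear maps; $(F\otimes G)(v\otimes w)=(-1)^{p(G)p(v)}F(v)\otimes G(w)$. $\mathbb{K}\supseteq\mathbb{Q}$ means all positive integers are invertible in $\mathbb{K}$. A Lie $\mathbb{K}$-superalgebra is a $\mathbb{K}$-module $\mathfrak{g}$ with an even $\mathbb{K}$-bilinear bracket satisfying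 $[X,Y]=-(-1)^{p(X)p(Y)}[Y,X]$; $[X,X]=0$ for $X\in\mathfrak{g}_0$; $[[X,Y],Z]=[X,[Y,Z]]-(-1)^{p(X)p(Y)}[Y,[X,Z]]$; $[Y,[Y,Y]]=0$ for $Y\in\mathfrak{g}_1$. Write $\mathrm{ad}X=[X,\cdot]$. $\mathfrak{g}$ is $N$-nilpotent if $\mathrm{ad}X_1\circ\cdots\circ\mathrm{ad}X_N=0$ for all $X_i\in\mathfrak{g}$. $S(\mathfrak{g})=\bigoplus_nS^n(\mathfrak{g})$ is the quotient of $T(\mathfrak{g})$ by the ideal generated by $v\otimes w-(-1)^{p(v)p(w)}w\otimes v$ and $u\otimes u$ ($u\in\mathfrak{g}_1$); $\Delta:S(\mathfrak{g})\to S(\mathfrak{g})\otimes S(\mathfrak{g})$ is the superalgebra morphism with $\Delta(X)=X\otimes1+1\otimes X$, $X\in\mathfrak{g}$. $U(\mathfrak{g})$ is the quotient of $T(\mathfrak{g})$ by the ideal generated by $a\otimes b-(-1)^{p(a)p(b)}b\otimes a-[a,b]$; $j:\mathfrak{g}\to U(\mathfrak{g})$ is the canonical map; $U_n=U_n(\mathfrak{g})$ is the submodule generated by products $j(X_1)\cdots j(X_l)$, $l\le n$ ($U_0=\mathbb{K}$); $gr(U(\mathfrak{g}))$ is the associated graded algebra (commutative under the assumptions), and $\tilde j:S(\mathfrak{g})\to gr(U(\mathfrak{g}))$ is the algebra morphism $X_1\cdots X_n\mapsto j(X_1)\cdots j(X_n)\bmod U_{n-1}$. Strong Poincaré–Birkhoff–Witt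 theorem with $\rho$: $\rho\in Hom(S(\mathfrak{g}),U(\mathfrak{g}))$ is an isomorphism such that (1) $\rho(S^n(\mathfrak{g}))\subseteq U_n(\mathfrak{g})$ for all $n$; (2) the associated graded map $gr(\rho)$ is $\tilde j$; (3) $\rho$ commutes with every derivation and every automorphism of $\mathfrak{g}$, i.e. $\rho$ intertwines the maps on $S(\mathfrak{g})$ and on $U(\mathfrak{g})$ obtained by extending a derivation of $\mathfrak{g}$ to derivations (resp. an automorphism of $\mathfrak{g}$ to superalgebra automorphisms). Symbol map. Let $\varphi_1(t)=\frac{t}{e^t-1}=\sum_nc_nt^n$ (in the $N$-nilpotent case only the terms $n<N$ are used; their coefficients lie in $\mathbb{Z}[\frac1{N!}]$). For $a\in\mathfrak{g}$ let $\varphi_1^a\in Hom(S(\mathfrak{g}),\mathfrak{g})$ be given by $\varphi_1^a(1)=c_0a$ and $$\varphi_1^a(X_1\cdots X_n)=(-1)^{p(a)(p(X_1)+\cdots+p(X_n))}c_n\sum_{s\in\Sigma_n}\alpha(X_{s(1)},\dots,X_{s(n)})\,\mathrm{ad}X_{s(1)}\circ\cdots\circ\mathrm{ad}X_{s(n)}(a)$$ (zero for $n\ge N$ in the nilpotent case), with $\alpha=\pm1$ the Koszul sign such that $\alpha(X_{s(1)},\dots,X_{s(n)})X_{s(1)}\cdots X_{s(n)}=X_1\cdots X_n$ in $S(\mathfrak{g})$. Put $\Phi_1^a=\mathrm{Mult}\circ(id\otimes\varphi_1^a)\circ\Delta$, $\mathrm{Mult}$ being the multiplication of $S(\mathfrak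 g)$. The map $a\mapsto\Phi_1^a$ is a representation of $\mathfrak{g}$ in $S(\mathfrak{g})$, so it extends to an algebra morphism $\Phi:U(\mathfrak{g})\to Hom(S(\mathfrak{g}),S(\mathfrak{g}))$ with $\Phi(j(a))=\Phi_1^a$; the symbol map is $\sigma(u):=\Phi(u)(1)$. *)

theory Defs
  imports
    "HOL-Algebra.QuotRing"
    "HOL-Algebra.Generated_Groups"
    "HOL-Algebra.Free_Abelian_Groups"
    "HOL-Combinatorics.Permutations"
    "HOL-Computational_Algebra.Formal_Power_Series"
    "HOL-Library.Z2"
begin

section \<open>Superrings, supermodules, superalgebras\<close>

text \<open>
  Parities are elements of the field \<open>bit\<close> of integers mod 2.  As with the record \<open>module\<close> of
  HOL-Algebra, one record serves modules and algebras; for a bare module the fields \<open>mult\<close> and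
  \<open>one\<close> are irrelevant.
\<close>

record 'a sring = "'a ring" +
  hpart :: "bit \<Rightarrow> 'a set"

record ('k, 'a) smod = "'a sring" +
  rsmult :: "'a \<Rightarrow> 'k \<Rightarrow> 'a"  (infixl "\<bullet>\<index>" 70)

record ('k, 'a) lie_sring = "('k, 'a) smod" +
  lbr :: "'a \<Rightarrow> 'a \<Rightarrow> 'a"

text \<open>$(-1)^k x$\<close>

definition sg :: "('a, 'r) ring_scheme \<Rightarrow> bit \<Rightarrow> 'a \<Rightarrow> 'a" where
  "sg M k x = (if k = 1 then \<ominus>\<^bsub>M\<^esub> x else x)"

text \<open>The component of parity \<open>i\<close> of \<open>x\<close>.\<close>

definition hcomp :: "('a, 'r) sring_scheme \<Rightarrow> bit \<Rightarrow> 'a \<Rightarrow> 'a" where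
  "hcomp M i x = (THE y. y \<in> hpart M i \<and> x \<ominus>\<^bsub>M\<^esub> y \<in> hpart M (i + 1))"

locale graded_group = abelian_group M for M (structure) +
  assumes hpart_subgroup: "subgroup (hpart M i) (add_monoid M)"
    and hpart_disjoint: "hpart M 0 \<inter> hpart M 1 = {\<zero>}"
    and hpart_sum: "hpart M 0 <+> hpart M 1 = carrier M"

locale comm_superring = ring K + graded_group K for K (structure) +
  assumes hpart_one: "\<one> \<in> hpart K 0"
    and hpart_mult: "\<lbrakk>a \<in> hpart K i; b \<in> hpart K j\<rbrakk> \<Longrightarrow> a \<otimes> b \<in> hpart K (i + j)"
    and supercomm: "\<lbrakk>a \<in> hpart K i; b \<in> hpart K j\<rbrakk> \<Longrightarrow> a \<otimes> b = sg K (i * j) (b \<otimes> a)"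
    and odd_square: "a \<in> hpart K 1 \<Longrightarrow> a \<otimes> a = \<zero>"

locale supermodule = K: comm_superring K + graded_group M for K and M (structure) +
  assumes rsmult_hpart:
      "\<lbrakk>m \<in> hpart M i; a \<in> hpart K j\<rbrakk> \<Longrightarrow> m \<bullet> a \<in> hpart M (i + j)"
    and rsmult_closed: "\<lbrakk>m \<in> carrier M; a \<in> carrier K\<rbrakk> \<Longrightarrow> m \<bullet> a \<in> carrier M"
    and rsmult_add_left:
      "\<lbrakk>m \<in> carrier M; n \<in> carrier M; a \<in> carrier K\<rbrakk> \<Longrightarrow> (m \<oplus> n) \<bullet> a = m \<bullet> a \<oplus> n \<bullet> a"
    and rsmult_add_right:
      "\<lbrakk>m \<in> carrier M; a \<in> carrier K; b \<in> carrier K\<rbrakk>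
        \<Longrightarrow> m \<bullet> (a \<oplus>\<^bsub>K\<^esub> b) = m \<bullet> a \<oplus> m \<bullet> b"
    and rsmult_assoc:
      "\<lbrakk>m \<in> carrier M; a \<in> carrier K; b \<in> carrier K\<rbrakk>
        \<Longrightarrow> m \<bullet> (a \<otimes>\<^bsub>K\<^esub> b) = (m \<bullet> a) \<bullet> b"
    and rsmult_one: "m \<in> carrier M \<Longrightarrow> m \<bullet> \<one>\<^bsub>K\<^esub> = m"

text \<open>The left action: $\alpha m = (-1)^{p(\alpha)p(m)} m\alpha$, extended bilinearly.\<close>

definition lsmult ::
    "'k sring \<Rightarrow> ('k, 'a, 'r) smod_scheme \<Rightarrow> 'k \<Rightarrow> 'a \<Rightarrow> 'a" where
  "lsmult K M a m =
    (\<Oplus>\<^bsub>M\<^esub>i\<in>{0,1}. \<Oplus>\<^bsub>M\<^esub>j\<in>{0,1}. sg M (i * j) (hcomp M j m \<bullet>\<^bsub>M\<^esub> hcomp K i a))"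

text \<open>
  Right \<open>K\<close>-linear maps, with the value \<open>undefined\<close> outside the carrier, so that maps are equal
  iff they agree on the carrier.  Every such map is the sum of its two homogeneous components.
\<close>

definition Hom ::
    "'k sring \<Rightarrow> ('k, 'a, 'r) smod_scheme \<Rightarrow> ('k, 'b, 's) smod_scheme \<Rightarrow> ('a \<Rightarrow> 'b) set" where
  "Hom K M N = {f \<in> carrier M \<rightarrow>\<^sub>E carrier N.
     (\<forall>x\<in>carrier M. \<forall>y\<in>carrier M. f (x \<oplus>\<^bsub>M\<^esub> y) = f x \<oplus>\<^bsub>N\<^esub> f y) \<and>
     (\<forall>x\<in>carrier M. \<forall>a\<in>carrier K. f (x \<bullet>\<^bsub>M\<^esub> a) = f x \<bullet>\<^bsub>N\<^esub> a)}"

definition hom_comp ::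
    "('a, 'r) sring_scheme \<Rightarrow> ('b, 's) sring_scheme \<Rightarrow> bit \<Rightarrow> ('a \<Rightarrow> 'b) \<Rightarrow> 'a \<Rightarrow> 'b" where
  "hom_comp M N d f = (\<lambda>x\<in>carrier M. \<Oplus>\<^bsub>N\<^esub>j\<in>{0,1}. hcomp N (d + j) (f (hcomp M j x)))"

definition preserves_parity ::
    "('a, 'r) sring_scheme \<Rightarrow> ('b, 's) sring_scheme \<Rightarrow> ('a \<Rightarrow> 'b) \<Rightarrow> bool" where
  "preserves_parity M N f \<longleftrightarrow> (\<forall>i. f ` hpart M i \<subseteq> hpart N i)"

definition superalg_hom ::
    "'k sring \<Rightarrow> ('k, 'a) smod \<Rightarrow> ('k, 'b) smod \<Rightarrow> ('a \<Rightarrow> 'b) set" where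
  "superalg_hom K A B = {f \<in> Hom K A B. f \<in> ring_hom A B \<and> preserves_parity A B f}"

text \<open>
  $\mathrm{Hom}(M,M)$ as a superalgebra under composition; the right action
  $(F\alpha)(v) = F(\alpha v)$ is the one for which $\alpha F$ is $v \mapsto \alpha F(v)$.
\<close>

definition End_alg :: "'k sring \<Rightarrow> ('k, 'a, 'r) smod_scheme \<Rightarrow> ('k, 'a \<Rightarrow> 'a) smod" where
  "End_alg K M =
    \<lparr>carrier = Hom K M M,
     monoid.mult = compose (carrier M),
     one = (\<lambda>x\<in>carrier M. x),
     ring.zero = (\<lambda>x\<in>carrier M. \<zero>\<^bsub>M\<^esub>),
     add = (\<lambda>f g. \<lambda>x\<in>carrier M. f x \<oplus>\<^bsub>M\<^esub> g x),
     hpart = (\<lambda>i. {f \<in> Hom K M M. \<forall>j. f ` hpart M j \<subseteq> hpart M (i + j)}),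
     rsmult = (\<lambda>f a. \<lambda>x\<in>carrier M. f (lsmult K M a x))\<rparr>"

definition quot_alg :: "('k, 'a) smod \<Rightarrow> 'a set \<Rightarrow> ('k, 'a set) smod" where
  "quot_alg A I =
    \<lparr>carrier = carrier (A Quot I),
     monoid.mult = monoid.mult (A Quot I),
     one = one (A Quot I),
     ring.zero = ring.zero (A Quot I),
     add = add (A Quot I),
     hpart = (\<lambda>i. (\<lambda>x. I +>\<^bsub>A\<^esub> x) ` hpart A i),
     rsmult = (\<lambda>C a. \<Union>c\<in>C. I +>\<^bsub>A\<^esub> (c \<bullet>\<^bsub>A\<^esub> a))\<rparr>"

definition rspan :: "'k sring \<Rightarrow> ('k, 'a, 'r) smod_scheme \<Rightarrow> 'a set \<Rightarrow> 'a set" where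
  "rspan K M B = generate (add_monoid M) {b \<bullet>\<^bsub>M\<^esub> a | b a. b \<in> B \<and> a \<in> carrier K}"

definition mprod :: "('a, 'r) monoid_scheme \<Rightarrow> 'a list \<Rightarrow> 'a" where
  "mprod A xs = foldr (monoid.mult A) xs \<one>\<^bsub>A\<^esub>"

text \<open>A derivation is a map both of whose homogeneous components obey the signed Leibniz rule.\<close>

definition superderivation ::
    "'k sring \<Rightarrow> ('k, 'a, 'r) smod_scheme \<Rightarrow> ('a \<Rightarrow> 'a \<Rightarrow> 'a) \<Rightarrow> ('a \<Rightarrow> 'a) \<Rightarrow> bool" where
  "superderivation K M pr D \<longleftrightarrow> D \<in> Hom K M M \<and>
    (\<forall>d i. \<forall>x\<in>hpart M i. \<forall>y\<in>carrier M.
       hom_comp M M d D (pr x y) =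
         pr (hom_comp M M d D x) y \<oplus>\<^bsub>M\<^esub> sg M (d * i) (pr x (hom_comp M M d D y)))"


section \<open>Lie superalgebras\<close>

locale lie_superalgebra = supermodule K L for K and L (structure) +
  assumes lbr_hpart: "\<lbrakk>x \<in> hpart L i; y \<in> hpart L j\<rbrakk> \<Longrightarrow> lbr L x y \<in> hpart L (i + j)"
    and lbr_closed: "\<lbrakk>x \<in> carrier L; y \<in> carrier L\<rbrakk> \<Longrightarrow> lbr L x y \<in> carrier L"
    and lbr_add_left:
      "\<lbrakk>x \<in> carrier L; y \<in> carrier L; z \<in> carrier L\<rbrakk>
        \<Longrightarrow> lbr L (x \<oplus> y) z = lbr L x z \<oplus> lbr L y z"
    and lbr_add_right:
      "\<lbrakk>x \<in> carrier L; y \<in> carrier L; z \<in> carrier L\<rbrakk>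
        \<Longrightarrow> lbr L x (y \<oplus> z) = lbr L x y \<oplus> lbr L x z"
    and lbr_balanced:
      "\<lbrakk>x \<in> carrier L; y \<in> carrier L; a \<in> carrier K\<rbrakk>
        \<Longrightarrow> lbr L (x \<bullet> a) y = lbr L x (lsmult K L a y)"
    and lbr_rsmult:
      "\<lbrakk>x \<in> carrier L; y \<in> carrier L; a \<in> carrier K\<rbrakk> \<Longrightarrow> lbr L x (y \<bullet> a) = lbr L x y \<bullet> a"
    and lbr_skew:
      "\<lbrakk>x \<in> hpart L i; y \<in> hpart L j\<rbrakk> \<Longrightarrow> lbr L x y = \<ominus> sg L (i * j) (lbr L y x)"
    and lbr_even: "x \<in> hpart L 0 \<Longrightarrow> lbr L x x = \<zero>"
    and lbr_jacobi:
      "\<lbrakk>x \<in> hpart L i; y \<in> hpart L j; z \<in> carrier L\<rbrakk>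
        \<Longrightarrow> lbr L (lbr L x y) z = lbr L x (lbr L y z) \<ominus> sg L (i * j) (lbr L y (lbr L x z))"
    and lbr_odd: "y \<in> hpart L 1 \<Longrightarrow> lbr L y (lbr L y y) = \<zero>"

definition lie_nilpotent :: "('k, 'g) lie_sring \<Rightarrow> nat \<Rightarrow> bool" where
  "lie_nilpotent L N \<longleftrightarrow>
    (\<forall>Xs. set Xs \<subseteq> carrier L \<and> length Xs = N \<longrightarrow>
      (\<forall>Y\<in>carrier L. foldr (lbr L) Xs Y = \<zero>\<^bsub>L\<^esub>))"

definition lie_derivation :: "'k sring \<Rightarrow> ('k, 'g) lie_sring \<Rightarrow> ('g \<Rightarrow> 'g) \<Rightarrow> bool" where
  "lie_derivation K L D \<longleftrightarrow> superderivation K L (lbr L) D"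

definition lie_automorphism :: "'k sring \<Rightarrow> ('k, 'g) lie_sring \<Rightarrow> ('g \<Rightarrow> 'g) \<Rightarrow> bool" where
  "lie_automorphism K L f \<longleftrightarrow> f \<in> Hom K L L \<and> bij_betw f (carrier L) (carrier L) \<and>
    preserves_parity L L f \<and>
    (\<forall>x\<in>carrier L. \<forall>y\<in>carrier L. f (lbr L x y) = lbr L (f x) (f y))"


section \<open>Tensor, symmetric and enveloping algebras\<close>

text \<open>
  The generator \<open>([X1,...,Xn], \<alpha>)\<close> of the free abelian group below stands for
  $X_1 \otimes \cdots \otimes X_n \alpha$, an element of
  $M^{\otimes n} \otimes_K K = M^{\otimes n}$; this also covers $T^0(M) = K$.
\<close>

fun word_mult ::
    "'k sring \<Rightarrow> ('k, 'a, 'r) smod_scheme \<Rightarrow> 'a list \<times> 'k \<Rightarrow> 'a list \<times> 'k \<Rightarrow> 'a list \<times> 'k" where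
  "word_mult K M (u, a) ([], b) = (u, a \<otimes>\<^bsub>K\<^esub> b)"
| "word_mult K M (u, a) (Y # w, b) = (u @ lsmult K M a Y # w, b)"

definition word_free ::
    "'k sring \<Rightarrow> ('k, 'a, 'r) smod_scheme \<Rightarrow> ('k, ('a list \<times> 'k) \<Rightarrow>\<^sub>0 int) smod" where
  "word_free K M =
    \<lparr>carrier = {x. Poly_Mapping.keys x \<subseteq> lists (carrier M) \<times> carrier K},
     monoid.mult = (\<lambda>x y. frag_extend (\<lambda>s. frag_extend (\<lambda>t. frag_of (word_mult K M s t)) y) x),
     one = frag_of ([], \<one>\<^bsub>K\<^esub>),
     ring.zero = 0,
     add = (+),
     hpart = (\<lambda>i. {x. Poly_Mapping.keys x \<subseteq>
        {(w, a). \<exists>ps j. list_all2 (\<lambda>X p. X \<in> hpart M p) w ps \<and> a \<in> hpart K j \<and>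
                    sum_list ps + j = i}}),
     rsmult = (\<lambda>x b. frag_extend (\<lambda>(w, a). frag_of (w, a \<otimes>\<^bsub>K\<^esub> b)) x)\<rparr>"

definition word_relations ::
    "'k sring \<Rightarrow> ('k, 'a, 'r) smod_scheme \<Rightarrow> (('a list \<times> 'k) \<Rightarrow>\<^sub>0 int) set" where
  "word_relations K M =
     {frag_of (u @ [X \<oplus>\<^bsub>M\<^esub> Y] @ w, a) - frag_of (u @ [X] @ w, a) - frag_of (u @ [Y] @ w, a)
        | u X Y w a. set u \<subseteq> carrier M \<and> X \<in> carrier M \<and> Y \<in> carrier M \<and>
            set w \<subseteq> carrier M \<and> a \<in> carrier K}
   \<union> {frag_of (w, a \<oplus>\<^bsub>K\<^esub> b) - frag_of (w, a) - frag_of (w, b)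
        | w a b. set w \<subseteq> carrier M \<and> a \<in> carrier K \<and> b \<in> carrier K}
   \<union> {frag_of (u @ [X \<bullet>\<^bsub>M\<^esub> a, Y] @ w, b) - frag_of (u @ [X, lsmult K M a Y] @ w, b)
        | u X Y w a b. set u \<subseteq> carrier M \<and> X \<in> carrier M \<and> Y \<in> carrier M \<and>
            set w \<subseteq> carrier M \<and> a \<in> carrier K \<and> b \<in> carrier K}
   \<union> {frag_of (u @ [X \<bullet>\<^bsub>M\<^esub> a], b) - frag_of (u @ [X], a \<otimes>\<^bsub>K\<^esub> b)
        | u X a b. set u \<subseteq> carrier M \<and> X \<in> carrier M \<and> a \<in> carrier K \<and> b \<in> carrier K}"

text \<open>The additive span of the relations is already a two-sided ideal.\<close>

definition word_ideal ::
    "'k sring \<Rightarrow> ('k, 'a, 'r) smod_scheme \<Rightarrow> (('a list \<times> 'k) \<Rightarrow>\<^sub>0 int) set" where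
  "word_ideal K M = generate (add_monoid (word_free K M)) (word_relations K M)"

definition tensor_alg ::
    "'k sring \<Rightarrow> ('k, 'a, 'r) smod_scheme \<Rightarrow> ('k, (('a list \<times> 'k) \<Rightarrow>\<^sub>0 int) set) smod" where
  "tensor_alg K M = quot_alg (word_free K M) (word_ideal K M)"

definition tensor_word ::
    "'k sring \<Rightarrow> ('k, 'a, 'r) smod_scheme \<Rightarrow> 'a list \<Rightarrow> (('a list \<times> 'k) \<Rightarrow>\<^sub>0 int) set" where
  "tensor_word K M Xs = word_ideal K M +>\<^bsub>word_free K M\<^esub> frag_of (Xs, \<one>\<^bsub>K\<^esub>)"

definition sym_ideal ::
    "'k sring \<Rightarrow> ('k, 'a, 'r) smod_scheme \<Rightarrow> (('a list \<times> 'k) \<Rightarrow>\<^sub>0 int) set set" where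
  "sym_ideal K M = genideal (tensor_alg K M)
     ({tensor_word K M [v, w] \<ominus>\<^bsub>tensor_alg K M\<^esub> sg (tensor_alg K M) (i * j) (tensor_word K M [w, v])
         | v w i j. v \<in> hpart M i \<and> w \<in> hpart M j}
      \<union> {tensor_word K M [u, u] | u. u \<in> hpart M 1})"

definition sym_alg ::
    "'k sring \<Rightarrow> ('k, 'a, 'r) smod_scheme \<Rightarrow> ('k, (('a list \<times> 'k) \<Rightarrow>\<^sub>0 int) set set) smod" where
  "sym_alg K M = quot_alg (tensor_alg K M) (sym_ideal K M)"

definition sym_in ::
    "'k sring \<Rightarrow> ('k, 'a, 'r) smod_scheme \<Rightarrow> 'a \<Rightarrow> (('a list \<times> 'k) \<Rightarrow>\<^sub>0 int) set set" where
  "sym_in K M = (\<lambda>X\<in>carrier M. sym_ideal K M +>\<^bsub>tensor_alg K M\<^esub> tensor_word K M [X])"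

definition sym_pow ::
    "'k sring \<Rightarrow> ('k, 'a, 'r) smod_scheme \<Rightarrow> nat \<Rightarrow> (('a list \<times> 'k) \<Rightarrow>\<^sub>0 int) set set set" where
  "sym_pow K M n = rspan K (sym_alg K M)
     {mprod (sym_alg K M) (map (sym_in K M) Xs) | Xs. set Xs \<subseteq> carrier M \<and> length Xs = n}"

definition env_ideal ::
    "'k sring \<Rightarrow> ('k, 'g) lie_sring \<Rightarrow> (('g list \<times> 'k) \<Rightarrow>\<^sub>0 int) set set" where
  "env_ideal K L = genideal (tensor_alg K L)
     {tensor_word K L [a, b]
        \<ominus>\<^bsub>tensor_alg K L\<^esub> sg (tensor_alg K L) (i * j) (tensor_word K L [b, a])
        \<ominus>\<^bsub>tensor_alg K L\<^esub> tensor_word K L [lbr L a b]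
        | a b i j. a \<in> hpart L i \<and> b \<in> hpart L j}"

definition env_alg ::
    "'k sring \<Rightarrow> ('k, 'g) lie_sring \<Rightarrow> ('k, (('g list \<times> 'k) \<Rightarrow>\<^sub>0 int) set set) smod" where
  "env_alg K L = quot_alg (tensor_alg K L) (env_ideal K L)"

definition env_in ::
    "'k sring \<Rightarrow> ('k, 'g) lie_sring \<Rightarrow> 'g \<Rightarrow> (('g list \<times> 'k) \<Rightarrow>\<^sub>0 int) set set" where
  "env_in K L = (\<lambda>X\<in>carrier L. env_ideal K L +>\<^bsub>tensor_alg K L\<^esub> tensor_word K L [X])"

definition env_fil ::
    "'k sring \<Rightarrow> ('k, 'g) lie_sring \<Rightarrow> nat \<Rightarrow> (('g list \<times> 'k) \<Rightarrow>\<^sub>0 int) set set set" where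
  "env_fil K L n = rspan K (env_alg K L)
     {mprod (env_alg K L) (map (env_in K L) Xs) | Xs. set Xs \<subseteq> carrier L \<and> length Xs \<le> n}"


section \<open>Tensor products of superalgebras and the coproduct\<close>

text \<open>
  $(x \otimes y)(x' \otimes y') = (-1)^{p(y)p(x')} xx' \otimes yy'$, extended biadditively.  For
  bare modules only the module structure of the tensor product is meaningful.
\<close>

definition pair_free ::
    "'k sring \<Rightarrow> ('k, 'a) smod \<Rightarrow> ('k, 'b) smod \<Rightarrow> ('k, ('a \<times> 'b) \<Rightarrow>\<^sub>0 int) smod" where
  "pair_free K M N =
    \<lparr>carrier = {x. Poly_Mapping.keys x \<subseteq> carrier M \<times> carrier N},
     monoid.mult = (\<lambda>s t. frag_extend (\<lambda>(x, y). frag_extend (\<lambda>(x', y').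
        \<Sum>i\<in>{0,1}. \<Sum>j\<in>{0,1}. frag_cmul (if i * j = 1 then -1 else 1)
          (frag_of (x \<otimes>\<^bsub>M\<^esub> hcomp M j x', hcomp N i y \<otimes>\<^bsub>N\<^esub> y'))) t) s),
     one = frag_of (\<one>\<^bsub>M\<^esub>, \<one>\<^bsub>N\<^esub>),
     ring.zero = 0,
     add = (+),
     hpart = (\<lambda>k. {x. Poly_Mapping.keys x \<subseteq>
        {(m, n). \<exists>i j. m \<in> hpart M i \<and> n \<in> hpart N j \<and> i + j = k}}),
     rsmult = (\<lambda>x a. frag_extend (\<lambda>(m, n). frag_of (m, n \<bullet>\<^bsub>N\<^esub> a)) x)\<rparr>"

definition pair_relations ::
    "'k sring \<Rightarrow> ('k, 'a) smod \<Rightarrow> ('k, 'b) smod \<Rightarrow> (('a \<times> 'b) \<Rightarrow>\<^sub>0 int) set" where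
  "pair_relations K M N =
     {frag_of (m \<oplus>\<^bsub>M\<^esub> m', n) - frag_of (m, n) - frag_of (m', n)
        | m m' n. m \<in> carrier M \<and> m' \<in> carrier M \<and> n \<in> carrier N}
   \<union> {frag_of (m, n \<oplus>\<^bsub>N\<^esub> n') - frag_of (m, n) - frag_of (m, n')
        | m n n'. m \<in> carrier M \<and> n \<in> carrier N \<and> n' \<in> carrier N}
   \<union> {frag_of (m \<bullet>\<^bsub>M\<^esub> a, n) - frag_of (m, lsmult K N a n)
        | m n a. m \<in> carrier M \<and> n \<in> carrier N \<and> a \<in> carrier K}"

definition pair_ideal ::
    "'k sring \<Rightarrow> ('k, 'a) smod \<Rightarrow> ('k, 'b) smod \<Rightarrow> (('a \<times> 'b) \<Rightarrow>\<^sub>0 int) set" where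
  "pair_ideal K M N = generate (add_monoid (pair_free K M N)) (pair_relations K M N)"

definition tensor_prod ::
    "'k sring \<Rightarrow> ('k, 'a) smod \<Rightarrow> ('k, 'b) smod \<Rightarrow> ('k, (('a \<times> 'b) \<Rightarrow>\<^sub>0 int) set) smod" where
  "tensor_prod K M N = quot_alg (pair_free K M N) (pair_ideal K M N)"

definition pure_tensor ::
    "'k sring \<Rightarrow> ('k, 'a) smod \<Rightarrow> ('k, 'b) smod \<Rightarrow> 'a \<Rightarrow> 'b \<Rightarrow> (('a \<times> 'b) \<Rightarrow>\<^sub>0 int) set" where
  "pure_tensor K M N m n = pair_ideal K M N +>\<^bsub>pair_free K M N\<^esub> frag_of (m, n)"

text \<open>$(F \otimes G)(v \otimes w) = (-1)^{p(G)p(v)} F(v) \otimes G(w)$, additive in \<open>G\<close>.\<close>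

definition tensor_map ::
    "'k sring \<Rightarrow> ('k, 'a) smod \<Rightarrow> ('k, 'b) smod \<Rightarrow> ('k, 'c) smod \<Rightarrow> ('k, 'd) smod \<Rightarrow>
     ('a \<Rightarrow> 'c) \<Rightarrow> ('b \<Rightarrow> 'd) \<Rightarrow> (('a \<times> 'b) \<Rightarrow>\<^sub>0 int) set \<Rightarrow> (('c \<times> 'd) \<Rightarrow>\<^sub>0 int) set" where
  "tensor_map K M N M' N' F G =
    (THE H. H \<in> Hom K (tensor_prod K M N) (tensor_prod K M' N') \<and>
       (\<forall>k. \<forall>v\<in>hpart M k. \<forall>w\<in>carrier N.
          H (pure_tensor K M N v w) =
            (\<Oplus>\<^bsub>tensor_prod K M' N'\<^esub>d\<in>{0,1}. sg (tensor_prod K M' N') (d * k)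
               (pure_tensor K M' N' (F v) (hom_comp N N' d G w)))))"

definition mult_map ::
    "'k sring \<Rightarrow> ('k, 'a) smod \<Rightarrow> (('a \<times> 'a) \<Rightarrow>\<^sub>0 int) set \<Rightarrow> 'a" where
  "mult_map K A = (THE H. H \<in> Hom K (tensor_prod K A A) A \<and>
     (\<forall>x\<in>carrier A. \<forall>y\<in>carrier A. H (pure_tensor K A A x y) = x \<otimes>\<^bsub>A\<^esub> y))"

definition sym_coprod where
  "sym_coprod K M = (let S = sym_alg K M; i = sym_in K M in
     THE D. D \<in> superalg_hom K S (tensor_prod K S S) \<and>
       (\<forall>X\<in>carrier M. D (i X) =
          pure_tensor K S S (i X) \<one>\<^bsub>S\<^esub> \<oplus>\<^bsub>tensor_prod K S S\<^esub> pure_tensor K S S \<one>\<^bsub>S\<^esub> (i X)))"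


section \<open>The symbol map\<close>

text \<open>The coefficients of $t / (e^t - 1)$.\<close>

definition todd_coeff :: "nat \<Rightarrow> rat" where
  "todd_coeff n = fps_nth (fps_X / (fps_exp 1 - 1)) n"

text \<open>
  The image of a rational number in \<open>K\<close>.  If the denominator is not invertible in \<open>K\<close> the value is
  0; among the coefficients of $\varphi_1$ this can happen, under the hypotheses of the theorem,
  only for $n \ge N$ in the \<open>N\<close>-nilpotent case, where the terms are zero anyway.
\<close>

definition of_rat_in :: "'k sring \<Rightarrow> rat \<Rightarrow> 'k" where
  "of_rat_in K q = (let (a, b) = quotient_of q in
     if [b] \<cdot>\<^bsub>K\<^esub> \<one>\<^bsub>K\<^esub> \<in> Units K
     then ([a] \<cdot>\<^bsub>K\<^esub> \<one>\<^bsub>K\<^esub>) \<otimes>\<^bsub>K\<^esub> inv\<^bsub>K\<^esub> ([b] \<cdot>\<^bsub>K\<^esub> \<one>\<^bsub>K\<^esub>) else \<zero>\<^bsub>K\<^esub>)"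

text \<open>
  Exponent of the Koszul sign of the permutation \<open>s\<close> for letters of parities \<open>ps\<close>: one factor
  $(-1)^{p(X_{s(i)})p(X_{s(j)})}$ for each inversion $i < j$, $s(j) < s(i)$.
\<close>

definition koszul :: "bit list \<Rightarrow> (nat \<Rightarrow> nat) \<Rightarrow> bit" where
  "koszul ps s = (\<Sum>(i, j) \<in> {(i, j). i < j \<and> j < length ps \<and> s j < s i}. ps ! s i * ps ! s j)"

text \<open>$\varphi_1^a$, written for homogeneous $X_i$ and the homogeneous components of \<open>a\<close>.\<close>

definition phi1 ::
    "'k sring \<Rightarrow> ('k, 'g) lie_sring \<Rightarrow> 'g \<Rightarrow> (('g list \<times> 'k) \<Rightarrow>\<^sub>0 int) set set \<Rightarrow> 'g" where
  "phi1 K L a = (THE f. f \<in> Hom K (sym_alg K L) L \<and>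
     (\<forall>Xs ps. list_all2 (\<lambda>X p. X \<in> hpart L p) Xs ps \<longrightarrow>
        f (mprod (sym_alg K L) (map (sym_in K L) Xs)) =
          (\<Oplus>\<^bsub>L\<^esub>q\<in>{0,1}. sg L (q * sum_list ps)
             ((\<Oplus>\<^bsub>L\<^esub>s\<in>{s. s permutes {..<length Xs}}.
                sg L (koszul ps s)
                  (foldr (\<lambda>i Y. lbr L (Xs ! s i) Y) [0..<length Xs] (hcomp L q a)))
              \<bullet>\<^bsub>L\<^esub> of_rat_in K (todd_coeff (length Xs))))))"

definition Phi1 where
  "Phi1 K L a = (let S = sym_alg K L in
     (\<lambda>x\<in>carrier S. mult_map K S
       (tensor_map K S S S S (\<lambda>y\<in>carrier S. y) (\<lambda>y\<in>carrier S. sym_in K L (phi1 K L a y))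
         (sym_coprod K L x))))"

definition Phi where
  "Phi K L = (THE F. F \<in> superalg_hom K (env_alg K L) (End_alg K (sym_alg K L)) \<and>
     (\<forall>a\<in>carrier L. F (env_in K L a) = Phi1 K L a))"

definition symbol_map where
  "symbol_map K L = (\<lambda>u\<in>carrier (env_alg K L). Phi K L u \<one>\<^bsub>sym_alg K L\<^esub>)"


section \<open>Associated graded algebra and the strong PBW theorem\<close>

definition fil_below :: "('a, 'r) ring_scheme \<Rightarrow> (nat \<Rightarrow> 'a set) \<Rightarrow> nat \<Rightarrow> 'a set" where
  "fil_below A Fil n = (case n of 0 \<Rightarrow> {\<zero>\<^bsub>A\<^esub>} | Suc m \<Rightarrow> Fil m)"

text \<open>
  Elements of $\bigoplus_n \mathrm{Fil}_n / \mathrm{Fil}_{n-1}$ are finitely supported families of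
  cosets.
\<close>

definition gr_alg :: "('k, 'a) smod \<Rightarrow> (nat \<Rightarrow> 'a set) \<Rightarrow> ('k, nat \<Rightarrow> 'a set) smod" where
  "gr_alg A Fil = (let B = fil_below A Fil;
       C = {f. (\<forall>n. f n \<in> (\<lambda>x. B n +>\<^bsub>A\<^esub> x) ` Fil n) \<and> finite {n. f n \<noteq> B n}} in
    \<lparr>carrier = C,
     monoid.mult = (\<lambda>f g n. B n <+>\<^bsub>A\<^esub>
        {\<Oplus>\<^bsub>A\<^esub>i\<in>{..n}. x i \<otimes>\<^bsub>A\<^esub> y (n - i) | x y. \<forall>i\<le>n. x i \<in> f i \<and> y i \<in> g i}),
     one = (\<lambda>n. if n = 0 then B 0 +>\<^bsub>A\<^esub> \<one>\<^bsub>A\<^esub> else B n),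
     ring.zero = B,
     add = (\<lambda>f g n. f n <+>\<^bsub>A\<^esub> g n),
     hpart = (\<lambda>i. {f \<in> C. \<forall>n. f n \<in> (\<lambda>x. B n +>\<^bsub>A\<^esub> x) ` (Fil n \<inter> hpart A i)}),
     rsmult = (\<lambda>f a n. B n <+>\<^bsub>A\<^esub> {x \<bullet>\<^bsub>A\<^esub> a | x. x \<in> f n})\<rparr>)"

definition gr_class ::
    "('k, 'a) smod \<Rightarrow> (nat \<Rightarrow> 'a set) \<Rightarrow> nat \<Rightarrow> 'a \<Rightarrow> nat \<Rightarrow> 'a set" where
  "gr_class A Fil n x = (\<lambda>m. if m = n then fil_below A Fil n +>\<^bsub>A\<^esub> x else fil_below A Fil m)"

definition gr_env where
  "gr_env K L = gr_alg (env_alg K L) (env_fil K L)"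

definition j_tilde where
  "j_tilde K L = (THE f. f \<in> superalg_hom K (sym_alg K L) (gr_env K L) \<and>
     (\<forall>Xs. set Xs \<subseteq> carrier L \<longrightarrow>
        f (mprod (sym_alg K L) (map (sym_in K L) Xs)) =
          gr_class (env_alg K L) (env_fil K L) (length Xs)
            (mprod (env_alg K L) (map (env_in K L) Xs))))"

text \<open>
  The map induced on associated graded modules by a filtered map; $S(\mathfrak g)$ is identified
  with its associated graded module through its grading.
\<close>

definition gr_map where
  "gr_map K L r = (THE f. f \<in> Hom K (sym_alg K L) (gr_env K L) \<and>
     (\<forall>n. \<forall>x\<in>sym_pow K L n. f x = gr_class (env_alg K L) (env_fil K L) n (r x)))"

definition ext_derivation ::
    "'k sring \<Rightarrow> ('k, 'g) lie_sring \<Rightarrow> ('k, 'a) smod \<Rightarrow> ('g \<Rightarrow> 'a) \<Rightarrow> ('g \<Rightarrow> 'g) \<Rightarrow> 'a \<Rightarrow> 'a" where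
  "ext_derivation K L A i D = (THE E. superderivation K A (monoid.mult A) E \<and>
     (\<forall>X\<in>carrier L. E (i X) = i (D X)))"

definition ext_automorphism ::
    "'k sring \<Rightarrow> ('k, 'g) lie_sring \<Rightarrow> ('k, 'a) smod \<Rightarrow> ('g \<Rightarrow> 'a) \<Rightarrow> ('g \<Rightarrow> 'g) \<Rightarrow> 'a \<Rightarrow> 'a" where
  "ext_automorphism K L A i f = (THE E. E \<in> superalg_hom K A A \<and>
     bij_betw E (carrier A) (carrier A) \<and> (\<forall>X\<in>carrier L. E (i X) = i (f X)))"

text \<open>An isomorphism of \<open>K\<close>-modules is understood to respect the \<open>\<int>/2\<close>-gradings.\<close>

definition strong_PBW where
  "strong_PBW K L r \<longleftrightarrow>
     r \<in> Hom K (sym_alg K L) (env_alg K L) \<and>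
     preserves_parity (sym_alg K L) (env_alg K L) r \<and>
     bij_betw r (carrier (sym_alg K L)) (carrier (env_alg K L)) \<and>
     (\<forall>n. r ` sym_pow K L n \<subseteq> env_fil K L n) \<and>
     gr_map K L r = j_tilde K L \<and>
     (\<forall>D. lie_derivation K L D \<longrightarrow> (\<forall>x\<in>carrier (sym_alg K L).
        r (ext_derivation K L (sym_alg K L) (sym_in K L) D x) =
          ext_derivation K L (env_alg K L) (env_in K L) D (r x))) \<and>
     (\<forall>f. lie_automorphism K L f \<longrightarrow> (\<forall>x\<in>carrier (sym_alg K L).
        r (ext_automorphism K L (sym_alg K L) (sym_in K L) f x) =
          ext_automorphism K L (env_alg K L) (env_in K L) f (r x)))"

end

(* The generating-function identity of t/(e^t - 1) makes a |-> Phi_1^a a representation of the Lie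
superalgebra on its symmetric algebra, by a computation in convolution algebras of graded maps.
Since c_0 = 1, sigma (X_1 ... X_n) equals X_1 ... X_n up to terms of lower degree, so sigma is onto
by induction on the degree. If u lies in U_n and sigma u = 0, then the degree n part of a tensor
representing u vanishes in the symmetric algebra, which puts u in U_(n-1); hence sigma is injective.
Every ingredient is natural in the Lie superalgebra, so sigma commutes with derivations and
automorphisms. *)

theory Submission
  imports Defs "HOL-Algebra.UnivPoly" "HOL-Combinatorics.Multiset_Permutations"
begin

text \<open>An element of Hom(S(g), g) can be read as a formal g-valued function on g, or as a
  formal vector field; \<open>Ph\<close> is the operator of that field on S(g), and the projection
  \<open>xS\<close> onto degree one is the generic point x. In this reading phi_1^a is c(ad x)(a)
  with c(t) = t/(e^t - 1), where ad is taken for the convolution bracket, and the representation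
  property says that the commutator of the fields of a and b is the field of [a, b]. In degree r
  both sides are combinations of the brackets [(ad x)^k a, (ad x)^(r-k) b]. Comparing coefficients
  leaves one identity for each r and k, the expanded form of w = u + v + uv for u = e^x - 1, v = e^y
  - 1, w = e^(x+y) - 1. In the nilpotent case these brackets vanish from the degree on in which a
  denominator may fail to be invertible. Convolution identities are proved on monomials by removing
  the first letter: left translation \<open>dl\<close> obeys a Leibniz rule, so both sides satisfy
  one recursion and only their values at 1 have to be compared. Word length is no grading of U(g).
  Degrees are therefore separated in the tensor algebra, whose homogeneous parts are well defined
  and can be mapped to S(g) and to U(g) alike.\<close>

abbreviation (input) carrier_mem (infix "<:" 50) where "x <: G == x \<in> carrier G"
abbreviation (input) mult_in ("_ *[_] _" [70, 0, 71] 70) where "x *[G] y == x \<otimes>\<^bsub>G\<^esub> y"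
abbreviation (input) add_in ("_ +[_] _" [65, 0, 66] 65) where "x +[G] y == x \<oplus>\<^bsub>G\<^esub> y"
abbreviation (input) minus_in ("_ -[_] _" [65, 0, 66] 65) where "x -[G] y == x \<ominus>\<^bsub>G\<^esub> y"
abbreviation (input) uminus_in ("-[_] _" [0, 81] 80) where "-[G] x == \<ominus>\<^bsub>G\<^esub> x"
abbreviation (input) rsmult_in ("_ .[_] _" [70, 0, 71] 70) where "x .[G] a == x \<bullet>\<^bsub>G\<^esub> a"
abbreviation (input) coset_in ("_ +>[_] _" [60, 0, 61] 60) where "H +>[G] x == H +>\<^bsub>G\<^esub> x"
abbreviation (input) inv_in ("inv[_] _" [0, 81] 80) where "inv[G] x == inv\<^bsub>G\<^esub> x"
abbreviation (input) one_in ("1[_]") where "1[G] == \<one>\<^bsub>G\<^esub>"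
abbreviation (input) zero_in ("0[_]") where "0[G] == \<zero>\<^bsub>G\<^esub>"
abbreviation (input) "hp == hpart"
abbreviation (input) "hps M == list_all2 (%X p. X : hp M p)"
abbreviation (input) "tw == tensor_word"
abbreviation (input) "car == carrier"
abbreviation (input) "wid == word_ideal"
abbreviation (input) "td == todd_coeff"
lemmas (in supermodule) rsc = rsmult_closed

section \<open>Additive maps, signs, parity components and the left action of scalars\<close>

section \<open>Graded modules\<close>

declare add_bit_eq_xor [simp del] mult_bit_eq_and [simp del]

lemma bit_add_self [simp]: "(x::bit) + x = 0" "x + (x + y) = y" by(cases x; simp; cases y; simp)+

lemma bit_mult_self: "(x::bit) * x = x" "x * (x * y) = x * y" by(cases x; simp)+

text \<open>Sign exponents live in the field with two elements; with x + x = 0 they are compared as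
  polynomials.\<close>

lemmas bit_poly = bit_add_self bit_mult_self algebra_simps

text \<open>A plain function without extensionality or scalars, so that lambda terms and composites
  qualify as they stand, unlike members of \<open>Hom\<close>.\<close>

definition addmap :: "('a,'r) ring_scheme => ('b,'s) ring_scheme => ('a => 'b) => bool" where
 "addmap M N f \<longleftrightarrow> f : car M \<rightarrow> car N & (ALL x:car M. ALL y:car M. f (x +[M] y) = f x +[N] f y)"

lemma addmapI: assumes "!!x. x <: M ==> f x <: N" and "!!x y. x <: M ==> y <: M ==> f (x +[M] y) = f x +[N] f y"
 shows "addmap M N f" using assms by(auto simp: addmap_def)

lemma addmapD: assumes "addmap M N f" shows "x <: M ==> f x <: N" and "x <: M ==> y <: M ==> f (x +[M] y) = f x +[N] f y"
 using assms by(auto simp: addmap_def)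

lemmas amD1 = addmapD(1) and amD2 = addmapD(2)

lemma am_o: "addmap M N f ==> addmap N P g ==> addmap M P (%x. g (f x))" by(simp add: addmap_def Pi_iff)

lemma am_group_hom: assumes "abelian_group M" "abelian_group N" "addmap M N f" shows "abelian_group_hom M N f"
 using assms by(auto intro!: abelian_group_homI group_hom.intro abelian_group.a_group
   group_hom_axioms.intro simp: hom_def addmap_def)

lemma am_zn: assumes "abelian_group M" "abelian_group N" "addmap M N f" shows "f 0[M] = 0[N]" "x <: M ==> f (-[M] x) = -[N] f x"
  "x <: M ==> f (sg M k x) = sg N k (f x)"
  "x <: M ==> y <: M ==> f (x -[M] y) = f x -[N] f y"
proof -
 interpret abelian_group_hom M N f by(rule am_group_hom[OF assms])
 show "f 0[M] = 0[N]" by simp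
 show neg: "f (-[M] x) = -[N] f x" if "x <: M" for x using that by simp
 show "x <: M ==> f (sg M k x) = sg N k (f x)" by(simp add: sg_def)
 show "x <: M ==> y <: M ==> f (x -[M] y) = f x -[N] f y" by(simp add: a_minus_def)
qed

lemma am_fs: assumes "abelian_group M" "abelian_group N" "addmap M N f" "g : I \<rightarrow> car M"
 shows "f (\<Oplus>\<^bsub>M\<^esub>i\<in>I. g i) = (\<Oplus>\<^bsub>N\<^esub>i\<in>I. f (g i))"
proof -
 interpret abelian_group_hom M N f by(rule am_group_hom[OF assms(1-3)])
 show ?thesis using assms(4) proof (induction I rule: infinite_finite_induct)
  case (insert x F)
  thus ?case by(subst G.finsum_insert) (auto simp: Pi_iff intro!: H.finsum_insert[symmetric])
 qed auto
qed

context abelian_group begin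

lemmas abx = abelian_group_axioms

lemma mn_cancel: "x <: G ==> y <: G ==> (x \<ominus> y) \<oplus> y = x" by(simp add: a_minus_def a_assoc l_neg)

lemma mn_zero_iff: "x <: G ==> y <: G ==> x \<ominus> y = \<zero> \<longleftrightarrow> x = y"
 using mn_cancel[of x y] by(auto simp: a_minus_def r_neg)

lemma sg_c [simp]: "x <: G ==> sg G k x <: G" by(simp add: sg_def)

lemma sg_0 [simp]: "sg G 0 x = x" by(simp add: sg_def)

lemma sg_zero [simp]: "sg G k \<zero> = \<zero>" by(simp add: sg_def)

lemma sg_sg: "x <: G ==> sg G k (sg G l x) = sg G (k + l) x" by(cases k; cases l) (simp_all add: sg_def)

lemma sg_neg: "x <: G ==> \<ominus> sg G k x = sg G (k + 1) x" by(cases k) (simp_all add: sg_def)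


lemma neg_eq_sg: "\<ominus> x = sg G 1 x" by(simp add: sg_def)

lemma sg_add: "x <: G ==> y <: G ==> sg G k (x \<oplus> y) = sg G k x \<oplus> sg G k y" by(simp add: sg_def minus_add)

lemma sg_am: "addmap G G (sg G k)" by(simp add: addmap_def sg_add)


lemma finsum_bit:
 "f 0 <: G ==> f 1 <: G ==> (\<Oplus>i\<in>{0,1::bit}. f i) = f 0 \<oplus> f 1" by simp

lemma am_zero: "addmap M G (%_. \<zero>)" by(simp add: addmap_def)

lemma am_add:
 "addmap M G f ==> addmap M G g ==> addmap M G (%x. f x \<oplus> g x)" by(auto simp: addmap_def Pi_iff a_ac)

lemma am_fs_fun: assumes "finite I" "!!i. i : I ==> addmap M G (f i)" shows "addmap M G (%x. \<Oplus>i\<in>I. f i x)" using assms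
proof (induction I)
 case (insert j F)
 show ?case proof (rule addmapI)
  fix x y assume xy: "x <: M" "y <: M"
  have c: "i : insert j F ==> f i x <: G" "i : insert j F ==> f i y <: G" for i using insert xy amD1[of M G "f i"] by blast+
  show "(\<Oplus>i\<in>insert j F. f i x) <: G" using c by(intro finsum_closed) auto
  have "(\<Oplus>i\<in>insert j F. f i (x +[M] y)) = (\<Oplus>i\<in>insert j F. f i x \<oplus> f i y)"
   using c by(intro finsum_cong') (auto simp: amD2[OF insert.prems xy])
  also have "... = (\<Oplus>i\<in>insert j F. f i x) \<oplus> (\<Oplus>i\<in>insert j F. f i y)"
   using c by(intro finsum_addf) auto
  finally show "(\<Oplus>i\<in>insert j F. f i (x +[M] y)) = (\<Oplus>i\<in>insert j F. f i x) \<oplus> (\<Oplus>i\<in>insert j F. f i y)" .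
 qed
qed (simp add: am_zero)

end

context graded_group begin

lemma hpc: "x : hp M i ==> x <: M" using subgroup.subset[OF hpart_subgroup, of i] by auto

lemma hpart_zero [simp]: "\<zero> : hp M i" using subgroup.one_closed[OF hpart_subgroup, of i] by simp

lemma hp_add: "x : hp M i ==> y : hp M i ==> x \<oplus> y : hp M i" using subgroup.m_closed[OF hpart_subgroup, of x i y] by simp

lemma hp_neg: "x : hp M i ==> \<ominus> x : hp M i" using subgroup.m_inv_closed[OF hpart_subgroup, of x i] by(simp add: a_inv_def)

lemma hp_mn: "x : hp M i ==> y : hp M i ==> x \<ominus> y : hp M i" by(simp add: a_minus_def hp_add hp_neg)

lemma hp_sg: "x : hp M i ==> sg M k x : hp M i" by(simp add: sg_def hp_neg)

lemma hp_fs: "finite I ==> (!!j. j : I ==> f j : hp M i) ==> (\<Oplus>j\<in>I. f j) : hp M i"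
proof (induction I rule: finite_induct)
 case (insert x F)
 hence "(\<Oplus>j\<in>insert x F. f j) = f x \<oplus> (\<Oplus>j\<in>F. f j)" by(intro finsum_insert) (auto intro: hpc)
 thus ?case using insert by(simp add: hp_add)
qed simp

lemma hpart_both: "x : hp M i ==> x : hp M (i + 1) ==> x = \<zero>" using hpart_disjoint by(cases i) auto

lemma hom_split: assumes "x <: M"
 obtains x0 x1 where "x0 : hp M 0" "x1 : hp M 1" "x = x0 \<oplus> x1"
 using assms unfolding hpart_sum[symmetric] by(auto simp: set_add_def')

text \<open>Two candidates for the component differ by an element of both parities, hence by zero.
  This makes the description in \<open>hcomp\<close> a proper one.\<close>

lemma hcomp_eq: assumes "y : hp M i" "z : hp M (i + 1)" shows "hcomp M i (y \<oplus> z) = y" unfolding hcomp_def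
proof (rule the_equality)
 note c = assms[THEN hpc]
 have "y \<oplus> z \<ominus> y = z" using c a_comm[of y z] by(simp add: a_minus_def a_assoc r_neg)
 thus "y : hp M i & y \<oplus> z \<ominus> y : hp M (i + 1)" using assms by simp
next
 fix w assume w: "w : hp M i & y \<oplus> z \<ominus> w : hp M (i + 1)"
 note c = assms[THEN hpc] hpc[OF conjunct1[OF w]]
 have "y \<oplus> z \<ominus> w \<ominus> z = (y \<ominus> w) \<oplus> (z \<oplus> \<ominus> z)"
  using c by(simp add: a_minus_def a_ac del: r_neg)
 hence "y \<oplus> z \<ominus> w \<ominus> z = y \<ominus> w" using c by(simp add: r_neg)
 moreover have "y \<oplus> z \<ominus> w \<ominus> z : hp M (i + 1)" using w assms hp_mn by blast
 moreover have "y \<ominus> w : hp M i" using w assms by(intro hp_mn) auto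
 ultimately have "y \<ominus> w = \<zero>" using hpart_both by auto
 thus "w = y" using c by(simp add: mn_zero_iff)
qed

lemma hcomp_hom: "x : hp M j ==> hcomp M i x = (if i = j then x else \<zero>)"
 using hcomp_eq[of x i \<zero>] hcomp_eq[of \<zero> i x] hpc[of x] by(cases i; cases j) auto

lemma hcomp_h [simp]: assumes "x <: M" shows "hcomp M i x : hp M i"
proof -
 obtain x0 x1 where x: "x0 : hp M 0" "x1 : hp M 1" "x = x0 \<oplus> x1" by(rule hom_split[OF assms])
 hence "x = x1 \<oplus> x0" by(simp add: a_comm hpc)
 thus ?thesis using x hcomp_eq[of x0 0 x1] hcomp_eq[of x1 1 x0] by(cases i) auto
qed

lemma hcomp_closed [simp]: "x <: M ==> hcomp M i x <: M" using hcomp_h hpc by blast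

lemma hcomp_sum: assumes "x <: M" shows "x = hcomp M 0 x \<oplus> hcomp M 1 x"
proof -
 obtain x0 x1 where x: "x0 : hp M 0" "x1 : hp M 1" "x = x0 \<oplus> x1" by(rule hom_split[OF assms])
 hence "x = x1 \<oplus> x0" by(simp add: a_comm hpc)
 thus ?thesis using x hcomp_eq[of x0 0 x1] hcomp_eq[of x1 1 x0] by auto
qed

lemma hcomp_add: assumes "x <: M" "y <: M" shows "hcomp M i (x \<oplus> y) = hcomp M i x \<oplus> hcomp M i y"
proof -
 have s: "z = hcomp M i z \<oplus> hcomp M (i + 1) z" if "z <: M" for z
  using hcomp_sum[OF that] that by(cases i) (simp_all add: a_comm)
 have "x \<oplus> y = (hcomp M i x \<oplus> hcomp M i y) \<oplus> (hcomp M (i+1) x \<oplus> hcomp M (i+1) y)"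
  by(subst s[OF assms(1)], subst s[OF assms(2)]) (use assms in "simp add: a_ac")
 thus ?thesis using assms by(simp add: hcomp_eq hp_add)
qed


text \<open>An element is the sum of an even and an odd one. Sign rules, which are stated for
  homogeneous elements, reach all elements through this induction.\<close>

lemma hom_ind [consumes 1, case_names hom add]: assumes "x <: M" "!!i x. x : hp M i ==> P x"
  "!!x y. x <: M ==> y <: M ==> P x ==> P y ==> P (x \<oplus> y)" shows "P x" using hom_split[OF assms(1)] assms(2,3) hpc by metis

lemma am_eqI: assumes "addmap M N f" "addmap M N g" "!!i x. x : hp M i ==> f x = g x" "x <: M" shows "f x = g x"
 using assms(4) by(induction rule: hom_ind) (simp_all add: assms(3) amD2[OF assms(1)] amD2[OF assms(2)])

end

lemma HomI: assumes "!!x. x <: M ==> f x <: N" "!!x. x ~: car M ==> f x = undefined"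
  and "!!x y. x <: M ==> y <: M ==> f (x +[M] y) = f x +[N] f y" and "!!x a. x <: M ==> a <: K ==> f (x .[M] a) = f x .[N] a"
 shows "f : Hom K M N" using assms by(auto simp: Hom_def PiE_def extensional_def)

lemma HomD: assumes "f : Hom K M N" shows "addmap M N f" "x <: M ==> f x <: N" "f : extensional (car M)"
  "x <: M ==> y <: M ==> f (x +[M] y) = f x +[N] f y"
  "x <: M ==> a <: K ==> f (x .[M] a) = f x .[N] a" using assms by(auto simp: Hom_def addmap_def PiE_def)

lemma Hom_eqI: assumes "f : Hom K M N" "g : Hom K M N'" "!!x. x <: M ==> f x = g x" shows "f = g"
 using HomD(3)[OF assms(1)] HomD(3)[OF assms(2)] assms(3) by(rule extensionalityI)

locale smodule = supermodule K M for K :: "'k sring" and M :: "('k, 'a, 'r) smod_scheme" (structure)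
begin

lemma rsmult_zero_left [simp]: "a <: K ==> \<zero> \<bullet> a = \<zero>" by(rule am_zn(1)[OF abx abx])
  (simp add: addmap_def rsc rsmult_add_left)

lemma rsmult_zero_right [simp]: "m <: M ==> m \<bullet> 0[K] = \<zero>" by(rule am_zn(1)[OF K.abx abx, of "%a. m \<bullet> a"])
  (simp add: addmap_def rsc rsmult_add_right)

lemma rsmult_neg_left: "m <: M ==> a <: K ==> (\<ominus> m) \<bullet> a = \<ominus> (m \<bullet> a)"
 by(rule am_zn(2)[OF abx abx, of "%m. m \<bullet> a"])
  (simp_all add: addmap_def rsc rsmult_add_left)

lemma rsmult_neg_right: "m <: M ==> a <: K ==> m \<bullet> (-[K] a) = \<ominus> (m \<bullet> a)"
 by(rule am_zn(2)[OF K.abx abx, of "%a. m \<bullet> a"])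
  (simp_all add: addmap_def rsc rsmult_add_right)

lemma rs_sg: "m <: M ==> a <: K ==> sg M k m \<bullet> a = sg M k (m \<bullet> a)"
 "m <: M ==> a <: K ==> m \<bullet> (sg K k a) = sg M k (m \<bullet> a)" by(simp_all add: sg_def rsmult_neg_left rsmult_neg_right)

lemma ls_expand: assumes "m <: M" "a <: K"
 shows "lsmult K M a m = (hcomp M 0 m \<bullet> hcomp K 0 a \<oplus> hcomp M 1 m \<bullet> hcomp K 0 a) \<oplus>
  (hcomp M 0 m \<bullet> hcomp K 1 a \<oplus> \<ominus> (hcomp M 1 m \<bullet> hcomp K 1 a))"
 using assms by(simp add: lsmult_def finsum_bit rsc sg_def a_ac)

lemma ls_hom: assumes "m : hp M j" "a : hp K i" shows "lsmult K M a m = sg M (i * j) (m \<bullet> a)"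
proof -
 note c = hpc[OF assms(1)] K.hpc[OF assms(2)]
 show ?thesis using assms c by(cases i; cases j) (simp_all add: ls_expand hcomp_hom[OF assms(1)] K.hcomp_hom[OF assms(2)]
    rsc sg_def)
qed

lemma lsmult_closed [simp]:
 "m <: M ==> a <: K ==> lsmult K M a m <: M" by(simp add: ls_expand rsc)

lemma ls_hp:
 "m : hp M j ==> a : hp K i ==> lsmult K M a m : hp M (i + j)"
 unfolding ls_hom add.commute[of i j] by(rule hp_sg[OF rsmult_hpart])

lemma lsm_addr:
 "m <: M ==> n <: M ==> a <: K ==> lsmult K M a (m \<oplus> n) = lsmult K M a m \<oplus> lsmult K M a n"
 by(simp add: ls_expand hcomp_add rsmult_add_left rsc a_ac minus_add)

lemma lsm_addl:
 "m <: M ==> a <: K ==> b <: K ==> lsmult K M (a +[K] b) m = lsmult K M a m \<oplus> lsmult K M b m"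
 by(simp add: ls_expand K.hcomp_add rsmult_add_right rsc a_ac minus_add)

lemma lsmult_one [simp]: "m <: M ==> lsmult K M 1[K] m = m"
proof (induction rule: hom_ind)
 case (hom i x) thus ?case using ls_hom[OF hom K.hpart_one] rsmult_one[OF hpc[OF hom]] by simp
qed (simp add: lsm_addr)

text \<open>Moving b and then a across m yields m(ba); supercommutativity of \<open>K\<close> turns
  ba into ab, and the collected sign is the one for moving ab.\<close>

lemma ls_assoc: assumes "a <: K" "b <: K" "m <: M" shows "lsmult K M (a *[K] b) m = lsmult K M a (lsmult K M b m)" using assms(3)
proof (induction rule: hom_ind)
 case (hom k m)
 note m = hpc[OF hom]
 from assms(1) show ?case proof (induction rule: K.hom_ind)
  case (hom i a)
  note a = K.hpc[OF hom]
  from assms(2) show ?case proof (induction rule: K.hom_ind)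
   case (hom j b)
   note b = K.hpc[OF hom]
   note h = `a : hp K i` `b : hp K j` `m : hp M k`
   have "lsmult K M a (lsmult K M b m) = sg M (i * (j + k)) ((sg M (j * k) (m \<bullet> b)) \<bullet> a)"
    using ls_hom[OF ls_hp[OF h(3,2)] h(1)] ls_hom[OF h(3,2)] by simp
   also have "... = sg M (i * (j + k) + j * k) (m \<bullet> (b *[K] a))" using a b m by(simp add: rs_sg rsc sg_sg rsmult_assoc)
   also have "m \<bullet> (b *[K] a) = sg M (j * i) (m \<bullet> (a *[K] b))"
    using a b m K.supercomm[OF h(2,1)] by(simp add: rs_sg rsc)
   finally have "lsmult K M a (lsmult K M b m) = sg M ((i + j) * k) (m \<bullet> (a *[K] b))"
    using a b m by(simp add: sg_sg rsc bit_poly)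
   thus ?case using ls_hom[OF h(3) K.hpart_mult[OF h(1,2)]] by simp
  qed (use a m in "simp add: K.r_distr lsm_addl lsm_addr")
 qed (use assms(2) m in "simp add: K.l_distr lsm_addl")
qed (use assms in "simp add: lsm_addr")

text \<open>Both sides are signed multiples of m(ab): the left one arises as m(ba), and
  supercommutativity of \<open>K\<close> supplies the missing sign.\<close>

lemma ls_rs: assumes "a <: K" "b <: K" "m <: M" shows "lsmult K M a (m \<bullet> b) = lsmult K M a m \<bullet> b" using assms(3)
proof (induction rule: hom_ind)
 case (hom k m)
 note m = hpc[OF hom]
 from assms(1) show ?case proof (induction rule: K.hom_ind)
  case (hom i a)
  note a = K.hpc[OF hom]
  from assms(2) show ?case proof (induction rule: K.hom_ind)
   case (hom j b)
   note b = K.hpc[OF hom]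
   note h = `a : hp K i` `b : hp K j` `m : hp M k`
   have "lsmult K M a (m \<bullet> b) = sg M (i * (k + j)) (m \<bullet> (b *[K] a))"
    using ls_hom[OF rsmult_hpart[OF h(3,2)] h(1)] a b m by(simp add: rsmult_assoc)
   also have "... = sg M (i * (k + j) + j * i) (m \<bullet> (a *[K] b))"
    using a b m K.supercomm[OF h(2,1)] by(simp add: rs_sg rsc sg_sg)
   also have "... = lsmult K M a m \<bullet> b" using a b m ls_hom[OF h(3,1)]
    by(cases i; cases j; cases k) (simp_all add: rs_sg rsc rsmult_assoc)
   finally show ?case .
  qed (use a m in "simp add: rsmult_add_right lsm_addr rsc")
 qed (use assms(2) m in "simp add: rsmult_add_left lsm_addl rsc")
qed (use assms in "simp add: lsm_addr rsmult_add_left rsc")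

end

section \<open>Quotient groups and rings with their scalar action\<close>

section \<open>Quotients\<close>

lemma ab_cong: assumes "abelian_group R" "car R' = car R" "ring.zero R' = ring.zero R" "add R' = add R" shows "abelian_group R'"
proof -
 interpret R: abelian_group R by fact
 show ?thesis proof (rule abelian_groupI, unfold assms(2-4))
  fix x assume "x <: R"
  thus "EX y:car R. y +[R] x = 0[R]" using R.l_neg by blast
 qed (auto intro: R.a_assoc R.a_comm)
qed

text \<open>\<open>quot_alg\<close> copies the ring fields of \<open>Quot\<close> into a larger
  record; the ring laws depend on these fields alone.\<close>

lemma ring_cong: assumes "ring R" "car R' = car R" "monoid.mult R' = monoid.mult R" "one R' = one R"
  "ring.zero R' = ring.zero R" "add R' = add R" shows "ring R'"
proof -
 interpret R: ring R by fact
 have "abelian_group R'" by(rule ab_cong[OF R.abx assms(2,5,6)])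
 moreover have "Group.monoid R'" by(rule monoidI, unfold assms(2-4)) (auto intro: R.m_assoc)
 ultimately show ?thesis by(rule ringI; unfold assms(2-6)) (auto intro: R.l_distr R.r_distr)
qed

lemma ring_homD: assumes "h : ring_hom R S" shows "addmap R S h" "x <: R ==> h x <: S" "h 1[R] = 1[S]"
  "x <: R ==> y <: R ==> h (x +[R] y) = h x +[S] h y"
  "x <: R ==> y <: R ==> h (x *[R] y) = h x *[S] h y" using assms by(auto simp: ring_hom_def addmap_def)

lemma quot_alg_sel [simp]:
 "car (quot_alg A I) = car (A Quot I)"
 "monoid.mult (quot_alg A I) = monoid.mult (A Quot I)"
 "one (quot_alg A I) = one (A Quot I)"
 "ring.zero (quot_alg A I) = ring.zero (A Quot I)"
 "add (quot_alg A I) = add (A Quot I)"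
 "hp (quot_alg A I) = (%i. (%x. I +>[A] x) ` hp A i)"
 "C .[quot_alg A I] a = (\<Union>c\<in>C. I +>[A] (c .[A] a))" by(simp_all add: quot_alg_def)

locale smod_quot = abelian_subgroup I A for I and A :: "('k, 'a) smod" (structure)
begin

lemma qu_c: "car (quot_alg A I) = (%x. I +> x) ` car A" by(auto simp: FactRing_simps)

lemma proj_c: "x <: A ==> I +> x : car (quot_alg A I)" by(simp add: qu_c del: quot_alg_sel)

lemma qu_cases: assumes "C : car (quot_alg A I)"
 obtains x where "x <: A" "C = I +> x" using assms unfolding qu_c by blast

lemma proj_add:
 "x <: A ==> y <: A ==> I +> (x \<oplus> y) = (I +> x) +[quot_alg A I] (I +> y)" by(simp add: FactRing_def a_rcos_sum)

lemma quot_zero: "0[quot_alg A I] = I" by(simp add: FactRing_def)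

lemma qu_ab: "abelian_group (quot_alg A I)"
proof -
 have "abelian_group (A Quot I)" by(rule comm_group_abelian_groupI)
   (simp add: FactRing_def a_factorgroup_is_comm_group[unfolded A_FactGroup_def'])
 thus ?thesis by(rule ab_cong) simp_all
qed

lemma proj_am: "addmap A (quot_alg A I) (%x. I +> x)" by(intro addmapI proj_c proj_add)

lemma proj_eq_iff: assumes "x <: A" "y <: A" shows "I +> x = I +> y \<longleftrightarrow> x \<ominus> y : I"
proof -
 have "x : I +> y \<longleftrightarrow> x \<ominus> y : I" unfolding a_minus_def by(rule a_rcos_module[OF assms(2,1)])
 thus ?thesis using a_repr_independence'[of x y] a_rcos_self[OF assms(1)] assms(2) by metis
qed

lemma proj_zero_iff: assumes "x <: A" shows "I +> x = 0[quot_alg A I] \<longleftrightarrow> x : I"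
 unfolding quot_zero using assms a_rcos_const a_rcos_self by metis

lemma quot_lift: assumes N: "abelian_group N" and h: "addmap A N h" and z: "!!x. x : I ==> h x = 0[N]"
 obtains h' where "addmap (quot_alg A I) N h'" "!!x. x <: A ==> h' (I +> x) = h x"
proof -
 interpret N: abelian_group N by fact
 define h' where "h' C = h (SOME x. x <: A & I +> x = C)" for C
 have h': "h' (I +> x) = h x" if x: "x <: A" for x proof -
  define y where "y = (SOME y. y <: A & I +> y = I +> x)"
  have y: "y <: A" "I +> y = I +> x" using someI[of "%y. y <: A & I +> y = I +> x" x] x by(auto simp: y_def)
  have "h (y \<ominus> x) = 0[N]" using y x z proj_eq_iff by blast
  hence "h y = h x" using x y am_zn(4)[OF abx N h y(1) x] amD1[OF h] by(simp add: N.mn_zero_iff)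
  thus ?thesis by(simp add: h'_def y_def)
 qed
 show thesis proof
  show "addmap (quot_alg A I) N h'" proof (rule addmapI)
   fix x y assume xy: "x : car (quot_alg A I)" "y : car (quot_alg A I)"
   obtain u v where uv: "u <: A" "x = I +> u" "v <: A" "y = I +> v" using xy qu_cases by metis
   show "h' x <: N" using uv h' amD1[OF h] by simp
   show "h' (x +[quot_alg A I] y) = h' x +[N] h' y" using uv h' amD2[OF h] by(simp only: proj_add[symmetric] a_closed)
  qed
 qed (rule h')
qed

text \<open>The scalar action on cosets is a union over all representatives. It collapses to a
  single coset because the subgroup is stable under the scalar.\<close>

lemma qu_rs: assumes x: "x <: A" and f: "addmap A A (%x. x \<bullet> a)" and I: "!!x. x : I ==> x \<bullet> a : I"
 shows "(I +> x) .[quot_alg A I] a = I +> (x \<bullet> a)"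
proof -
 have "I +> (c \<bullet> a) = I +> (x \<bullet> a)" if c: "c : I +> x" for c proof -
  obtain k where k: "k : I" "c = k \<oplus> x" using c by(auto simp: a_r_coset_def')
  have kc: "k <: A" using k by simp
  have "c \<bullet> a = k \<bullet> a \<oplus> x \<bullet> a" using k kc x amD2[OF f] by simp
  moreover have "(k \<bullet> a \<oplus> x \<bullet> a) \<ominus> x \<bullet> a = k \<bullet> a"
   using kc x amD1[OF f] by(simp add: a_minus_def a_assoc r_neg)
  ultimately show ?thesis using kc x amD1[OF f] I[OF k(1)] proj_eq_iff[of "k \<bullet> a \<oplus> x \<bullet> a" "x \<bullet> a"]
   by(simp only: a_closed)
 qed
 hence "(\<Union>c\<in>I +> x. I +> (c \<bullet> a)) = (\<Union>c\<in>I +> x. I +> (x \<bullet> a))" by(rule SUP_cong[OF refl])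
 moreover have "x : I +> x" using x by(rule a_rcos_self)
 ultimately show ?thesis unfolding quot_alg_sel by blast
qed

end

lemma smod_quotI: assumes "abelian_group A" "subgroup I (add_monoid A)" shows "smod_quot I A"
 using assms by(simp add: smod_quot_def abelian_subgroupI3 additive_subgroupI)

locale smod_ideal = ideal I A for I and A :: "('k, 'a) smod" (structure)
begin

sublocale smod_quot I A ..

lemma quot_ring: "ring (quot_alg A I)" using quotient_is_ring by(rule ring_cong) simp_all

lemma proj_mult:
 "x <: A ==> y <: A ==> I +> (x \<otimes> y) = (I +> x) *[quot_alg A I] (I +> y)" by(simp add: FactRing_def rcoset_mult_add)

lemma quot_one: "1[quot_alg A I] = I +> \<one>" by(simp add: FactRing_def)

text \<open>If the scalar acts as right multiplication by a ring element, the stability of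
  \<open>I\<close> comes from the ideal property.\<close>

lemma qu_rs': assumes "x <: A" "c <: A" "!!x. x <: A ==> x \<bullet> a = x \<otimes> c"
 shows "(I +> x) .[quot_alg A I] a = (I +> x) *[quot_alg A I] (I +> c)"
proof -
 have "addmap A A (%x. x \<bullet> a)" by(rule addmapI) (simp_all add: assms l_distr)
 moreover have "!!x. x : I ==> x \<bullet> a : I" by(simp add: assms I_r_closed)
 ultimately have "(I +> x) .[quot_alg A I] a = I +> (x \<bullet> a)" by(intro qu_rs assms(1))
 thus ?thesis by(simp only: assms proj_mult)
qed

lemma quot_lift_ring: assumes R: "ring R" and h: "h : ring_hom A R" and z: "!!x. x : I ==> h x = 0[R]"
 obtains h' where "h' : ring_hom (quot_alg A I) R" "!!x. x <: A ==> h' (I +> x) = h x"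
proof -
 interpret R: ring R by fact
 obtain h' where h': "addmap (quot_alg A I) R h'" "!!x. x <: A ==> h' (I +> x) = h x"
  using quot_lift[OF R.abx ring_homD(1)[OF h] z] by blast
 have "h' : ring_hom (quot_alg A I) R" proof (rule ring_hom_memI)
  fix x y assume xy: "x : car (quot_alg A I)" "y : car (quot_alg A I)"
  obtain u v where uv: "u <: A" "x = I +> u" "v <: A" "y = I +> v" using xy qu_cases by metis
  show "h' (x *[quot_alg A I] y) = h' x *[R] h' y" using uv h'(2) ring_homD(5)[OF h] by(simp only: proj_mult[symmetric] m_closed)
 qed (use addmapD[OF h'(1)] h'(2) ring_homD(3)[OF h] in "simp_all only: quot_one one_closed")
 thus thesis using h'(2) that by blast
qed

end


section \<open>The tensor algebra, its inductions and its universal property\<close>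

section \<open>The tensor algebra\<close>

lemma fe_add_fun:
 "frag_extend (%s. f s + g s) x = frag_extend f x + frag_extend g x" by(simp add: frag_extend_def frag_cmul_distrib2 sum.distrib)

lemma fe_mn_fun: "frag_extend (%s. - f s) x = - frag_extend f x"
proof -
 have "frag_cmul c (- y) = - frag_cmul c y" for c and y :: "'a \<Rightarrow>\<^sub>0 int" by(rule poly_mapping_eqI) simp
 thus ?thesis by(simp add: frag_extend_def sum_negf del: minus_frag_cmul)
qed

lemma keys_fe_subset: assumes "!!s. s : Poly_Mapping.keys x ==> Poly_Mapping.keys (f s) <= B"
 shows "Poly_Mapping.keys (frag_extend f x) <= B" using keys_frag_extend[of f x] assms by blast

lemma W_sel [simp]:
 "car (word_free K M) = {x. Poly_Mapping.keys x <= lists (car M) \<times> car K}"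
 "x *[word_free K M] y = frag_extend (%s. frag_extend (%t. frag_of (word_mult K M s t)) y) x"
 "1[word_free K M] = frag_of ([], 1[K])" "0[word_free K M] = 0"
 "x +[word_free K M] y = x + y"
 "hp (word_free K M) i = {x. Poly_Mapping.keys x <= {(w, a). EX ps j. hps M w ps & a : hp K j & sum_list ps + j = i}}"
 "x .[word_free K M] b = frag_extend (%(w, a). frag_of (w, a *[K] b)) x" by(simp_all add: word_free_def)

lemma frag_ind [consumes 1, case_names zero gen add neg]: assumes "Poly_Mapping.keys x <= B" "P 0" "!!s. s : B ==> P (frag_of s)"
  "!!x y. Poly_Mapping.keys x <= B ==> Poly_Mapping.keys y <= B ==> P x ==> P y ==> P (x + y)"
  "!!x. Poly_Mapping.keys x <= B ==> P x ==> P (- x)" shows "P x" using assms(1)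
proof (rule free_Abelian_group_induct)
 fix x y :: "'a \<Rightarrow>\<^sub>0 int"
 assume "Poly_Mapping.keys x <= B" "Poly_Mapping.keys y <= B" "P x" "P y"
 thus "P (x - y)" using assms(4)[of x "- y"] assms(5)[of y] by simp
qed (use assms in auto)

locale tmodule = smodule K M for K :: "'k sring" and M :: "('k, 'a, 'r) smod_scheme" (structure)
begin

abbreviation "W == word_free K M"

lemma word_mult_c:
 "s : lists (car M) \<times> car K ==> t : lists (car M) \<times> car K ==> word_mult K M s t : lists (car M) \<times> car K"
 by(cases s; cases t; cases "fst t") auto

lemma word_mult_assoc: assumes "r : lists (car M) \<times> car K" "s : lists (car M) \<times> car K"
  "t : lists (car M) \<times> car K" shows "word_mult K M (word_mult K M r s) t = word_mult K M r (word_mult K M s t)"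
proof -
 obtain u a v b w c where [simp]: "r = (u, a)" "s = (v, b)" "t = (w, c)" by(metis surj_pair)
 show ?thesis using assms by(cases v; cases w) (auto simp: ls_assoc K.m_assoc)
qed

lemma W_ab: "abelian_group W"
proof (rule abelian_groupI)
 fix x assume "x <: W"
 thus "EX y:car W. y +[W] x = 0[W]" by(intro bexI[of _ "- x"]) auto
qed (auto simp: add_ac dest!: subsetD[OF keys_add])

lemma W_ring: "ring W"
proof -
 let ?B = "lists (car M) \<times> car K"
 have cl: "x *[W] y <: W" if "x <: W" "y <: W" for x y using that unfolding W_sel mem_Collect_eq
  by(intro keys_fe_subset) (simp, rule word_mult_c, blast+)
 have one: "1[W] <: W" by simp
 have assoc: "x *[W] y *[W] z = x *[W] (y *[W] z)" if "x <: W" "y <: W" "z <: W" for x y z proof -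
  from that(1)[unfolded W_sel mem_Collect_eq] show ?thesis proof (induction rule: frag_ind)
   case (gen r)
   from that(2)[unfolded W_sel mem_Collect_eq] show ?case proof (induction rule: frag_ind)
    case (gen s)
    from that(3)[unfolded W_sel mem_Collect_eq] show ?case by(induction rule: frag_ind)
      (use gen `r : ?B` in "simp_all add: frag_extend_add frag_extend_minus frag_extend_of word_mult_assoc")
   qed (simp_all add: frag_extend_add frag_extend_minus frag_extend_of fe_add_fun)
  qed (simp_all add: frag_extend_add frag_extend_minus)
 qed
 have neut: "1[W] *[W] x = x" "x *[W] 1[W] = x" if "x <: W" for x proof -
  have 1: "word_mult K M ([], 1[K]) s = s" "word_mult K M s ([], 1[K]) = s" if "s : ?B" for s
   using that by(cases s; cases "fst s"; auto)+
  show "1[W] *[W] x = x" using that[unfolded W_sel mem_Collect_eq]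
   by(induction rule: frag_ind) (auto simp: frag_extend_add frag_extend_minus frag_extend_of 1)
  show "x *[W] 1[W] = x" using that[unfolded W_sel mem_Collect_eq]
   by(induction rule: frag_ind) (auto simp: frag_extend_add frag_extend_minus frag_extend_of 1)
 qed
 show ?thesis by(intro ringI W_ab monoidI cl one assoc neut)
   (simp_all add: frag_extend_add fe_add_fun)
qed


lemma frag_of_W: "set w <= car M ==> a <: K ==> frag_of (w, a) <: W" by auto

lemma W_diff: "x <: W ==> y <: W ==> x - y <: W" unfolding W_sel mem_Collect_eq using keys_diff[of x y] by blast

lemma W_add: "x <: W ==> y <: W ==> x + y <: W" unfolding W_sel mem_Collect_eq using keys_add[of x y] by blast

lemma rels_c: "word_relations K M <= car W"
proof
 fix r assume "r : word_relations K M"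
 thus "r <: W" unfolding word_relations_def by(elim UnE CollectE exE conjE; hypsubst; intro W_diff frag_of_W) (simp_all add: rsc)
qed

lemma wi_sub: "subgroup (wid K M) (add_monoid W)" unfolding word_ideal_def using rels_c
 by(intro group.generate_is_subgroup abelian_group.a_group W_ab) simp

lemma wi_rel: assumes "set u <= car M" "set w <= car M" "X <: M" "a <: K" "b <: K"
 shows "Y <: M ==> frag_of (u @ (X \<oplus> Y) # w, a) - frag_of (u @ X # w, a) - frag_of (u @ Y # w, a) : wid K M"
  and "frag_of (w, a +[K] b) - frag_of (w, a) - frag_of (w, b) : wid K M"
  and "Y <: M ==> frag_of (u @ (X \<bullet> a) # Y # w, b) - frag_of (u @ X # lsmult K M a Y # w, b) : wid K M"
  and "frag_of (u @ [X \<bullet> a], b) - frag_of (u @ [X], a *[K] b) : wid K M"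
proof -
 note i = generate.incl[of _ "word_relations K M" "add_monoid W", folded word_ideal_def]
 show "frag_of (u @ (X \<oplus> Y) # w, a) - frag_of (u @ X # w, a) - frag_of (u @ Y # w, a) : wid K M" if "Y <: M"
  by(rule i, unfold word_relations_def, rule UnI1, rule UnI1, rule UnI1)
   (use assms that in "force")
 show "frag_of (w, a +[K] b) - frag_of (w, a) - frag_of (w, b) : wid K M"
  by(rule i, unfold word_relations_def, rule UnI1, rule UnI1, rule UnI2)
   (use assms in "force")
 show "frag_of (u @ (X \<bullet> a) # Y # w, b) - frag_of (u @ X # lsmult K M a Y # w, b) : wid K M" if "Y <: M"
  by(rule i, unfold word_relations_def, rule UnI1, rule UnI2)
   (use assms that in "force")
 show "frag_of (u @ [X \<bullet> a], b) - frag_of (u @ [X], a *[K] b) : wid K M"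
  by(rule i, unfold word_relations_def, rule UnI2) (use assms in "force")
qed

lemma wi_zero: "0 : wid K M" using subgroup.one_closed[OF wi_sub] by simp

lemma wi_add: "x : wid K M ==> y : wid K M ==> x + y : wid K M" using subgroup.m_closed[OF wi_sub, of x y] by simp

lemma wi_neg: assumes "x : wid K M" shows "- x : wid K M"
proof -
 have "x <: W" using subgroup.subset[OF wi_sub] assms by auto
 hence "inv[add_monoid W] x = - x" by(intro group.inv_equality abelian_group.a_group W_ab) auto
 thus ?thesis using subgroup.m_inv_closed[OF wi_sub assms] by simp
qed

text \<open>The product of a relation with a word is again a relation, possibly of another kind.
  When the scalar of the relation meets a letter of the word, additivity in the scalar becomes
  additivity in that letter, and pulling a scalar out of the last letter becomes the balance between
  two neighbouring letters.\<close>

lemma rel_mult: assumes r: "r : word_relations K M" and s: "s : lists (car M) \<times> car K"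
 shows "frag_of s *[W] r : wid K M" "r *[W] frag_of s : wid K M"
proof -
 obtain v d where vd: "s = (v, d)" "set v <= car M" "d <: K" using s by auto
 have l: "set t <= car M ==> Z <: M ==> c <: K ==> set (lsmult K M c Z # t) <= car M" for t Z c by simp
 consider (1) u X Y w a where "r = frag_of (u @ (X \<oplus> Y) # w, a) - frag_of (u @ X # w, a) - frag_of (u @ Y # w, a)"
   "set u <= car M" "X <: M" "Y <: M" "set w <= car M" "a <: K"
  | (2) w a b where "r = frag_of (w, a +[K] b) - frag_of (w, a) - frag_of (w, b)"
   "set w <= car M" "a <: K" "b <: K"
  | (3) u X Y w a b where "r = frag_of (u @ (X \<bullet> a) # Y # w, b) - frag_of (u @ X # lsmult K M a Y # w, b)"
   "set u <= car M" "X <: M" "Y <: M" "set w <= car M" "a <: K" "b <: K"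
  | (4) u X a b where "r = frag_of (u @ [X \<bullet> a], b) - frag_of (u @ [X], a *[K] b)"
   "set u <= car M" "X <: M" "a <: K" "b <: K" using r unfolding word_relations_def by auto
 thus "frag_of s *[W] r : wid K M" proof cases
  \<comment> \<open>Two instances are supplied: for nonempty \<open>u\<close> the scalar
    \<open>d\<close> acts on the first letter of \<open>u\<close>, for empty \<open>u\<close> it
    acts on \<open>X\<close> and \<open>Y\<close> themselves.\<close>
  case 1 thus ?thesis
   using wi_rel(1)[of "v @ lsmult K M d (hd u) # tl u" w X a a Y] wi_rel(1)[of v w "lsmult K M d X" a a "lsmult K M d Y"] vd
   by(cases u) (simp_all add: frag_extend_diff frag_extend_of lsm_addr)
 next
  case 2 thus ?thesis
   using wi_rel(2)[of "[]" "v @ lsmult K M d (hd w) # tl w" \<zero> a b] wi_rel(2)[of "[]" v \<zero> "d *[K] a" "d *[K] b"] vd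
   by(cases w) (simp_all add: frag_extend_diff frag_extend_of K.r_distr)
 next
  case 3 thus ?thesis using wi_rel(3)[of "v @ lsmult K M d (hd u) # tl u" w X a b Y] wi_rel(3)[of v w "lsmult K M d X" a b Y] vd
   by(cases u) (simp_all add: frag_extend_diff frag_extend_of ls_rs)
 next
  case 4 thus ?thesis using wi_rel(4)[of "v @ lsmult K M d (hd u) # tl u" "[]" X a b] wi_rel(4)[of v "[]" "lsmult K M d X" a b] vd
   by(cases u) (simp_all add: frag_extend_diff frag_extend_of ls_rs)
 qed
 consider (1) u X Y w a where "r = frag_of (u @ (X \<oplus> Y) # w, a) - frag_of (u @ X # w, a) - frag_of (u @ Y # w, a)"
   "set u <= car M" "X <: M" "Y <: M" "set w <= car M" "a <: K"
  | (2) w a b where "r = frag_of (w, a +[K] b) - frag_of (w, a) - frag_of (w, b)"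
   "set w <= car M" "a <: K" "b <: K"
  | (3) u X Y w a b where "r = frag_of (u @ (X \<bullet> a) # Y # w, b) - frag_of (u @ X # lsmult K M a Y # w, b)"
   "set u <= car M" "X <: M" "Y <: M" "set w <= car M" "a <: K" "b <: K"
  | (4) u X a b where "r = frag_of (u @ [X \<bullet> a], b) - frag_of (u @ [X], a *[K] b)"
   "set u <= car M" "X <: M" "a <: K" "b <: K" using r unfolding word_relations_def by auto
 thus "r *[W] frag_of s : wid K M" proof cases
  case 1 thus ?thesis using wi_rel(1)[of u "w @ lsmult K M a (hd v) # tl v" X d d Y] wi_rel(1)[of u w X "a *[K] d" d Y] vd
   by(cases v) (simp_all add: frag_extend_diff frag_extend_of)
 next
  case 2 thus ?thesis
   using wi_rel(1)[of w "tl v" "lsmult K M a (hd v)" d d "lsmult K M b (hd v)"] wi_rel(2)[of "[]" w \<zero> "a *[K] d" "b *[K] d"] vd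
   by(cases v) (simp_all add: frag_extend_diff frag_extend_of K.l_distr lsm_addl)
 next
  case 3 thus ?thesis using wi_rel(3)[of u "w @ lsmult K M b (hd v) # tl v" X a d Y] wi_rel(3)[of u w X a "b *[K] d" Y] vd
   by(cases v) (simp_all add: frag_extend_diff frag_extend_of)
 next
  case 4 thus ?thesis using wi_rel(3)[of u "tl v" X a d "lsmult K M b (hd v)"] wi_rel(4)[of u "[]" X a "b *[K] d"] vd
   by(cases v) (simp_all add: frag_extend_diff frag_extend_of ls_assoc K.m_assoc)
 qed
qed

lemma W_neg: "x <: W ==> -[W] x = - x" using abelian_group.minus_equality[OF W_ab, of "- x" x] by simp

lemma wi_mult: assumes r: "r : wid K M" and x: "x <: W" shows "x *[W] r : wid K M & r *[W] x : wid K M"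
 using x[unfolded W_sel mem_Collect_eq]
proof (induction rule: frag_ind)
 case zero thus ?case by(simp add: frag_extend_def wi_zero)
next
 case (gen s)
 interpret W: ring W by(rule W_ring)
 have s: "frag_of s <: W" using gen by auto
 from r[unfolded word_ideal_def] show ?case proof (induction rule: generate.induct)
  case one thus ?case by(simp add: frag_extend_def wi_zero)
 next
  case (incl h) thus ?case using rel_mult[OF _ gen] by blast
 next
  case (inv h)
  hence "h <: W" using rels_c by auto
  thus ?case using rel_mult[OF inv gen] wi_neg W_neg[of h, unfolded a_inv_def]
   by(simp add: frag_extend_minus frag_extend_of del: W_sel(1,4,5))
 next
  case (eng h1 h2)
  thus ?case by(simp add: frag_extend_of frag_extend_add wi_add)
 qed
next
 case (add x y)
 thus ?case by(simp add: frag_extend_add fe_add_fun wi_add)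
next
 case (neg x)
 thus ?case by(simp add: frag_extend_minus fe_mn_fun wi_neg)
qed

lemma W_ideal: "smod_ideal (wid K M) W" by(rule smod_ideal.intro)
  (use wi_mult wi_sub W_ring in "auto intro!: idealI simp del: W_sel")

sublocale WI: smod_ideal "wid K M" W by(rule W_ideal)

abbreviation "T == tensor_alg K M"

definition "tscal a = wid K M +>[W] frag_of ([], a)"

abbreviation "tin X == tw K M [X]"

sublocale T: ring T unfolding tensor_alg_def by(rule WI.quot_ring)

lemma T_word_c:
 "set w <= car M ==> a <: K ==> wid K M +>[W] frag_of (w, a) <: T" unfolding tensor_alg_def by(intro WI.proj_c frag_of_W)

lemma tscal_c [simp]: "a <: K ==> tscal a <: T" unfolding tscal_def by(rule T_word_c) auto

lemma tin_closed [simp]: "X <: M ==> tin X <: T" unfolding tensor_word_def by(rule T_word_c) auto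

lemma T_proj: assumes "x <: W" "y <: W" shows "wid K M +>[W] (x + y) = (wid K M +>[W] x) +[T] (wid K M +>[W] y)"
  "wid K M +>[W] (x *[W] y) = (wid K M +>[W] x) *[T] (wid K M +>[W] y)"
 unfolding tensor_alg_def using WI.proj_add[OF assms] WI.proj_mult[OF assms] by simp_all

lemma T_proj_eq: assumes "x <: W" "y <: W" "x - y : wid K M" shows "wid K M +>[W] x = wid K M +>[W] y"
 using assms WI.proj_eq_iff[OF assms(1,2)] W_neg[OF assms(2)] by(simp add: a_minus_def)

lemma T_word_add: assumes "set w <= car M" "a <: K" "b <: K" shows "wid K M +>[W] frag_of (w, a +[K] b) =
  (wid K M +>[W] frag_of (w, a)) +[T] (wid K M +>[W] frag_of (w, b))"
 by(insert wi_rel(2)[of "[]" w \<zero> a b] assms, subst T_proj(1)[symmetric]; (rule T_proj_eq)?; (intro W_add frag_of_W)?)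
  (simp_all add: diff_diff_eq)

lemma tscal_add: "a <: K ==> b <: K ==> tscal (a +[K] b) = tscal a +[T] tscal b" unfolding tscal_def by(rule T_word_add) auto

lemma tscal_mult: "a <: K ==> b <: K ==> tscal (a *[K] b) = tscal a *[T] tscal b"
 unfolding tscal_def by(subst T_proj(2)[symmetric]) (auto simp: frag_extend_of)

lemma tscal_one: "tscal 1[K] = 1[T]" unfolding tscal_def tensor_alg_def by(simp add: FactRing_def)

lemma tin_add: assumes "X <: M" "Y <: M" shows "tin (X \<oplus> Y) = tin X +[T] tin Y" unfolding tensor_word_def
 by(insert wi_rel(1)[of "[]" "[]" X "1[K]" "1[K]" Y] assms, subst T_proj(1)[symmetric]; (rule T_proj_eq)?; (intro W_add frag_of_W)?)
  (simp_all add: diff_diff_eq)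

lemma tin_rsmult: assumes "X <: M" "a <: K" shows "tin (X \<bullet> a) = tin X *[T] tscal a" unfolding tensor_word_def tscal_def
 by(insert wi_rel(4)[of "[]" "[]" X a "1[K]"] assms, subst T_proj(2)[symmetric]; (rule T_proj_eq)?)
  (simp_all add: frag_extend_of rsc)

lemma T_word_Cons: assumes "X <: M" "set w <= car M" "a <: K"
 shows "wid K M +>[W] frag_of (X # w, a) = tin X *[T] (wid K M +>[W] frag_of (w, a))"
proof -
 have "frag_of (X # w, a) = frag_of ([X], 1[K]) *[W] frag_of (w, a)" using assms by(cases w) (simp_all add: frag_extend_of)
 moreover have "frag_of ([X], 1[K]) <: W" "frag_of (w, a) <: W" using assms by(auto intro: frag_of_W)
 ultimately show ?thesis unfolding tensor_word_def by(simp only: T_proj(2))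
qed

lemma tin_lsmult: assumes "X <: M" "a <: K" shows "tin (lsmult K M a X) = tscal a *[T] tin X" unfolding tensor_word_def tscal_def
 using assms by(subst T_proj(2)[symmetric]) (auto simp: frag_extend_of)

lemma tensor_word2:
 "v <: M ==> w <: M ==> tw K M [v, w] = tin v *[T] tin w" using T_word_Cons[of v "[w]" "1[K]"] by(simp add: tensor_word_def)

lemma T_rsmult: assumes "x <: T" "a <: K" shows "x .[T] a = x *[T] tscal a"
proof -
 have a: "frag_of ([], a) <: W" using assms by auto
 have "(%s. case s of (w, b) => frag_of (w, b *[K] a)) = (%s. frag_of (word_mult K M s ([], a)))" by auto
 hence r: "x .[W] a = x *[W] frag_of ([], a)" for x by(simp add: frag_extend_of)
 obtain y where "y <: W" "x = wid K M +>[W] y" using assms(1) unfolding tensor_alg_def by(rule WI.qu_cases)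
 thus ?thesis unfolding tscal_def tensor_alg_def using WI.qu_rs'[OF _ a r] by simp
qed

text \<open>\<open>P\<close> is not assumed to be closed under negatives. Instead \<open>B\<close>
  is closed under negating the scalar of a word, and \<open>P\<close> is proved for x and -x
  together.\<close>

lemma T_frag_induct: assumes x: "Poly_Mapping.keys x <= B" and B: "B <= lists (car M) \<times> car K"
  and neg: "!!w a. (w, a) : B ==> (w, -[K] a) : B" and zero: "P 0[T]"
  and gen: "!!w a. (w, a) : B ==> P (wid K M +>[W] frag_of (w, a))"
  and add: "!!s t. s <: T ==> t <: T ==> P s ==> P t ==> P (s +[T] t)" shows "P (wid K M +>[W] x)"
proof -
 have z: "P (wid K M +>[W] 0)" using zero WI.proj_zero_iff[of 0] wi_zero by(simp add: tensor_alg_def del: quot_alg_sel)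
 have c: "wid K M +>[W] x <: T" if "Poly_Mapping.keys x <= B" for x unfolding tensor_alg_def using that B by(intro WI.proj_c) auto
 have "P (wid K M +>[W] x) & P (wid K M +>[W] (- x))" using x proof (induction rule: frag_ind)
  case (gen s)
  obtain w a where s: "s = (w, a)" by(cases s)
  hence wa: "(w, a) : B" "set w <= car M" "a <: K" using gen B by auto
  have fz: "wid K M +>[W] frag_of (w, 0[K]) = 0[T]" by(rule am_zn(1)[OF K.abx T.abx, of "%a. wid K M +>[W] frag_of (w, a)"])
    (rule addmapI, use wa(2) in "simp_all add: T_word_c T_word_add")
  have "wid K M +>[W] frag_of (w, -[K] a) = -[T] (wid K M +>[W] frag_of (w, a))"
   by(rule am_zn(2)[OF K.abx T.abx, of "%a. wid K M +>[W] frag_of (w, a)"])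
    (rule addmapI, use wa(2,3) in "simp_all add: T_word_c T_word_add")
  also have "... = wid K M +>[W] (- frag_of (w, a))" using am_zn(2)[OF W_ab WI.qu_ab WI.proj_am frag_of_W[OF wa(2,3)]]
    W_neg[OF frag_of_W[OF wa(2,3)]] by(simp add: tensor_alg_def)
  finally show ?case using gen assms(5)[OF wa(1)] assms(5)[OF neg[OF wa(1)]] by(simp add: s)
 next
  case (add x y)
  hence w: "x <: W" "y <: W" "- x <: W" "- y <: W" using B by auto
  have k: "Poly_Mapping.keys (- x) <= B" "Poly_Mapping.keys (- y) <= B" using add by auto
  have e: "- (x + y) = - x + - y" by simp
  show ?case unfolding e T_proj(1)[OF w(1,2)] T_proj(1)[OF w(3,4)]
   using add assms(6)[OF c[OF add(1)] c[OF add(2)]] assms(6)[OF c[OF k(1)] c[OF k(2)]] by simp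
 qed (use z in simp_all)
 thus ?thesis ..
qed

text \<open>A word grows from a scalar by adding letters on the left, which is the shape of all
  recursions below.\<close>

lemma T_induct [consumes 1, case_names scal mult add]: assumes "x <: T" "!!a. a <: K ==> P (tscal a)"
  "!!X y. X <: M ==> y <: T ==> P y ==> P (tin X *[T] y)"
  "!!x y. x <: T ==> y <: T ==> P x ==> P y ==> P (x +[T] y)" shows "P x"
proof -
 obtain y where y: "y <: W" "x = wid K M +>[W] y" using assms(1) unfolding tensor_alg_def by(rule WI.qu_cases)
 have "tscal 0[K] = 0[T]" by(rule am_zn(1)[OF K.abx T.abx])
   (auto intro!: addmapI tscal_add)
 hence z: "P 0[T]" using assms(2)[of "0[K]"] by simp
 show ?thesis unfolding y(2) proof (rule T_frag_induct[where B="lists (car M) \<times> car K"])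
  fix w a assume "(w, a) : lists (car M) \<times> car K"
  hence "set w <= car M" "a <: K" by auto
  thus "P (wid K M +>[W] frag_of (w, a))"
   by(induction w) (simp_all add: assms(2)[unfolded tscal_def] T_word_Cons assms(3) T_word_c)
 qed (use y z assms(4) in auto)
qed

text \<open>Elements of parity i are by definition classes of combinations of words each of which
  has parity i, so the induction can stay inside that set of words.\<close>

lemma T_hp_ind [consumes 1, case_names zero scal mult add]:
 assumes "x : hp T i" "!!i. P i 0[T]" "!!j a. a : hp K j ==> P j (tscal a)"
  "!!p X j y. X : hp M p ==> y : hp T j ==> P j y ==> P (p + j) (tin X *[T] y)"
  "!!j x y. x <: T ==> y <: T ==> P j x ==> P j y ==> P j (x +[T] y)" shows "P i x"
proof -
 obtain y where y: "y : hp W i" "x = wid K M +>[W] y" using assms(1) by(auto simp: tensor_alg_def simp del: W_sel)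
 have hp: "wid K M +>[W] frag_of (w, a) : hp T (sum_list ps + j)" if "hps M w ps" "a : hp K j" for w a ps j
  using that by(force simp: tensor_alg_def)
 have cl: "set w <= car M" if "hps M w ps" for w ps using that by(induction rule: list_all2_induct) (auto intro: hpc)
 show ?thesis unfolding y(2) proof (rule T_frag_induct[OF y(1)[unfolded W_sel mem_Collect_eq]])
  fix w a assume "(w, a) : {(w, a). EX ps j. hps M w ps & a : hp K j & sum_list ps + j = i}"
  then obtain ps j where psj: "hps M w ps" "a : hp K j" "sum_list ps + j = i" by auto
  from psj(1) have "P (sum_list ps + j) (wid K M +>[W] frag_of (w, a))" proof (induction rule: list_all2_induct)
   case Nil thus ?case using assms(3)[OF psj(2)] by(simp add: tscal_def)
  next
   case (Cons X w p ps)
   thus ?case using assms(4)[OF Cons(1) hp[OF Cons(2) psj(2)]] cl[OF Cons(2)] psj(2) by(simp add: T_word_Cons hpc K.hpc add.assoc)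
  qed
  thus "P i (wid K M +>[W] frag_of (w, a))" by(simp add: psj(3))
 next
  show "P i 0[T]" by(rule assms(2))
 next
  fix w a assume "(w, a) : {(w, a). EX ps j. hps M w ps & a : hp K j & sum_list ps + j = i}"
  thus "(w, -[K] a) : {(w, a). EX ps j. hps M w ps & a : hp K j & sum_list ps + j = i}" using K.hp_neg by blast
 next
  show "{(w, a). EX ps j. hps M w ps & a : hp K j & sum_list ps + j = i} <= lists (car M) \<times> car K"
   using cl K.hpc by fastforce
 qed (use assms(5) in blast)
qed

lemma T_hp_c: "x : hp T i ==> x <: T" by(induction rule: T_hp_ind)
  (simp_all add: tscal_c K.hpc hpc)

text \<open>The target is a bare ring. Scalars enter through a second map \<open>g\<close>, and
  \<open>fr\<close> and \<open>fl\<close> say that \<open>f\<close> respects both actions. The same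
  lemma thus serves endomorphism rings, polynomial rings and quotients of the tensor
  algebra.\<close>

lemma tensor_univ: assumes R: "ring R" and f: "addmap M R f" and g: "addmap K R g" and g1: "g 1[K] = 1[R]"
  and gm: "!!a b. a <: K ==> b <: K ==> g (a *[K] b) = g a *[R] g b"
  and fr: "!!X a. X <: M ==> a <: K ==> f (X \<bullet> a) = f X *[R] g a"
  and fl: "!!X a. X <: M ==> a <: K ==> f (lsmult K M a X) = g a *[R] f X"
 obtains h where "h : ring_hom T R" "!!X. X <: M ==> h (tin X) = f X"
  "!!a. a <: K ==> h (tscal a) = g a"
proof -
 interpret R: ring R by fact
 let ?B = "lists (car M) \<times> car K"
 define e where "e = (%(w, a). foldr (%X y. f X *[R] y) w (g a))"
 note fc = amD1[OF f] and gc = amD1[OF g]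
 have ec: "e s <: R" if sB: "s : ?B" for s proof -
  obtain w a where "s = (w, a)" "set w <= car M" "a <: K" using sB by(cases s) auto
  thus ?thesis unfolding e_def by(induction w arbitrary: s) (auto intro: fc gc)
 qed
 obtain h where h: "h : hom (free_Abelian_group ?B) (add_monoid R)"
  "!!s. s : ?B ==> h (frag_of s) = e s"
  by(rule comm_group.free_Abelian_group_universal[OF R.a_comm_group, of e ?B]) (use ec in auto)
 have he: "h (frag_of (w, a)) = e (w, a)" if "set w <= car M" "a <: K" for w a using that by(intro h(2)) auto
 have ha: "addmap W R h" using h(1) by(auto simp: addmap_def hom_def)
 note hc = amD1[OF ha]
 have hneg: "h (- x) = -[R] h x" if "x <: W" for x using am_zn(2)[OF W_ab R.abx ha that] W_neg[OF that] by simp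
 have h0: "h 0 = 0[R]" using am_zn(1)[OF W_ab R.abx ha] by simp
 have hadd: "h (x + y) = h x +[R] h y" if "x <: W" "y <: W" for x y using amD2[OF ha that] by simp
 have hdiff: "h (x - y) = h x -[R] h y" if "x <: W" "y <: W" for x y
  using hadd[of x "- y"] hneg[of y] that by(simp add: a_minus_def)
 have foldr_g: "foldr (%X y. f X *[R] y) w (z *[R] z') = foldr (%X y. f X *[R] y) w z *[R] z'"
  if "set w <= car M" "z <: R" "z' <: R" for w z z' proof -
  have "foldr (%X y. f X *[R] y) w z <: R" if "set w <= car M" for w using that `z <: R` by(induction w) (auto intro: fc)
  with that show ?thesis by(induction w) (auto simp: fc R.m_assoc)
 qed
 have fcl: "foldr (%X y. f X *[R] y) w z <: R" if "set w <= car M" "z <: R" for w z using that by(induction w) (auto intro: fc)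
 have em: "e (word_mult K M s t) = e s *[R] e t" if "s : ?B" "t : ?B" for s t proof -
  obtain u a v b where st: "s = (u, a)" "t = (v, b)" by(metis surj_pair)
  with that have c: "set u <= car M" "set v <= car M" "a <: K" "b <: K" by auto
  show ?thesis proof (cases v)
   case Nil
   thus ?thesis using c st by(simp add: e_def gm foldr_g gc)
  next
   case (Cons Y w)
   thus ?thesis using c st by(simp add: e_def fl gc fc R.m_assoc fcl foldr_g[symmetric])
  qed
 qed
 have hm: "h (x *[W] y) = h x *[R] h y" if xy: "x <: W" "y <: W" for x y proof -
  from xy(1)[unfolded W_sel mem_Collect_eq] show ?thesis proof (induction rule: frag_ind)
   case zero
   have "0 *[W] y = 0" using WI.l_null[OF xy(2)] by(simp del: W_sel(1,2))
   thus ?case using h0 hc[OF xy(2)] by(simp del: W_sel)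
  next
   case (gen s)
   from xy(2)[unfolded W_sel mem_Collect_eq] show ?case proof (induction rule: frag_ind)
    case zero thus ?case using gen h0 h(2) ec by(simp add: frag_extend_of)
   next
    case (gen t)
    thus ?case using `s : ?B` h(2) em word_mult_c by(simp add: frag_extend_of)
   next
    case (add y z)
    have c: "frag_of s <: W" "y <: W" "z <: W" using gen add by auto
    have "frag_of s *[W] (y + z) = frag_of s *[W] y + frag_of s *[W] z"
     using WI.r_distr[of y z "frag_of s"] c by(simp del: W_sel(1,2))
    thus ?case
     using add(3,4) hadd[OF WI.m_closed[OF c(1,2)] WI.m_closed[OF c(1,3)]] hadd[OF c(2,3)] hc[OF c(1)] hc[OF c(2)] hc[OF c(3)]
     by(simp add: R.r_distr del: W_sel)
   next
    case (neg y)
    have c: "frag_of s <: W" "y <: W" using gen neg by auto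
    have "frag_of s *[W] (- y) = - (frag_of s *[W] y)"
     using WI.r_minus[of "frag_of s" y] c W_neg[OF c(2)] W_neg[OF WI.m_closed[OF c]] by(simp del: W_sel)
    thus ?case using neg(2) hneg[OF WI.m_closed[OF c]] hneg[OF c(2)] hc[OF c(1)] hc[OF c(2)] by(simp add: R.r_minus del: W_sel)
   qed
  next
   case (add x z)
   have c: "x <: W" "z <: W" using add by auto
   have "(x + z) *[W] y = x *[W] y + z *[W] y" using WI.l_distr[OF c xy(2)] by(simp del: W_sel(1,2))
   thus ?case
    using add(3,4) hadd[OF WI.m_closed[OF c(1) xy(2)] WI.m_closed[OF c(2) xy(2)]] hadd[OF c] hc[OF c(1)] hc[OF c(2)] hc[OF xy(2)]
    by(simp add: R.l_distr del: W_sel)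
  next
   case (neg x)
   have c: "x <: W" using neg by auto
   have "(- x) *[W] y = - (x *[W] y)" using WI.l_minus[OF c xy(2)] W_neg[OF c] W_neg[OF WI.m_closed[OF c xy(2)]]
    by(simp del: W_sel)
   thus ?case using neg(2) hneg[OF WI.m_closed[OF c xy(2)]] hneg[OF c] hc[OF c] hc[OF xy(2)] by(simp add: R.l_minus del: W_sel)
  qed
 qed
 have hr: "h : ring_hom W R" proof (rule ring_hom_memI)
  show "h 1[W] = 1[R]" using h(2)[of "([], 1[K])"] g1 by(simp add: e_def)
 qed (use hc hm amD2[OF ha] in "simp_all del: W_sel")
 have foldr_app: "e (u @ w, a) = foldr (%X y. f X *[R] y) u (e (w, a))" for u w a by(simp add: e_def)
 have foldr_add: "foldr (%X y. f X *[R] y) u (z +[R] z') = foldr (%X y. f X *[R] y) u z +[R] foldr (%X y. f X *[R] y) u z'"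
  if "set u <= car M" "z <: R" "z' <: R" for u z z' using that by(induction u) (auto simp: R.r_distr fc fcl)
 have rel0: "h (x - y - z) = 0[R]" if "h x = h y +[R] h z" "x <: W" "y <: W" "z <: W" for x y z proof -
  have "h x = h (y + z)" using that hadd by simp
  moreover have "y + z <: W" using that by(auto dest!: subsetD[OF keys_add])
  ultimately have "h (x - (y + z)) = 0[R]" using that hdiff[of x "y + z"] hc by(simp add: R.mn_zero_iff del: W_sel)
  thus ?thesis by(simp add: diff_diff_eq)
 qed
 have rel1: "h (x - y) = 0[R]" if "h x = h y" "x <: W" "y <: W" for x y using that hdiff hc by(simp add: R.mn_zero_iff del: W_sel)
 have hrel: "h r = 0[R]" if "r : word_relations K M" for r using that unfolding word_relations_def
 proof (elim UnE CollectE exE conjE)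
  fix u X Y w a
  assume r: "r = frag_of (u @ [X \<oplus> Y] @ w, a) - frag_of (u @ [X] @ w, a) - frag_of (u @ [Y] @ w, a)"
   and c: "set u <= car M" "X <: M" "Y <: M" "set w <= car M" "a <: K"
  have w: "e (w, a) <: R" using c by(intro ec) auto
  have "e (u @ [X \<oplus> Y] @ w, a) = e (u @ [X] @ w, a) +[R] e (u @ [Y] @ w, a)" using c w amD2[OF f c(2,3)]
   by(simp add: foldr_app) (simp add: e_def foldr_add R.l_distr fc)
  thus ?thesis unfolding r by(intro rel0) (use c in "simp_all add: he frag_of_W del: W_sel")
 next
  fix w a b assume r: "r = frag_of (w, a +[K] b) - frag_of (w, a) - frag_of (w, b)" and c: "set w <= car M" "a <: K" "b <: K"
  have "e (w, a +[K] b) = e (w, a) +[R] e (w, b)" using c amD2[OF g c(2,3)] by(simp add: e_def foldr_add gc)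
  thus ?thesis unfolding r by(intro rel0) (use c in "simp_all add: he frag_of_W del: W_sel")
 next
  fix u X Y w a b
  assume r: "r = frag_of (u @ [X \<bullet> a, Y] @ w, b) - frag_of (u @ [X, lsmult K M a Y] @ w, b)"
   and c: "set u <= car M" "X <: M" "Y <: M" "set w <= car M" "a <: K" "b <: K"
  have w: "e (w, b) <: R" using c by(intro ec) auto
  have "e (u @ [X \<bullet> a, Y] @ w, b) = e (u @ [X, lsmult K M a Y] @ w, b)"
   using c w by(simp add: foldr_app) (simp add: e_def fr fl R.m_assoc fc gc fcl)
  thus ?thesis unfolding r by(intro rel1) (use c in "simp_all add: he frag_of_W rsc del: W_sel")
 next
  fix u X a b
  assume r: "r = frag_of (u @ [X \<bullet> a], b) - frag_of (u @ [X], a *[K] b)"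
   and c: "set u <= car M" "X <: M" "a <: K" "b <: K"
  have "e (u @ [X \<bullet> a], b) = e (u @ [X], a *[K] b)" using c by(simp add: e_def fr gm R.m_assoc fc gc)
  thus ?thesis unfolding r by(intro rel1) (use c in "simp_all add: he frag_of_W rsc del: W_sel")
 qed
 have hI: "h x = 0[R]" if "x : wid K M" for x using that unfolding word_ideal_def proof (induction rule: generate.induct)
  case (inv r)
  thus ?case using hrel[OF inv] hneg[of r] W_neg[of r, unfolded a_inv_def] rels_c by(auto simp del: W_sel)
 next
  case (eng x y)
  hence "x <: W" "y <: W" using WI.a_subset by(auto simp: word_ideal_def simp del: W_sel)
  thus ?case using eng amD2[OF ha] by(simp del: W_sel)
 qed (use h0 hrel in auto)
 obtain h' where h': "h' : ring_hom T R" "!!x. x <: W ==> h' (wid K M +>[W] x) = h x"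
  using WI.quot_lift_ring[OF R hr hI] unfolding tensor_alg_def by blast
 show thesis proof (rule that[OF h'(1)])
  fix X assume X: "X <: M"
  have "h' (tin X) = e ([X], 1[K])" unfolding tensor_word_def using X by(subst h'(2)) (auto simp: h(2))
  thus "h' (tin X) = f X" using X by(simp add: e_def g1 fc)
 next
  fix a assume a: "a <: K"
  have "h' (tscal a) = e ([], a)" unfolding tscal_def using a by(subst h'(2)) (auto simp: h(2))
  thus "h' (tscal a) = g a" by(simp add: e_def)
 qed
qed

end

section \<open>Endomorphism rings and ring actions on abelian groups\<close>

section \<open>Endomorphism rings and actions\<close>

lemma End_alg_sel [simp]:
 "car (End_alg K M) = Hom K M M" "monoid.mult (End_alg K M) = compose (car M)"
 "one (End_alg K M) = (\<lambda>x\<in>car M. x)" "ring.zero (End_alg K M) = (\<lambda>x\<in>car M. 0[M])"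
 "add (End_alg K M) = (%f g. \<lambda>x\<in>car M. f x +[M] g x)"
 "hp (End_alg K M) = (%i. {f : Hom K M M. ALL j. f ` hp M j <= hp M (i + j)})"
 "f .[End_alg K M] a = (\<lambda>x\<in>car M. f (lsmult K M a x))" by(simp_all add: End_alg_def)

lemma End_ring: assumes M: "abelian_group M" and s: "!!a. a <: K ==> addmap M M (%x. x .[M] a)" shows "ring (End_alg K M)"
proof -
 interpret M: abelian_group M by fact
 note sc = amD1[OF s] and sa = amD2[OF s]
 have z: "0[M] .[M] a = 0[M]" if "a <: K" for a by(rule am_zn(1)[OF M M s[OF that]])
 have n: "-[M] x .[M] a = -[M] (x .[M] a)" if "a <: K" "x <: M" for a x using am_zn(2)[OF M M s[OF that(1)] that(2)] .
 have add: "(\<lambda>x\<in>car M. f x +[M] g x) : Hom K M M" if "f : Hom K M M" "g : Hom K M M" for f g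
  by(rule HomI) (use HomD[OF that(1)] HomD[OF that(2)] in "simp_all add: sc sa M.a_ac")
 have neg: "(\<lambda>x\<in>car M. -[M] f x) : Hom K M M" if "f : Hom K M M" for f
  by(rule HomI) (use HomD[OF that] in "simp_all add: sc n M.minus_add")
 have zero: "(\<lambda>x\<in>car M. 0[M]) : Hom K M M" by(rule HomI) (simp_all add: z sc)
 have one: "(\<lambda>x\<in>car M. x) : Hom K M M" by(rule HomI) (simp_all add: sc)
 have comp: "compose (car M) f g : Hom K M M" if "f : Hom K M M" "g : Hom K M M" for f g
  by(rule HomI) (use HomD[OF that(1)] HomD[OF that(2)] in "simp_all add: sc compose_def")
 show ?thesis proof (rule ringI)
  show "abelian_group (End_alg K M)" proof (rule abelian_groupI)
   fix f assume "f : car (End_alg K M)"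
   hence f: "f : Hom K M M" by simp
   show "EX g:car (End_alg K M). g +[End_alg K M] f = 0[End_alg K M]"
    by(rule bexI[of _ "\<lambda>x\<in>car M. -[M] f x"], unfold End_alg_sel, rule restrict_ext)
     (use neg[OF f] HomD(2)[OF f] in "simp_all add: M.l_neg")
   show "0[End_alg K M] +[End_alg K M] f = f" using HomD(2)[OF f] HomD(3)[OF f] by(intro extensionalityI[of _ "car M"]) simp_all
   fix g assume "g : car (End_alg K M)"
   hence g: "g : Hom K M M" by simp
   show "f +[End_alg K M] g : car (End_alg K M)" using add[OF f g] by simp
   show "f +[End_alg K M] g = g +[End_alg K M] f" unfolding End_alg_sel
    by(rule restrict_ext) (use HomD(2)[OF f] HomD(2)[OF g] in "simp add: M.a_comm")
   fix h assume "h : car (End_alg K M)"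
   hence h: "h : Hom K M M" by simp
   show "f +[End_alg K M] g +[End_alg K M] h = f +[End_alg K M] (g +[End_alg K M] h)" unfolding End_alg_sel
    by(rule restrict_ext) (use HomD(2)[OF f] HomD(2)[OF g] HomD(2)[OF h] in "simp add: M.a_assoc")
  qed (use zero in simp)
  show "Group.monoid (End_alg K M)" proof (rule monoidI)
   fix f assume "f : car (End_alg K M)"
   hence f: "f : Hom K M M" by simp
   show "1[End_alg K M] *[End_alg K M] f = f" "f *[End_alg K M] 1[End_alg K M] = f" using HomD(2)[OF f] HomD(3)[OF f]
    by(simp_all add: compose_def extensionalityI[of _ "car M"])
   fix g assume "g : car (End_alg K M)"
   hence g: "g : Hom K M M" by simp
   show "f *[End_alg K M] g : car (End_alg K M)" using comp[OF f g] by simp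
   fix h assume "h : car (End_alg K M)"
   hence h: "h : Hom K M M" by simp
   show "f *[End_alg K M] g *[End_alg K M] h = f *[End_alg K M] (g *[End_alg K M] h)" unfolding End_alg_sel compose_def
    by(rule restrict_ext) (use HomD(2)[OF f] HomD(2)[OF g] HomD(2)[OF h] in simp)
  qed (use one in simp)
  fix f g h
  assume "f : car (End_alg K M)" "g : car (End_alg K M)" "h : car (End_alg K M)"
  hence f: "f : Hom K M M" and g: "g : Hom K M M" and h: "h : Hom K M M" by simp_all
  show "(f +[End_alg K M] g) *[End_alg K M] h = f *[End_alg K M] h +[End_alg K M] g *[End_alg K M] h"
   unfolding End_alg_sel compose_def by(rule restrict_ext) (use HomD(2)[OF f] HomD(2)[OF g] HomD(2)[OF h] in simp)
  show "h *[End_alg K M] (f +[End_alg K M] g) = h *[End_alg K M] f +[End_alg K M] h *[End_alg K M] g"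
   unfolding End_alg_sel compose_def by(rule restrict_ext) (use HomD(2)[OF f] HomD(2)[OF g] HomD(4)[OF h] in simp)
 qed
qed

text \<open>Over an empty set of scalars linearity is additivity, so \<open>End_alg kempty G\<close>
  is the ring of all additive endomorphisms of an abelian group.\<close>

definition kempty :: "'k sring" where "kempty = undefined\<lparr>carrier := {}\<rparr>"

lemma carrier_kempty [simp]: "car kempty = {}" by(simp add: kempty_def)

text \<open>The pointwise form of a ring homomorphism into an endomorphism ring, free of
  \<open>restrict\<close> and \<open>compose\<close>.\<close>

definition is_action :: "('a, 'r) ring_scheme => ('b, 's) ring_scheme => ('a => 'b => 'b) => bool" where
 "is_action R G A \<longleftrightarrow> (ALL s:car R. addmap G G (A s)) &
  (ALL s:car R. ALL t:car R. ALL v:car G. A (s +[R] t) v = A s v +[G] A t v &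
    A (s *[R] t) v = A s (A t v)) & (ALL v:car G. A 1[R] v = v)"

lemma is_actD: assumes "is_action R G A" shows "s <: R ==> addmap G G (A s)"
  "s <: R ==> v <: G ==> A s v <: G"
  "s <: R ==> v <: G ==> w <: G ==> A s (v +[G] w) = A s v +[G] A s w"
  "s <: R ==> t <: R ==> v <: G ==> A (s +[R] t) v = A s v +[G] A t v"
  "s <: R ==> t <: R ==> v <: G ==> A (s *[R] t) v = A s (A t v)"
  "v <: G ==> A 1[R] v = v" using assms by(auto simp: is_action_def addmap_def)

lemma is_act_sg: assumes "ring R" "abelian_group G" "is_action R G A" "s <: R" "t <: R" "v <: G"
 shows "A (sg R k s) v = sg G k (A s v)" "A (s -[R] t) v = A s v -[G] A t v"
proof -
 interpret R: ring R by fact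
 have a: "addmap R G (%s. A s v)" by(rule addmapI) (use is_actD[OF assms(3)] assms(6) in auto)
 show "A (sg R k s) v = sg G k (A s v)" "A (s -[R] t) v = A s v -[G] A t v"
  using am_zn(3,4)[OF R.abx assms(2) a] assms(4,5) by simp_all
qed

lemma End_kempty: "f : Hom kempty G G \<longleftrightarrow> addmap G G f & f : extensional (car G)"
 by(auto simp: Hom_def addmap_def PiE_def)

lemma restrict_End: assumes "abelian_group G" "addmap G G f" shows "restrict f (car G) : Hom kempty G G"
proof -
 interpret abelian_group G by fact
 show ?thesis unfolding End_kempty using assms(2) by(simp add: addmap_def Pi_iff)
qed

lemma is_action_End: fixes G :: "('k, 'b) smod" assumes "ring R" "abelian_group G" "h : ring_hom R (End_alg kempty G)"
 shows "is_action R G h" unfolding is_action_def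
proof (intro conjI ballI)
 note h = ring_homD[OF assms(3)]
 show "addmap G G (h s)" if "s <: R" for s using h(2)[OF that] by(simp add: End_kempty)
 show "h (s +[R] t) v = h s v +[G] h t v" "h (s *[R] t) v = h s (h t v)" if "s <: R" "t <: R" "v <: G" for s t v
  using h(4,5)[OF that(1,2)] that(3) by(simp_all add: compose_def)
 show "h 1[R] v = v" if "v <: G" for v using h(3) that by simp
qed

text \<open>Serves as an abelian group of functions, on which the parity of an element of a quotient
  algebra is detected; hence the undefined fields.\<close>

definition fun_mod :: "('k, 'a, 'r) smod_scheme => ('k, 'i => 'a) smod" where
 "fun_mod M = \<lparr>carrier = {f. ALL i. f i <: M}, monoid.mult = undefined, one = undefined,
  ring.zero = (%_. 0[M]), add = (%f g i. f i +[M] g i), hpart = undefined, rsmult = undefined\<rparr>"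

lemma fun_mod_sel [simp]:
 "f : car (fun_mod M) \<longleftrightarrow> (ALL i. f i <: M)" "0[fun_mod M] = (%_. 0[M])"
 "f +[fun_mod M] g = (%i. f i +[M] g i)" by(simp_all add: fun_mod_def)

lemma fun_mod_ab: fixes M :: "('k, 'a, 'r) smod_scheme"
 assumes "abelian_group M" shows "abelian_group (fun_mod M :: ('k, 'i => 'a) smod)"
proof -
 interpret abelian_group M by fact
 show ?thesis proof (rule abelian_groupI)
  fix f :: "'i => 'a" assume "f : car (fun_mod M :: ('k, 'i => 'a) smod)"
  thus "EX y:car (fun_mod M :: ('k, 'i => 'a) smod). y +[fun_mod M] f = 0[fun_mod M :: ('k, 'i => 'a) smod]"
   by(intro bexI[of _ "%i. -[M] f i"]) (auto simp: l_neg)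
 qed (auto simp: a_ac)
qed

lemma am_sub_img: assumes "abelian_group M" "abelian_group N" "addmap M N f" "subgroup I (add_monoid M)"
 shows "subgroup (f ` I) (add_monoid N)"
 using group_hom.subgroup_img_is_subgroup[OF abelian_group_hom.a_group_hom[OF am_group_hom[OF assms(1-3)]] assms(4)] .


section \<open>Quotients of the tensor algebra by relations of pure parity\<close>

section \<open>Quotients of the tensor algebra\<close>

context tmodule begin

lemma W_hp_sub: "subgroup (hp W i) (add_monoid W)"
proof -
 define HB where "HB = {(w, a). EX ps j. hps M w ps & a : hp K j & sum_list ps + j = i}"
 have HB: "HB <= lists (car M) \<times> car K" proof -
  have "set w <= car M" if "hps M w ps" for w ps using that by(induction rule: list_all2_induct) (auto intro: hpc)
  thus ?thesis unfolding HB_def using K.hpc by fastforce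
 qed
 have hp: "hp W i = {x. Poly_Mapping.keys x <= HB}" by(simp add: HB_def)
 have c: "x <: W" if "x : hp W i" for x using that HB unfolding hp by auto
 show ?thesis proof (rule group.subgroupI[OF abelian_group.a_group[OF W_ab]])
  show "hp W i <= car (add_monoid W)" using c by(auto simp del: W_sel)
  show "hp W i ~= {}" unfolding hp by(auto intro: exI[of _ 0])
  show "inv[add_monoid W] x : hp W i" if "x : hp W i" for x
   using W_neg[OF c[OF that], unfolded a_inv_def] that unfolding hp by simp
  show "x *[add_monoid W] y : hp W i" if "x : hp W i" "y : hp W i" for x y using that keys_add[of x y] unfolding hp by auto
 qed
qed

lemma T_proj_addmap: "addmap W T (%x. wid K M +>[W] x)" unfolding tensor_alg_def by(rule WI.proj_am)

lemma T_hp_eq: "hp T i = (%x. wid K M +>[W] x) ` hp W i" by(simp add: tensor_alg_def)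

lemma T_hp_sub: "subgroup (hp T i) (add_monoid T)" unfolding T_hp_eq by(rule am_sub_img[OF W_ab T.abx T_proj_addmap W_hp_sub])

lemma T_hpart_closed:
 "x : hp T i ==> y : hp T i ==> x +[T] y : hp T i"
 "x : hp T i ==> -[T] x : hp T i"
 "x : hp T i ==> sg T k x : hp T i"
 "x : hp T i ==> y : hp T i ==> x -[T] y : hp T i"
 using subgroup.m_closed[OF T_hp_sub, of x i y] subgroup.m_inv_closed[OF T_hp_sub, of x i]
  subgroup.m_closed[OF T_hp_sub, of x i "-[T] y"] subgroup.m_inv_closed[OF T_hp_sub, of y i]
 by(auto simp: a_inv_def sg_def a_minus_def)

lemma word_mult_hom: assumes "hps M u ps" "a : hp K i"
  "hps M v qs" "b : hp K j" shows "EX w c rs k. word_mult K M (u, a) (v, b) = (w, c) & hps M w rs &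
  c : hp K k & sum_list rs + k = (sum_list ps + i) + (sum_list qs + j)"
proof (cases v)
 case Nil
 have "word_mult K M (u, a) (v, b) = (u, a *[K] b)" "qs = []" using Nil assms(3) by simp_all
 thus ?thesis using assms K.hpart_mult[OF assms(2,4)] by(auto simp: add.assoc)
next
 case (Cons Y w)
 then obtain q qs' where q: "qs = q # qs'" "Y : hp M q" "hps M w qs'" using assms(3) by(auto simp: list_all2_Cons1)
 have "hps M (u @ lsmult K M a Y # w) (ps @ (i + q) # qs')"
  using assms(1) q ls_hp[OF q(2) assms(2)] by(simp add: list_all2_appendI)
 thus ?thesis using Cons assms(4) q by(auto intro!: exI[of _ "ps @ (i + q) # qs'"] exI[of _ j] simp: algebra_simps)
qed

lemma T_hpart_mult: assumes "x : hp T i" "y : hp T j" shows "x *[T] y : hp T (i + j)"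
proof -
 obtain u v where uv: "u : hp W i" "v : hp W j"
  "x = wid K M +>[W] u" "y = wid K M +>[W] v" using assms unfolding T_hp_eq by blast
 have c: "u <: W" "v <: W" using subgroup.subset[OF W_hp_sub] uv by auto
 have "Poly_Mapping.keys (u *[W] v) <= {(w, a). EX ps k. hps M w ps & a : hp K k & sum_list ps + k = i + j}" unfolding W_sel
 proof (rule keys_fe_subset, rule keys_fe_subset)
  fix s t assume "s : Poly_Mapping.keys u" "t : Poly_Mapping.keys v"
  hence "s : {(w, a). EX ps k. hps M w ps & a : hp K k & sum_list ps + k = i}"
   "t : {(w, a). EX ps k. hps M w ps & a : hp K k & sum_list ps + k = j}" using uv(1,2) by auto
  then obtain us a ps k vs b qs l where s: "s = (us, a)" "hps M us ps"
   "a : hp K k" "sum_list ps + k = i" and t: "t = (vs, b)" "hps M vs qs"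
   "b : hp K l" "sum_list qs + l = j" by auto
  thus "Poly_Mapping.keys (frag_of (word_mult K M s t)) <= {(w, a). EX ps k. hps M w ps & a : hp K k & sum_list ps + k = i + j}"
   using word_mult_hom[OF s(2,3) t(2,3)] unfolding keys_frag_of s(1) t(1) s(4)[symmetric] t(4)[symmetric] by fastforce
 qed
 hence "u *[W] v : hp W (i + j)" by simp
 thus ?thesis unfolding uv T_proj(2)[OF c, symmetric] T_hp_eq by(rule imageI)
qed

lemma tscal_hpart: "a : hp K i ==> tscal a : hp T i" unfolding tscal_def T_hp_eq by(rule imageI) auto

lemma tin_hp: "X : hp M i ==> tin X : hp T i" unfolding tensor_word_def T_hp_eq
 by(rule imageI) (auto intro!: exI[of _ "[i]"] exI[of _ 0] K.hpart_one)

text \<open>This is \<open>tensor_univ\<close> for the additive endomorphism ring: operators for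
  letters and scalars that are compatible with both actions define a module over the tensor
  algebra.\<close>

lemma tensor_action: fixes G :: "('k, 'b) smod" assumes G: "abelian_group G" and f: "!!X. X <: M ==> addmap G G (f X)"
   "!!X Y v. X <: M ==> Y <: M ==> v <: G ==> f (X \<oplus> Y) v = f X v +[G] f Y v" and g: "!!a. a <: K ==> addmap G G (g a)"
   "!!a b v. a <: K ==> b <: K ==> v <: G ==> g (a +[K] b) v = g a v +[G] g b v"
   "!!a b v. a <: K ==> b <: K ==> v <: G ==> g (a *[K] b) v = g a (g b v)"
   "!!v. v <: G ==> g 1[K] v = v" and fg: "!!X a v. X <: M ==> a <: K ==> v <: G ==> f (X \<bullet> a) v = f X (g a v)"
   "!!X a v. X <: M ==> a <: K ==> v <: G ==> f (lsmult K M a X) v = g a (f X v)"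
 obtains h where "h : ring_hom T (End_alg kempty G)" "is_action T G h"
  "!!X v. X <: M ==> v <: G ==> h (tin X) v = f X v"
  "!!a v. a <: K ==> v <: G ==> h (tscal a) v = g a v"
proof -
 let ?r = "%f. restrict f (car G)"
 have R: "ring (End_alg kempty G)" by(rule End_ring[OF G]) simp
 note fc = amD1[OF f(1)] and gc = amD1[OF g(1)]
 have "addmap M (End_alg kempty G) (%X. ?r (f X))"
  by(rule addmapI) (use f in "auto simp: restrict_End[OF G] intro!: restrict_ext")
 moreover have "addmap K (End_alg kempty G) (%a. ?r (g a))"
  by(rule addmapI) (use g in "auto simp: restrict_End[OF G] intro!: restrict_ext")
 ultimately obtain h where h: "h : ring_hom T (End_alg kempty G)"
  "!!X. X <: M ==> h (tin X) = ?r (f X)" "!!a. a <: K ==> h (tscal a) = ?r (g a)"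
  by(rule tensor_univ[OF R]) (use g fg fc gc in "auto simp: compose_def rsc intro!: restrict_ext")
 show thesis by(rule that[OF h(1) is_action_End[OF T.ring_axioms G h(1)]]) (simp_all add: h)
qed

end

text \<open>A common frame for S(g) and U(g). The relations are homogeneous in parity but not in
  word length, since those of U(g) mix lengths.\<close>

locale talg = tmodule K M for K :: "'k sring" and M :: "('k, 'a, 'r) smod_scheme" (structure) +
 fixes Gn :: "(('a list \<times> 'k) \<Rightarrow>\<^sub>0 int) set set"
  and Q :: "('k, (('a list \<times> 'k) \<Rightarrow>\<^sub>0 int) set set) smod"
  and qin :: "'a => (('a list \<times> 'k) \<Rightarrow>\<^sub>0 int) set set" assumes Q_eq: "Q = quot_alg T (genideal T Gn)"
  and qin_eq: "X <: M ==> qin X = genideal T Gn +>[T] tin X" and Gn_hom: "r : Gn ==> EX i. r : hp T i"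
begin

abbreviation "J == genideal T Gn"

definition "pq t = J +>[T] t"

definition "qscal a = pq (tscal a)"

lemma Gn_c: "Gn <= car T" using Gn_hom T_hp_c by blast

lemma J_ideal: "smod_ideal J T" using T.genideal_ideal[OF Gn_c] by(rule smod_ideal.intro)

lemma Q_ring: "ring Q" unfolding Q_eq by(rule smod_ideal.quot_ring[OF J_ideal])

sublocale Q: ring Q by(rule Q_ring)

lemma J_qu: "smod_quot J T"
 by(rule smod_quotI[OF T.abx additive_subgroup.a_subgroup[OF ideal.axioms(1)[OF T.genideal_ideal[OF Gn_c]]]])

lemma pq_closed [simp]: "t <: T ==> pq t <: Q" unfolding pq_def Q_eq by(rule smod_quot.proj_c[OF J_qu])

lemma pq_add: "s <: T ==> t <: T ==> pq (s +[T] t) = pq s +[Q] pq t" unfolding pq_def Q_eq by(rule smod_quot.proj_add[OF J_qu])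

lemma pq_mult: "s <: T ==> t <: T ==> pq (s *[T] t) = pq s *[Q] pq t"
 unfolding pq_def Q_eq by(rule smod_ideal.proj_mult[OF J_ideal])

lemma pq_one: "pq 1[T] = 1[Q]" unfolding pq_def Q_eq by(rule smod_ideal.quot_one[OF J_ideal, symmetric])

lemma pq_am: "addmap T Q pq" by(simp add: addmapI pq_add)

lemma pq_neg:
 "t <: T ==> pq (-[T] t) = -[Q] pq t" "t <: T ==> pq (sg T k t) = sg Q k (pq t)"
 "s <: T ==> t <: T ==> pq (s -[T] t) = pq s -[Q] pq t" using am_zn[OF T.abx Q.abx pq_am] by simp_all

lemma pq_zero_iff: "t <: T ==> pq t = 0[Q] \<longleftrightarrow> t : J"
 unfolding pq_def Q_eq by(rule smod_quot.proj_zero_iff[OF J_qu])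

lemma pq_gen: "r : Gn ==> pq r = 0[Q]" using Gn_c T.genideal_self[OF Gn_c] by(subst pq_zero_iff) auto

lemma pq_eq_iff: "s <: T ==> t <: T ==> pq s = pq t \<longleftrightarrow> s -[T] t : J"
 unfolding pq_def Q_eq by(rule smod_quot.proj_eq_iff[OF J_qu])

lemma pq_cases: assumes "x <: Q" obtains t where "t <: T" "x = pq t"
 using assms unfolding Q_eq by(rule smod_quot.qu_cases[OF J_qu]) (simp add: pq_def that)

lemma pq_tin: "X <: M ==> pq (tin X) = qin X" by(simp add: qin_eq pq_def)

lemma pq_tscal: "pq (tscal a) = qscal a" by(simp add: qscal_def)

lemma qin_c [simp]: "X <: M ==> qin X <: Q" by(simp add: pq_tin[symmetric])

lemma qscal_closed [simp]: "a <: K ==> qscal a <: Q" by(simp add: qscal_def)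

lemma qin_add: "X <: M ==> Y <: M ==> qin (X \<oplus> Y) = qin X +[Q] qin Y" by(simp add: pq_tin[symmetric] tin_add pq_add)

lemma qin_am: "addmap M Q qin" by(simp add: addmapI qin_add)

lemma qin_neg: "X <: M ==> qin (\<ominus> X) = -[Q] qin X" "X <: M ==> qin (sg M k X) = sg Q k (qin X)"
 "qin \<zero> = 0[Q]" using am_zn[OF abx Q.abx qin_am] by simp_all

lemma qscal_add: "a <: K ==> b <: K ==> qscal (a +[K] b) = qscal a +[Q] qscal b" by(simp add: qscal_def tscal_add pq_add)

lemma qscal_mult: "a <: K ==> b <: K ==> qscal (a *[K] b) = qscal a *[Q] qscal b" by(simp add: qscal_def tscal_mult pq_mult)

lemma qscal_one: "qscal 1[K] = 1[Q]" by(simp add: qscal_def tscal_one pq_one)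

lemma qscal_am: "addmap K Q qscal" by(simp add: addmapI qscal_add)

lemma qscal_neg: "a <: K ==> qscal (-[K] a) = -[Q] qscal a"
 "a <: K ==> qscal (sg K k a) = sg Q k (qscal a)" "qscal 0[K] = 0[Q]" using am_zn[OF K.abx Q.abx qscal_am] by simp_all

lemma qin_rs: "X <: M ==> a <: K ==> qin (X \<bullet> a) = qin X *[Q] qscal a"
 by(simp add: pq_tin[symmetric] rsc tin_rsmult pq_mult qscal_def)

lemma qin_ls: "X <: M ==> a <: K ==> qin (lsmult K M a X) = qscal a *[Q] qin X"
 by(simp add: pq_tin[symmetric] tin_lsmult pq_mult qscal_def)

lemma Q_rs: "x <: Q ==> a <: K ==> x .[Q] a = x *[Q] qscal a"
proof -
 assume a: "x <: Q" "a <: K"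
 obtain t where t: "t <: T" "x = pq t" using pq_cases[OF a(1)] .
 show ?thesis unfolding t(2) qscal_def pq_def Q_eq
  by(rule smod_ideal.qu_rs'[OF J_ideal t(1) tscal_c[OF a(2)]]) (rule T_rsmult[OF _ a(2)])
qed

lemma Q_ind [consumes 1, case_names scal mult add]: assumes "x <: Q" "!!a. a <: K ==> P (qscal a)"
  "!!X y. X <: M ==> y <: Q ==> P y ==> P (qin X *[Q] y)"
  "!!x y. x <: Q ==> y <: Q ==> P x ==> P y ==> P (x +[Q] y)" shows "P x"
proof -
 obtain t where t: "t <: T" "x = pq t" using pq_cases[OF assms(1)] .
 show ?thesis unfolding t(2) using t(1) by(induction rule: T_induct)
   (simp_all add: pq_tscal pq_mult pq_add pq_tin assms(2-4))
qed

lemma Q_univ: assumes R: "ring R" and h: "h : ring_hom T R" and z: "!!r. r : Gn ==> h r = 0[R]"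
 obtains h' where "h' : ring_hom Q R" "!!t. t <: T ==> h' (pq t) = h t"
proof -
 interpret hh: ring_hom_ring T R h using ring_hom_ringI2[OF T.ring_axioms R h] .
 have "Gn <= a_kernel T R h" proof
  fix r assume r: "r : Gn"
  hence "r <: T" using Gn_c by blast
  thus "r : a_kernel T R h" unfolding a_kernel_def' using z[OF r] by blast
 qed
 hence "J <= a_kernel T R h" by(rule T.genideal_minimal[OF hh.kernel_is_ideal])
 hence "h x = 0[R]" if "x : J" for x using that unfolding a_kernel_def' by blast
 thus thesis using smod_ideal.quot_lift_ring[OF J_ideal R h] that unfolding pq_def Q_eq by blast
qed

lemma Q_act: fixes G :: "('k, 'b) smod" assumes G: "abelian_group G" and h: "h : ring_hom T (End_alg kempty G)"
  and z: "!!r v. r : Gn ==> v <: G ==> h r v = 0[G]"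
 obtains h' where "h' : ring_hom Q (End_alg kempty G)" "is_action Q G h'"
  "!!t. t <: T ==> h' (pq t) = h t"
proof -
 have R: "ring (End_alg kempty G)" by(rule End_ring[OF G]) simp
 have "h r = 0[End_alg kempty G]" if r: "r : Gn" for r proof -
  have "h r : extensional (car G)" using ring_homD(2)[OF h] r Gn_c by(auto simp: End_kempty)
  thus ?thesis using z[OF r] by(intro extensionalityI[of _ "car G"]) auto
 qed
 thus thesis using Q_univ[OF R h] is_action_End[OF Q_ring G] that by metis
qed

lemma Q_hp_eq: "hp Q i = pq ` hp T i" by(auto simp: Q_eq pq_def)

lemma Q_hp_ind [consumes 1, case_names zero scal mult add]:
 assumes "x : hp Q i" "!!i. P i 0[Q]" "!!j a. a : hp K j ==> P j (qscal a)"
  "!!p X j y. X : hp M p ==> y : hp Q j ==> P j y ==> P (p + j) (qin X *[Q] y)"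
  "!!j x y. x <: Q ==> y <: Q ==> P j x ==> P j y ==> P j (x +[Q] y)" shows "P i x"
proof -
 obtain t where t: "t : hp T i" "x = pq t" using assms(1) by(auto simp: Q_hp_eq)
 have z: "pq 0[T] = 0[Q]" by(rule am_zn(1)[OF T.abx Q.abx pq_am])
 show ?thesis unfolding t(2) using t(1) proof (induction rule: T_hp_ind)
  case (mult p X j y)
  thus ?case using assms(4)[of X p "pq y" j] by(simp add: pq_mult hpc T_hp_c pq_tin Q_hp_eq)
 qed (simp_all add: z pq_tscal pq_add assms(2,3,5))
qed

lemma qin_hp: "X : hp M p ==> qin X : hp Q p" using pq_tin[OF hpc, symmetric] tin_hp by(auto simp: Q_hp_eq)

lemma qscal_hp: "a : hp K p ==> qscal a : hp Q p" using tscal_hpart by(auto simp: Q_hp_eq qscal_def)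

lemma Q_hp_mult: "x : hp Q i ==> y : hp Q j ==> x *[Q] y : hp Q (i + j)" unfolding Q_hp_eq
 by(elim imageE, hypsubst, subst pq_mult[symmetric]) (auto intro: T_hp_c T_hpart_mult)

lemma Q_hp_sub: "subgroup (hp Q i) (add_monoid Q)" unfolding Q_hp_eq by(rule am_sub_img[OF T.abx Q.abx pq_am T_hp_sub])

lemma hpart_split: assumes X: "X <: M" shows "qin X = qin (hcomp M 0 X) +[Q] qin (hcomp M 1 X)"
 using qin_add[of "hcomp M 0 X" "hcomp M 1 X"] X by(simp flip: hcomp_sum)

lemma qscal_split: assumes X: "a <: K" shows "qscal a = qscal (hcomp K 0 a) +[Q] qscal (hcomp K 1 a)"
 using qscal_add[of "hcomp K 0 a" "hcomp K 1 a"] X by(simp flip: K.hcomp_sum)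

text \<open>The parity grading of the quotient is detected by the action on functions on the parities
 for which an element of parity \<open>i\<close> multiplies by itself and shifts by \<open>i\<close>.\<close>

lemma Q_hpart_disjoint: assumes "x : hp Q 0" "x : hp Q 1" shows "x = 0[Q]"
proof -
 let ?G = "fun_mod Q :: ('k, bit => _) smod"
 define f where "f X = (%(v :: bit => _) i. qin (hcomp M 0 X) *[Q] v i +[Q] qin (hcomp M 1 X) *[Q] v (i + 1))" for X
 define g where "g a = (%(v :: bit => _) i. qscal (hcomp K 0 a) *[Q] v i +[Q] qscal (hcomp K 1 a) *[Q] v (i + 1))" for a
 have G: "abelian_group ?G" by(rule fun_mod_ab[OF Q.abx])
 have fa: "addmap ?G ?G (f X)" if "X <: M" for X by(rule addmapI) (use that in "auto simp: f_def Q.r_distr Q.a_ac")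
 have ga: "addmap ?G ?G (g a)" if "a <: K" for a by(rule addmapI) (use that in "auto simp: g_def Q.r_distr Q.a_ac")
 have fh: "f X v = (%i. qin X *[Q] v (i + p))" if "X : hp M p" "v : car ?G" for X v p
  using that hpc[OF that(1)] by(cases p) (auto simp: f_def hcomp_hom[OF that(1)] qin_neg)
 have gh: "g a v = (%i. qscal a *[Q] v (i + p))" if "a : hp K p" "v : car ?G" for a v p
  using that K.hpc[OF that(1)] by(cases p) (auto simp: g_def K.hcomp_hom[OF that(1)] qscal_neg)
 have f2: "f (X \<oplus> Y) v = f X v +[?G] f Y v" if "X <: M" "Y <: M" "v : car ?G" for X Y v
  using that by(auto simp: f_def hcomp_add qin_add Q.l_distr Q.a_ac)
 have g2: "g (a +[K] b) v = g a v +[?G] g b v" if "a <: K" "b <: K" "v : car ?G" for a b v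
  using that by(auto simp: g_def K.hcomp_add qscal_add Q.l_distr Q.a_ac)
 note gc = amD1[OF ga] and fc = amD1[OF fa]
 have g3: "g (a *[K] b) v = g a (g b v)" if ab: "a <: K" "b <: K" "v : car ?G" for a b v using ab(1)
 proof (induction rule: K.hom_ind)
  case (hom i a)
  note a = K.hpc[OF hom]
  from ab(2) show ?case proof (induction rule: K.hom_ind)
   case (hom j b)
   thus ?case using gh[OF K.hpart_mult[OF `a : hp K i` hom] ab(3)] a K.hpc[OF hom] ab(3)
    by(subst gh[OF hom ab(3)], subst gh[OF `a : hp K i`]) (auto simp: qscal_mult Q.m_assoc add.assoc)
  qed (use a ab in "simp add: K.r_distr g2 amD2[OF ga] gc del: fun_mod_sel")
 qed (use ab in "simp add: K.l_distr g2 gc del: fun_mod_sel")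
 have fg1: "f (X \<bullet> a) v = f X (g a v)" if ab: "X <: M" "a <: K" "v : car ?G" for X a v using ab(1)
 proof (induction rule: hom_ind)
  case (hom i X)
  note a = hpc[OF hom]
  from ab(2) show ?case proof (induction rule: K.hom_ind)
   case (hom j b)
   thus ?case using fh[OF rsmult_hpart[OF `X : hp M i` hom] ab(3)] a K.hpc[OF hom] ab(3)
    by(subst gh[OF hom ab(3)], subst fh[OF `X : hp M i`]) (auto simp: qin_rs Q.m_assoc add.assoc)
  qed (use a ab in "simp add: rsmult_add_right f2 g2 amD2[OF fa] gc rsc del: fun_mod_sel")
 qed (use ab in "simp add: rsmult_add_left f2 gc rsc del: fun_mod_sel")
 have fg2: "f (lsmult K M a X) v = g a (f X v)" if ab: "X <: M" "a <: K" "v : car ?G" for X a v using ab(1)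
 proof (induction rule: hom_ind)
  case (hom i X)
  note a = hpc[OF hom]
  from ab(2) show ?case proof (induction rule: K.hom_ind)
   case (hom j b)
   thus ?case using fh[OF ls_hp[OF `X : hp M i` hom] ab(3)] a K.hpc[OF hom] ab(3)
    by(subst fh[OF `X : hp M i` ab(3)], subst gh[OF hom]) (auto simp: qin_ls Q.m_assoc add_ac)
  qed (use a ab in "simp add: lsm_addl f2 g2 fc del: fun_mod_sel")
 qed (use ab in "simp add: lsm_addr f2 amD2[OF ga] fc del: fun_mod_sel")
 obtain h where h: "h : ring_hom T (End_alg kempty ?G)" "is_action T ?G h"
  "!!X v. X <: M ==> v : car ?G ==> h (tin X) v = f X v"
  "!!a v. a <: K ==> v : car ?G ==> h (tscal a) v = g a v" by(rule tensor_action[OF G fa f2 ga g2 g3 _ fg1 fg2])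
   (auto simp: gh[OF K.hpart_one] qscal_one simp del: fun_mod_sel, simp)
 have hh: "h t v = (%j. pq t *[Q] v (j + i))" if "t : hp T i" "v : car ?G" for t i v using that(1)
 proof (induction rule: T_hp_ind)
  case (scal j a)
  thus ?case using gh[OF scal that(2)] that(2) by(simp add: h(4) K.hpc pq_tscal)
 next
  case (mult p X j y)
  note c = hpc[OF mult(1)] T_hp_c[OF mult(2)]
  have y: "h y v : car ?G" using is_actD(2)[OF h(2) c(2) that(2)] .
  have "h (tin X *[T] y) v = f X (h y v)"
   using c y that(2) is_actD(5)[OF h(2) tin_closed[OF c(1)] c(2)] by(simp add: h(3) del: fun_mod_sel)
  thus ?case using c that(2) fh[OF mult(1) y] unfolding mult(3) by(auto simp: pq_mult pq_tin Q.m_assoc add_ac)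
 next
  case (add j x y)
  thus ?case using is_actD(4)[OF h(2) add(1,2) that(2)] that(2) by(simp add: pq_add Q.l_distr)
 qed (use that(2) am_zn(1)[OF T.abx G, of "%t. h t v"]
   am_zn(1)[OF T.abx Q.abx pq_am]
   is_actD(2,4)[OF h(2)] in "simp_all add: addmap_def Pi_iff")
 obtain h' where h': "is_action Q ?G h'" "!!t. t <: T ==> h' (pq t) = h t" proof (rule Q_act[OF G h(1)])
  fix r v assume rv: "r : Gn" "v : car ?G"
  then obtain i where "r : hp T i" using Gn_hom by blast
  thus "h r v = 0[?G]" using rv by(simp add: hh pq_gen)
 qed (use that in blast)
 have hx: "h' x v = (%j. x *[Q] v (j + i))" if "x : hp Q i" "v : car ?G" for x i v proof -
  obtain t where t: "t : hp T i" "x = pq t" using `x : hp Q i` by(auto simp: Q_hp_eq)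
  thus ?thesis using h'(2)[OF T_hp_c[OF t(1)]] hh[OF t(1) that(2)] by simp
 qed
 have "x <: Q" using subgroup.subset[OF Q_hp_sub] assms(1) by auto
 \<comment> \<open>On the indicator function of parity 0, an even element gives itself in coordinate
   0 and an odd element gives zero there.\<close>
 moreover define v where "v = (%i::bit. if i = 0 then 1[Q] else 0[Q])"
 moreover have "v : car ?G" by(simp add: v_def)
 moreover from this have "h' x v 0 = x *[Q] v 0" "h' x v 0 = x *[Q] v 1"
  using fun_cong[OF hx[OF assms(1), of v], of 0] fun_cong[OF hx[OF assms(2), of v], of 0] by(simp_all only: add_0)
 ultimately show ?thesis by(simp add: v_def)
qed

lemma Q_graded: "graded_group Q"
proof (intro graded_group.intro graded_group_axioms.intro Q.abx Q_hp_sub)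
 have z: "0[Q] : hp Q i" for i using subgroup.one_closed[OF Q_hp_sub, of i] by simp
 show "hp Q 0 Int hp Q 1 = {0[Q]}" using Q_hpart_disjoint z by auto
 have c: "x <: Q" if "x : hp Q i" for x i using subgroup.subset[OF Q_hp_sub] that by auto
 have p: "x +[Q] y : hp Q i" if "x : hp Q i" "y : hp Q i" for x y i using subgroup.m_closed[OF Q_hp_sub that] by simp
 have "EX x0:hp Q 0. EX x1:hp Q 1. x = x0 +[Q] x1" if "x <: Q" for x using that proof (induction rule: Q_ind)
  case (scal a)
  thus ?case using qscal_split[OF scal] qscal_hp[OF K.hcomp_h[OF scal]] by blast
 next
  case (mult X y)
  then obtain y0 y1 where y: "y0 : hp Q 0" "y1 : hp Q 1" "y = y0 +[Q] y1" by blast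
  let ?X = "%i. qin (hcomp M i X)"
  have X: "?X i : hp Q i" for i using qin_hp hcomp_h[OF mult(1)] by blast
  have "qin X *[Q] y = (?X 0 *[Q] y0 +[Q] ?X 1 *[Q] y1) +[Q] (?X 0 *[Q] y1 +[Q] ?X 1 *[Q] y0)" using c[OF X] c[OF y(1)] c[OF y(2)]
   by(simp add: hpart_split[OF mult(1)] y(3) Q.l_distr Q.r_distr Q.a_ac)
  moreover have "?X 0 *[Q] y0 +[Q] ?X 1 *[Q] y1 : hp Q 0" "?X 0 *[Q] y1 +[Q] ?X 1 *[Q] y0 : hp Q 1"
   using p Q_hp_mult[OF X y(1)] Q_hp_mult[OF X y(2)] by(metis add_0 add.right_neutral bit_add_self(1))+
  ultimately show ?case by blast
 next
  case (add x y)
  then obtain x0 x1 y0 y1 where xy: "x0 : hp Q 0" "x1 : hp Q 1" "x = x0 +[Q] x1"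
   "y0 : hp Q 0" "y1 : hp Q 1" "y = y0 +[Q] y1" by blast
  hence "x +[Q] y = (x0 +[Q] y0) +[Q] (x1 +[Q] y1)" using c by(simp add: Q.a_ac)
  thus ?case using p xy by blast
 qed
 thus "hp Q 0 <+>\<^bsub>Q\<^esub> hp Q 1 = car Q" using c by(auto simp: set_add_def')
qed

lemma Q_supermodule: "supermodule K Q"
proof -
 interpret graded_group Q by(rule Q_graded)
 show ?thesis proof (intro supermodule.intro supermodule_axioms.intro K.comm_superring_axioms Q_graded)
  fix m i a j assume "m : hp Q i" "a : hp K j"
  thus "m .[Q] a : hp Q (i + j)" using Q_hp_mult[OF _ qscal_hp] Q_rs hpc K.hpc by simp
 qed (simp_all add: Q_rs Q.l_distr Q.r_distr qscal_add qscal_mult qscal_one Q.m_assoc)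
qed

sublocale Q: smodule K Q by(rule smodule.intro) (rule Q_supermodule)

text \<open>For a scalar this is supercommutativity of \<open>K\<close>, for a letter it is the sign
  in the left action; along a word the signs add up.\<close>

lemma qs_comm: assumes a: "a : hp K i" and x: "x : hp Q j" shows "qscal a *[Q] x = sg Q (i * j) (x *[Q] qscal a)" using x
proof (induction rule: Q_hp_ind)
 note ac = K.hpc[OF a]
 {
  case (scal j b)
  note bc = K.hpc[OF scal]
  have "qscal (a *[K] b) = sg Q (i * j) (qscal (b *[K] a))" using K.supercomm[OF a scal] ac bc by(simp add: qscal_neg)
  thus ?case using ac bc by(simp add: qscal_mult)
 next
  case (mult p X j y)
  note c = hpc[OF mult(1)] Q.hpc[OF mult(2)]
  have "qin (lsmult K M a X) = sg Q (i * p) (qin X *[Q] qscal a)"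
   using ls_hom[OF mult(1) a] c(1) ac by(simp add: qin_neg qin_rs rsc)
  hence e: "qscal a *[Q] qin X = sg Q (i * p) (qin X *[Q] qscal a)" using qin_ls[OF c(1) ac] by simp
  have "qscal a *[Q] (qin X *[Q] y) = sg Q (i * p) (qin X *[Q] (qscal a *[Q] y))"
   using c ac e by(cases i; cases p) (simp_all add: sg_def Q.m_assoc[symmetric] Q.l_minus)
  also have "... = sg Q (i * p) (sg Q (i * j) (qin X *[Q] (y *[Q] qscal a)))"
   unfolding mult(3) using c ac by(simp add: sg_def Q.r_minus)
  also have "... = sg Q (i * (p + j)) (qin X *[Q] y *[Q] qscal a)" using c ac by(simp add: Q.sg_sg Q.m_assoc distrib_left)
  finally show ?case .
 next
  case (add j x y)
  thus ?case using ac by(simp add: Q.l_distr Q.r_distr Q.sg_add)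
 }
qed (use K.hpc[OF a] in simp)

lemma Q_ls: assumes "a <: K" "x <: Q" shows "lsmult K Q a x = qscal a *[Q] x" using assms(2)
proof (induction rule: Q.hom_ind)
 case (hom j x)
 note xc = Q.hpc[OF hom]
 from assms(1) show ?case proof (induction rule: K.hom_ind)
  case (hom i a)
  thus ?case using Q.ls_hom[OF `x : hp Q j` hom] qs_comm[OF hom `x : hp Q j`] xc by(simp add: Q_rs K.hpc)
 qed (use xc in "simp add: Q.lsm_addl qscal_add Q.l_distr")
qed (use assms in "simp add: Q.lsm_addr Q.r_distr")

section \<open>Homogeneous monomials and spans of words of prescribed lengths\<close>

inductive hmono :: "nat => bit => (('a list \<times> 'k) \<Rightarrow>\<^sub>0 int) set set => bool" where
 one: "hmono 0 0 1[Q]"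
| mult: "hmono n p m ==> X : hp M q ==> hmono (Suc n) (q + p) (qin X *[Q] m)"

lemma Q_one_hp: "1[Q] : hp Q 0" using qscal_hp[OF K.hpart_one] by(simp add: qscal_one)

lemma hmono_hp: "hmono n p m ==> m : hp Q p" by(induction rule: hmono.induct) (auto intro: Q_one_hp Q_hp_mult qin_hp)

lemma hmonoc: "hmono n p m ==> m <: Q" using hmono_hp Q.hpc by blast

lemma hmono_word:
 "hps M Xs ps ==> hmono (length Xs) (sum_list ps) (mprod Q (map qin Xs))"
 by(induction rule: list_all2_induct) (auto simp: mprod_def intro: hmono.intros)

text \<open>Indexed by a set of lengths: \<open>Fl {n}\<close> is spanned by the words of length n,
  \<open>Fl {..n}\<close> and \<open>Fl {..<n}\<close> are steps of the filtration, and
  \<open>Fl UNIV\<close> is everything. Spans for disjoint sets may meet, as they do in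
  U(g).\<close>

inductive_set Fl :: "nat set => (('a list \<times> 'k) \<Rightarrow>\<^sub>0 int) set set set" for A where
 zero: "0[Q] : Fl A"
| gen: "hmono n p m ==> n : A ==> a : hp K j ==> m *[Q] qscal a : Fl A"
| add: "x : Fl A ==> y : Fl A ==> x +[Q] y : Fl A"

lemma Fl_c: "x : Fl A ==> x <: Q" by(induction rule: Fl.induct) (simp_all add: hmonoc K.hpc)

lemma Fl_neg: "x : Fl A ==> -[Q] x : Fl A"
proof (induction rule: Fl.induct)
 case (gen n p m a j)
 hence "-[Q] (m *[Q] qscal a) = m *[Q] qscal (-[K] a)" by(simp add: qscal_neg K.hpc hmonoc Q.r_minus)
 thus ?case using Fl.gen[OF gen(1,2) K.hp_neg[OF gen(3)]] by simp
next
 case (add x y) thus ?case by(simp add: Q.minus_add Fl_c Fl.add)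
qed (simp add: Fl.zero)

lemma Fl_mn: "x : Fl A ==> y : Fl A ==> x -[Q] y : Fl A" by(simp add: a_minus_def Fl.add Fl_neg)

lemma Fl_sg: "x : Fl A ==> sg Q k x : Fl A" by(simp add: sg_def Fl_neg)

lemma Fl_finsum: "finite I ==> (!!i. i : I ==> f i : Fl A) ==> (\<Oplus>\<^bsub>Q\<^esub>i\<in>I. f i) : Fl A"
proof (induction I rule: finite_induct)
 case (insert x F)
 hence "(\<Oplus>\<^bsub>Q\<^esub>j\<in>insert x F. f j) = f x +[Q] (\<Oplus>\<^bsub>Q\<^esub>j\<in>F. f j)"
  by(intro Q.finsum_insert) (auto intro: Fl_c)
 thus ?case using insert by(simp add: Fl.add)
qed (simp add: Fl.zero)

lemma Fl_sub: "subgroup (Fl A) (add_monoid Q)" using Fl_c Fl_neg Fl.zero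
 by(intro group.subgroupI[OF abelian_group.a_group[OF Q.abx]])
  (auto simp: a_inv_def[symmetric] intro: Fl.add dest: arg_cong[where f="%S. 0[Q] : S"])

lemma Fl_mono: "x : Fl A ==> A <= B ==> x : Fl B" by(induction rule: Fl.induct) (auto intro: Fl.intros)

lemma Fl_sc: assumes "x : Fl A" "c <: K" shows "x *[Q] qscal c : Fl A" using assms(2)
proof (induction rule: K.hom_ind)
 case (hom i c)
 note c = K.hpc[OF hom]
 from assms(1) show ?case proof (induction rule: Fl.induct)
  case (gen n p m a j)
  thus ?case using Fl.gen[OF gen(1,2) K.hpart_mult[OF gen(3) hom]] c by(simp add: qscal_mult K.hpc hmonoc Q.m_assoc)
 qed (use c in "simp_all add: Fl.zero Fl.add Q.l_distr Fl_c")
qed (use assms in "simp add: qscal_add Q.r_distr Fl_c Fl.add")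

lemma Fl_in: assumes "x : Fl A" "X <: M" shows "qin X *[Q] x : Fl (Suc ` A)" using assms(2)
proof (induction rule: hom_ind)
 case (hom i X)
 note X = hpc[OF hom]
 from assms(1) show ?case proof (induction rule: Fl.induct)
  case (gen n p m a j)
  thus ?case using Fl.gen[OF hmono.mult[OF gen(1) hom] _ gen(3), of "Suc ` A"] X by(simp add: K.hpc hmonoc Q.m_assoc)
 qed (use X in "simp_all add: Fl.zero Fl.add Q.r_distr Fl_c")
qed (use assms in "simp add: qin_add Q.l_distr Fl_c Fl.add")

lemma Fl_scal_left: assumes "x : Fl A" "c <: K" shows "qscal c *[Q] x : Fl A" using assms(2)
proof (induction rule: K.hom_ind)
 case (hom i c)
 note c = K.hpc[OF hom]
 from assms(1) show ?case proof (induction rule: Fl.induct)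
  case (gen n p m a j)
  have m: "m <: Q" "a <: K" using gen hmonoc K.hpc by auto
  have "qscal c *[Q] (m *[Q] qscal a) = sg Q (i * p) (m *[Q] qscal (c *[K] a))" using qs_comm[OF hom hmono_hp[OF gen(1)]] c m
   by(cases i; cases p) (simp_all add: sg_def Q.m_assoc[symmetric] Q.l_minus qscal_mult)
  thus ?case using Fl_sg[OF Fl.gen[OF gen(1,2) K.hpart_mult[OF hom gen(3)]]] by simp
 qed (use c in "simp_all add: Fl.zero Fl.add Q.r_distr Fl_c")
qed (use assms in "simp add: qscal_add Q.l_distr Fl_c Fl.add")

lemma Fl_mult: assumes "x : Fl A" "y : Fl B" "!!a b. a : A ==> b : B ==> a + b : C" shows "x *[Q] y : Fl C" using assms(1)
proof (induction rule: Fl.induct)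
 case (gen n p m a j)
 note a = K.hpc[OF gen(3)]
 have "m *[Q] z : Fl ((%b. n + b) ` B)" if "z : Fl B" for z using gen(1) proof (induction rule: hmono.induct)
  case one thus ?case using that by(simp add: Fl_c)
 next
  case (mult n p m X q)
  thus ?case using Fl_in[OF mult(3) hpc[OF mult(2)]] that by(simp add: hmonoc hpc Q.m_assoc Fl_c image_image)
 qed
 from this[OF Fl_scal_left[OF assms(2) a]] show ?case using a Fl_c[OF assms(2)] hmonoc[OF gen(1)] assms(3)[OF gen(2)]
  by(simp add: Q.m_assoc) (erule Fl_mono, auto)
qed (use assms(2) in "simp_all add: Fl_c Fl.zero Fl.add Q.l_distr")

lemma Fl_UNIV: "Fl UNIV = car Q"
proof
 show "car Q <= Fl UNIV" proof
  fix x assume "x <: Q"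
  thus "x : Fl UNIV" proof (induction rule: Q_ind)
   case (scal a)
   thus ?case proof (induction rule: K.hom_ind)
    case (hom i a)
    thus ?case using Fl.gen[OF hmono.one _ hom, of UNIV] by(simp add: K.hpc)
   qed (simp add: qscal_add Fl.add)
  next
   case (mult X y) thus ?case using Fl_in Fl_mono by blast
  qed (simp add: Fl.add)
 qed
qed (use Fl_c in blast)

lemma Fl_finite: assumes "x <: Q" shows "EX n. x : Fl {..n}"
proof -
 have "x : Fl UNIV" using assms by(simp add: Fl_UNIV)
 thus ?thesis proof (induction rule: Fl.induct)
  case (gen n p m a j) thus ?case using Fl.gen[OF gen(1) _ gen(3), of "{..n}"] by auto
 next
  case (add x y)
  then obtain n m where "x : Fl {..n}" "y : Fl {..m}" by blast
  hence "x : Fl {..max n m}" "y : Fl {..max n m}" by(auto elim!: Fl_mono)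
  thus ?case using Fl.add by blast
 qed (use Fl.zero in blast)
qed

lemma Fl_word: assumes "set Xs <= car M" shows "mprod Q (map qin Xs) : Fl {length Xs}" using assms
proof (induction Xs)
 case Nil
 thus ?case using Fl.gen[OF hmono.one _ K.hpart_one, of "{0}"] by(simp add: mprod_def qscal_one)
next
 case (Cons X Xs) thus ?case using Fl_in[of "mprod Q (map qin Xs)" "{length Xs}" X] by(simp add: mprod_def)
qed

lemma hmono_mprod: "hmono n p m ==> EX Xs. set Xs <= car M & length Xs = n & m = mprod Q (map qin Xs)"
proof (induction rule: hmono.induct)
 case one show ?case by(rule exI[of _ "[]"]) (simp add: mprod_def)
next
 case (mult n p m X q)
 then obtain Xs where "set Xs <= car M" "length Xs = n" "m = mprod Q (map qin Xs)" by blast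
 thus ?case using hpc[OF mult(2)] by(intro exI[of _ "X # Xs"]) (simp add: mprod_def)
qed

text \<open>The letters on the left may be inhomogeneous; splitting each of them into components
  shows that homogeneous monomials span the same group. This connects \<open>Fl\<close> with
  \<open>sym_pow\<close> and \<open>env_fil\<close>.\<close>

lemma Fl_rspan: "rspan K Q {mprod Q (map qin Xs) | Xs. set Xs <= car M & length Xs : A} = Fl A"
proof
 let ?B = "{mprod Q (map qin Xs) | Xs. set Xs <= car M & length Xs : A}"
 let ?H = "{b .[Q] a | b a. b : ?B & a <: K}"
 have H: "?H <= Fl A" proof
  fix x assume "x : ?H"
  then obtain Xs a where x: "x = mprod Q (map qin Xs) .[Q] a" "set Xs <= car M" "length Xs : A" "a <: K" by blast
  have "mprod Q (map qin Xs) : Fl A" using Fl_word[OF x(2)] x(3) by(auto elim: Fl_mono)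
  thus "x : Fl A" using x Fl_sc by(simp add: Q_rs Fl_c)
 qed
 thus "rspan K Q ?B <= Fl A" unfolding rspan_def by(intro group.generate_subgroup_incl[OF abelian_group.a_group[OF Q.abx]] Fl_sub)
 show "Fl A <= rspan K Q ?B" proof
  fix x assume "x : Fl A"
  thus "x : rspan K Q ?B" unfolding rspan_def proof (induction rule: Fl.induct)
   case zero thus ?case using generate.one[of "add_monoid Q"] by simp
  next
   case (gen n p m a j)
   then obtain Xs where "set Xs <= car M" "length Xs = n" "m = mprod Q (map qin Xs)" using hmono_mprod by blast
   moreover have "m *[Q] qscal a = m .[Q] a" using gen by(simp add: Q_rs hmonoc K.hpc)
   ultimately show ?case using gen K.hpc by(intro generate.incl) blast
  next
   case (add x y) thus ?case using generate.eng[of x "add_monoid Q"] by simp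
  qed
 qed
qed

lemma Q_am_eqI: assumes f: "addmap Q N f" and g: "addmap Q N g" and N: "abelian_group N"
  and eq: "!!n p m a j. hmono n p m ==> a : hp K j ==> f (m *[Q] qscal a) = g (m *[Q] qscal a)" and x: "x <: Q" shows "f x = g x"
proof -
 have "x : Fl UNIV" using x by(simp add: Fl_UNIV)
 thus ?thesis proof (induction rule: Fl.induct)
  case zero
  show ?case using am_zn(1)[OF Q.abx N f] am_zn(1)[OF Q.abx N g] by simp
 qed (simp_all add: eq amD2[OF f] amD2[OF g] Fl_c)
qed

text \<open>Right linearity removes the scalar of a spanning element, so linear maps are compared on
  homogeneous monomials alone.\<close>

lemma Q_Hom_eqI: assumes f: "f : Hom K Q N" and g: "g : Hom K Q N" and N: "abelian_group N"
  and eq: "!!n p m. hmono n p m ==> f m = g m" shows "f = g"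
proof (rule Hom_eqI[OF f g])
 fix x assume x: "x <: Q"
 show "f x = g x" proof (rule Q_am_eqI[OF HomD(1)[OF f] HomD(1)[OF g] N _ x])
  fix n p m a j assume "hmono n p m" "a : hp K j"
  thus "f (m *[Q] qscal a) = g (m *[Q] qscal a)" using HomD(5)[OF f, of m a] HomD(5)[OF g, of m a] eq
   by(simp add: Q_rs hmonoc K.hpc)
 qed
qed

end

context tmodule begin

text \<open>The operators are given on homogeneous letters, with the parity as an argument of its
  own, because their formulas contain signs that depend on it. A general letter acts through its two
  components.\<close>

lemma tensor_action_hom: fixes G :: "('k, 'b) smod" assumes G: "abelian_group G" and f: "!!p X. X : hp M p ==> addmap G G (f p X)"
   "!!p X Y v. X : hp M p ==> Y : hp M p ==> v <: G ==> f p (X \<oplus> Y) v = f p X v +[G] f p Y v"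
  and g: "!!a. a <: K ==> addmap G G (g a)"
   "!!a b v. a <: K ==> b <: K ==> v <: G ==> g (a +[K] b) v = g a v +[G] g b v"
   "!!a b v. a <: K ==> b <: K ==> v <: G ==> g (a *[K] b) v = g a (g b v)"
   "!!v. v <: G ==> g 1[K] v = v"
  and fg: "!!p X j a v. X : hp M p ==> a : hp K j ==> v <: G ==> f (p + j) (X \<bullet> a) v = f p X (g a v)"
   "!!p X j a v. X : hp M p ==> a : hp K j ==> v <: G ==> f (j + p) (lsmult K M a X) v = g a (f p X v)"
 obtains h where "h : ring_hom T (End_alg kempty G)" "is_action T G h"
  "!!p X v. X : hp M p ==> v <: G ==> h (tin X) v = f p X v"
  "!!a v. a <: K ==> v <: G ==> h (tscal a) v = g a v"
proof -
 interpret G: abelian_group G by fact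
 define F where "F X v = f 0 (hcomp M 0 X) v +[G] f 1 (hcomp M 1 X) v" for X v
 note fc = amD1[OF f(1)] and gc = amD1[OF g(1)]
 have f0: "f p \<zero> v = 0[G]" if "v <: G" for p v proof -
  have "f p \<zero> v = f p \<zero> v +[G] f p \<zero> v" using f(2)[of \<zero> p \<zero> v] that by simp
  thus ?thesis using fc[of \<zero> p v] that by simp
 qed
 have Fh: "F X v = f p X v" if "X : hp M p" "v <: G" for X p v
  using that fc by(cases p) (auto simp: F_def hcomp_hom[OF that(1)] f0)
 have Fa: "addmap G G (F X)" if "X <: M" for X unfolding F_def by(intro G.am_add f(1) hcomp_h that)
 have F2: "F (X \<oplus> Y) v = F X v +[G] F Y v" if "X <: M" "Y <: M" "v <: G" for X Y v
  using that fc by(simp add: F_def hcomp_add f(2) G.a_ac)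
 note Fc = amD1[OF Fa]
 have FG: "F (X \<bullet> a) v = F X (g a v)" "F (lsmult K M a X) v = g a (F X v)" if ab: "X <: M" "a <: K" "v <: G" for X a v
 proof -
  show "F (X \<bullet> a) v = F X (g a v)" using ab(1) proof (induction rule: hom_ind)
   case (hom i X)
   note X = hpc[OF hom]
   from ab(2) show ?case proof (induction rule: K.hom_ind)
    case (hom j b)
    thus ?case using Fh[OF rsmult_hpart[OF `X : hp M i` hom] ab(3)] Fh[OF `X : hp M i`] fg(1)[OF `X : hp M i` hom ab(3)]
      gc[OF K.hpc[OF hom] ab(3)] by simp
   qed (use X ab in "simp add: rsmult_add_right F2 g(2) amD2[OF Fa] gc rsc")
  qed (use ab in "simp add: rsmult_add_left F2 gc rsc")
  show "F (lsmult K M a X) v = g a (F X v)" using ab(1) proof (induction rule: hom_ind)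
   case (hom i X)
   note X = hpc[OF hom]
   from ab(2) show ?case proof (induction rule: K.hom_ind)
    case (hom j b)
    thus ?case using Fh[OF ls_hp[OF `X : hp M i` hom] ab(3)] Fh[OF `X : hp M i` ab(3)] fg(2)[OF `X : hp M i` hom ab(3)] by simp
   qed (use X ab in "simp add: lsm_addl F2 g(2) Fc")
  qed (use ab in "simp add: lsm_addr F2 amD2[OF g(1)] Fc")
 qed
 obtain h where h: "h : ring_hom T (End_alg kempty G)" "is_action T G h"
  "!!X v. X <: M ==> v <: G ==> h (tin X) v = F X v"
  "!!a v. a <: K ==> v <: G ==> h (tscal a) v = g a v"
  by(rule tensor_action[OF G Fa F2 g FG]) (assumption | (rule that; assumption))+
 show thesis by(rule that[OF h(1,2) _ h(4)]) (simp_all add: h(3) Fh hpc)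
qed

end

section \<open>Actions of S(g) and U(g), and the parts of S(g) in degrees 0 and 1\<close>

section \<open>Symmetric and enveloping algebra\<close>

locale lsa = lie_superalgebra K L for K :: "'k sring" and L :: "('k, 'g) lie_sring" (structure)
begin

sublocale tmodule K L by(intro tmodule.intro smodule.intro supermodule_axioms)

definition "sym_gens = {tw K L [v, w] -[T] sg T (i * j) (tw K L [w, v])
    | v w i j. v : hp L i & w : hp L j} Un {tw K L [u, u] | u. u : hp L 1}"

definition "env_gens = {tw K L [a, b] -[T] sg T (i * j) (tw K L [b, a])
    -[T] tw K L [lbr L a b] | a b i j. a : hp L i & b : hp L j}"

lemma tw2_hp: assumes "v : hp L i" "w : hp L j" shows "tw K L [v, w] : hp T (i + j)"
 using T_hpart_mult[OF tin_hp[OF assms(1)] tin_hp[OF assms(2)]] assms by(simp add: tensor_word2 hpc)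

sublocale S: talg K L sym_gens "sym_alg K L" "sym_in K L"
proof
 show "sym_alg K L = quot_alg T (genideal T sym_gens)" by(simp add: sym_alg_def sym_ideal_def sym_gens_def)
 show "sym_in K L X = genideal T sym_gens +>[T] tin X" if "X <: L" for X
  using that by(simp add: sym_in_def sym_ideal_def sym_gens_def)
 fix r assume "r : sym_gens"
 thus "EX i. r : hp T i" unfolding sym_gens_def proof (elim UnE CollectE exE conjE)
  fix v w i j assume r: "r = tw K L [v, w] -[T] sg T (i * j) (tw K L [w, v])" and h: "v : hp L i" "w : hp L j"
  show ?thesis unfolding r using T_hpart_closed(4)[OF tw2_hp[OF h] T_hpart_closed(3)[of _ "i + j"]] tw2_hp[OF h(2,1)]
   by(auto simp: add.commute)
 qed (use tw2_hp in blast)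
qed

sublocale U: talg K L env_gens "env_alg K L" "env_in K L"
proof
 show "env_alg K L = quot_alg T (genideal T env_gens)" by(simp add: env_alg_def env_ideal_def env_gens_def)
 show "env_in K L X = genideal T env_gens +>[T] tin X" if "X <: L" for X
  using that by(simp add: env_in_def env_ideal_def env_gens_def)
 fix r assume "r : env_gens"
 then obtain v w i j where r: "r = tw K L [v, w] -[T] sg T (i * j) (tw K L [w, v]) -[T] tw K L [lbr L v w]"
  and h: "v : hp L i" "w : hp L j" unfolding env_gens_def by blast
 have "tw K L [w, v] : hp T (i + j)" using tw2_hp[OF h(2,1)] by(simp add: add.commute)
 thus "EX i. r : hp T i" unfolding r
  using T_hpart_closed(4)[OF T_hpart_closed(4)[OF tw2_hp[OF h] T_hpart_closed(3)[of _ "i + j"]] tin_hp[OF lbr_hpart[OF h]]]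
  by blast
qed

abbreviation "SA == sym_alg K L"
abbreviation "UA == env_alg K L"
abbreviation "io == sym_in K L"
abbreviation "jm == env_in K L"
abbreviation "br == lbr L"

lemma sym_comm: assumes "v : hp L i" "w : hp L j" shows "io v *[SA] io w = sg SA (i * j) (io w *[SA] io v)"
proof -
 note c = assms[THEN hpc]
 have "tw K L [v, w] -[T] sg T (i * j) (tw K L [w, v]) : sym_gens" using assms unfolding sym_gens_def by blast
 from S.pq_gen[OF this] show ?thesis using c by(simp add: tensor_word2 S.pq_neg S.pq_mult S.pq_tin S.Q.mn_zero_iff)
qed

lemma sym_odd: "u : hp L 1 ==> io u *[SA] io u = 0[SA]"
proof -
 assume u: "u : hp L 1"
 hence "tw K L [u, u] : sym_gens" unfolding sym_gens_def by blast
 from S.pq_gen[OF this] show ?thesis using hpc[OF u] by(simp add: tensor_word2 S.pq_mult S.pq_tin)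
qed

lemma env_comm: assumes "v : hp L i" "w : hp L j" shows "jm v *[UA] jm w = sg UA (i * j) (jm w *[UA] jm v) +[UA] jm (br v w)"
proof -
 note c = assms[THEN hpc] hpc[OF lbr_hpart[OF assms]]
 have "tw K L [v, w] -[T] sg T (i * j) (tw K L [w, v]) -[T] tw K L [br v w] : env_gens"
  using assms unfolding env_gens_def by blast
 from U.pq_gen[OF this]
 have "jm v *[UA] jm w -[UA] sg UA (i * j) (jm w *[UA] jm v) = jm (br v w)"
  using c by(simp add: tensor_word2 U.pq_neg U.pq_mult U.pq_tin U.Q.mn_zero_iff)
 thus ?thesis using c U.Q.mn_cancel[of "jm v *[UA] jm w" "sg UA (i * j) (jm w *[UA] jm v)"] by(simp add: U.Q.a_comm)
qed

text \<open>Additive maps out of S(g) are obtained by letting such an action move a fixed vector;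
  the target needs no algebra structure for this.\<close>

lemma sym_action: fixes G :: "('k, 'b) smod" assumes G: "abelian_group G" and f: "!!p X. X : hp L p ==> addmap G G (f p X)"
   "!!p X Y v. X : hp L p ==> Y : hp L p ==> v <: G ==> f p (X \<oplus> Y) v = f p X v +[G] f p Y v"
  and g: "!!a. a <: K ==> addmap G G (g a)"
   "!!a b v. a <: K ==> b <: K ==> v <: G ==> g (a +[K] b) v = g a v +[G] g b v"
   "!!a b v. a <: K ==> b <: K ==> v <: G ==> g (a *[K] b) v = g a (g b v)"
   "!!v. v <: G ==> g 1[K] v = v"
  and fg: "!!p X j a v. X : hp L p ==> a : hp K j ==> v <: G ==> f (p + j) (X \<bullet> a) v = f p X (g a v)"
   "!!p X j a v. X : hp L p ==> a : hp K j ==> v <: G ==> f (j + p) (lsmult K L a X) v = g a (f p X v)"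
  and comm: "!!v w i j z. v : hp L i ==> w : hp L j ==> z <: G ==> f i v (f j w z) = sg G (i * j) (f j w (f i v z))"
  and odd: "!!u z. u : hp L 1 ==> z <: G ==> f 1 u (f 1 u z) = 0[G]"
 obtains A where "A : ring_hom SA (End_alg kempty G)" "is_action SA G A"
  "!!p X v. X : hp L p ==> v <: G ==> A (io X) v = f p X v"
  "!!a v. a <: K ==> v <: G ==> A (S.qscal a) v = g a v"
proof -
 interpret G: abelian_group G by fact
 obtain h where h: "h : ring_hom T (End_alg kempty G)" "is_action T G h"
  "!!p X v. X : hp L p ==> v <: G ==> h (tin X) v = f p X v"
  "!!a v. a <: K ==> v <: G ==> h (tscal a) v = g a v"
  by(rule tensor_action_hom[OF G f g fg]) (assumption | (rule that; assumption))+
 note fc = amD1[OF f(1)]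
 have h2: "h (tw K L [v, w]) z = f i v (f j w z)" if "v : hp L i" "w : hp L j" "z <: G" for v w i j z
  using that is_actD(5)[OF h(2)] by(simp add: tensor_word2 hpc h(3) fc)
 obtain A where A: "A : ring_hom SA (End_alg kempty G)" "is_action SA G A" "!!t. t <: T ==> A (S.pq t) = h t"
 proof (rule S.Q_act[OF G h(1)])
  fix r z assume "r : sym_gens" and z: "z <: G"
  thus "h r z = 0[G]" unfolding sym_gens_def proof (elim UnE CollectE exE conjE)
   fix v w i j assume r: "r = tw K L [v, w] -[T] sg T (i * j) (tw K L [w, v])" and vw: "v : hp L i" "w : hp L j"
   have c: "tw K L [v, w] <: T" "tw K L [w, v] <: T" using vw by(simp_all add: tensor_word2 hpc)
   show ?thesis unfolding r using is_act_sg[OF T.ring_axioms G h(2)] c z vw by(simp add: h2 comm[OF vw z] fc G.mn_zero_iff)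
  next
   fix u assume "r = tw K L [u, u]" "u : hp L 1"
   thus ?thesis using z by(simp add: h2 odd)
  qed
 qed (use that in blast)
 show thesis proof (rule that[OF A(1,2)])
  fix p X v assume "X : hp L p" "v <: G"
  thus "A (io X) v = f p X v" using A(3)[of "tin X"] hpc[of X p] by(simp add: S.pq_tin h(3))
 next
  fix a v assume "a <: K" "v <: G"
  thus "A (S.qscal a) v = g a v" using A(3)[of "tscal a"] by(simp add: S.pq_tscal h(4))
 qed
qed

text \<open>Later applied to the operators \<open>Ph p (psih p X)\<close> on S(g), whose commutation
  rule thereby becomes a representation of U(g).\<close>

lemma env_action: fixes G :: "('k, 'b) smod" assumes G: "abelian_group G" and f: "!!p X. X : hp L p ==> addmap G G (f p X)"
   "!!p X Y v. X : hp L p ==> Y : hp L p ==> v <: G ==> f p (X \<oplus> Y) v = f p X v +[G] f p Y v"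
  and g: "!!a. a <: K ==> addmap G G (g a)"
   "!!a b v. a <: K ==> b <: K ==> v <: G ==> g (a +[K] b) v = g a v +[G] g b v"
   "!!a b v. a <: K ==> b <: K ==> v <: G ==> g (a *[K] b) v = g a (g b v)"
   "!!v. v <: G ==> g 1[K] v = v"
  and fg: "!!p X j a v. X : hp L p ==> a : hp K j ==> v <: G ==> f (p + j) (X \<bullet> a) v = f p X (g a v)"
   "!!p X j a v. X : hp L p ==> a : hp K j ==> v <: G ==> f (j + p) (lsmult K L a X) v = g a (f p X v)"
  and comm: "!!v w i j z. v : hp L i ==> w : hp L j ==> z <: G ==>
    f i v (f j w z) = sg G (i * j) (f j w (f i v z)) +[G] f (i + j) (br v w) z"
 obtains A where "A : ring_hom UA (End_alg kempty G)" "is_action UA G A"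
  "!!p X v. X : hp L p ==> v <: G ==> A (jm X) v = f p X v"
  "!!a v. a <: K ==> v <: G ==> A (U.qscal a) v = g a v"
proof -
 interpret G: abelian_group G by fact
 obtain h where h: "h : ring_hom T (End_alg kempty G)" "is_action T G h"
  "!!p X v. X : hp L p ==> v <: G ==> h (tin X) v = f p X v"
  "!!a v. a <: K ==> v <: G ==> h (tscal a) v = g a v"
  by(rule tensor_action_hom[OF G f g fg]) (assumption | (rule that; assumption))+
 note fc = amD1[OF f(1)]
 have h2: "h (tw K L [v, w]) z = f i v (f j w z)" if "v : hp L i" "w : hp L j" "z <: G" for v w i j z
  using that is_actD(5)[OF h(2)] by(simp add: tensor_word2 hpc h(3) fc)
 obtain A where A: "A : ring_hom UA (End_alg kempty G)" "is_action UA G A" "!!t. t <: T ==> A (U.pq t) = h t"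
 proof (rule U.Q_act[OF G h(1)])
  fix r z assume "r : env_gens" and z: "z <: G"
  then obtain v w i j where r: "r = tw K L [v, w] -[T] sg T (i * j) (tw K L [w, v]) -[T] tin (br v w)"
   and vw: "v : hp L i" "w : hp L j" unfolding env_gens_def by blast
  note b = lbr_hpart[OF vw]
  have c: "tw K L [v, w] <: T" "tw K L [w, v] <: T" "tin (br v w) <: T" using vw hpc[OF b] by(simp_all add: tensor_word2 hpc)
  note gc = fc[OF vw(2) fc[OF vw(1) z]] fc[OF b z]
  have "h r z = (sg G (i * j) (f j w (f i v z)) +[G] f (i + j) (br v w) z) -[G] sg G (i * j) (f j w (f i v z)) -[G] f (i + j) (br v w) z"
   unfolding r using is_act_sg[OF T.ring_axioms G h(2)] c z vw by(simp add: h2 comm[OF vw z] h(3)[OF b z])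
  also have "... = 0[G]" proof -
   have "(x +[G] y) -[G] x -[G] y = 0[G]" if "x <: G" "y <: G" for x y
    using that G.a_comm[of x y] by(simp add: a_minus_def G.a_assoc G.r_neg)
   thus ?thesis using gc by simp
  qed
  finally show "h r z = 0[G]" .
 qed (use that in blast)
 show thesis proof (rule that[OF A(1,2)])
  fix p X v assume "X : hp L p" "v <: G"
  thus "A (jm X) v = f p X v" using A(3)[of "tin X"] hpc[of X p] by(simp add: U.pq_tin h(3))
 next
  fix a v assume "a <: K" "v <: G"
  thus "A (U.qscal a) v = g a v" using A(3)[of "tscal a"] by(simp add: U.pq_tscal h(4))
 qed
qed

text \<open>The additive group K + g, that is S(g) modulo words of length at least two.\<close>

definition kl_mod :: "('k, 'k \<times> 'g) smod" where
 "kl_mod = \<lparr>carrier = car K \<times> car L, monoid.mult = undefined, one = undefined,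
  ring.zero = (0[K], \<zero>), add = (%(a, X) (b, Y). (a +[K] b, X \<oplus> Y)), hpart = undefined, rsmult = undefined\<rparr>"

text \<open>Let a letter X send (a, Y) to (0, Xa). Two letters then act by zero, so the relations of
  S(g) hold, and moving (1, 0) by u reads off the parts of u in degrees 0 and 1.\<close>

lemma ex_eps_prL:
 obtains eps prL where "addmap SA K eps" "addmap SA L prL"
  "!!a. a <: K ==> eps (S.qscal a) = a" "!!a. a <: K ==> prL (S.qscal a) = \<zero>"
  "!!X u. X <: L ==> u <: SA ==> eps (io X *[SA] u) = 0[K]"
  "!!X u. X <: L ==> u <: SA ==> prL (io X *[SA] u) = X \<bullet> eps u"
proof -
 have sel: "car kl_mod = car K \<times> car L" "0[kl_mod] = (0[K], \<zero>)"
  "(a, X) +[kl_mod] (b, Y) = (a +[K] b, X \<oplus> Y)" for a X b Y by(simp_all add: kl_mod_def)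
 have G: "abelian_group kl_mod" proof (rule abelian_groupI)
  fix x assume "x : car kl_mod"
  thus "EX y:car kl_mod. y +[kl_mod] x = 0[kl_mod]"
   by(intro bexI[of _ "(-[K] fst x, \<ominus> snd x)"]) (auto simp: sel K.l_neg l_neg)
 qed (auto simp: sel K.a_ac a_ac)
 have sgz: "sg kl_mod k (0[K], \<zero>) = (0[K], \<zero>)" for k using abelian_group.sg_zero[OF G, of k] by(simp add: sel)
 obtain A where A: "is_action SA kl_mod A"
  "!!p X v. X : hp L p ==> v : car kl_mod ==> A (io X) v = (0[K], X \<bullet> fst v)"
  "!!a v. a <: K ==> v : car kl_mod ==> A (S.qscal a) v = (a *[K] fst v, lsmult K L a (snd v))"
  by(rule sym_action[OF G, of "%p X v. (0[K], X \<bullet> fst v)" "%a v. (a *[K] fst v, lsmult K L a (snd v))"])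
   (auto intro!: addmapI simp: sel rsc rsmult_add_left rsmult_add_right K.r_distr K.l_distr hpc K.hpc
    lsm_addl lsm_addr ls_assoc K.m_assoc rsmult_assoc ls_rs sgz)
 have v: "(1[K], \<zero>) : car kl_mod" by(simp add: sel)
 have lz: "lsmult K L a \<zero> = \<zero>" if "a <: K" for a
  by(rule am_zn(1)[OF abx abx]) (use that in "auto intro!: addmapI lsm_addr")
 have Ac: "A u (1[K], \<zero>) : car kl_mod" if "u <: SA" for u using is_actD(2)[OF A(1) that v] .
 have AX: "A (io X) w = (0[K], X \<bullet> fst w)" if "X <: L" "w : car kl_mod" for X w using that(1)
 proof (induction rule: hom_ind)
  case (add X Y)
  thus ?case using is_actD(4)[OF A(1), of "io X" "io Y" w] that(2) by(auto simp: S.qin_add sel rsmult_add_left)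
 qed (use A(2) that in blast)
 have split: "A (u +[SA] w) (1[K], \<zero>) = (fst (A u (1[K], \<zero>)) +[K] fst (A w (1[K], \<zero>)),
   snd (A u (1[K], \<zero>)) \<oplus> snd (A w (1[K], \<zero>)))" if "u <: SA" "w <: SA" for u w
  using is_actD(4)[OF A(1) that v] by(metis sel(3) prod.collapse)
 show thesis by(rule that[of "%u. fst (A u (1[K], \<zero>))" "%u. snd (A u (1[K], \<zero>))"])
   (use Ac in "auto intro!: addmapI simp: sel split A(3)[OF _ v] is_actD(5)[OF A(1) S.qin_c _ v] AX lz mem_Times_iff")
qed

end

section \<open>The tensor square of S(g), its product, and the coproduct\<close>

section \<open>The coproduct\<close>

lemma PF_sel [simp]:
 "car (pair_free K M N) = {x. Poly_Mapping.keys x <= car M \<times> car N}"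
 "s *[pair_free K M N] t = frag_extend (%(x, y). frag_extend (%(x', y').
    \<Sum>i\<in>{0,1}. \<Sum>j\<in>{0,1}. frag_cmul (if i * j = 1 then -1 else 1)
     (frag_of (x *[M] hcomp M j x', hcomp N i y *[N] y'))) t) s"
 "1[pair_free K M N] = frag_of (1[M], 1[N])" "0[pair_free K M N] = 0"
 "x +[pair_free K M N] y = x + y"
 "hp (pair_free K M N) k = {x. Poly_Mapping.keys x <= {(m, n). EX i j. m : hp M i & n : hp N j & i + j = k}}"
 "x .[pair_free K M N] a = frag_extend (%(m, n). frag_of (m, n .[N] a)) x" by(simp_all add: pair_free_def)

context lsa begin

abbreviation "PF == pair_free K SA SA"
abbreviation "PI == pair_ideal K SA SA"
abbreviation "PA == tensor_prod K SA SA"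
abbreviation "pt == pure_tensor K SA SA"
abbreviation "kp == S.qscal"

lemma PF_ab: "abelian_group PF"
proof (rule abelian_groupI)
 fix x assume "x <: PF"
 thus "EX y:car PF. y +[PF] x = 0[PF]" by(intro bexI[of _ "- x"]) auto
qed (auto simp: add_ac dest!: subsetD[OF keys_add])

lemma PF_neg: "x <: PF ==> -[PF] x = - x" using abelian_group.minus_equality[OF PF_ab, of "- x" x] by simp

lemma frag_of_PF: "v <: SA ==> w <: SA ==> frag_of (v, w) <: PF" by auto

lemma PF_diff: "x <: PF ==> y <: PF ==> x - y <: PF" unfolding PF_sel mem_Collect_eq using keys_diff[of x y] by blast

lemma PF_add: "x <: PF ==> y <: PF ==> x + y <: PF" unfolding PF_sel mem_Collect_eq using keys_add[of x y] by blast

lemma pair_rels_c: "pair_relations K SA SA <= car PF"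
proof
 fix r assume "r : pair_relations K SA SA"
 thus "r <: PF" unfolding pair_relations_def by(elim UnE CollectE exE conjE; hypsubst; intro PF_diff frag_of_PF)
   (simp_all add: S.Q.rsc)
qed

lemma pi_sub: "subgroup PI (add_monoid PF)" unfolding pair_ideal_def using pair_rels_c
 by(intro group.generate_is_subgroup abelian_group.a_group PF_ab) simp

lemma PI_qu: "smod_quot PI PF" by(rule smod_quotI[OF PF_ab pi_sub])

lemma PA_ab: "abelian_group PA" unfolding tensor_prod_def by(rule smod_quot.qu_ab[OF PI_qu])

sublocale PA: abelian_group PA by(rule PA_ab)

definition "pr x = PI +>[PF] x"

lemma pt_pr: "pt v w = pr (frag_of (v, w))" by(simp add: pure_tensor_def pr_def)

lemma pr_c: "x <: PF ==> pr x <: PA" unfolding pr_def tensor_prod_def by(rule smod_quot.proj_c[OF PI_qu])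

lemma pr_add: "x <: PF ==> y <: PF ==> pr (x + y) = pr x +[PA] pr y"
 using smod_quot.proj_add[OF PI_qu, of x y] by(simp add: pr_def tensor_prod_def)

lemma pr_zero: "pr 0 = 0[PA]" using pr_add[of 0 0] pr_c[of 0] PA.add.r_cancel_one'[of "pr 0" "pr 0"] by simp

lemma pr_addmap: "addmap PF PA pr" unfolding addmap_def using pr_c pr_add by auto

lemma pr_neg: "x <: PF ==> pr (- x) = -[PA] pr x" using am_zn(2)[OF PF_ab PA_ab pr_addmap, of x] by(simp add: PF_neg)

lemma pr_eq: "x <: PF ==> y <: PF ==> x - y : PI ==> pr x = pr y"
 using smod_quot.proj_eq_iff[OF PI_qu, of x y] by(simp add: pr_def a_minus_def PF_neg)

lemma pr_zero_iff: "x <: PF ==> pr x = 0[PA] \<longleftrightarrow> x : PI"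
 using smod_quot.proj_zero_iff[OF PI_qu, of x] by(simp add: pr_def tensor_prod_def)

lemma pt_closed [simp]: "v <: SA ==> w <: SA ==> pt v w <: PA" unfolding pt_pr by(intro pr_c frag_of_PF)

lemma pair_rel: "r : pair_relations K SA SA ==> r : PI" unfolding pair_ideal_def by(rule generate.incl)

lemma pt_add_left: assumes "v <: SA" "v' <: SA" "w <: SA" shows "pt (v +[SA] v') w = pt v w +[PA] pt v' w"
proof -
 have "frag_of (v +[SA] v', w) - frag_of (v, w) - frag_of (v', w) : PI"
  by(rule pair_rel, unfold pair_relations_def) (use assms in blast)
 hence "pr (frag_of (v +[SA] v', w)) = pr (frag_of (v, w) + frag_of (v', w))"
  using assms by(intro pr_eq PF_add frag_of_PF) (simp_all add: diff_diff_eq)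
 thus ?thesis using assms by(simp add: pt_pr pr_add frag_of_PF del: PF_sel)
qed

lemma pt_add_right: assumes "v <: SA" "w' <: SA" "w <: SA" shows "pt v (w +[SA] w') = pt v w +[PA] pt v w'"
proof -
 have "frag_of (v, w +[SA] w') - frag_of (v, w) - frag_of (v, w') : PI"
  by(rule pair_rel, unfold pair_relations_def) (use assms in blast)
 hence "pr (frag_of (v, w +[SA] w')) = pr (frag_of (v, w) + frag_of (v, w'))"
  using assms by(intro pr_eq PF_add frag_of_PF) (simp_all add: diff_diff_eq)
 thus ?thesis using assms by(simp add: pt_pr pr_add frag_of_PF del: PF_sel)
qed

lemma pt_bal: assumes "v <: SA" "w <: SA" "a <: K" shows "pt (v *[SA] kp a) w = pt v (kp a *[SA] w)"
proof -
 have "frag_of (v .[SA] a, w) - frag_of (v, lsmult K SA a w) : PI"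
  by(rule pair_rel, unfold pair_relations_def) (use assms in blast)
 thus ?thesis unfolding pt_pr using assms by(intro pr_eq frag_of_PF) (simp_all add: S.Q_rs S.Q_ls)
qed

lemma pt_neg: assumes "v <: SA" "w <: SA" shows "pt (-[SA] v) w = -[PA] pt v w" "pt v (-[SA] w) = -[PA] pt v w"
  "pt (sg SA k v) w = sg PA k (pt v w)" "pt v (sg SA k w) = sg PA k (pt v w)"
  "pt 0[SA] w = 0[PA]" "pt v 0[SA] = 0[PA]"
proof -
 have l: "addmap SA PA (%v. pt v w)" by(rule addmapI) (simp_all add: assms pt_add_left)
 have r: "addmap SA PA (pt v)" by(rule addmapI) (simp_all add: assms pt_add_right)
 show "pt (-[SA] v) w = -[PA] pt v w" "pt (sg SA k v) w = sg PA k (pt v w)" "pt 0[SA] w = 0[PA]"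
  using am_zn[OF S.Q.abx PA_ab l] assms by simp_all
 show "pt v (-[SA] w) = -[PA] pt v w" "pt v (sg SA k w) = sg PA k (pt v w)" "pt v 0[SA] = 0[PA]"
  using am_zn[OF S.Q.abx PA_ab r] assms by simp_all
qed

lemma P_frag_induct: assumes x: "Poly_Mapping.keys x <= B" and B: "B <= car SA \<times> car SA"
  and neg: "!!v w. (v, w) : B ==> (-[SA] v, w) : B" and zero: "P 0[PA]" and gen: "!!v w. (v, w) : B ==> P (pt v w)"
  and add: "!!s t. s <: PA ==> t <: PA ==> P s ==> P t ==> P (s +[PA] t)" shows "P (pr x)"
proof -
 have "P (pr x) & P (pr (- x))" using x proof (induction rule: frag_ind)
  case (gen s)
  obtain v w where s: "s = (v, w)" by(cases s)
  hence vw: "(v, w) : B" "v <: SA" "w <: SA" using gen B by auto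
  hence "pr (- frag_of (v, w)) = pt (-[SA] v) w" by(simp add: pr_neg[OF frag_of_PF] pt_pr[symmetric] pt_neg)
  thus ?case using assms(5)[OF vw(1)] assms(5)[OF neg[OF vw(1)]] by(simp add: s pt_pr)
 next
  case (add x y)
  hence w: "x <: PF" "y <: PF" "- x <: PF" "- y <: PF" using B by auto
  have e: "- (x + y) = - x + - y" by simp
  show ?case unfolding e pr_add[OF w(1,2)] pr_add[OF w(3,4)] using add assms(6) pr_c w by blast
 qed (use zero pr_zero in simp_all)
 thus ?thesis ..
qed

lemma P_cases: assumes "z <: PA" obtains x where "x <: PF" "z = pr x" using assms unfolding tensor_prod_def
 by(rule smod_quot.qu_cases[OF PI_qu]) (simp add: pr_def that)

lemma P_induct [consumes 1, case_names pt add]: assumes "z <: PA" "!!v w. v <: SA ==> w <: SA ==> P (pt v w)"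
  "!!s t. s <: PA ==> t <: PA ==> P s ==> P t ==> P (s +[PA] t)" shows "P z"
proof -
 obtain x where x: "x <: PF" "z = pr x" using P_cases[OF assms(1)] .
 have "P 0[PA]" using assms(2)[of "0[SA]" "0[SA]"] pt_neg(5)[of "0[SA]" "0[SA]"] by simp
 from P_frag_induct[where P=P, OF x(1)[unfolded PF_sel mem_Collect_eq] order_refl _ this]
 show ?thesis unfolding x(2) using assms(2,3) by blast
qed

lemma P_hom_induct [consumes 1, case_names pt add]: assumes "z <: PA" "!!i j v w. v : hp SA i ==> w : hp SA j ==> P (pt v w)"
  "!!s t. s <: PA ==> t <: PA ==> P s ==> P t ==> P (s +[PA] t)" shows "P z" using assms(1)
proof (induction rule: P_induct)
 case (pt v w)
 from pt(1) show ?case proof (induction rule: S.Q.hom_ind)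
  case (hom i v)
  from pt(2) show ?case by(induction rule: S.Q.hom_ind)
    (use hom assms(2,3) in "simp_all add: pt_add_right S.Q.hpc")
 qed (use pt assms(3) in "simp add: pt_add_left")
qed (rule assms(3))

lemma PA_hp_eq: "hp PA k = pr ` hp PF k" by(simp add: tensor_prod_def pr_def)

lemma P_hp_ind [consumes 1, case_names zero pt add]: assumes "z : hp PA k" "P 0[PA]"
  "!!i j v w. v : hp SA i ==> w : hp SA j ==> i + j = k ==> P (pt v w)"
  "!!s t. s <: PA ==> t <: PA ==> P s ==> P t ==> P (s +[PA] t)" shows "P z"
proof -
 obtain x where x: "x : hp PF k" "z = pr x" using assms(1) by(auto simp: PA_hp_eq)
 show ?thesis unfolding x(2) by(rule P_frag_induct[where P=P, OF x(1)[unfolded PF_sel mem_Collect_eq]])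
   (use assms(2-4) S.Q.hpc S.Q.hp_neg in "blast+")
qed

lemma PA_hp_pt: "v : hp SA i ==> w : hp SA j ==> pt v w : hp PA (i + j)" unfolding PA_hp_eq pt_pr by(rule imageI) auto

lemma PA_hp_add: "x : hp PA k ==> y : hp PA k ==> x +[PA] y : hp PA k" and PA_hpart_zero: "0[PA] : hp PA k"
 and PA_hpart_sg: "x : hp PA k ==> sg PA j x : hp PA k"
proof -
 have c: "x <: PF" if "x : hp PF k" for x using that S.Q.hpc unfolding PF_sel by blast
 { fix x y assume "x : hp PA k" "y : hp PA k"
  then obtain u v where uv: "u : hp PF k" "v : hp PF k" "x = pr u" "y = pr v" unfolding PA_hp_eq by blast
  hence "u + v : hp PF k" using keys_add[of u v] unfolding PF_sel by blast
  thus "x +[PA] y : hp PA k" unfolding uv pr_add[OF c[OF uv(1)] c[OF uv(2)], symmetric] PA_hp_eq by(rule imageI) }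
 show "0[PA] : hp PA k" unfolding PA_hp_eq pr_zero[symmetric] by(rule imageI) simp
 { fix x assume x: "x : hp PA k"
  then obtain u where u: "u : hp PF k" "x = pr u" unfolding PA_hp_eq by blast
  have "pr (- u) : hp PA k" unfolding PA_hp_eq using u by(intro imageI) simp
  thus "sg PA j x : hp PA k" using u x by(simp add: sg_def pr_neg[OF c]) }
qed

lemma P_lift: assumes N: "abelian_group N" and hc: "!!v w. v <: SA ==> w <: SA ==> h v w <: N"
  and hl: "!!v v' w. v <: SA ==> v' <: SA ==> w <: SA ==> h (v +[SA] v') w = h v w +[N] h v' w"
  and hr: "!!v w w'. v <: SA ==> w' <: SA ==> w <: SA ==> h v (w +[SA] w') = h v w +[N] h v w'"
  and hb: "!!v w a. v <: SA ==> w <: SA ==> a <: K ==> h (v *[SA] kp a) w = h v (kp a *[SA] w)"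
 obtains H where "addmap PA N H" "!!v w. v <: SA ==> w <: SA ==> H (pt v w) = h v w"
proof -
 interpret N: abelian_group N by fact
 let ?B = "car SA \<times> car SA"
 obtain g where g: "g : hom (free_Abelian_group ?B) (add_monoid N)"
  "!!s. s : ?B ==> g (frag_of s) = (case s of (v, w) => h v w)"
  by(rule comm_group.free_Abelian_group_universal[OF N.a_comm_group, of "%(v, w). h v w" ?B]) (use hc in auto)
 have ga: "addmap PF N g" using g(1) by(auto simp: addmap_def hom_def)
 note gc = amD1[OF ga]
 have ge: "g (frag_of (v, w)) = h v w" if "v <: SA" "w <: SA" for v w using that g(2) by simp
 have gneg: "g (- x) = -[N] g x" if "x <: PF" for x using am_zn(2)[OF PF_ab N ga that] PF_neg[OF that] by simp
 have g0: "g 0 = 0[N]" using am_zn(1)[OF PF_ab N ga] by simp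
 have gadd: "g (x + y) = g x +[N] g y" if "x <: PF" "y <: PF" for x y using amD2[OF ga that] by simp
 have gdiff: "g (x - y) = 0[N]" if "x <: PF" "y <: PF" "g x = g y" for x y
  using gadd[of x "- y"] gneg[of y] that gc[OF that(1)] by(simp add: N.r_neg)
 have grel: "g r = 0[N]" if "r : pair_relations K SA SA" for r using that unfolding pair_relations_def diff_diff_eq
  by(elim UnE CollectE exE conjE; hypsubst; intro gdiff PF_add frag_of_PF)
   (simp_all add: gadd frag_of_PF ge hl hr hb S.Q_rs S.Q_ls del: PF_sel)
 have gI: "g x = 0[N]" if "x : PI" for x using that unfolding pair_ideal_def proof (induction rule: generate.induct)
  case (inv r)
  hence "r <: PF" using pair_rels_c by blast
  thus ?case using grel[OF inv] gneg[of r] PF_neg[of r, unfolded a_inv_def] by(simp del: PF_sel)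
 next
  case (eng x y)
  hence "x <: PF" "y <: PF" using subgroup.subset[OF pi_sub] by(auto simp: pair_ideal_def simp del: PF_sel)
  thus ?case using eng amD2[OF ga] by(simp del: PF_sel)
 qed (use g0 grel in auto)
 obtain H where H: "addmap PA N H" "!!x. x <: PF ==> H (pr x) = g x"
  using smod_quot.quot_lift[OF PI_qu N ga gI] unfolding tensor_prod_def pr_def by blast
 show thesis by(rule that[OF H(1)]) (simp add: pt_pr H(2) frag_of_PF ge del: PF_sel)
qed

text \<open>Formulas with exchange signs make sense on homogeneous arguments only. The sum of the
  four formulas for the components of v and w is a balanced biadditive map on all arguments.\<close>

lemma P_lift_hom: assumes N: "abelian_group N" and hc: "!!i j v w. v : hp SA i ==> w : hp SA j ==> h i j v w <: N"
  and hl: "!!i j v v' w. v : hp SA i ==> v' : hp SA i ==> w : hp SA j ==> h i j (v +[SA] v') w = h i j v w +[N] h i j v' w"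
  and hr: "!!i j v w w'. v : hp SA i ==> w' : hp SA j ==> w : hp SA j ==> h i j v (w +[SA] w') = h i j v w +[N] h i j v w'"
  and hb: "!!i j l v w a. v : hp SA i ==> w : hp SA j ==> a : hp K l ==> h (i + l) j (v *[SA] kp a) w = h i (l + j) v (kp a *[SA] w)"
 obtains H where "addmap PA N H" "!!i j v w. v : hp SA i ==> w : hp SA j ==> H (pt v w) = h i j v w"
proof -
 interpret N: abelian_group N by fact
 define g where "g v w = (h 0 0 (hcomp SA 0 v) (hcomp SA 0 w) +[N] h 0 1 (hcomp SA 0 v) (hcomp SA 1 w)) +[N]
  (h 1 0 (hcomp SA 1 v) (hcomp SA 0 w) +[N] h 1 1 (hcomp SA 1 v) (hcomp SA 1 w))" for v w note hp = S.Q.hcomp_h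
 have gc: "g v w <: N" if "v <: SA" "w <: SA" for v w using that by(simp add: g_def hc[OF hp hp])
 have z1: "h i j 0[SA] w = 0[N]" if "w : hp SA j" for i j w proof -
  have "h i j 0[SA] w = h i j 0[SA] w +[N] h i j 0[SA] w" using hl[of "0[SA]" i "0[SA]" w j] that by simp
  thus ?thesis using hc[of "0[SA]" i w j] that by simp
 qed
 have z2: "h i j v 0[SA] = 0[N]" if "v : hp SA i" for i j v proof -
  have "h i j v 0[SA] = h i j v 0[SA] +[N] h i j v 0[SA]" using hr[of v i "0[SA]" j "0[SA]"] that by simp
  thus ?thesis using hc[of v i "0[SA]" j] that by simp
 qed
 have gh: "g v w = h i j v w" if "v : hp SA i" "w : hp SA j" for v w i j
  using that z1 z2 hc[OF that] unfolding g_def S.Q.hcomp_hom[OF that(1)] S.Q.hcomp_hom[OF that(2)] by(cases i; cases j) simp_all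
 have gl: "g (v +[SA] v') w = g v w +[N] g v' w" if "v <: SA" "v' <: SA" "w <: SA" for v v' w
  using that by(simp add: g_def S.Q.hcomp_add hl[OF hp hp hp] hc[OF hp hp] N.a_ac)
 have gr: "g v (w +[SA] w') = g v w +[N] g v w'" if "v <: SA" "w' <: SA" "w <: SA" for v w w'
  using that by(simp add: g_def S.Q.hcomp_add hr[OF hp hp hp] hc[OF hp hp] N.a_ac)
 have gb: "g (v *[SA] kp a) w = g v (kp a *[SA] w)" if vwa: "v <: SA" "w <: SA" "a <: K" for v w a using vwa(1)
 proof (induction rule: S.Q.hom_ind)
  case (hom i v)
  note v = hom S.Q.hpc[OF hom]
  from vwa(2) show ?case proof (induction rule: S.Q.hom_ind)
   case (hom j w)
   note w = hom S.Q.hpc[OF hom]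
   from vwa(3) show ?case proof (induction rule: K.hom_ind)
    case (hom l a)
    note ka = S.qscal_hp[OF hom]
    show ?case using gh[OF S.Q_hp_mult[OF v(1) ka] w(1)] gh[OF v(1) S.Q_hp_mult[OF ka w(1)]] hb[OF v(1) w(1) hom] by simp
   qed (use v w in "simp add: S.qscal_add S.Q.l_distr S.Q.r_distr gl gr")
  qed (use v vwa in "simp add: S.Q.r_distr gr")
 qed (use vwa in "simp add: S.Q.l_distr gl")
 obtain H where "addmap PA N H" "!!v w. v <: SA ==> w <: SA ==> H (pt v w) = g v w"
  by(rule P_lift[OF N gc gl gr gb]) (assumption | (rule that; assumption))+
 thus thesis using that gh S.Q.hpc by metis
qed

lemma P_eqI: assumes "addmap PA N f" "addmap PA N g"
  "!!i j v w. v : hp SA i ==> w : hp SA j ==> f (pt v w) = g (pt v w)" "z <: PA" shows "f z = g z"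
 using assms(4) by(induction rule: P_hom_induct) (simp_all add: assms(3) amD2[OF assms(1)] amD2[OF assms(2)])

text \<open>Let H be the map lifted from v, w |-> v tensor wa. Then pr (x a) = H (pr x), so pr (x a)
  vanishes for x in \<open>PI\<close>; this is the stability of \<open>PI\<close> under
  scalars.\<close>

lemma pt_rs: assumes a: "a <: K" shows "addmap PA PA (%z. z .[PA] a)"
  and "v <: SA ==> w <: SA ==> pt v w .[PA] a = pt v (w *[SA] kp a)"
proof -
 obtain H where H: "addmap PA PA H" "!!v w. v <: SA ==> w <: SA ==> H (pt v w) = pt v (w *[SA] kp a)"
  by(rule P_lift[OF PA_ab, of "%v w. pt v (w *[SA] kp a)"])
   (use a in "simp_all add: pt_add_left pt_add_right S.Q.l_distr pt_bal S.Q.m_assoc")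
 let ?f = "%x. x .[PF] a"
 have fa: "addmap PF PF ?f" proof (rule addmapI)
  fix x assume "x <: PF"
  thus "?f x <: PF" unfolding PF_sel mem_Collect_eq by(intro keys_fe_subset) (use a S.Q.rsc in "auto simp: keys_frag_of")
 qed (simp add: frag_extend_add)
 note fc = amD1[OF fa]
 have pH: "pr (?f x) = H (pr x)" if x: "x <: PF" for x using x[unfolded PF_sel mem_Collect_eq] proof (induction rule: frag_ind)
  case zero thus ?case using am_zn(1)[OF PA_ab PA_ab H(1)] by(simp add: pr_zero)
 next
  case (gen s)
  then obtain v w where "s = (v, w)" "v <: SA" "w <: SA" by auto
  thus ?case using H(2)[of v w] a by(simp add: frag_extend_of pt_pr S.Q_rs)
 next
  case (add x y)
  hence c: "x <: PF" "y <: PF" by auto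
  thus ?case using add(3,4) amD2[OF H(1) pr_c[OF c(1)] pr_c[OF c(2)]] amD2[OF fa c] pr_add[OF fc[OF c(1)] fc[OF c(2)]] pr_add[OF c]
   by(simp del: PF_sel(1,7))
 next
  case (neg x)
  hence c: "x <: PF" by auto
  have "?f (- x) = - ?f x" by(simp add: frag_extend_minus)
  thus ?case using neg(2) am_zn(2)[OF PA_ab PA_ab H(1) pr_c[OF c]] pr_neg[OF c] pr_neg[OF fc[OF c]] by(simp del: PF_sel)
 qed
 have fI: "?f x : PI" if "x : PI" for x proof -
  have x: "x <: PF" using that subgroup.subset[OF pi_sub] by auto
  have "pr x = 0[PA]" using pr_zero_iff[OF x] that by simp
  hence "pr (?f x) = 0[PA]" using pH[OF x] am_zn(1)[OF PA_ab PA_ab H(1)] by simp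
  thus ?thesis using pr_zero_iff[OF fc[OF x]] by simp
 qed
 have eq: "z .[PA] a = H z" if z: "z <: PA" for z proof -
  obtain x where x: "x <: PF" "z = pr x" using P_cases[OF z] .
  show ?thesis using smod_quot.qu_rs[OF PI_qu x(1) fa fI] pH[OF x(1)] unfolding x(2) pr_def tensor_prod_def by simp
 qed
 show "addmap PA PA (%z. z .[PA] a)" using H(1) by(simp add: addmap_def eq Pi_iff)
 show "v <: SA ==> w <: SA ==> pt v w .[PA] a = pt v (w *[SA] kp a)" by(simp add: eq H(2))
qed


end

context lsa begin

lemma qscal_hom_mult: assumes "a : hp K l" "v : hp SA i" shows "kp a *[SA] v : hp SA (l + i)" "v *[SA] kp a : hp SA (i + l)"
 using S.Q_hp_mult S.qscal_hp assms by blast+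


text \<open>Two liftings in a row: for fixed v' and w', right multiplication by v' tensor w' is
  additive in z (the map \<open>H\<close>); for fixed z the result is balanced in v' and w' (the map
  \<open>G\<close>).\<close>

lemma ex_P_mult:
 obtains \<mu> where "!!z z'. z <: PA ==> z' <: PA ==> \<mu> z z' <: PA"
  "!!z. z <: PA ==> addmap PA PA (\<mu> z)" "!!z. z <: PA ==> addmap PA PA (%y. \<mu> y z)"
  "!!v w i j v' w'. v <: SA ==> w : hp SA j ==> v' : hp SA i ==> w' <: SA ==>
   \<mu> (pt v w) (pt v' w') = sg PA (i * j) (pt (v *[SA] v') (w *[SA] w'))"
proof -
 note hc = S.Q.hpc
 have "EX H. addmap PA PA H & (ALL i j. ALL v:hp SA i. ALL w:hp SA j. H (pt v w) = sg PA (i' * j) (pt (v *[SA] v') (w *[SA] w')))"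
  if vw: "v' : hp SA i'" "w' <: SA" for i' v' w' proof -
  obtain H where "addmap PA PA H" "!!i j v w. v : hp SA i ==> w : hp SA j ==> H (pt v w) = sg PA (i' * j) (pt (v *[SA] v') (w *[SA] w'))"
  proof (rule P_lift_hom[OF PA_ab, of "%i j v w. sg PA (i' * j) (pt (v *[SA] v') (w *[SA] w'))"])
   fix i j l v w a assume h: "v : hp SA i" "w : hp SA j" "a : hp K l"
   note c = hc[OF h(1)] hc[OF h(2)] K.hpc[OF h(3)] hc[OF vw(1)] vw(2)
   have "pt (v *[SA] kp a *[SA] v') (w *[SA] w') = sg PA (l * i') (pt (v *[SA] v') (kp a *[SA] (w *[SA] w')))" proof -
    have "v *[SA] kp a *[SA] v' = sg SA (l * i') (v *[SA] v' *[SA] kp a)"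
     using c S.qs_comm[OF h(3) vw(1)] by(cases l; cases i') (simp_all add: sg_def S.Q.m_assoc S.Q.r_minus)
    thus ?thesis using c by(simp add: pt_neg pt_bal)
   qed
   thus "sg PA (i' * j) (pt (v *[SA] kp a *[SA] v') (w *[SA] w')) =
    sg PA (i' * (l + j)) (pt (v *[SA] v') (kp a *[SA] w *[SA] w'))" using c by(simp add: PA.sg_sg S.Q.m_assoc algebra_simps)
  qed (use hc hc[OF vw(1)] vw(2) that in "simp_all add: S.Q.l_distr pt_add_left pt_add_right PA.sg_add")
  thus ?thesis by blast
 qed
 note ex = this
 define H where "H i' v' w' = (SOME H. addmap PA PA H & (ALL i j. ALL v:hp SA i. ALL w:hp SA j.
   H (pt v w) = sg PA (i' * j) (pt (v *[SA] v') (w *[SA] w'))))" for i' v' w'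
 have HH: "addmap PA PA (H i' v' w') & (ALL i j. ALL v:hp SA i. ALL w:hp SA j.
   H i' v' w' (pt v w) = sg PA (i' * j) (pt (v *[SA] v') (w *[SA] w')))" if "v' : hp SA i'" "w' <: SA" for i' v' w'
  unfolding H_def using ex[OF that] by(rule someI_ex)
 have H: "addmap PA PA (H i' v' w')" "!!i j v w. v : hp SA i ==> w : hp SA j ==>
   H i' v' w' (pt v w) = sg PA (i' * j) (pt (v *[SA] v') (w *[SA] w'))" if "v' : hp SA i'" "w' <: SA" for i' v' w'
  using HH[OF that] by blast+
 note Hc = amD1[OF H(1)]
 have "EX G. addmap PA PA G & (ALL i j. ALL v':hp SA i. ALL w':hp SA j. G (pt v' w') = H i v' w' z)" if z: "z <: PA" for z proof -
  obtain G where "addmap PA PA G" "!!i j v' w'. v' : hp SA i ==> w' : hp SA j ==> G (pt v' w') = H i v' w' z"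
  proof (rule P_lift_hom[OF PA_ab, of "%i j v' w'. H i v' w' z"])
   fix i j v v' w assume h: "v : hp SA i" "v' : hp SA i" "w : hp SA j"
   show "H i (v +[SA] v') w z = H i v w z +[PA] H i v' w z" by(rule P_eqI[OF H(1) PA.am_add[OF H(1) H(1)] _ z])
     (use h hc in "simp_all add: S.Q.hp_add H(2) S.Q.r_distr pt_add_left PA.sg_add")
  next
   fix i j v w w' assume h: "v : hp SA i" "w' : hp SA j" "w : hp SA j"
   show "H i v (w +[SA] w') z = H i v w z +[PA] H i v w' z" by(rule P_eqI[OF H(1) PA.am_add[OF H(1) H(1)] _ z])
     (use h hc in "simp_all add: S.Q.hp_add H(2) S.Q.r_distr pt_add_right PA.sg_add")
  next
   fix i j l v' w' a assume h: "v' : hp SA i" "w' : hp SA j" "a : hp K l"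
   note c = hc[OF h(1)] hc[OF h(2)] K.hpc[OF h(3)]
   show "H (i + l) (v' *[SA] kp a) w' z = H i v' (kp a *[SA] w') z" proof (rule P_eqI[OF H(1) H(1) _ z])
    fix m n v w assume vw: "v : hp SA m" "w : hp SA n"
    note c' = hc[OF vw(1)] hc[OF vw(2)]
    have "w *[SA] (kp a *[SA] w') = sg SA (l * n) (kp a *[SA] (w *[SA] w'))" using c c' S.qs_comm[OF h(3) vw(2)]
     by(cases l; cases n) (simp_all add: sg_def S.Q.m_assoc[symmetric] S.Q.l_minus)
    thus "H (i + l) (v' *[SA] kp a) w' (pt v w) = H i v' (kp a *[SA] w') (pt v w)"
     using H(2)[OF qscal_hom_mult(2)[OF h(3,1)] c(2) vw] H(2)[OF h(1) _ vw, of "kp a *[SA] w'"] c c'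
     by(simp add: S.Q.m_assoc[symmetric] pt_bal pt_neg PA.sg_sg) (simp add: S.Q.m_assoc algebra_simps)
   qed (use h c qscal_hom_mult in simp_all)
  qed (use z Hc hc that in simp_all)
  thus ?thesis by blast
 qed
 note ex = this
 define G where "G z = (SOME G. addmap PA PA G & (ALL i j. ALL v':hp SA i. ALL w':hp SA j. G (pt v' w') = H i v' w' z))" for z
 have GG: "addmap PA PA (G z) & (ALL i j. ALL v':hp SA i. ALL w':hp SA j. G z (pt v' w') = H i v' w' z)" if "z <: PA" for z
  unfolding G_def using ex[OF that] by(rule someI_ex)
 have G: "addmap PA PA (G z)" "!!i j v' w'. v' : hp SA i ==> w' : hp SA j ==> G z (pt v' w') = H i v' w' z"
  if "z <: PA" for z using GG[OF that] by blast+
 note Gc = amD1[OF G(1)]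
 have Gl: "addmap PA PA (%y. G y z)" if z: "z <: PA" for z proof (rule addmapI)
  fix x y assume xy: "x <: PA" "y <: PA"
  show "G (x +[PA] y) z = G x z +[PA] G y z" by(rule P_eqI[OF G(1) PA.am_add[OF G(1) G(1)] _ z])
    (use xy hc in "simp_all add: G(2) amD2[OF H(1)]")
 qed (use Gc z in simp)
 have Ghom: "G (pt v w) (pt v' w') = sg PA (i * j) (pt (v *[SA] v') (w *[SA] w'))"
  if "v <: SA" "w : hp SA j" "v' : hp SA i" "w' <: SA" for v w v' w' i j using that(1) proof (induction rule: S.Q.hom_ind)
  case (hom k v)
  note v = hom hc[OF hom]
  from that(4) show ?case proof (induction rule: S.Q.hom_ind)
   case (hom l w')
   show ?case using G(2)[OF _ that(3) hom] H(2)[OF that(3) hc[OF hom] v(1) that(2)] v hc[OF that(2)] by simp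
  next
   case (add x y)
   thus ?case using that(2,3) hc v by(simp add: pt_add_right amD2[OF G(1)] S.Q.r_distr PA.sg_add)
  qed
 next
  case (add x y)
  thus ?case using that hc by(simp add: pt_add_left amD2[OF Gl] S.Q.l_distr PA.sg_add)
 qed
 show thesis by(rule that[of G]) (simp_all add: Gc G(1) Gl Ghom)
qed

text \<open>The product of two cosets is a union over all pairs of representatives. It is one coset
  because the product of representatives is mapped to the bilinear product \<open>\<mu>\<close> of
  their classes, which does not depend on the choice.\<close>

lemma PA_mult_props: shows PA_mult_closed: "!!z z'. z <: PA ==> z' <: PA ==> z *[PA] z' <: PA"
  and PA_mult_right: "!!z. z <: PA ==> addmap PA PA (%y. z *[PA] y)"
  and PA_mult_left: "!!z. z <: PA ==> addmap PA PA (%y. y *[PA] z)"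
  and pt_mult: "!!v w i j v' w'. v <: SA ==> w : hp SA j ==> v' : hp SA i ==> w' <: SA ==>
   pt v w *[PA] pt v' w' = sg PA (i * j) (pt (v *[SA] v') (w *[SA] w'))"
proof -
 obtain \<mu> where \<mu>: "!!z z'. z <: PA ==> z' <: PA ==> \<mu> z z' <: PA"
  "!!z. z <: PA ==> addmap PA PA (\<mu> z)" "!!z. z <: PA ==> addmap PA PA (%y. \<mu> y z)"
  "!!v w i j v' w'. v <: SA ==> w : hp SA j ==> v' : hp SA i ==> w' <: SA ==>
   \<mu> (pt v w) (pt v' w') = sg PA (i * j) (pt (v *[SA] v') (w *[SA] w'))" using ex_P_mult by blast
 define m where "m = (%(x, y) (x', y'). \<Sum>i\<in>{0,1::bit}. \<Sum>j\<in>{0,1}. frag_cmul (if i * j = 1 then -1 else 1)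
     (frag_of (x *[SA] hcomp SA j x', hcomp SA i y *[SA] y')))"
 have mult: "x *[PF] y = frag_extend (%s. frag_extend (m s) y) x" for x y by(simp add: m_def case_prod_unfold)
 have mc: "m s t <: PF & pr (m s t) = \<mu> (pr (frag_of s)) (pr (frag_of t))"
  if st: "s : car SA \<times> car SA" "t : car SA \<times> car SA" for s t proof -
  obtain v w v' w' where e: "s = (v, w)" "t = (v', w')" by(metis surj_pair)
  with st have c: "v <: SA" "w <: SA" "v' <: SA" "w' <: SA" by auto
  let ?f = "%i j. frag_of (v *[SA] hcomp SA j v', hcomp SA i w *[SA] w')"
  have me: "m s t = (?f 0 0 + ?f 0 1) + (?f 1 0 + - ?f 1 1)" by(simp add: m_def e)
  have fc: "?f i j <: PF" "- ?f 1 1 <: PF" for i j using c by(auto intro!: frag_of_PF simp del: PF_sel) (simp)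
  have sum: "?f 0 0 + ?f 0 1 <: PF" "?f 1 0 + - ?f 1 1 <: PF" by(intro PF_add fc)+
  have p: "\<mu> (pt v (hcomp SA i w)) (pt (hcomp SA j v') w') = sg PA (j * i) (pr (?f i j))" for i j
   using \<mu>(4)[OF c(1) S.Q.hcomp_h[OF c(2)] S.Q.hcomp_h[OF c(3)] c(4)] by(simp add: pt_pr)
  have wd: "pt v w = pt v (hcomp SA 0 w) +[PA] pt v (hcomp SA 1 w)"
   using c pt_add_right[of v "hcomp SA 1 w" "hcomp SA 0 w"] by(simp flip: S.Q.hcomp_sum)
  have vd: "pt v' w' = pt (hcomp SA 0 v') w' +[PA] pt (hcomp SA 1 v') w'"
   using c pt_add_left[of "hcomp SA 0 v'" "hcomp SA 1 v'" w'] by(simp flip: S.Q.hcomp_sum)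
  have "\<mu> (pt v w) (pt v' w') = (pr (?f 0 0) +[PA] pr (?f 0 1)) +[PA] (pr (?f 1 0) +[PA] sg PA 1 (pr (?f 1 1)))"
   unfolding wd vd using c by(simp add: amD2[OF \<mu>(3)] amD2[OF \<mu>(2)] p PA.a_ac pr_c[OF fc(1)] del: PF_sel)
  also have "... = pr (m s t)"
   unfolding me pr_add[OF sum] pr_add[OF fc(1) fc(1)] pr_add[OF fc(1) fc(2)] pr_neg[OF fc(1)] PA.neg_eq_sg by(rule refl)
  finally show ?thesis using PF_add[OF sum] me by(simp add: e pt_pr)
 qed
 have car: "x <: PF \<longleftrightarrow> Poly_Mapping.keys x <= car SA \<times> car SA" for x by simp
 have cl1: "frag_extend (m s) y <: PF" if s: "s : car SA \<times> car SA" and y: "y <: PF" for s y unfolding car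
 proof (rule keys_fe_subset)
  fix t assume "t : Poly_Mapping.keys y"
  hence "t : car SA \<times> car SA" using y unfolding car by blast
  thus "Poly_Mapping.keys (m s t) <= car SA \<times> car SA" using mc[OF s] unfolding car by blast
 qed
 have cl: "x *[PF] y <: PF" if x: "x <: PF" and y: "y <: PF" for x y unfolding car mult proof (rule keys_fe_subset)
  fix t assume "t : Poly_Mapping.keys x"
  hence "t : car SA \<times> car SA" using x unfolding car by blast
  thus "Poly_Mapping.keys (frag_extend (m t) y) <= car SA \<times> car SA" using cl1 y unfolding car by blast
 qed
 have mz: "\<mu> z 0[PA] = 0[PA]" "\<mu> 0[PA] z = 0[PA]" if "z <: PA" for z by(rule am_zn(1)[OF PA_ab PA_ab \<mu>(2)[OF that]],
   rule am_zn(1)[OF PA_ab PA_ab \<mu>(3)[OF that]])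
 have mneg: "\<mu> z (-[PA] y) = -[PA] \<mu> z y" "\<mu> (-[PA] y) z = -[PA] \<mu> y z" if "z <: PA" "y <: PA" for z y
  by(rule am_zn(2)[OF PA_ab PA_ab \<mu>(2)[OF that(1)] that(2)],
   rule am_zn(2)[OF PA_ab PA_ab \<mu>(3)[OF that(1)] that(2)])
 have p1: "pr (frag_extend (m s) y) = \<mu> (pr (frag_of s)) (pr y)" if s: "s : car SA \<times> car SA" and y: "y <: PF" for s y
 proof -
  have sc: "pr (frag_of s) <: PA" using s by(intro pr_c) auto
  from y[unfolded PF_sel mem_Collect_eq] show ?thesis proof (induction rule: frag_ind)
   case zero thus ?case using sc by(simp add: pr_zero mz(1))
  next
   case (gen t) thus ?case using mc[OF s gen] by(simp add: frag_extend_of)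
  next
   case (add x y)
   hence c: "x <: PF" "y <: PF" by auto
   show ?case using add(3,4) amD2[OF \<mu>(2)[OF sc] pr_c[OF c(1)] pr_c[OF c(2)]]
    by(simp only: frag_extend_add pr_add[OF cl1[OF s c(1)] cl1[OF s c(2)]] pr_add[OF c])
  next
   case (neg x)
   hence c: "x <: PF" by auto
   show ?case using neg(2) by(simp only: frag_extend_minus pr_neg[OF cl1[OF s c]] pr_neg[OF c] mneg(1)[OF sc pr_c[OF c]])
  qed
 qed
 have p2: "pr (x *[PF] y) = \<mu> (pr x) (pr y)" if x: "x <: PF" and y: "y <: PF" for x y proof -
  have yc: "pr y <: PA" using y by(intro pr_c) auto
  from x[unfolded PF_sel mem_Collect_eq] show ?thesis unfolding mult proof (induction rule: frag_ind)
   case zero thus ?case using yc by(simp add: pr_zero mz(2))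
  next
   case (gen s) thus ?case using p1[OF gen y] by(simp add: frag_extend_of)
  next
   case (add u v)
   hence c: "u <: PF" "v <: PF" by auto
   show ?case using add(3,4) amD2[OF \<mu>(3)[OF yc] pr_c[OF c(1)] pr_c[OF c(2)]]
    by(simp only: frag_extend_add pr_add[OF cl[OF c(1) y, unfolded mult] cl[OF c(2) y, unfolded mult]] pr_add[OF c])
  next
   case (neg u)
   hence c: "u <: PF" by auto
   show ?case using neg(2) by(simp only: frag_extend_minus pr_neg[OF cl[OF c y, unfolded mult]] pr_neg[OF c] mneg(2)[OF yc pr_c[OF c]])
  qed
 qed
 have eq: "z *[PA] z' = \<mu> z z'" if zz: "z <: PA" "z' <: PA" for z z' proof -
  interpret Q: smod_quot PI PF by(rule PI_qu)
  obtain x y where x: "x <: PF" "z = pr x" and y: "y <: PF" "z' = pr y" using P_cases zz by metis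
  have "pr (a *[PF] b) = \<mu> z z'" if ab: "a : pr x" "b : pr y" for a b proof -
   have c: "a <: PF" "b <: PF" using Q.a_elemrcos_carrier[OF x(1)] Q.a_elemrcos_carrier[OF y(1)] ab by(simp_all only: pr_def)
   have "pr a = pr x" "pr b = pr y"
    using Q.a_repr_independence'[of a x] Q.a_repr_independence'[of b y] ab x y unfolding pr_def by simp_all
   thus ?thesis using p2[OF c] x y by simp
  qed
  moreover have "x : pr x" "y : pr y" unfolding pr_def using Q.a_rcos_self x y by simp_all
  ultimately have "(\<Union>a\<in>pr x. \<Union>b\<in>pr y. pr (a *[PF] b)) = \<mu> z z'" by blast
  moreover have "z *[PA] z' = (\<Union>a\<in>z. \<Union>b\<in>z'. pr (a *[PF] b))"
   by(simp add: tensor_prod_def FactRing_def rcoset_mult_def pr_def del: PF_sel)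
  ultimately show ?thesis using x y by simp
 qed
 show "z *[PA] z' <: PA" if "z <: PA" "z' <: PA" for z z' using that by(simp add: eq \<mu>(1))
 show "addmap PA PA (%y. z *[PA] y)" if "z <: PA" for z using \<mu>(2)[OF that] that by(simp add: addmap_def eq Pi_iff)
 show "addmap PA PA (%y. y *[PA] z)" if "z <: PA" for z using \<mu>(3)[OF that] that by(simp add: addmap_def eq Pi_iff)
 show "pt v w *[PA] pt v' w' = sg PA (i * j) (pt (v *[SA] v') (w *[SA] w'))"
  if "v <: SA" "w : hp SA j" "v' : hp SA i" "w' <: SA" for v w i j v' w' using \<mu>(4)[OF that] that S.Q.hpc by(simp add: eq)
qed

lemma PA_one: "1[PA] = pt 1[SA] 1[SA]" by(simp add: tensor_prod_def FactRing_def pure_tensor_def)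

lemma ex_lam: assumes X: "X : hp L p"
 obtains H where "addmap PA PA H" "!!i j v w. v : hp SA i ==> w : hp SA j ==>
  H (pt v w) = pt (io X *[SA] v) w +[PA] sg PA (p * i) (pt v (io X *[SA] w))"
proof (rule P_lift_hom[OF PA_ab, of "%i j v w. pt (io X *[SA] v) w +[PA] sg PA (p * i) (pt v (io X *[SA] w))"])
 note hc = S.Q.hpc
 note Xc = hpc[OF X]
 fix i j l v w a assume h: "v : hp SA i" "w : hp SA j" "a : hp K l"
 note c = hc[OF h(1)] hc[OF h(2)] K.hpc[OF h(3)]
 have "io X *[SA] (kp a *[SA] w) = sg SA (l * p) (kp a *[SA] (io X *[SA] w))" using c Xc S.qs_comm[OF h(3) S.qin_hp[OF X]]
  by(cases l; cases p) (simp_all add: sg_def S.Q.m_assoc[symmetric] S.Q.l_minus)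
 hence "sg PA (p * (i + l)) (pt (v *[SA] kp a) (io X *[SA] w)) = sg PA (p * i) (pt v (io X *[SA] (kp a *[SA] w)))"
  using c Xc by(simp add: pt_bal pt_neg PA.sg_sg algebra_simps)
 thus "pt (io X *[SA] (v *[SA] kp a)) w +[PA] sg PA (p * (i + l)) (pt (v *[SA] kp a) (io X *[SA] w)) =
  pt (io X *[SA] v) (kp a *[SA] w) +[PA] sg PA (p * i) (pt v (io X *[SA] (kp a *[SA] w)))"
  using c Xc by(simp add: S.Q.m_assoc[symmetric] pt_bal)
qed (use S.Q.hpc hpc[OF X] that in "simp_all add: S.Q.r_distr pt_add_left pt_add_right PA.sg_add PA.a_ac")

text \<open>Left multiplication by X tensor 1 + 1 tensor X, given by its values on pure tensors so
  that it can be fed to \<open>sym_action\<close> as an additive map.\<close>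

definition "lam p X = (SOME H. addmap PA PA H & (ALL i j. ALL v:hp SA i. ALL w:hp SA j.
  H (pt v w) = pt (io X *[SA] v) w +[PA] sg PA (p * i) (pt v (io X *[SA] w))))"

lemma lam: assumes X: "X : hp L p" shows "addmap PA PA (lam p X)" "v : hp SA i ==> w <: SA ==>
  lam p X (pt v w) = pt (io X *[SA] v) w +[PA] sg PA (p * i) (pt v (io X *[SA] w))"
proof -
 have 1: "addmap PA PA (lam p X) & (ALL i j. ALL v:hp SA i. ALL w:hp SA j.
  lam p X (pt v w) = pt (io X *[SA] v) w +[PA] sg PA (p * i) (pt v (io X *[SA] w)))" proof -
  obtain H where "addmap PA PA H" "!!i j v w. v : hp SA i ==> w : hp SA j ==>
   H (pt v w) = pt (io X *[SA] v) w +[PA] sg PA (p * i) (pt v (io X *[SA] w))" using ex_lam[OF X] by blast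
  hence "EX H. addmap PA PA H & (ALL i j. ALL v:hp SA i. ALL w:hp SA j.
   H (pt v w) = pt (io X *[SA] v) w +[PA] sg PA (p * i) (pt v (io X *[SA] w)))" by blast
  thus ?thesis unfolding lam_def by(rule someI_ex)
 qed
 thus 2: "addmap PA PA (lam p X)" by blast
 assume v: "v : hp SA i" and w: "w <: SA"
 note vc = S.Q.hpc[OF v] hpc[OF X]
 show "lam p X (pt v w) = pt (io X *[SA] v) w +[PA] sg PA (p * i) (pt v (io X *[SA] w))" using w
 proof (induction rule: S.Q.hom_ind)
  case (hom j w) thus ?case using 1 v by blast
 next
  case (add x y)
  thus ?case using vc by(simp add: pt_add_right amD2[OF 2] S.Q.r_distr PA.sg_add PA.a_ac)
 qed
qed

lemma lam_closed: "X : hp L p ==> z <: PA ==> lam p X z <: PA" using amD1[OF lam(1)] .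

text \<open>Left multiplication by a scalar; it acts through the first factor.\<close>

definition "gsc a = (SOME H. addmap PA PA H & (ALL v:car SA. ALL w:car SA. H (pt v w) = pt (kp a *[SA] v) w))"

lemma gsc: assumes a: "a <: K" shows "addmap PA PA (gsc a)" "v <: SA ==> w <: SA ==> gsc a (pt v w) = pt (kp a *[SA] v) w"
proof -
 obtain H where "addmap PA PA H" "!!v w. v <: SA ==> w <: SA ==> H (pt v w) = pt (kp a *[SA] v) w"
  by(rule P_lift[OF PA_ab, of "%v w. pt (kp a *[SA] v) w"])
   (use a in "simp_all add: pt_add_left pt_add_right S.Q.r_distr pt_bal S.Q.m_assoc[symmetric]")
 hence "EX H. addmap PA PA H & (ALL v:car SA. ALL w:car SA. H (pt v w) = pt (kp a *[SA] v) w)" by blast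
 hence "addmap PA PA (gsc a) & (ALL v:car SA. ALL w:car SA. gsc a (pt v w) = pt (kp a *[SA] v) w)"
  unfolding gsc_def by(rule someI_ex)
 thus "addmap PA PA (gsc a)" "v <: SA ==> w <: SA ==> gsc a (pt v w) = pt (kp a *[SA] v) w" by blast+
qed


end

section \<open>Linear maps of pure parity and the splitting of a linear map\<close>

definition hHom :: "'k sring => ('k, 'a, 'r) smod_scheme => ('k, 'b, 's) smod_scheme => bit => ('a => 'b) set" where
 "hHom K M N d = {f : Hom K M N. ALL i. f ` hp M i <= hp N (d + i)}"

lemma hHomI: "f : Hom K M N ==> (!!i x. x : hp M i ==> f x : hp N (d + i)) ==> f : hHom K M N d" by(auto simp: hHom_def)

lemma hHomD: "f : hHom K M N d ==> f : Hom K M N" "f : hHom K M N d ==> x : hp M i ==> f x : hp N (d + i)" by(auto simp: hHom_def)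

lemmas hHom_am = HomD(1)[OF hHomD(1)]
lemmas hHom_c = HomD(2)[OF hHomD(1)]
lemmas hHom_add = HomD(4)[OF hHomD(1)]
lemmas hHom_rs = HomD(5)[OF hHomD(1)]

text \<open>A left scalar is a signed right scalar. On one side the sign is computed before
  \<open>F\<close> is applied and on the other side after it, and in between the parity has changed
  by \<open>d\<close>.\<close>

lemma hHom_ls: assumes "smodule K M" "smodule K N" and F: "F : hHom K M N d" and a: "a : hp K l" and x: "x <: M"
 shows "F (lsmult K M a x) = sg N (d * l) (lsmult K N a (F x))"
proof -
 interpret M: smodule K M by fact
 interpret N: smodule K N by fact
 note ac = M.K.hpc[OF a]
 note Fc = hHom_c[OF F] and Fa = hHom_add[OF F]
 from x show ?thesis proof (induction rule: M.hom_ind)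
  case (hom i x)
  note xc = M.hpc[OF hom]
  have "F (lsmult K M a x) = sg N (l * i) (F x .[N] a)" using am_zn(3)[OF M.abx N.abx hHom_am[OF F] M.rsc[OF xc ac]]
   by(simp add: M.ls_hom[OF hom a] hHom_rs[OF F xc ac])
  also have "... = sg N (d * l) (lsmult K N a (F x))"
   using Fc[OF xc] ac by(simp add: N.ls_hom[OF hHomD(2)[OF F hom] a] N.sg_sg N.rsc distrib_left mult.commute add.commute)
  finally show ?case .
 next
  case (add x y)
  thus ?case using ac Fc by(simp add: M.lsm_addr Fa N.lsm_addr N.sg_add)
 qed
qed

lemma hom_comp_hHom: assumes "smodule K M" "smodule K N" and F: "F : Hom K M N" shows "hom_comp M N d F : hHom K M N d"
  and "x <: M ==> F x = hom_comp M N 0 F x +[N] hom_comp M N 1 F x"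
  and "x : hp M i ==> hom_comp M N d F x = hcomp N (d + i) (F x)"
proof -
 interpret M: smodule K M by fact
 interpret N: smodule K N by fact
 note Fc = HomD(2)[OF F] and Fa = HomD(4)[OF F]
 have F0: "F 0[M] = 0[N]" by(rule am_zn(1)[OF M.abx N.abx HomD(1)[OF F]])
 have ex: "hom_comp M N d F x = hcomp N d (F (hcomp M 0 x)) +[N] hcomp N (d + 1) (F (hcomp M 1 x))" if "x <: M" for x d
  using that Fc by(simp add: hom_comp_def)
 have N0: "hcomp N i 0[N] = 0[N]" for i using N.hcomp_hom[of "0[N]" i i] by simp
 have eq: "hom_comp M N d F x = hcomp N (d + i) (F x)" if "x : hp M i" for x i d
  using that M.hpc[OF that] Fc unfolding ex[OF M.hpc[OF that]] by(cases i) (simp_all add: M.hcomp_hom[OF that] F0 N0)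
 thus "x : hp M i ==> hom_comp M N d F x = hcomp N (d + i) (F x)" by blast
 have ad: "addmap M N (hom_comp M N d F)" for d by(rule addmapI) (simp_all add: ex Fc Fa M.hcomp_add N.hcomp_add N.a_ac)
 show "F x = hom_comp M N 0 F x +[N] hom_comp M N 1 F x" if "x <: M"
 proof (rule M.am_eqI[OF HomD(1)[OF F] N.am_add[OF ad ad] _ that])
  fix i x assume x: "x : hp M i"
  show "F x = hom_comp M N 0 F x +[N] hom_comp M N 1 F x"
   unfolding eq[OF x] using N.hcomp_sum[OF Fc[OF M.hpc[OF x]]] Fc[OF M.hpc[OF x]] by(cases i) (simp_all add: N.a_comm)
 qed
 have rs: "hom_comp M N d F (x .[M] a) = hom_comp M N d F x .[N] a" if xa: "x <: M" "a <: K" for x a using xa(1)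
 proof (induction rule: M.hom_ind)
  case (hom i x)
  note x = hom M.hpc[OF hom]
  from xa(2) show ?case proof (induction rule: M.K.hom_ind)
   case (hom l a)
   note a = hom M.K.hpc[OF hom]
   let ?y = "%j. hcomp N j (F x)"
   have "F x .[N] a = ?y (d + i) .[N] a +[N] ?y (d + i + 1) .[N] a" using N.hcomp_sum[OF Fc[OF x(2)]] Fc[OF x(2)] a
    by(cases "d + i") (simp_all add: N.rsmult_add_left[symmetric] N.a_comm)
   moreover have "?y j .[N] a : hp N (j + l)" for j using N.rsmult_hpart[OF N.hcomp_h a(1)] Fc[OF x(2)] by blast
   ultimately have "hcomp N (d + i + l) (F x .[N] a) = ?y (d + i) .[N] a"
    using N.hcomp_eq[of "?y (d + i) .[N] a" "d + i + l" "?y (d + i + 1) .[N] a"]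
    by(metis (no_types, lifting) add.assoc add.commute)
   thus ?case using eq[OF M.rsmult_hpart[OF x(1) a(1)]] eq[OF x(1)] HomD(5)[OF F x(2) a(2)] by(simp add: add.assoc)
  next
   case (add a b)
   thus ?case using x addmapD[OF ad] by(simp add: M.rsmult_add_right M.rsc N.rsmult_add_right)
  qed
 next
  case (add x y)
  thus ?case using xa addmapD[OF ad] by(simp add: M.rsmult_add_left M.rsc N.rsmult_add_left)
 qed
 show "hom_comp M N d F : hHom K M N d" proof (rule hHomI, rule HomI)
  fix x i assume x: "x : hp M i"
  show "hom_comp M N d F x : hp N (d + i)" unfolding eq[OF x] using Fc M.hpc[OF x] by simp
 qed (use addmapD[OF ad] rs in "simp_all add: hom_comp_def")
qed

text \<open>\<open>hom_comp\<close> enters through \<open>tensor_map\<close> and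
  \<open>superderivation\<close>; here it is identified whenever an explicit splitting into
  homogeneous maps is at hand.\<close>

lemma hom_comp_eq: assumes "smodule K M" "smodule K N" and F: "F : Hom K M N"
  and G: "!!d. G d : hHom K M N d" "!!x. x <: M ==> F x = G 0 x +[N] G 1 x" shows "hom_comp M N d F = G d"
proof -
 interpret M: smodule K M by fact
 interpret N: smodule K N by fact
 note h = hom_comp_hHom[OF assms(1-3)]
 have "hom_comp M N d F x = G d x" if x: "x <: M" for x proof (rule M.am_eqI[OF hHom_am[OF h(1)] hHom_am[OF G(1)] _ x])
  fix i x assume x: "x : hp M i"
  have g: "G j x : hp N (j + i)" for j using hHomD(2)[OF G(1) x] .
  note c = N.hpc[OF g]
  have "F x = G d x +[N] G (d + 1) x" using G(2)[OF M.hpc[OF x]] c by(cases d) (simp_all add: N.a_comm)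
  moreover have "G (d + 1) x : hp N (d + i + 1)" using g[of "d + 1"] by(simp add: add_ac)
  ultimately show "hom_comp M N d F x = G d x" using N.hcomp_eq[OF g] h(3)[OF x] by simp
 qed
 thus ?thesis by(intro Hom_eqI[OF hHomD(1)[OF h(1)] hHomD(1)[OF G(1)]])
qed

context lsa begin

lemma lam_lam: assumes v: "v : hp L i" and w: "w : hp L j" and x: "x : hp SA k" and y: "y <: SA"
 shows "lam i v (lam j w (pt x y)) = (pt (io v *[SA] io w *[SA] x) y +[PA] sg PA (i * (j + k)) (pt (io w *[SA] x) (io v *[SA] y))) +[PA]
  sg PA (j * k) (pt (io v *[SA] x) (io w *[SA] y) +[PA] sg PA (i * k) (pt x (io v *[SA] io w *[SA] y)))"
proof -
 note c = hpc[OF v] hpc[OF w] S.Q.hpc[OF x] y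
 have "lam i v (lam j w (pt x y)) = lam i v (pt (io w *[SA] x) y) +[PA] sg PA (j * k) (lam i v (pt x (io w *[SA] y)))"
  using c am_zn(3)[OF PA_ab PA_ab lam(1)[OF v]] by(simp add: lam(2)[OF w x y] amD2[OF lam(1)[OF v]])
 thus ?thesis using c lam(2)[OF v x, of "io w *[SA] y"] lam(2)[OF v S.Q_hp_mult[OF S.qin_hp[OF w] x] y] by(simp add: S.Q.m_assoc)
qed

text \<open>S(g) acts on its tensor square, a letter X acting as X tensor 1 + 1 tensor X, and the
  coproduct of u is the result of moving 1 tensor 1 by u. The supercommutation of these operators is
  read off from \<open>lam_lam\<close>.\<close>

lemma ex_coprod:
 obtains D where "addmap SA PA D" "D 1[SA] = pt 1[SA] 1[SA]"
  "!!p X u. X : hp L p ==> u <: SA ==> D (io X *[SA] u) = lam p X (D u)"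
  "!!a u. a <: K ==> u <: SA ==> D (kp a *[SA] u) = gsc a (D u)"
  "!!a. a <: K ==> D (kp a) = pt (kp a) 1[SA]"
proof -
 note hc = S.Q.hpc
 obtain A where A: "A : ring_hom SA (End_alg kempty PA)" "is_action SA PA A"
  "!!p X v. X : hp L p ==> v <: PA ==> A (io X) v = lam p X v"
  "!!a v. a <: K ==> v <: PA ==> A (kp a) v = gsc a v" proof (rule sym_action[OF PA_ab, of lam gsc])
  fix p X Y z assume h: "X : hp L p" "Y : hp L p" "z <: PA"
  note c = hpc[OF h(1)] hpc[OF h(2)]
  show "lam p (X \<oplus> Y) z = lam p X z +[PA] lam p Y z"
   by(rule P_eqI[OF lam(1)[OF hp_add[OF h(1,2)]] PA.am_add[OF lam(1)[OF h(1)] lam(1)[OF h(2)]] _ h(3)])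
    (use c hc in "simp add: lam(2)[OF h(1)] lam(2)[OF h(2)] lam(2)[OF hp_add[OF h(1,2)]] S.qin_add S.Q.l_distr pt_add_left pt_add_right PA.sg_add PA.a_ac")
 next
  fix a b z assume h: "a <: K" "b <: K" "z <: PA"
  have ab: "a +[K] b <: K" "a *[K] b <: K" using h by simp_all
  show "gsc (a +[K] b) z = gsc a z +[PA] gsc b z"
   by(rule P_eqI[OF gsc(1)[OF ab(1)] PA.am_add[OF gsc(1)[OF h(1)] gsc(1)[OF h(2)]] _ h(3)])
    (use h hc in "simp add: gsc(2) S.qscal_add S.Q.l_distr pt_add_left")
  show "gsc (a *[K] b) z = gsc a (gsc b z)" by(rule P_eqI[OF gsc(1)[OF ab(2)] am_o[OF gsc(1)[OF h(2)] gsc(1)[OF h(1)]] _ h(3)])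
    (use h hc in "simp add: gsc(2) S.qscal_mult S.Q.m_assoc")
 next
  fix z assume h: "z <: PA"
  show "gsc 1[K] z = z" by(rule P_eqI[OF gsc(1)[OF K.one_closed] _ _ h])
    (use hc in "simp_all add: gsc(2) S.qscal_one addmap_def")
 next
  fix p X j a z assume h: "X : hp L p" "a : hp K j" "z <: PA"
  note c = hpc[OF h(1)] K.hpc[OF h(2)]
  show "lam (p + j) (X \<bullet> a) z = lam p X (gsc a z)"
  proof (rule P_eqI[OF lam(1)[OF rsmult_hpart[OF h(1,2)]] am_o[OF gsc(1)[OF c(2)] lam(1)[OF h(1)]] _ h(3)])
   fix i k v w assume vw: "v : hp SA i" "w : hp SA k"
   note vc = hc[OF vw(1)] hc[OF vw(2)]
   have "kp a *[SA] (io X *[SA] w) = sg SA (j * p) (io X *[SA] (kp a *[SA] w))" using c vc S.qs_comm[OF h(2) S.qin_hp[OF h(1)]]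
    by(cases j; cases p) (simp_all add: sg_def S.Q.m_assoc[symmetric] S.Q.l_minus)
   hence e: "pt (kp a *[SA] v) (io X *[SA] w) = sg PA (j * i + j * p) (pt v (io X *[SA] (kp a *[SA] w)))"
    using c vc by(simp add: S.qs_comm[OF h(2) vw(1)] pt_neg pt_bal PA.sg_sg)
   show "lam (p + j) (X \<bullet> a) (pt v w) = lam p X (gsc a (pt v w))"
    using c vc lam(2)[OF rsmult_hpart[OF h(1,2)] vw(1) vc(2)] lam(2)[OF h(1) S.Q_hp_mult[OF S.qscal_hp[OF h(2)] vw(1)] vc(2)]
    by(simp add: gsc(2) S.qin_rs S.Q.m_assoc e PA.sg_sg bit_poly)
  qed
  show "lam (j + p) (lsmult K L a X) z = gsc a (lam p X z)"
  proof (rule P_eqI[OF lam(1)[OF ls_hp[OF h(1,2)]] am_o[OF lam(1)[OF h(1)] gsc(1)[OF c(2)]] _ h(3)])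
   fix i k v w assume vw: "v : hp SA i" "w : hp SA k"
   note vc = hc[OF vw(1)] hc[OF vw(2)]
   have e: "pt (kp a *[SA] v) (io X *[SA] w) = sg PA (j * i) (pt v (kp a *[SA] (io X *[SA] w)))"
    using c vc by(simp add: S.qs_comm[OF h(2) vw(1)] pt_neg pt_bal)
   show "lam (j + p) (lsmult K L a X) (pt v w) = gsc a (lam p X (pt v w))"
    using c vc lam(2)[OF ls_hp[OF h(1,2)] vw(1) vc(2)] lam(2)[OF h(1) vw(1) vc(2)]
     am_zn(3)[OF PA_ab PA_ab gsc(1)[OF c(2)]] by(simp add: gsc(2) S.qin_ls S.Q.m_assoc amD2[OF gsc(1)] e PA.sg_sg bit_poly)
  qed
 next
  fix v w i j z assume h: "v : hp L i" "w : hp L j" "z <: PA"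
  note c = hpc[OF h(1)] hpc[OF h(2)]
  show "lam i v (lam j w z) = sg PA (i * j) (lam j w (lam i v z))"
  proof (rule P_eqI[OF am_o[OF lam(1)[OF h(2)] lam(1)[OF h(1)]] am_o[OF am_o[OF lam(1)[OF h(1)] lam(1)[OF h(2)]] PA.sg_am] _ h(3)])
   fix k l x y assume xy: "x : hp SA k" "y : hp SA l"
   note xc = hc[OF xy(1)] hc[OF xy(2)]
   show "lam i v (lam j w (pt x y)) = sg PA (i * j) (lam j w (lam i v (pt x y)))"
    unfolding lam_lam[OF h(1,2) xy(1) xc(2)] lam_lam[OF h(2,1) xy(1) xc(2)] sym_comm[OF h(1,2)]
    using c xc by(cases i; cases j; cases k)
     (simp_all add: sg_def S.Q.l_minus pt_neg PA.minus_add PA.a_ac)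
  qed
 next
  fix u z assume h: "u : hp L 1" "z <: PA"
  note c = hpc[OF h(1)]
  show "lam 1 u (lam 1 u z) = 0[PA]" proof (rule P_eqI[OF am_o[OF lam(1)[OF h(1)] lam(1)[OF h(1)]] PA.am_zero _ h(2)])
   fix k l x y assume xy: "x : hp SA k" "y : hp SA l"
   note xc = hc[OF xy(1)] hc[OF xy(2)]
   have mz: "-[PA] 0[PA] = 0[PA]" by(rule PA.minus_equality) simp_all
   show "lam 1 u (lam 1 u (pt x y)) = 0[PA]" unfolding lam_lam[OF h(1,1) xy(1) xc(2)] sym_odd[OF h(1)]
    using c xc by(cases k) (simp_all add: mz sg_def pt_neg PA.l_neg PA.r_neg)
  qed
 qed (use lam(1) gsc(1) that in blast)+
 define D where "D u = A u (pt 1[SA] 1[SA])" for u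
 have o: "pt 1[SA] 1[SA] <: PA" by simp
 show thesis proof (rule that[of D])
  show Da: "addmap SA PA D" by(rule addmapI) (use is_actD[OF A(2)] o in "simp_all add: D_def")
  show "D 1[SA] = pt 1[SA] 1[SA]" using is_actD(6)[OF A(2) o] by(simp add: D_def)
  show "D (io X *[SA] u) = lam p X (D u)" if "X : hp L p" "u <: SA" for p X u
   using that is_actD(5)[OF A(2) _ that(2) o, of "io X"] A(3)[OF that(1)] is_actD(2)[OF A(2) that(2) o] by(simp add: D_def hpc)
  show g: "D (kp a *[SA] u) = gsc a (D u)" if "a <: K" "u <: SA" for a u
   using that is_actD(5)[OF A(2) _ that(2) o, of "kp a"] A(4)[OF that(1)] is_actD(2)[OF A(2) that(2) o] by(simp add: D_def)
  show "D (kp a) = pt (kp a) 1[SA]" if "a <: K" for a using that A(4)[OF that o] by(simp add: D_def gsc(2))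
 qed
qed

text \<open>Multiplicativity follows by induction on the first factor from lam X (z z') = (lam X z)
  z'. The recursion D (X u) = lam X (D u) is kept next to existence and uniqueness because later
  computations with the coproduct rest on it.\<close>

lemma coprod_ex1:
 defines "P == %D. D : superalg_hom K SA PA & (ALL X:car L. D (io X) = pt (io X) 1[SA] +[PA] pt 1[SA] (io X))"
 shows "EX D. P D & (ALL p X u. X : hp L p --> u <: SA --> D (io X *[SA] u) = lam p X (D u)) & (ALL D'. P D' --> D' = D)"
proof -
 note hc = S.Q.hpc
 obtain D where D: "addmap SA PA D" "D 1[SA] = pt 1[SA] 1[SA]"
  "!!p X u. X : hp L p ==> u <: SA ==> D (io X *[SA] u) = lam p X (D u)"
  "!!a u. a <: K ==> u <: SA ==> D (kp a *[SA] u) = gsc a (D u)"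
  "!!a. a <: K ==> D (kp a) = pt (kp a) 1[SA]" using ex_coprod by blast
 note Dc = amD1[OF D(1)]
 let ?D = "restrict D (car SA)"
 have rs: "D (u *[SA] kp a) = D u .[PA] a" if ua: "u <: SA" "a <: K" for u a using ua(1) proof (induction rule: S.Q_ind)
  case (scal b)
  thus ?case using ua(2) pt_bal[of "kp b" "1[SA]" a] D(5)[OF K.m_closed[OF scal ua(2)]] by(simp add: D(5) pt_rs(2) S.qscal_mult)
 next
  case (mult X y)
  have "D (io X *[SA] (y *[SA] kp a)) = D (io X *[SA] y) .[PA] a" using mult(1) proof (induction rule: hom_ind)
   case (hom p X)
   have "lam p X (z .[PA] a) = lam p X z .[PA] a" if z: "z <: PA" for z
    by(rule P_eqI[OF am_o[OF pt_rs(1)[OF ua(2)] lam(1)[OF hom]] am_o[OF lam(1)[OF hom] pt_rs(1)[OF ua(2)]] _ z])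
     (use ua(2) hc hpc[OF hom] am_zn(3)[OF PA_ab PA_ab pt_rs(1)[OF ua(2)]]
      in "simp add: lam(2)[OF hom] pt_rs(2) amD2[OF pt_rs(1)] S.Q.m_assoc")
   thus ?case using mult(2,3) ua(2) by(simp add: D(3)[OF hom] Dc)
  next
   case (add X Y)
   thus ?case using mult(2) ua(2) amD2[OF pt_rs(1)[OF ua(2)]] by(simp add: S.qin_add S.Q.l_distr amD2[OF D(1)] Dc)
  qed
  thus ?case using mult ua(2) by(simp add: S.Q.m_assoc)
 next
  case (add x y)
  thus ?case using ua(2) amD2[OF pt_rs(1)[OF ua(2)]] by(simp add: S.Q.l_distr amD2[OF D(1)] Dc)
 qed
 have DX: "D (io X) = pt (io X) 1[SA] +[PA] pt 1[SA] (io X)" if "X <: L" for X using that proof (induction rule: hom_ind)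
  case (hom p X)
  thus ?case using D(3)[OF hom S.Q.one_closed] hpc[OF hom] lam(2)[OF hom S.Q_one_hp S.Q.one_closed] by(simp add: D(2))
 qed (simp add: S.qin_add amD2[OF D(1)] pt_add_left pt_add_right PA.a_ac)
 have mult: "D (x *[SA] y) = D x *[PA] D y" if xy: "x <: SA" "y <: SA" for x y using xy(1) proof (induction rule: S.Q_ind)
  case (scal a)
  have "gsc a z = pt (kp a) 1[SA] *[PA] z" if "z <: PA" for z by(rule P_eqI[OF gsc(1)[OF scal] PA_mult_right _ that])
    (use scal hc in "simp_all add: gsc(2) pt_mult[OF _ S.Q_one_hp]")
  thus ?case using scal xy by(simp add: D(4,5) Dc)
 next
  case (mult X x)
  have "D (io X *[SA] (x *[SA] y)) = D (io X *[SA] x) *[PA] D y" using mult(1) proof (induction rule: hom_ind)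
   case (hom p X)
   note Xc = hpc[OF hom]
   have "lam p X (z *[PA] z') = lam p X z *[PA] z'" if z: "z <: PA" "z' <: PA" for z z'
   proof (rule P_eqI[OF am_o[OF PA_mult_left[OF z(2)] lam(1)[OF hom]] am_o[OF lam(1)[OF hom] PA_mult_left[OF z(2)]] _ z(1)])
    fix i j v w assume vw: "v : hp SA i" "w : hp SA j"
    note vc = hc[OF vw(1)] hc[OF vw(2)]
    have pv: "pt v w <: PA" "lam p X (pt v w) <: PA" using vc lam_closed[OF hom] by simp_all
    show "lam p X (pt v w *[PA] z') = lam p X (pt v w) *[PA] z'"
    proof (rule P_eqI[OF am_o[OF PA_mult_right[OF pv(1)] lam(1)[OF hom]] PA_mult_right[OF pv(2)] _ z(2)])
     fix i' j' v' w' assume vw': "v' : hp SA i'" "w' : hp SA j'"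
     note vc' = hc[OF vw'(1)] hc[OF vw'(2)]
     have ptc: "pt v' w' <: PA" using vc' by simp
     have s: "sg PA k z *[PA] pt v' w' = sg PA k (z *[PA] pt v' w')" if "z <: PA" for k z
      using am_zn(3)[OF PA_ab PA_ab PA_mult_left[OF ptc] that] .
     show "lam p X (pt v w *[PA] pt v' w') = lam p X (pt v w) *[PA] pt v' w'"
      using vc vc' Xc am_zn(3)[OF PA_ab PA_ab lam(1)[OF hom]]
       lam(2)[OF hom S.Q_hp_mult[OF vw(1) vw'(1)], of "w *[SA] w'"]
       pt_mult[OF _ S.Q_hp_mult[OF S.qin_hp[OF hom] vw(2)] vw'(1), of v w']
      by(simp add: pt_mult[OF _ vw(2) vw'(1)] lam(2)[OF hom vw(1)] amD2[OF PA_mult_left[OF ptc]]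
        s S.Q.m_assoc PA.sg_sg PA.sg_add bit_poly)
    qed
   qed
   thus ?case using mult(2,3) xy by(simp add: D(3)[OF hom] Dc)
  next
   case (add X Y)
   thus ?case using mult(2) xy by(simp add: S.qin_add S.Q.l_distr amD2[OF D(1)] amD2[OF PA_mult_left] Dc)
  qed
  thus ?case using mult xy by(simp add: S.Q.m_assoc)
 next
  case (add x x')
  thus ?case using xy by(simp add: S.Q.l_distr amD2[OF D(1)] amD2[OF PA_mult_left] Dc)
 qed
 have par: "D u : hp PA i" if "u : hp SA i" for u i using that proof (induction rule: S.Q_hp_ind)
  case (zero i)
  thus ?case using am_zn(1)[OF S.Q.abx PA_ab D(1)] by(simp add: PA_hpart_zero)
 next
  case (scal j a)
  thus ?case using PA_hp_pt[OF S.qscal_hp[OF scal] S.Q_one_hp] by(simp add: D(5) K.hpc)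
 next
  case (mult p X j y)
  have "lam p X z : hp PA (p + j)" if "z : hp PA j" for z using that proof (induction rule: P_hp_ind)
   case zero
   thus ?case using am_zn(1)[OF PA_ab PA_ab lam(1)[OF mult(1)]] by(simp add: PA_hpart_zero)
  next
   case (pt i k v w)
   have "pt (io X *[SA] v) w : hp PA (p + j)" "pt v (io X *[SA] w) : hp PA (p + j)"
    using PA_hp_pt[OF S.Q_hp_mult[OF S.qin_hp[OF mult(1)] pt(1)] pt(2)]
     PA_hp_pt[OF pt(1) S.Q_hp_mult[OF S.qin_hp[OF mult(1)] pt(2)]] pt(3) by(auto simp: algebra_simps)
   thus ?case using lam(2)[OF mult(1) pt(1) hc[OF pt(2)]] by(simp add: PA_hp_add PA_hpart_sg)
  qed (simp add: amD2[OF lam(1)[OF mult(1)]] PA_hp_add)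
  thus ?case using mult hc by(simp add: D(3))
 qed (simp add: amD2[OF D(1)] PA_hp_add)
 have "P ?D" unfolding P_def superalg_hom_def proof (intro conjI CollectI ballI)
  show "?D : Hom K SA PA" by(rule HomI) (simp_all add: Dc amD2[OF D(1)] rs S.Q_rs)
  show "?D : ring_hom SA PA" by(rule ring_hom_memI) (simp_all add: Dc amD2[OF D(1)] mult D(2) PA_one)
  show "preserves_parity SA PA ?D" unfolding preserves_parity_def using par hc by auto
 qed (simp add: DX)
 moreover have "D' = ?D" if D': "P D'" for D' proof -
  have h: "D' : Hom K SA PA" "D' : ring_hom SA PA" "!!X. X <: L ==> D' (io X) = D (io X)"
   using D' DX unfolding P_def superalg_hom_def by auto
  have "D' u = D u" if "u <: SA" for u using that proof (induction rule: S.Q_ind)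
   case (scal a)
   have "D' (1[SA] .[SA] a) = D 1[SA] .[PA] a"
    using HomD(5)[OF h(1) S.Q.one_closed scal] ring_homD(3)[OF h(2)] by(simp add: D(2) PA_one)
   also have "... = D (kp a)" using rs[OF S.Q.one_closed scal] scal by simp
   finally show ?case using scal by(simp add: S.Q_rs)
  qed (use h(3) in "simp_all add: ring_homD(4,5)[OF h(2)] mult amD2[OF D(1)]")
  thus ?thesis using HomD(3)[OF h(1)] by(intro extensionalityI[of _ "car SA"]) auto
 qed
 moreover have "ALL p X u. X : hp L p --> u <: SA --> ?D (io X *[SA] u) = lam p X (?D u)" by(simp add: D(3) hpc)
 ultimately show ?thesis by blast
qed

abbreviation "\<Delta> == sym_coprod K L"

lemma coprod: shows coprod_hom: "\<Delta> : superalg_hom K SA PA"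
  and coprod_in: "!!p X u. X : hp L p ==> u <: SA ==> \<Delta> (io X *[SA] u) = lam p X (\<Delta> u)"
proof -
 obtain D where D: "D : superalg_hom K SA PA & (ALL X:car L. D (io X) = pt (io X) 1[SA] +[PA] pt 1[SA] (io X))"
  "ALL p X u. X : hp L p --> u <: SA --> D (io X *[SA] u) = lam p X (D u)"
  "ALL D'. D' : superalg_hom K SA PA & (ALL X:car L. D' (io X) = pt (io X) 1[SA] +[PA] pt 1[SA] (io X)) --> D' = D"
  using coprod_ex1 by blast
 have "\<Delta> = D" unfolding sym_coprod_def Let_def by(rule the_equality) (use D(1,3) in blast)+
 thus "\<Delta> : superalg_hom K SA PA"
  "!!p X u. X : hp L p ==> u <: SA ==> \<Delta> (io X *[SA] u) = lam p X (\<Delta> u)" using D by blast+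
qed

lemma coprod_Hom: "\<Delta> : Hom K SA PA" using coprod_hom by(simp add: superalg_hom_def)

lemma coprod_one: "\<Delta> 1[SA] = pt 1[SA] 1[SA]" using coprod_hom by(simp add: superalg_hom_def ring_hom_def PA_one)

lemma coprod_hpart: "u : hp SA i ==> \<Delta> u : hp PA i" using coprod_hom by(auto simp: superalg_hom_def preserves_parity_def)

end

section \<open>Convolution of maps on S(g) and its Leibniz rule\<close>

section \<open>Convolution\<close>

text \<open>Even pairings balanced over \<open>K\<close>; the instances are the bracket of g and the
  product of S(g).\<close>

definition bil :: "'k sring => ('k, 'a, 'r) smod_scheme => ('k, 'b, 's) smod_scheme => ('k, 'c, 't) smod_scheme =>
  ('a => 'b => 'c) => bool" where "bil K M1 M2 N b \<longleftrightarrow> smodule K M1 & smodule K M2 & smodule K N &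
  (ALL y:car M2. addmap M1 N (%x. b x y)) & (ALL x:car M1. addmap M2 N (b x)) &
  (ALL x:car M1. ALL y:car M2. ALL a:car K. b (x .[M1] a) y = b x (lsmult K M2 a y) &
    b x (y .[M2] a) = b x y .[N] a) &
  (ALL i j. ALL x:hp M1 i. ALL y:hp M2 j. b x y : hp N (i + j))"

lemma bilD: assumes "bil K M1 M2 N b" shows "smodule K M1" "smodule K M2" "smodule K N"
  "y <: M2 ==> addmap M1 N (%x. b x y)" "x <: M1 ==> addmap M2 N (b x)"
  "x <: M1 ==> y <: M2 ==> b x y <: N"
  "x <: M1 ==> y <: M2 ==> a <: K ==> b (x .[M1] a) y = b x (lsmult K M2 a y)"
  "x <: M1 ==> y <: M2 ==> a <: K ==> b x (y .[M2] a) = b x y .[N] a"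
  "x : hp M1 i ==> y : hp M2 j ==> b x y : hp N (i + j)" using assms by(auto simp: bil_def addmap_def)

lemma bil_sg: assumes "bil K M1 M2 N b" "x <: M1" "y <: M2"
 shows "b x (sg M2 k y) = sg N k (b x y)" "b (sg M1 k x) y = sg N k (b x y)"
proof -
 interpret M1: smodule K M1 by(rule bilD(1)[OF assms(1)])
 interpret M2: smodule K M2 by(rule bilD(2)[OF assms(1)])
 interpret N: smodule K N by(rule bilD(3)[OF assms(1)])
 show "b x (sg M2 k y) = sg N k (b x y)" "b (sg M1 k x) y = sg N k (b x y)"
  using am_zn(3)[OF M2.abx N.abx bilD(5)[OF assms(1,2)] assms(3)]
   am_zn(3)[OF M1.abx N.abx bilD(4)[OF assms(1,3)] assms(2)] by simp_all
qed

context lsa begin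

text \<open>For a formal function on g, whose Taylor coefficients are the values on monomials, this
  is the derivative in the direction X; the value at 1 is the value at the origin.\<close>

definition "dl X F = (\<lambda>u\<in>car SA. F (io X *[SA] u))"

lemma dl_app [simp]: "u <: SA ==> dl X F u = F (io X *[SA] u)" by(simp add: dl_def)

definition "lin2 N k F l G = (\<lambda>u\<in>car SA. sg N k (F u) +[N] sg N l (G u))"

definition "lc N I c G = (\<lambda>u\<in>car SA. \<Oplus>\<^bsub>N\<^esub>i\<in>I. G i u .[N] c i)"

lemma dl_hHom: assumes X: "X : hp L p" and F: "F : hHom K SA N d" shows "dl X F : hHom K SA N (d + p)"
proof (rule hHomI, rule HomI)
 note Xc = hpc[OF X]
 show "dl X F (x .[SA] a) = dl X F x .[N] a" if "x <: SA" "a <: K" for x a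
  using that Xc hHom_rs[OF F, of "io X *[SA] x" a] by(simp add: S.Q_rs S.Q.m_assoc)
 show "dl X F x : hp N (d + p + i)" if "x : hp SA i" for i x
  using hHomD(2)[OF F S.Q_hp_mult[OF S.qin_hp[OF X] that]] S.Q.hpc[OF that] by(simp add: add.assoc)
qed (use F hpc[OF X] hHom_c[OF F] hHom_add[OF F] in "simp_all add: S.Q.r_distr", simp add: dl_def)

lemma lin2_hHom: assumes N: "smodule K N" and F: "F : hHom K SA N d" and G: "G : hHom K SA N d"
 shows "lin2 N k F l G : hHom K SA N d"
proof -
 interpret N: smodule K N by fact
 show ?thesis proof (rule hHomI, rule HomI)
  show "lin2 N k F l G x : hp N (d + i)" if "x : hp SA i" for i x
   using hHomD(2)[OF F that] hHomD(2)[OF G that] S.Q.hpc[OF that] by(simp add: lin2_def N.hp_add N.hp_sg)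
  show "lin2 N k F l G (x +[SA] y) = lin2 N k F l G x +[N] lin2 N k F l G y" if "x <: SA" "y <: SA" for x y
   using that hHom_c[OF F] hHom_c[OF G] by(simp add: lin2_def hHom_add[OF F] hHom_add[OF G] N.sg_add N.a_ac)
 qed (use hHom_c[OF F] hHom_c[OF G] hHom_rs[OF F] hHom_rs[OF G] S.Q.rsc in
   "simp_all add: lin2_def N.rsmult_add_left N.rs_sg del: S.Q_rs")
qed

text \<open>Multiplying values by c on the right is right linear because even scalars are central;
  hence the requirement that the coefficients lie in \<open>hp K 0\<close>.\<close>

lemma lc_hHom:
 assumes N: "smodule K N" and I: "finite I" and c: "!!i. i : I ==> c i : hp K 0" and G: "!!i. i : I ==> G i : hHom K SA N d"
 shows "lc N I c G : hHom K SA N d"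
proof -
 interpret N: smodule K N by fact
 note cc = K.hpc[OF c]
 note Gc = hHom_c[OF G]
 have cl: "G i x .[N] c i <: N" if "x <: SA" "i : I" for x i using that by(intro N.rsc Gc cc)
 show ?thesis proof (rule hHomI, rule HomI)
  show "lc N I c G x : hp N (d + i)" if x: "x : hp SA i" for i x unfolding lc_def restrict_apply'[OF S.Q.hpc[OF x]]
   using N.rsmult_hpart[OF hHomD(2)[OF G x] c] by(intro N.hp_fs I) fastforce
  show "lc N I c G x <: N" if "x <: SA" for x using cl that by(auto simp: lc_def intro!: N.finsum_closed)
  show "lc N I c G (x +[SA] y) = lc N I c G x +[N] lc N I c G y" if xy: "x <: SA" "y <: SA" for x y proof -
   have "(\<Oplus>\<^bsub>N\<^esub>i\<in>I. G i (x +[SA] y) .[N] c i) = (\<Oplus>\<^bsub>N\<^esub>i\<in>I. G i x .[N] c i +[N] G i y .[N] c i)"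
    using cl xy by(intro N.finsum_cong') (simp_all add: hHom_add[OF G] N.rsmult_add_left Gc cc)
   thus ?thesis using cl xy by(simp add: lc_def N.finsum_addf)
  qed
  show "lc N I c G (x .[SA] a) = lc N I c G x .[N] a" if xa: "x <: SA" "a <: K" for x a proof -
   have "addmap N N (%y. y .[N] a)" by(rule addmapI) (simp_all add: xa N.rsc N.rsmult_add_left)
   from am_fs[OF N.abx N.abx this, of "%i. G i x .[N] c i" I]
   have "lc N I c G x .[N] a = (\<Oplus>\<^bsub>N\<^esub>i\<in>I. (G i x .[N] c i) .[N] a)" using cl xa by(simp add: lc_def)
   also have "... = (\<Oplus>\<^bsub>N\<^esub>i\<in>I. G i (x .[SA] a) .[N] c i)"
    using xa cl S.Q.rsc[OF xa] K.supercomm[OF c K.hcomp_h] proof (intro N.finsum_cong')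
    fix i assume i: "i : I"
    have "c i *[K] a = a *[K] c i" using xa(2) proof (induction rule: K.hom_ind)
     case (hom l a) thus ?case using K.supercomm[OF c[OF i] hom] by simp
    qed (use cc[OF i] in "simp add: K.l_distr K.r_distr")
    thus "(G i x .[N] c i) .[N] a = G i (x .[SA] a) .[N] c i"
     using xa i cc Gc by(simp add: hHom_rs[OF G] N.rsmult_assoc[symmetric])
   qed auto
   finally show ?thesis using S.Q.rsc[OF xa] by(simp add: lc_def)
  qed
 qed (simp add: lc_def)
qed

lemma ex_cv: assumes b: "bil K M1 M2 N b" and F: "F : hHom K SA M1 d" and G: "G : hHom K SA M2 e"
 obtains H where "addmap PA N H" "!!i v w. v : hp SA i ==> w <: SA ==> H (pt v w) = sg N (e * i) (b (F v) (G w))"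
proof -
 interpret M1: smodule K M1 by(rule bilD(1)[OF b])
 interpret M2: smodule K M2 by(rule bilD(2)[OF b])
 interpret N: smodule K N by(rule bilD(3)[OF b])
 note hc = S.Q.hpc
 note Fc = hHom_c[OF F] and Gc = hHom_c[OF G]
 note bc = bilD(6)[OF b]
 obtain H where H: "addmap PA N H" "!!i j v w. v : hp SA i ==> w : hp SA j ==> H (pt v w) = sg N (e * i) (b (F v) (G w))"
 proof (rule P_lift_hom[OF N.abx, of "%i j v w. sg N (e * i) (b (F v) (G w))"])
  fix i j l v w a assume h: "v : hp SA i" "w : hp SA j" "a : hp K l"
  note c = hc[OF h(1)] hc[OF h(2)] K.hpc[OF h(3)]
  have "F (v *[SA] kp a) = F v .[M1] a" using c hHom_rs[OF F c(1,3)] by(simp add: S.Q_rs)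
  moreover have "G (kp a *[SA] w) = sg M2 (e * l) (lsmult K M2 a (G w))"
   using hHom_ls[OF S.Q.smodule_axioms M2.smodule_axioms G h(3) c(2)] c by(simp add: S.Q_ls)
  ultimately show "sg N (e * (i + l)) (b (F (v *[SA] kp a)) (G w)) = sg N (e * i) (b (F v) (G (kp a *[SA] w)))"
   using c Fc Gc by(simp add: bilD(7)[OF b] bil_sg[OF b] bc N.sg_sg distrib_left)
 qed (use hc Fc Gc bc amD2[OF bilD(4)[OF b]] amD2[OF bilD(5)[OF b]] that in
  "simp_all add: hHom_add[OF F] hHom_add[OF G] N.sg_add")
 show thesis proof (rule that[OF H(1)])
  fix i v w assume v: "v : hp SA i" and w: "w <: SA"
  show "H (pt v w) = sg N (e * i) (b (F v) (G w))" using w proof (induction rule: S.Q.hom_ind)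
   case (add x y)
   thus ?case using hc[OF v] Fc Gc bc amD2[OF bilD(5)[OF b]] by(simp add: pt_add_right amD2[OF H(1)] hHom_add[OF G] N.sg_add)
  qed (rule H(2)[OF v])
 qed
qed

text \<open>The pairing b composed with F tensor G, before the coproduct is applied;
  \<open>e\<close> stands for the parity of G and produces the exchange sign.\<close>

definition "cv N b e F G = (SOME H. addmap PA N H &
  (ALL i. ALL v:hp SA i. ALL w:car SA. H (pt v w) = sg N (e * i) (b (F v) (G w))))"

lemma cv: assumes b: "bil K M1 M2 N b" and F: "F : hHom K SA M1 d" and G: "G : hHom K SA M2 e" shows "addmap PA N (cv N b e F G)"
  "v : hp SA i ==> w <: SA ==> cv N b e F G (pt v w) = sg N (e * i) (b (F v) (G w))"
proof -
 obtain H where "addmap PA N H" "!!i v w. v : hp SA i ==> w <: SA ==> H (pt v w) = sg N (e * i) (b (F v) (G w))"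
  using ex_cv[OF assms] by blast
 hence "EX H. addmap PA N H & (ALL i. ALL v:hp SA i. ALL w:car SA. H (pt v w) = sg N (e * i) (b (F v) (G w)))" by blast
 hence "addmap PA N (cv N b e F G) & (ALL i. ALL v:hp SA i. ALL w:car SA. cv N b e F G (pt v w) = sg N (e * i) (b (F v) (G w)))"
  unfolding cv_def by(rule someI_ex)
 thus "addmap PA N (cv N b e F G)"
  "v : hp SA i ==> w <: SA ==> cv N b e F G (pt v w) = sg N (e * i) (b (F v) (G w))" by blast+
qed

definition "conv N b e F G = (\<lambda>u\<in>car SA. cv N b e F G (\<Delta> u))"

lemma coprod_c: "u <: SA ==> \<Delta> u <: PA" by(rule HomD(2)[OF coprod_Hom])

lemma conv_eqI: assumes b: "bil K M1 M2 N b" and F: "F : hHom K SA M1 d" and G: "G : hHom K SA M2 e"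
  and f: "addmap PA N f" "!!i j v w. v : hp SA i ==> w : hp SA j ==> f (pt v w) = sg N (e * i) (b (F v) (G w))" and u: "u <: SA"
 shows "conv N b e F G u = f (\<Delta> u)" using P_eqI[OF cv(1)[OF b F G] f(1) _ coprod_c[OF u]] u cv(2)[OF b F G] f(2) S.Q.hpc
 by(simp add: conv_def)

lemma conv_one: assumes b: "bil K M1 M2 N b" and F: "F : hHom K SA M1 d" and G: "G : hHom K SA M2 e"
 shows "conv N b e F G 1[SA] = b (F 1[SA]) (G 1[SA])"
proof -
 interpret N: smodule K N by(rule bilD(3)[OF b])
 show ?thesis using cv(2)[OF b F G S.Q_one_hp S.Q.one_closed] by(simp add: conv_def coprod_one)
qed

lemma conv_hHom: assumes b: "bil K M1 M2 N b" and F: "F : hHom K SA M1 d" and G: "G : hHom K SA M2 e"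
 shows "conv N b e F G : hHom K SA N (d + e)"
proof (rule hHomI, rule HomI)
 interpret M1: smodule K M1 by(rule bilD(1)[OF b])
 interpret M2: smodule K M2 by(rule bilD(2)[OF b])
 interpret N: smodule K N by(rule bilD(3)[OF b])
 note hc = S.Q.hpc
 note Fc = hHom_c[OF F] and Gc = hHom_c[OF G]
 note cva = cv(1)[OF b F G]
 show "conv N b e F G (u .[SA] a) = conv N b e F G u .[N] a" if ua: "u <: SA" "a <: K" for u a proof -
  have na: "addmap N N (%y. y .[N] a)" by(rule addmapI) (simp_all add: ua N.rsc N.rsmult_add_left)
  have "cv N b e F G (z .[PA] a) = cv N b e F G z .[N] a" if z: "z <: PA" for z
  proof (rule P_eqI[OF am_o[OF pt_rs(1)[OF ua(2)] cva] am_o[OF cva na] _ z])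
   fix i j v w assume vw: "v : hp SA i" "w : hp SA j"
   note c = hc[OF vw(1)] hc[OF vw(2)]
   have "G (w *[SA] kp a) = G w .[M2] a" using hHom_rs[OF G c(2) ua(2)] c ua by(simp add: S.Q_rs)
   thus "cv N b e F G (pt v w .[PA] a) = cv N b e F G (pt v w) .[N] a"
    using c ua Fc Gc by(simp add: pt_rs(2) cv(2)[OF b F G vw(1)] bilD(8)[OF b] bilD(6)[OF b] N.rs_sg)
  qed
  thus ?thesis using ua S.Q.rsc[OF ua] HomD(5)[OF coprod_Hom ua] coprod_c[OF ua(1)] by(simp add: conv_def)
 qed
 show "conv N b e F G u : hp N (d + e + k)" if u: "u : hp SA k" for k u proof -
  have "cv N b e F G z : hp N (d + e + k)" if "z : hp PA k" for z using that proof (induction rule: P_hp_ind)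
   case zero
   thus ?case using am_zn(1)[OF PA_ab N.abx cva] by simp
  next
   case (pt i j v w)
   thus ?case using bilD(9)[OF b hHomD(2)[OF F pt(1)] hHomD(2)[OF G pt(2)]] hc[OF pt(2)]
    by(simp add: cv(2)[OF b F G pt(1)] N.hp_sg pt(3)[symmetric] algebra_simps)
  qed (simp add: amD2[OF cva] N.hp_add)
  thus ?thesis using coprod_hpart[OF u] hc[OF u] by(simp add: conv_def)
 qed
qed (use addmapD[OF cv(1)[OF assms]] coprod_c HomD(4)[OF coprod_Hom] in "simp_all add: conv_def")

text \<open>The coproduct turns multiplication by X into \<open>lam\<close>, whose two terms put X
  on one factor or the other. Together with \<open>conv_one\<close> this rule determines a
  convolution on all monomials, so identities follow by induction on \<open>hmono\<close>, with the
  maps generalised because their derivatives take their place.\<close>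

lemma conv_in: assumes b: "bil K M1 M2 N b" and F: "F : hHom K SA M1 d" and G: "G : hHom K SA M2 e"
  and X: "X : hp L p" and u: "u <: SA"
 shows "conv N b e F G (io X *[SA] u) = sg N (p * e) (conv N b e (dl X F) G u) +[N] conv N b (e + p) F (dl X G) u"
proof -
 interpret N: smodule K N by(rule bilD(3)[OF b])
 note hc = S.Q.hpc
 note Fc = hHom_c[OF F] and Gc = hHom_c[OF G]
 note Xc = hpc[OF X]
 note F' = dl_hHom[OF X F] and G' = dl_hHom[OF X G]
 note a1 = cv(1)[OF b F G] cv(1)[OF b F' G] cv(1)[OF b F G']
 have "cv N b e F G (lam p X z) = sg N (p * e) (cv N b e (dl X F) G z) +[N] cv N b (e + p) F (dl X G) z" if z: "z <: PA" for z
 proof (rule P_eqI[OF am_o[OF lam(1)[OF X] a1(1)] N.am_add[OF am_o[OF a1(2) N.sg_am] a1(3)] _ z])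
  fix i j v w assume vw: "v : hp SA i" "w : hp SA j"
  note c = hc[OF vw(1)] hc[OF vw(2)]
  have "cv N b e F G (lam p X (pt v w)) = cv N b e F G (pt (io X *[SA] v) w) +[N] sg N (p * i) (cv N b e F G (pt v (io X *[SA] w)))"
   using c Xc am_zn(3)[OF PA_ab N.abx a1(1)] by(simp add: lam(2)[OF X vw(1)] amD2[OF a1(1)])
  thus "cv N b e F G (lam p X (pt v w)) = sg N (p * e) (cv N b e (dl X F) G (pt v w)) +[N] cv N b (e + p) F (dl X G) (pt v w)"
   using c Xc Fc Gc bilD(6)[OF b] cv(2)[OF b F G S.Q_hp_mult[OF S.qin_hp[OF X] vw(1)] c(2)]
   by(simp add: cv(2)[OF b F G vw(1)] cv(2)[OF b F' G vw(1)] cv(2)[OF b F G' vw(1)] N.sg_sg algebra_simps)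
 qed
 thus ?thesis using u Xc coprod_c by(simp add: conv_def coprod_in[OF X])
qed

lemma conv_lin2_right:
 assumes b: "bil K M1 M2 N b" and F: "F : hHom K SA M1 d" and G: "G : hHom K SA M2 e" and H: "H : hHom K SA M2 e" and u: "u <: SA"
 shows "conv N b e F (lin2 M2 k G l H) u = sg N k (conv N b e F G u) +[N] sg N l (conv N b e F H u)"
proof -
 interpret M2: smodule K M2 by(rule bilD(2)[OF b])
 interpret N: smodule K N by(rule bilD(3)[OF b])
 note hc = S.Q.hpc
 note Fc = hHom_c[OF F] and Gc = hHom_c[OF G] and Hc = hHom_c[OF H]
 note a = N.am_add[OF am_o[OF cv(1)[OF b F G] N.sg_am[of k]] am_o[OF cv(1)[OF b F H] N.sg_am[of l]]]
 from conv_eqI[OF b F lin2_hHom[OF M2.smodule_axioms G H] a _ u] show ?thesis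
  using u hc Fc Gc Hc bilD(6)[OF b] amD2[OF bilD(5)[OF b]]
  by(simp add: conv_def lin2_def cv(2)[OF b F G] cv(2)[OF b F H] bil_sg[OF b] N.sg_sg N.sg_add add.commute)
qed

lemma conv_lin2_left:
 assumes b: "bil K M1 M2 N b" and F: "F : hHom K SA M1 d" and G: "G : hHom K SA M1 d" and H: "H : hHom K SA M2 e" and u: "u <: SA"
 shows "conv N b e (lin2 M1 k F l G) H u = sg N k (conv N b e F H u) +[N] sg N l (conv N b e G H u)"
proof -
 interpret M1: smodule K M1 by(rule bilD(1)[OF b])
 interpret N: smodule K N by(rule bilD(3)[OF b])
 note hc = S.Q.hpc
 note Fc = hHom_c[OF F] and Gc = hHom_c[OF G] and Hc = hHom_c[OF H]
 note a = N.am_add[OF am_o[OF cv(1)[OF b F H] N.sg_am[of k]] am_o[OF cv(1)[OF b G H] N.sg_am[of l]]]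
 from conv_eqI[OF b lin2_hHom[OF M1.smodule_axioms F G] H a _ u] show ?thesis
  using u hc Fc Gc Hc bilD(6)[OF b] amD2[OF bilD(4)[OF b]]
  by(simp add: conv_def lin2_def cv(2)[OF b F H] cv(2)[OF b G H] bil_sg[OF b] N.sg_sg N.sg_add add.commute)
qed

lemma conv_lc_right: assumes b: "bil K M1 M2 N b" and F: "F : hHom K SA M1 d" and I: "finite I"
  and c: "!!i. i : I ==> c i : hp K 0" and G: "!!i. i : I ==> G i : hHom K SA M2 e"
 shows "conv N b e F (lc M2 I c G) = lc N I c (%i. conv N b e F (G i))"
proof -
 interpret M2: smodule K M2 by(rule bilD(2)[OF b])
 interpret N: smodule K N by(rule bilD(3)[OF b])
 note hc = S.Q.hpc
 note cc = K.hpc[OF c]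
 note Fc = hHom_c[OF F] and Gc = hHom_c[OF G]
 let ?f = "%z. \<Oplus>\<^bsub>N\<^esub>i\<in>I. cv N b e F (G i) z .[N] c i"
 have a: "addmap PA N ?f" proof (rule N.am_fs_fun[OF I])
  fix i assume i: "i : I"
  have "addmap N N (%y. y .[N] c i)" by(rule addmapI) (simp_all add: cc[OF i] N.rsc N.rsmult_add_left)
  from am_o[OF cv(1)[OF b F G[OF i]] this]
  show "addmap PA N (%z. cv N b e F (G i) z .[N] c i)" .
 qed
 have "conv N b e F (lc M2 I c G) u = ?f (\<Delta> u)" if u: "u <: SA" for u
 proof (rule conv_eqI[OF b F lc_hHom[OF M2.smodule_axioms I c G] a _ u])
  fix i j v w assume vw: "v : hp SA i" "w : hp SA j"
  note vc = hc[OF vw(1)] hc[OF vw(2)]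
  have cl: "(%n. G n w .[M2] c n) : I \<rightarrow> car M2" using cc Gc vc by(auto intro: M2.rsc)
  have bcl: "(%n. b (F v) (G n w) .[N] c n) : I \<rightarrow> car N" using cc Gc Fc vc bilD(6)[OF b] by(auto intro!: N.rsc)
  have "sg N (e * i) (b (F v) (lc M2 I c G w)) = sg N (e * i) (\<Oplus>\<^bsub>N\<^esub>n\<in>I. b (F v) (G n w .[M2] c n))"
   using vc am_fs[OF M2.abx N.abx bilD(5)[OF b Fc[OF vc(1)]] cl] by(simp add: lc_def)
  also have "(\<Oplus>\<^bsub>N\<^esub>n\<in>I. b (F v) (G n w .[M2] c n)) = (\<Oplus>\<^bsub>N\<^esub>n\<in>I. b (F v) (G n w) .[N] c n)"
   using bcl by(intro N.finsum_cong') (simp_all add: bilD(8)[OF b] Fc Gc vc cc)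
  also have "sg N (e * i) ... = (\<Oplus>\<^bsub>N\<^esub>n\<in>I. sg N (e * i) (b (F v) (G n w) .[N] c n))"
   by(rule am_fs[OF N.abx N.abx N.sg_am bcl])
  also have "... = ?f (pt v w)" using bcl cc Gc Fc vc bilD(6)[OF b]
   by(intro N.finsum_cong') (auto simp: cv(2)[OF b F G vw(1)] N.rs_sg intro!: N.sg_c N.rsc)
  finally show "?f (pt v w) = sg N (e * i) (b (F v) (lc M2 I c G w))" by simp
 qed
 thus ?thesis by(intro extensionalityI[of _ "car SA"]) (simp_all add: lc_def conv_def)
qed


abbreviation "C == hHom K SA L"
abbreviation "EE == hHom K SA SA"
abbreviation "brc == conv L br"
text \<open>For a formal vector field Y on g, composing F with \<open>Ph e Y\<close> differentiates
  F along Y.\<close>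

definition "Ph e Y = conv SA (\<otimes>\<^bsub>SA\<^esub>) e (\<lambda>u\<in>car SA. u) (\<lambda>u\<in>car SA. io (Y u))"

lemma bil_br: "bil K L L L br" unfolding bil_def
 using smodule_axioms by(auto simp: addmap_def lbr_closed lbr_add_left lbr_add_right lbr_balanced lbr_rsmult lbr_hpart)

lemma bil_mult: "bil K SA SA SA (\<otimes>\<^bsub>SA\<^esub>)" unfolding bil_def using S.Q.smodule_axioms
 by(simp add: addmap_def S.Q.l_distr S.Q.r_distr S.Q_rs S.Q_ls S.Q.m_assoc S.Q_hp_mult Pi_iff)

lemma idS: "(\<lambda>u\<in>car SA. u) : EE 0" by(rule hHomI, rule HomI) (simp_all add: S.Q.rsc S.Q.hpc del: S.Q_rs)

lemma in_comp: assumes Y: "Y : C e" shows "(\<lambda>u\<in>car SA. io (Y u)) : EE e" by(rule hHomI, rule HomI)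
  (use hHom_c[OF Y] hHom_add[OF Y] hHom_rs[OF Y] S.Q.rsc S.Q.hpc hHomD(2)[OF Y] in
   \<open>simp_all add: S.qin_add S.qin_rs S.Q_rs[of "io _"] S.qin_hp\<close>)

lemma Ph_hHom: "Y : C e ==> Ph e Y : EE e" unfolding Ph_def using conv_hHom[OF bil_mult idS in_comp[of Y e]] by simp

lemma Ph_one: "Y : C e ==> Ph e Y 1[SA] = io (Y 1[SA])"
 unfolding Ph_def using conv_one[OF bil_mult idS in_comp[of Y e]] hHom_c[of Y K SA L e] by simp

text \<open>The supercommutator of \<open>Ph e Y\<close> with multiplication by X is an operator of
  the same kind, for the derivative of Y in the direction X. Inductions on \<open>Ph\<close> run on
  this recursion.\<close>

lemma Ph_in: assumes Y: "Y : C e" and X: "X : hp L p" and u: "u <: SA"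
 shows "Ph e Y (io X *[SA] u) = sg SA (p * e) (io X *[SA] Ph e Y u) +[SA] Ph (e + p) (dl X Y) u"
proof -
 let ?id = "\<lambda>u\<in>car SA. u" and ?Y = "\<lambda>u\<in>car SA. io (Y u)"
 note Xc = hpc[OF X] and Y' = in_comp[OF Y]
 note cva = cv[OF bil_mult idS Y']
 have m: "addmap SA SA (%x. io X *[SA] x)" by(rule addmapI) (simp_all add: Xc S.Q.r_distr)
 have "conv SA (\<otimes>\<^bsub>SA\<^esub>) e (dl X ?id) ?Y u = io X *[SA] cv SA (\<otimes>\<^bsub>SA\<^esub>) e ?id ?Y (\<Delta> u)"
  by(rule conv_eqI[OF bil_mult dl_hHom[OF X idS] Y' am_o[OF cva(1) m] _ u])
   (use Xc S.Q.hpc hHom_c[OF Y] in "simp add: cva(2) S.Q.m_assoc sg_def S.Q.r_minus")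
 moreover have "dl X ?Y = (\<lambda>u\<in>car SA. io (dl X Y u))"
  unfolding dl_def[of X "\<lambda>u\<in>car SA. io (Y u)"] using Xc by(intro restrict_ext) simp
 ultimately show ?thesis unfolding Ph_def conv_in[OF bil_mult idS Y' X u] using u by(simp add: conv_def)
qed

end

section \<open>Lie and vector field identities in the convolution algebra\<close>

context lsa begin

definition "cmp F P = (\<lambda>u\<in>car SA. F (P u))"

lemma cmp_app [simp]: "u <: SA ==> cmp F P u = F (P u)" by(simp add: cmp_def)

lemma cmp_hHom: assumes F: "F : hHom K SA N d" and P: "P : EE y" shows "cmp F P : hHom K SA N (d + y)" by(rule hHomI, rule HomI)
  (use hHom_c[OF P] hHom_add[OF P] hHom_rs[OF P] S.Q.rsc S.Q.hpc hHomD(2)[OF F hHomD(2)[OF P]]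
   hHom_c[OF F] hHom_add[OF F] hHom_rs[OF F] in "simp_all add: add.assoc cmp_def del: S.Q_rs")

lemma dl_conv: assumes "bil K M1 M2 N b" "F : hHom K SA M1 d" "G : hHom K SA M2 e" "X : hp L p"
 shows "dl X (conv N b e F G) = lin2 N (p * e) (conv N b e (dl X F) G) 0 (conv N b (e + p) F (dl X G))"
proof -
 interpret N: smodule K N by(rule bilD(3)[OF assms(1)])
 show ?thesis unfolding lin2_def dl_def[of X "conv N b e F G"] by(rule restrict_ext) (simp add: conv_in[OF assms])
qed

lemma Ph_lin2: assumes Y: "Y : C e" and Z: "Z : C e" and u: "u <: SA"
 shows "Ph e (lin2 L k Y l Z) u = sg SA k (Ph e Y u) +[SA] sg SA l (Ph e Z u)"
proof -
 have "(\<lambda>u\<in>car SA. io (lin2 L k Y l Z u)) = lin2 SA k (\<lambda>u\<in>car SA. io (Y u)) l (\<lambda>u\<in>car SA. io (Z u))"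
  unfolding lin2_def using hHom_c[OF Y] hHom_c[OF Z] by(intro restrict_ext) (simp add: S.qin_add S.qin_neg)
 thus ?thesis unfolding Ph_def using conv_lin2_right[OF bil_mult idS in_comp[OF Y] in_comp[OF Z] u] by simp
qed

lemma dl_cmp_Ph: assumes F: "F : C d" and Y: "Y : C y" and X: "X : hp L q" and m: "m <: SA"
 shows "F (Ph y Y (io X *[SA] m)) = sg L (q * y) (dl X F (Ph y Y m)) \<oplus> F (Ph (y + q) (dl X Y) m)"
 using hHom_c[OF Ph_hHom[OF Y] m] hHom_c[OF Ph_hHom[OF dl_hHom[OF X Y]] m] hpc[OF X]
  am_zn(3)[OF S.Q.abx abx hHom_am[OF F]] by(simp add: Ph_in[OF Y X m] hHom_add[OF F])

lemma brc_hHom: "F : C d ==> G : C e ==> brc e F G : C (d + e)" by(rule conv_hHom[OF bil_br])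

lemma brc_c: "F : C d ==> G : C e ==> u <: SA ==> brc e F G u <: L" using hHom_c[OF brc_hHom] .

lemma one_hp: assumes F: "F : hHom K SA N d" shows "F 1[SA] : hp N d" using hHomD(2)[OF F S.Q_one_hp] by simp

text \<open>At 1 this is skew symmetry in g. Removing a letter gives two terms on either side, which
  the induction hypothesis matches crosswise.\<close>

lemma brc_skew_mono: assumes "S.hmono n p m" "F : C d" "G : C e" shows "brc e F G m = sg L (d * e + 1) (brc d G F m)" using assms
proof (induction arbitrary: d e F G rule: S.hmono.induct)
 case one
 thus ?case using lbr_skew[OF one_hp[OF one(1)] one_hp[OF one(2)]] lbr_closed[OF hHom_c[OF one(2)] hHom_c[OF one(1)]]
  by(simp add: conv_one[OF bil_br one] conv_one[OF bil_br one(2,1)] sg_neg)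
next
 case (mult n p m X q)
 note m = S.hmonoc[OF mult(1)]
 note F = mult(4) and G = mult(5)
 note F' = dl_hHom[OF mult(2) F] and G' = dl_hHom[OF mult(2) G]
 show ?case unfolding conv_in[OF bil_br F G mult(2) m] conv_in[OF bil_br G F mult(2) m] mult(3)[OF F' G] mult(3)[OF F G']
  using brc_c[OF G F' m] brc_c[OF G' F m] by(cases q; cases d; cases e) (simp_all add: sg_def minus_add a_ac)
qed

text \<open>At 1 this is the Jacobi identity of g. Removing a letter X expands each of the three
  double brackets into three terms, according to the factor that X differentiates, and the induction
  hypothesis is used once for each of these factors.\<close>

lemma brc_jacobi_mono: assumes "S.hmono n p m" "Z : C z" "F : C d" "G : C e"
 shows "brc (d + e) Z (brc e F G) m = brc e (brc d Z F) G m \<oplus> sg L (z * d) (brc (z + e) F (brc e Z G) m)" using assms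
proof (induction arbitrary: z d e Z F G rule: S.hmono.induct)
 case one
 note h = one_hp[OF one(1)] one_hp[OF one(2)] one_hp[OF one(3)]
 note c = h[THEN hpc]
 show ?case
  using lbr_jacobi[OF h(1,2) c(3)] c lbr_closed mn_cancel[of "br (Z 1[SA]) (br (F 1[SA]) (G 1[SA]))" "sg L (z * d) (br (F 1[SA]) (br (Z 1[SA]) (G 1[SA])))"]
  by(simp add: conv_one[OF bil_br _ brc_hHom] conv_one[OF bil_br brc_hHom] conv_one[OF bil_br] one)
   (simp add: conv_one[OF bil_br one(1) brc_hHom[OF one(2,3)]] conv_one[OF bil_br one(2,3)]
    conv_one[OF bil_br brc_hHom[OF one(1,2)] one(3)] conv_one[OF bil_br one(1,2)]
    conv_one[OF bil_br one(2) brc_hHom[OF one(1,3)]] conv_one[OF bil_br one(1,3)])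
next
 case (mult n p m X q)
 note m = S.hmonoc[OF mult(1)]
 note Z = mult(4) and F = mult(5) and G = mult(6) and X = mult(2)
 note Z' = dl_hHom[OF X Z] and F' = dl_hHom[OF X F] and G' = dl_hHom[OF X G]
 have F'G: "brc e (dl X F) G : C (d + (e + q))" and FG': "brc (e + q) F (dl X G) : C (d + (e + q))"
  using brc_hHom[OF F' G] brc_hHom[OF F G'] by(simp_all add: add_ac)
 have Z'F: "brc d (dl X Z) F : C (z + (d + q))" and ZF': "brc (d + q) Z (dl X F) : C (z + (d + q))"
  using brc_hHom[OF Z' F] brc_hHom[OF Z F'] by(simp_all add: add_ac)
 have Z'G: "brc e (dl X Z) G : C (z + (e + q))" and ZG': "brc (e + q) Z (dl X G) : C (z + (e + q))"
  using brc_hHom[OF Z' G] brc_hHom[OF Z G'] by(simp_all add: add_ac)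
 have l: "brc (d + e) Z (brc e F G) (io X *[SA] m) = sg L (q * (d + e)) (brc (d + e) (dl X Z) (brc e F G) m) \<oplus>
   (sg L (q * e) (brc (d + (e + q)) Z (brc e (dl X F) G) m) \<oplus> brc (d + (e + q)) Z (brc (e + q) F (dl X G)) m)"
  using conv_in[OF bil_br Z brc_hHom[OF F G] X m] conv_lin2_right[OF bil_br Z F'G FG' m, of "q * e" 0] brc_c[OF Z FG' m]
  unfolding dl_conv[OF bil_br F G X] by(simp add: add_ac)
 have r1: "brc e (brc d Z F) G (io X *[SA] m) =
   sg L (q * e) (sg L (q * d) (brc e (brc d (dl X Z) F) G m) \<oplus> brc e (brc (d + q) Z (dl X F)) G m) \<oplus>
   brc (e + q) (brc d Z F) (dl X G) m"
  using conv_in[OF bil_br brc_hHom[OF Z F] G X m] conv_lin2_left[OF bil_br Z'F ZF' G m, of "q * d" 0] brc_c[OF ZF' G m]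
  unfolding dl_conv[OF bil_br Z F X] by simp
 have r2: "brc (z + e) F (brc e Z G) (io X *[SA] m) = sg L (q * (z + e)) (brc (z + e) (dl X F) (brc e Z G) m) \<oplus>
   (sg L (q * e) (brc (z + (e + q)) F (brc e (dl X Z) G) m) \<oplus> brc (z + (e + q)) F (brc (e + q) Z (dl X G)) m)"
  using conv_in[OF bil_br F brc_hHom[OF Z G] X m] conv_lin2_right[OF bil_br F Z'G ZG' m, of "q * e" 0] brc_c[OF F ZG' m]
  unfolding dl_conv[OF bil_br Z G X] by(simp add: add_ac)
 have i1: "brc (d + e) (dl X Z) (brc e F G) m =
   brc e (brc d (dl X Z) F) G m \<oplus> sg L ((z + q) * d) (brc (z + (e + q)) F (brc e (dl X Z) G) m)"
  using mult(3)[OF Z' F G] by(simp add: add_ac)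
 have i2: "brc (d + (e + q)) Z (brc e (dl X F) G) m =
   brc e (brc (d + q) Z (dl X F)) G m \<oplus> sg L (z * (d + q)) (brc (z + e) (dl X F) (brc e Z G) m)"
  using mult(3)[OF Z F' G] by(simp add: add_ac)
 have i3: "brc (d + (e + q)) Z (brc (e + q) F (dl X G)) m =
   brc (e + q) (brc d Z F) (dl X G) m \<oplus> sg L (z * d) (brc (z + (e + q)) F (brc (e + q) Z (dl X G)) m)"
  using mult(3)[OF Z F G'] by(simp add: add_ac)
 show ?case unfolding l r1 r2 i1 i2 i3 using brc_c[OF Z'F G m] brc_c[OF ZF' G m] brc_c[OF brc_hHom[OF Z F] G' m]
   brc_c[OF F' brc_hHom[OF Z G] m] brc_c[OF F Z'G m] brc_c[OF F ZG' m]
  by(cases q; cases d; cases e; cases z) (simp_all add: sg_def minus_add a_ac)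
qed

text \<open>The product rule for differentiating a bracket along Y. At 1 the operator
  \<open>Ph y Y\<close> yields the single letter Y(1), so the claim there is one application of the
  Leibniz rule.\<close>

lemma brc_Ph_mono: assumes "S.hmono n p m" "F : C d" "G : C e" "Y : C y"
 shows "brc e F G (Ph y Y m) = sg L (y * e) (brc e (cmp F (Ph y Y)) G m) \<oplus> brc (e + y) F (cmp G (Ph y Y)) m" using assms
proof (induction arbitrary: d e y F G Y rule: S.hmono.induct)
 case one
 note F = one(1) and G = one(2) and Y = one(3)
 note X = one_hp[OF Y]
 note P = Ph_hHom[OF Y]
 show ?case using conv_in[OF bil_br F G X S.Q.one_closed] hpc[OF X]
  by(simp add: Ph_one[OF Y] conv_one[OF bil_br dl_hHom[OF X F] G] conv_one[OF bil_br F dl_hHom[OF X G]]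
    conv_one[OF bil_br cmp_hHom[OF F P] G] conv_one[OF bil_br F cmp_hHom[OF G P]])
next
 case (mult n p m X q)
 note m = S.hmonoc[OF mult(1)]
 note F = mult(4) and G = mult(5) and Y = mult(6) and X = mult(2)
 note F' = dl_hHom[OF X F] and G' = dl_hHom[OF X G] and Y' = dl_hHom[OF X Y]
 note P = Ph_hHom[OF Y] and P' = Ph_hHom[OF Y']
 have dlc: "dl X (cmp F (Ph y Y)) = lin2 L (q * y) (cmp (dl X F) (Ph y Y)) 0 (cmp F (Ph (y + q) (dl X Y)))" if "F : C d" for F d
  unfolding lin2_def dl_def[of X "cmp F (Ph y Y)"] by(rule restrict_ext) (use hpc[OF X] hHom_c[OF P] in "simp add: dl_cmp_Ph[OF that Y X]")
 have FP1: "cmp (dl X F) (Ph y Y) : C (d + (y + q))" and FP2: "cmp F (Ph (y + q) (dl X Y)) : C (d + (y + q))"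
  and GP1: "cmp (dl X G) (Ph y Y) : C (e + (y + q))" and GP2: "cmp G (Ph (y + q) (dl X Y)) : C (e + (y + q))"
  using cmp_hHom[OF F' P] cmp_hHom[OF F P'] cmp_hHom[OF G' P] cmp_hHom[OF G P'] by(simp_all add: add_ac)
 note FP = cmp_hHom[OF F P] and GP = cmp_hHom[OF G P]
 have l: "brc e F G (Ph y Y (io X *[SA] m)) =
   sg L (q * y) (sg L (q * e) (brc e (dl X F) G (Ph y Y m)) \<oplus> brc (e + q) F (dl X G) (Ph y Y m)) \<oplus> brc e F G (Ph (y + q) (dl X Y) m)"
  using dl_cmp_Ph[OF brc_hHom[OF F G] Y X m] hHom_c[OF P m] by(simp add: conv_in[OF bil_br F G X])
 have r1: "brc e (cmp F (Ph y Y)) G (io X *[SA] m) =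
   sg L (q * e) (sg L (q * y) (brc e (cmp (dl X F) (Ph y Y)) G m) \<oplus> brc e (cmp F (Ph (y + q) (dl X Y))) G m)
   \<oplus> brc (e + q) (cmp F (Ph y Y)) (dl X G) m"
  using conv_in[OF bil_br FP G X m] conv_lin2_left[OF bil_br FP1 FP2 G m, of "q * y" 0] brc_c[OF FP2 G m]
  unfolding dlc[OF F] by simp
 have r2: "brc (e + y) F (cmp G (Ph y Y)) (io X *[SA] m) = sg L (q * (e + y)) (brc (e + y) (dl X F) (cmp G (Ph y Y)) m)
   \<oplus> (sg L (q * y) (brc (e + (y + q)) F (cmp (dl X G) (Ph y Y)) m) \<oplus> brc (e + (y + q)) F (cmp G (Ph (y + q) (dl X Y))) m)"
  using conv_in[OF bil_br F GP X m] conv_lin2_right[OF bil_br F GP1 GP2 m, of "q * y" 0] brc_c[OF F GP2 m]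
  unfolding dlc[OF G] by(simp add: add_ac)
 have i2: "brc (e + q) F (dl X G) (Ph y Y m) = sg L (y * (e + q)) (brc (e + q) (cmp F (Ph y Y)) (dl X G) m) \<oplus> brc (e + (y + q)) F (cmp (dl X G) (Ph y Y)) m"
  using mult(3)[OF F G' Y] by(simp add: add_ac)
 show ?case unfolding l r1 r2 mult(3)[OF F' G Y] i2 mult(3)[OF F G Y'] using brc_c[OF FP1 G m] brc_c[OF FP2 G m] brc_c[OF FP G' m]
   brc_c[OF F' GP m] brc_c[OF F GP1 m] brc_c[OF F GP2 m]
  by(cases q; cases d; cases e; cases y) (simp_all add: sg_def minus_add a_ac)
qed

text \<open>The Lie bracket of the vector fields Y and Z; the summand 1 in the exponent is the minus
  sign of the commutator.\<close>

definition "cmt y z Y Z = lin2 L 0 (cmp Y (Ph z Z)) (y * z + 1) (cmp Z (Ph y Y))"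

lemma cmt_hHom: "Y : C y ==> Z : C z ==> cmt y z Y Z : C (y + z)" unfolding cmt_def
 by(rule lin2_hHom[OF smodule_axioms cmp_hHom[OF _ Ph_hHom]]) (auto simp: add.commute[of y z] intro: cmp_hHom[OF _ Ph_hHom])

text \<open>At 1 the products of Y(1) and Z(1) cancel by commutativity of S(g), which leaves the two
  first order terms of \<open>cmt\<close>. The induction step needs that \<open>cmt\<close> obeys a
  Leibniz rule itself; this is \<open>dR\<close>.\<close>

lemma Ph_comm_mono: assumes "S.hmono n p m" "Y : C y" "Z : C z"
 shows "Ph y Y (Ph z Z m) = sg SA (y * z) (Ph z Z (Ph y Y m)) +[SA] Ph (y + z) (cmt y z Y Z) m" using assms
proof (induction arbitrary: y z Y Z rule: S.hmono.induct)
 case one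
 note Y = one(1) and Z = one(2)
 note y1 = one_hp[OF Y] and z1 = one_hp[OF Z]
 note c = hpc[OF y1] hpc[OF z1]
 have yc: "Y (io (Z 1[SA])) <: L" "Z (io (Y 1[SA])) <: L" using hHom_c[OF Y] hHom_c[OF Z] c by simp_all
 have e: "Ph y Y (io (Z 1[SA])) = sg SA (z * y) (io (Z 1[SA]) *[SA] io (Y 1[SA])) +[SA] io (Y (io (Z 1[SA])))"
  using Ph_in[OF Y z1 S.Q.one_closed] c by(simp add: Ph_one[OF Y] Ph_one[OF dl_hHom[OF z1 Y]])
 have f: "Ph z Z (io (Y 1[SA])) = sg SA (y * z) (io (Y 1[SA]) *[SA] io (Z 1[SA])) +[SA] io (Z (io (Y 1[SA])))"
  using Ph_in[OF Z y1 S.Q.one_closed] c by(simp add: Ph_one[OF Z] Ph_one[OF dl_hHom[OF y1 Z]])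
 have g: "Ph (y + z) (cmt y z Y Z) 1[SA] = io (Y (io (Z 1[SA]))) +[SA] sg SA (y * z + 1) (io (Z (io (Y 1[SA]))))"
  using yc by(simp add: Ph_one[OF cmt_hHom[OF Y Z]]) (simp add: cmt_def lin2_def Ph_one[OF Y] Ph_one[OF Z] S.qin_add S.qin_neg)
 have "Ph y Y (Ph z Z 1[SA]) = io (Y 1[SA]) *[SA] io (Z 1[SA]) +[SA] io (Y (io (Z 1[SA])))"
  using c by(simp add: Ph_one[OF Z] e sym_comm[OF z1 y1] S.Q.sg_sg mult.commute)
 also have "... = io (Y 1[SA]) *[SA] io (Z 1[SA]) +[SA] (sg SA (y * z) (io (Z (io (Y 1[SA])))) +[SA] -[SA] sg SA (y * z) (io (Z (io (Y 1[SA]))))) +[SA] io (Y (io (Z 1[SA])))"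
  using c yc by(simp add: S.Q.r_neg)
 also have "... = sg SA (y * z) (Ph z Z (Ph y Y 1[SA])) +[SA] Ph (y + z) (cmt y z Y Z) 1[SA]"
  using c yc by(simp add: Ph_one[OF Y] f g S.Q.sg_sg S.Q.sg_add S.Q.sg_neg S.Q.a_ac)
 finally show ?case .
next
 case (mult n p m X q)
 note m = S.hmonoc[OF mult(1)]
 note Y = mult(4) and Z = mult(5) and X = mult(2)
 note Y' = dl_hHom[OF X Y] and Z' = dl_hHom[OF X Z]
 note PY = Ph_hHom[OF Y] and PZ = Ph_hHom[OF Z] and PY' = Ph_hHom[OF Y'] and PZ' = Ph_hHom[OF Z']
 have Xc: "io X <: SA" using hpc[OF X] by simp
 note cl = hHom_c[OF PY] hHom_c[OF PZ] hHom_c[OF PY'] hHom_c[OF PZ']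
 have R1: "cmt (y + q) z (dl X Y) Z : C (y + (z + q))" and R2: "cmt y (z + q) Y (dl X Z) : C (y + (z + q))"
  using cmt_hHom[OF Y' Z] cmt_hHom[OF Y Z'] by(simp_all add: add_ac)
 note R = cmt_hHom[OF Y Z]
 have dR: "dl X (cmt y z Y Z) = lin2 L (q * z) (cmt (y + q) z (dl X Y) Z) 0 (cmt y (z + q) Y (dl X Z))"
  unfolding lin2_def dl_def[of X "cmt y z Y Z"] proof (rule restrict_ext)
  fix u assume u: "u <: SA"
  have c: "Y (io X *[SA] Ph z Z u) <: L" "Y (Ph (z + q) (dl X Z) u) <: L"
   "Z (io X *[SA] Ph y Y u) <: L" "Z (Ph (y + q) (dl X Y) u) <: L" using hHom_c[OF Y] hHom_c[OF Z] cl[OF u] Xc by simp_all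
  show "cmt y z Y Z (io X *[SA] u) = sg L (q * z) (cmt (y + q) z (dl X Y) Z u) \<oplus> sg L 0 (cmt y (z + q) Y (dl X Z) u)"
   using u Xc cl[OF u] c dl_cmp_Ph[OF Y Z X u] dl_cmp_Ph[OF Z Y X u] unfolding cmt_def lin2_def
   by(cases q; cases y; cases z) (simp_all add: sg_def minus_add a_ac)
 qed
 have two: "Ph a A (Ph b B (io X *[SA] m)) = sg SA (q * b) (sg SA (q * a) (io X *[SA] Ph a A (Ph b B m)) +[SA] Ph (a + q) (dl X A) (Ph b B m)) +[SA] Ph a A (Ph (b + q) (dl X B) m)"
  if A: "A : C a" and B: "B : C b" for a A b B using Xc hHom_c[OF Ph_hHom[OF B] m] hHom_c[OF Ph_hHom[OF dl_hHom[OF X B]] m]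
   am_zn(3)[OF S.Q.abx S.Q.abx hHom_am[OF Ph_hHom[OF A]]] by(simp add: Ph_in[OF B X m] hHom_add[OF Ph_hHom[OF A]] Ph_in[OF A X])
 have rR: "Ph (y + z) (cmt y z Y Z) (io X *[SA] m) = sg SA (q * (y + z)) (io X *[SA] Ph (y + z) (cmt y z Y Z) m) +[SA]
  (sg SA (q * z) (Ph (y + (z + q)) (cmt (y + q) z (dl X Y) Z) m) +[SA] Ph (y + (z + q)) (cmt y (z + q) Y (dl X Z)) m)"
  using Ph_in[OF R X m] Ph_lin2[OF R1 R2 m, of "q * z" 0] unfolding dR by(simp add: add_ac)
 have i1: "Ph (y + q) (dl X Y) (Ph z Z m) = sg SA ((y + q) * z) (Ph z Z (Ph (y + q) (dl X Y) m)) +[SA] Ph (y + (z + q)) (cmt (y + q) z (dl X Y) Z) m"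
  using mult(3)[OF Y' Z] by(simp add: add_ac)
 have i2: "Ph y Y (Ph (z + q) (dl X Z) m) = sg SA (y * (z + q)) (Ph (z + q) (dl X Z) (Ph y Y m)) +[SA] Ph (y + (z + q)) (cmt y (z + q) Y (dl X Z)) m"
  using mult(3)[OF Y Z'] by(simp add: add_ac)
 note A = cl(2)[OF cl(1)[OF m]] cl(2)[OF cl(3)[OF m]] cl(4)[OF cl(1)[OF m]] hHom_c[OF Ph_hHom[OF R] m]
  hHom_c[OF Ph_hHom[OF R1] m] hHom_c[OF Ph_hHom[OF R2] m]
 show ?case unfolding two[OF Y Z] two[OF Z Y] rR i1 i2 mult(3)[OF Y Z] using A Xc by(cases q; cases y; cases z)
   (simp_all add: sg_def S.Q.minus_add S.Q.a_ac S.Q.r_distr S.Q.r_minus)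
qed

lemma C_ext: assumes "F : hHom K SA N d" "G : hHom K SA N e" "abelian_group N" "!!n p m. S.hmono n p m ==> F m = G m"
 shows "F = G" using S.Q_Hom_eqI[OF hHomD(1)[OF assms(1)] hHomD(1)[OF assms(2)] assms(3,4)] .

end

unbundle fps_syntax

section \<open>Functional equation and recursion of the coefficients of t/(e^t - 1)\<close>

section \<open>The coefficients\<close>

text \<open>e^t - 1 has order 1 and hence divides t as a power series, so the quotient behind
  \<open>todd_coeff\<close> is exact.\<close>

lemma todd_times: "(fps_X / (fps_exp 1 - 1) :: rat fps) * (fps_exp 1 - 1) = fps_X"
proof (rule dvd_div_mult_self)
 have "(fps_exp 1 - 1 :: rat fps) ~= 0" by(auto simp: fps_eq_iff intro!: exI[of _ 1])
 moreover have "subdegree (fps_exp 1 - 1 :: rat fps) <= 1" by(rule subdegree_leI) simp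
 ultimately show "(fps_exp 1 - 1 :: rat fps) dvd fps_X" by(subst fps_dvd_iff) auto
qed

abbreviation "todd_fps == (fps_X / (fps_exp 1 - 1) :: rat fps)"

text \<open>The recursion of the numbers B_k / k!, read off from the coefficient of t^(n+1) in
  c(t)(e^t - 1) = t.\<close>

lemma todd_rec: "(\<Sum>k\<le>n. td k / fact (Suc n - k)) = (if n = 0 then 1 else 0)"
proof -
 have "(\<Sum>k\<le>Suc n. td k * (fps_exp 1 - 1 :: rat fps) $ (Suc n - k)) = (todd_fps * (fps_exp 1 - 1)) $ Suc n"
  unfolding todd_coeff_def fps_mult_nth atLeast0AtMost ..
 also have "... = (if n = 0 then 1 else 0)" unfolding todd_times by(simp add: fps_X_def)
 finally show ?thesis by(simp add: Suc_diff_le)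
qed

text \<open>Power series in two variables are power series in "y" over power series in "x";
 \<open>fps_shift2 f\<close> is \<open>f(x + y)\<close>.\<close>

definition fps_shift2 :: "rat fps => rat fps fps" where
 "fps_shift2 f = Abs_fps (%q. Abs_fps (%p. of_nat ((p + q) choose p) * f $ (p + q)))"

definition fps_y :: "rat fps => rat fps fps" where
 "fps_y f = Abs_fps (%q. fps_const (f $ q))"

lemma fps_y_nth: "fps_y f $ q = fps_const (f $ q)" by(simp add: fps_y_def)

text \<open>The substitution of x + y is multiplicative; on coefficients this is Vandermonde's
  convolution of binomials.\<close>

lemma fps_shift2_mult: "fps_shift2 (f * g) = fps_shift2 f * fps_shift2 g"
proof (rule fps_ext, rule fps_ext)
 fix q p
 let ?h = "%j n. of_nat (n choose j) * of_nat ((p + q - n) choose (p - j)) * (f $ n * g $ (p + q - n)) :: rat"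
 have "(fps_shift2 f * fps_shift2 g) $ q $ p =
   (\<Sum>i\<le>q. \<Sum>j\<le>p. of_nat ((j + i) choose j) * f $ (j + i) * (of_nat (((p - j) + (q - i)) choose (p - j)) * g $ ((p - j) + (q - i))))"
  by(simp add: fps_mult_nth fps_shift2_def fps_sum_nth atLeast0AtMost)
 also have "... = (\<Sum>i\<le>q. \<Sum>j\<le>p. ?h j (j + i))" by(intro sum.cong refl) (auto simp: algebra_simps)
 also have "... = (\<Sum>j\<le>p. \<Sum>i\<le>q. ?h j (j + i))" by(rule sum.swap)
 also have "... = (\<Sum>j\<le>p. \<Sum>n\<le>p + q. ?h j n)" proof (rule sum.cong[OF refl])
  fix j assume j: "j : {..p}"
  have "(\<Sum>i\<le>q. ?h j (j + i)) = (\<Sum>n\<in>(%i. j + i) ` {..q}. ?h j n)" by(subst sum.reindex) auto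
  also have "... = (\<Sum>n\<le>p + q. ?h j n)" proof (rule sum.mono_neutral_left)
   show "ALL n:{..p + q} - (%i. j + i) ` {..q}. ?h j n = 0" proof
    fix n assume n: "n : {..p + q} - (%i. j + i) ` {..q}"
    \<comment> \<open>In the first case the binomial \<open>n choose j\<close> vanishes, in the
      second case the binomial with \<open>p - j\<close> does.\<close>
    have "n < j \<or> j + q < n" proof (rule ccontr)
     assume "~?thesis" hence "n = j + (n - j)" "n - j <= q" by auto
     thus False using n by blast
    qed
    thus "?h j n = 0" using n j by(auto simp: binomial_eq_0)
   qed
  qed (use j in auto)
  finally show "(\<Sum>i\<le>q. ?h j (j + i)) = (\<Sum>n\<le>p + q. ?h j n)" .
 qed
 also have "... = (\<Sum>n\<le>p + q. \<Sum>j\<le>p. ?h j n)" by(rule sum.swap)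
 also have "... = (\<Sum>n\<le>p + q. of_nat ((p + q) choose p) * (f $ n * g $ (p + q - n)))" proof (rule sum.cong[OF refl])
  fix n assume n: "n : {..p + q}"
  have "(\<Sum>j\<le>p. ?h j n) = of_nat (\<Sum>j\<le>p. (n choose j) * ((p + q - n) choose (p - j))) * (f $ n * g $ (p + q - n))"
   by(simp add: sum_distrib_right)
  thus "(\<Sum>j\<le>p. ?h j n) = of_nat ((p + q) choose p) * (f $ n * g $ (p + q - n))"
   using n vandermonde[of n "p + q - n" p] by simp
 qed
 also have "... = fps_shift2 (f * g) $ q $ p" by(simp add: fps_shift2_def fps_mult_nth sum_distrib_left atLeast0AtMost)
 finally show "fps_shift2 (f * g) $ q $ p = (fps_shift2 f * fps_shift2 g) $ q $ p" by simp
qed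

lemma fps_y_mult: "fps_y (f * g) = fps_y f * fps_y g"
proof (rule fps_ext, rule fps_ext)
 fix q p
 have "(\<Sum>i = 0..q. fps_const (f $ i) * fps_const (g $ (q - i))) $ p = fps_const (\<Sum>i = 0..q. f $ i * g $ (q - i)) $ p"
  by(simp add: fps_sum_nth sum.If_cases)
 thus "fps_y (f * g) $ q $ p = (fps_y f * fps_y g) $ q $ p" by(simp add: fps_y_def fps_mult_nth[of _ _ q])
qed

lemma fps_shift2_exp: "fps_shift2 (fps_exp 1) = fps_const (fps_exp 1) * fps_y (fps_exp 1)"
 by(rule fps_ext, rule fps_ext) (simp add: fps_shift2_def fps_y_def binomial_fact)

text \<open>Let u, v, w be e^x - 1, e^y - 1, e^(x+y) - 1. Replacing x by c(x)u and y by c(y)v turns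
  the left side into c(x)c(y)(c(x+y)w - c(x)u - c(y)v) by w = u + v + uv, and the last factor is x +
  y - x - y.\<close>

lemma todd_identity2:
 defines "x == fps_const fps_X" and "y == fps_X" and "c == todd_fps"
 shows "x * (fps_y c * (fps_shift2 c - fps_const c)) + y * (fps_const c * (fps_shift2 c - fps_y c)) + x * (y * fps_shift2 c) = 0"
proof -
 let ?u = "fps_const (fps_exp 1 - 1) :: rat fps fps" and ?v = "fps_y (fps_exp 1 - 1)" and ?w = "fps_shift2 (fps_exp 1 - 1)"
 have X: "fps_const c * ?u = x" unfolding x_def c_def fps_const_mult todd_times ..
 have Y: "fps_y c * ?v = y" unfolding y_def c_def fps_y_mult[symmetric] todd_times
  by(rule fps_ext) (simp add: fps_y_def fps_X_def)
 have Z: "fps_shift2 c * ?w = x + y" unfolding y_def x_def c_def fps_shift2_mult[symmetric] todd_times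
  by(rule fps_ext, rule fps_ext) (auto simp: fps_shift2_def fps_X_def)
 have one: "fps_shift2 1 = 1" "fps_y 1 = 1" by((rule fps_ext)+, simp add: fps_shift2_def fps_y_def)+
 have sub: "fps_shift2 (f - g) = fps_shift2 f - fps_shift2 g" "fps_y (f - g) = fps_y f - fps_y g" for f g
  by((rule fps_ext)+, simp add: fps_shift2_def fps_y_def algebra_simps)+
 have U: "fps_const (fps_exp 1) = ?u + 1" by(simp flip: fps_const_sub)
 have V: "fps_y (fps_exp 1) = ?v + 1" by(simp add: sub one)
 have "?w = (?u + 1) * (?v + 1) - 1" by(simp only: sub(1) one(1) fps_shift2_exp U[symmetric] V[symmetric])
 hence W: "?w = ?u + ?v + ?u * ?v" by(simp add: algebra_simps)
 have alg: "c' * u * (d * (f - c')) + d * v * (c' * (f - d)) + c' * u * (d * v * f) =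
   c' * d * (f * (u + v + u * v) - c' * u - d * v)" for c' d f u v :: "rat fps fps" by(simp add: algebra_simps)
 have "x * (fps_y c * (fps_shift2 c - fps_const c)) + y * (fps_const c * (fps_shift2 c - fps_y c)) + x * (y * fps_shift2 c) =
  fps_const c * fps_y c * (fps_shift2 c * (?u + ?v + ?u * ?v) - fps_const c * ?u - fps_y c * ?v)"
  unfolding X[symmetric] Y[symmetric] by(rule alg)
 also have "... = 0" unfolding W[symmetric] Z X Y by simp
 finally show ?thesis .
qed

text \<open>The coefficient of x^(p+1) y^(q+1) in the functional equation. Subtracting c(x) and c(y)
  there removes the boundary terms, which is why the sums stop at q and p.\<close>

lemma todd_identity:
 "(\<Sum>k\<le>q. td k * (of_nat ((p + Suc q - k) choose p) * td (p + Suc q - k))) +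
 (\<Sum>k\<le>p. td k * (of_nat ((q + Suc p - k) choose q) * td (q + Suc p - k))) +
 of_nat ((p + q) choose p) * td (p + q) = 0"
proof -
 let ?c = todd_fps
 have a: "(fps_const fps_X * (fps_y ?c * (fps_shift2 ?c - fps_const ?c))) $ Suc q $ Suc p =
   (\<Sum>k\<le>q. td k * (of_nat ((p + Suc q - k) choose p) * td (p + Suc q - k)))" proof -
  have "(fps_const fps_X * (fps_y ?c * (fps_shift2 ?c - fps_const ?c))) $ Suc q $ Suc p =
    (\<Sum>k\<le>Suc q. ?c $ k * ((fps_shift2 ?c - fps_const ?c) $ (Suc q - k) $ p))"
   by(simp add: fps_mult_nth[of "fps_y ?c"] fps_sum_nth fps_y_nth atLeast0AtMost)
  thus ?thesis by(simp add: fps_shift2_def todd_coeff_def Suc_diff_le)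
 qed
 have b: "(fps_X * (fps_const ?c * (fps_shift2 ?c - fps_y ?c))) $ Suc q $ Suc p =
   (\<Sum>k\<le>p. td k * (of_nat ((q + Suc p - k) choose q) * td (q + Suc p - k)))" proof -
  have "(fps_X * (fps_const ?c * (fps_shift2 ?c - fps_y ?c))) $ Suc q $ Suc p =
    (\<Sum>k\<le>Suc p. ?c $ k * ((fps_shift2 ?c - fps_y ?c) $ q $ (Suc p - k)))" by(simp add: fps_mult_nth[of ?c] atLeast0AtMost)
  also have "... = (\<Sum>k\<le>p. ?c $ k * ((fps_shift2 ?c - fps_y ?c) $ q $ (Suc p - k)))"
   by(simp add: fps_shift2_def fps_y_def)
  also have "... = (\<Sum>k\<le>p. td k * (of_nat ((q + Suc p - k) choose q) * td (q + Suc p - k)))"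
  proof (rule sum.cong[OF refl])
   fix k assume "k : {..p}"
   hence "Suc p - k + q = q + Suc p - k" "Suc p - k ~= 0" "q <= q + Suc p - k" "q + Suc p - k - q = Suc p - k" by auto
   thus "?c $ k * ((fps_shift2 ?c - fps_y ?c) $ q $ (Suc p - k)) = td k * (of_nat ((q + Suc p - k) choose q) * td (q + Suc p - k))"
    using binomial_symmetric[of q "q + Suc p - k"] by(simp add: fps_shift2_def fps_y_def todd_coeff_def)
  qed
  finally show ?thesis .
 qed
 have c: "(fps_const fps_X * (fps_X * fps_shift2 ?c)) $ Suc q $ Suc p = of_nat ((p + q) choose p) * td (p + q)"
  by(simp add: fps_shift2_def todd_coeff_def)
 show ?thesis
  using arg_cong[OF todd_identity2, of "%f. f $ Suc q $ Suc p"] unfolding a[symmetric] b[symmetric] c[symmetric] by simp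
qed

text \<open>Reindexed by the total degree r, in the form in which the coefficients \<open>EC\<close>
  meet it.\<close>

lemma todd_identity': assumes j: "j <= r"
 shows "(\<Sum>i\<le>r. if j <= i then td (Suc i) * td (r - i) * of_nat (Suc i choose j) else 0) +
  (\<Sum>i\<le>r. if r - j <= i then td (Suc i) * td (r - i) * of_nat (Suc i choose (r - j)) else 0) +
  td r * of_nat (r choose j) = 0"
proof -
 have *: "(\<Sum>i\<le>r. if j <= i then td (Suc i) * td (r - i) * of_nat (Suc i choose j) else 0) =
   (\<Sum>k\<le>r - j. td k * (of_nat ((j + Suc (r - j) - k) choose j) * td (j + Suc (r - j) - k)))" if j: "j <= r" for j proof -
  have "(\<Sum>i\<le>r. if j <= i then td (Suc i) * td (r - i) * of_nat (Suc i choose j) else 0) =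
   (\<Sum>i\<in>{j..r}. td (Suc i) * td (r - i) * of_nat (Suc i choose j))" by(rule sum.mono_neutral_cong_right) auto
  also have "... = (\<Sum>k\<le>r - j. td k * (of_nat ((j + Suc (r - j) - k) choose j) * td (j + Suc (r - j) - k)))"
   by(rule sum.reindex_bij_witness[of _ "%k. r - k" "%i. r - i"]) (use j in "auto simp: Suc_diff_le")
  finally show ?thesis .
 qed
 have "r - (r - j) = j" "j + (r - j) = r" using j by auto
 thus ?thesis
  unfolding *[OF j] *[OF diff_le_self] using todd_identity[of "r - j" j] by(simp add: mult.commute binomial_symmetric[OF j])
qed

section \<open>Rational numbers with invertible denominator inside \<open>K\<close>\<close>

context lsa begin

abbreviation "ki a == [(a::int)] \<cdot>\<^bsub>K\<^esub> 1[K]"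
abbreviation "\<rho> == of_rat_in K"

text \<open>On these rationals \<open>\<rho>\<close> is additive and multiplicative; elsewhere it
  takes the default value zero and no law is claimed.\<close>

definition "kgood q \<longleftrightarrow> ki (snd (quotient_of q)) : Units K"

lemma ki_c [simp]: "ki a <: K" by simp

lemma ki_add: "ki (a + b) = ki a +[K] ki b" by(simp add: K.add.int_pow_mult)

lemma ki_mult: "ki (a * b) = ki a *[K] ki b"
proof -
 have "ki a *[K] ki b = [b] \<cdot>\<^bsub>K\<^esub> ki a" using K.add_pow_rdistr_int[of "ki a" "1[K]" b] by simp
 also have "... = ki (a * b)" using K.add.int_pow_pow[of "1[K]" b a] by simp
 finally show ?thesis ..
qed

lemma ki_one: "ki 1 = 1[K]" using K.add.int_pow_1 by simp

lemma ki_comm: "x <: K ==> ki a *[K] x = x *[K] ki a"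
 using K.add_pow_ldistr_int[of "1[K]" x a] K.add_pow_rdistr_int[of x "1[K]" a] by simp


lemma ki_dvd_unit: assumes "ki (b * t) : Units K" shows "ki b : Units K"
proof -
 let ?i = "inv[K] (ki (b * t))"
 have i: "?i <: K" "ki (b * t) *[K] ?i = 1[K]" using assms by simp_all
 have 1: "ki b *[K] (ki t *[K] ?i) = 1[K]" using i by(simp add: ki_mult K.m_assoc)
 moreover have "(ki t *[K] ?i) *[K] ki b = 1[K]" using 1 i(1) by(simp add: ki_comm[of "ki t *[K] ?i" b])
 ultimately show ?thesis using i(1) unfolding Units_def by(auto intro!: bexI[of _ "ki t *[K] ?i"])
qed

lemma inv_ki_mult: assumes "ki b : Units K" "ki d : Units K" shows "inv[K] (ki (b * d)) = inv[K] (ki b) *[K] inv[K] (ki d)"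
proof -
 have c: "inv[K] (ki b) <: K" "inv[K] (ki d) <: K" using assms by simp_all
 have "ki (b * d) *[K] (inv[K] (ki b) *[K] inv[K] (ki d)) = (ki b *[K] inv[K] (ki b)) *[K] (ki d *[K] inv[K] (ki d))"
  using c ki_comm[OF c(1), of d] by(simp add: ki_mult K.m_assoc[symmetric] del: K.Units_r_inv)
   (simp add: K.m_assoc del: K.Units_r_inv)
 hence e: "ki (b * d) *[K] (inv[K] (ki b) *[K] inv[K] (ki d)) = 1[K]" using assms by simp
 thus ?thesis using c ki_comm[of "inv[K] (ki b) *[K] inv[K] (ki d)" "b * d"] by(intro K.inv_unique'[symmetric]) simp_all
qed

text \<open>The fraction need not be reduced: the reduced denominator divides \<open>b\<close> and
  is therefore a unit along with it.\<close>

lemma rho_eq: assumes b: "b > 0" "ki b : Units K" and q: "q = of_int a / of_int b"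
 shows "kgood q" "\<rho> q = ki a *[K] inv[K] (ki b)"
proof -
 obtain a' b' where q': "quotient_of q = (a', b')" by(metis surj_pair)
 have b': "b' > 0" "coprime a' b'" "q = of_int a' / of_int b'"
  using quotient_of_denom_pos[OF q'] quotient_of_coprime[OF q'] quotient_of_div[OF q'] by auto
 have "(of_int (a' * b) :: rat) = of_int (a * b')" using q b'(1,3) b(1) by(simp add: field_simps)
 hence e: "a' * b = a * b'" by(simp only: of_int_eq_iff)
 hence "b' dvd a' * b" by simp
 hence "b' dvd b" using b'(2) by(simp add: coprime_commute coprime_dvd_mult_right_iff)
 then obtain t where t: "b = b' * t" by blast
 hence a: "a = a' * t" using e b'(1) by(simp add: mult.assoc mult.commute[of t])
 have u: "ki b' : Units K" using b(2) unfolding t by(rule ki_dvd_unit)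
 have ut: "ki t : Units K" using b(2) unfolding t mult.commute[of b'] by(rule ki_dvd_unit)
 show "kgood q" by(simp add: kgood_def q' u)
 have "inv[K] (ki b) = inv[K] (ki t) *[K] inv[K] (ki b')" unfolding t mult.commute[of b'] by(rule inv_ki_mult[OF ut u])
 hence "ki a *[K] inv[K] (ki b) = ki a' *[K] (ki t *[K] inv[K] (ki t)) *[K] inv[K] (ki b')"
  using u ut unfolding a ki_mult by(simp add: K.m_assoc del: K.Units_r_inv)
 thus "\<rho> q = ki a *[K] inv[K] (ki b)" using u ut by(simp add: of_rat_in_def q')
qed

lemma kgood_cases: assumes "kgood q" obtains a b where "b > 0" "ki b : Units K" "q = of_int a / of_int b"
 using assms quotient_of_denom_pos[of q] quotient_of_div[of q] unfolding kgood_def by(metis prod.collapse)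

lemma ki_unit_mult: "ki a : Units K ==> ki b : Units K ==> ki (a * b) : Units K" by(simp add: ki_mult)

lemma rho_add: assumes "kgood q" "kgood r" shows "kgood (q + r)" "\<rho> (q + r) = \<rho> q +[K] \<rho> r"
proof -
 obtain a b c d where ab: "b > 0" "ki b : Units K" "q = of_int a / of_int b"
  and cd: "d > 0" "ki d : Units K" "r = of_int c / of_int d" using assms kgood_cases by metis
 have s: "q + r = of_int (a * d + c * b) / of_int (b * d)" using ab cd by(simp add: field_simps)
 have bd: "b * d > 0" "ki (b * d) : Units K" using ab cd by(simp_all add: ki_unit_mult)
 show "kgood (q + r)" by(rule rho_eq(1)[OF bd s])
 have v: "inv[K] (ki b) <: K" "inv[K] (ki d) <: K" using ab cd by simp_all
 have 1: "ki a *[K] ki d *[K] (inv[K] (ki b) *[K] inv[K] (ki d)) = ki a *[K] inv[K] (ki b) *[K] (ki d *[K] inv[K] (ki d))"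
  using v ki_comm[OF v(1), of d] by(simp add: K.m_assoc del: K.Units_r_inv) (simp add: K.m_assoc[symmetric] del: K.Units_r_inv)
 have 2: "ki c *[K] ki b *[K] (inv[K] (ki b) *[K] inv[K] (ki d)) = ki c *[K] (ki b *[K] inv[K] (ki b)) *[K] inv[K] (ki d)"
  using v by(simp add: K.m_assoc del: K.Units_r_inv)
 show "\<rho> (q + r) = \<rho> q +[K] \<rho> r"
  unfolding rho_eq(2)[OF bd s] rho_eq(2)[OF ab] rho_eq(2)[OF cd] inv_ki_mult[OF ab(2) cd(2)] ki_add
  using v ab cd 1 2 by(simp add: K.l_distr ki_mult[of a d] ki_mult[of c b])
qed

lemma rho_mult: assumes "kgood q" "kgood r" shows "kgood (q * r)" "\<rho> (q * r) = \<rho> q *[K] \<rho> r"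
proof -
 obtain a b c d where ab: "b > 0" "ki b : Units K" "q = of_int a / of_int b"
  and cd: "d > 0" "ki d : Units K" "r = of_int c / of_int d" using assms kgood_cases by metis
 have s: "q * r = of_int (a * c) / of_int (b * d)" using ab cd by(simp add: field_simps)
 have bd: "b * d > 0" "ki (b * d) : Units K" using ab cd by(simp_all add: ki_unit_mult)
 show "kgood (q * r)" by(rule rho_eq(1)[OF bd s])
 have v: "inv[K] (ki b) <: K" "inv[K] (ki d) <: K" using ab cd by simp_all
 have "ki a *[K] ki c *[K] (inv[K] (ki b) *[K] inv[K] (ki d)) = ki a *[K] (ki c *[K] inv[K] (ki b)) *[K] inv[K] (ki d)"
  using v by(simp add: K.m_assoc)
 also have "... = ki a *[K] inv[K] (ki b) *[K] (ki c *[K] inv[K] (ki d))"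
  unfolding ki_comm[OF v(1), of c] using v by(simp add: K.m_assoc)
 finally show "\<rho> (q * r) = \<rho> q *[K] \<rho> r"
  unfolding rho_eq(2)[OF bd s] rho_eq(2)[OF ab] rho_eq(2)[OF cd] inv_ki_mult[OF ab(2) cd(2)] ki_mult[of a c] .
qed

lemma rho_int: "kgood (of_int a)" "\<rho> (of_int a) = ki a"
proof -
 have u: "ki 1 : Units K" "of_int a = (of_int a / of_int 1 :: rat)" by(simp_all add: ki_one)
 show "kgood (of_int a)" "\<rho> (of_int a) = ki a" using rho_eq[OF _ u] K.inv_one by(simp_all add: ki_one)
qed

lemma rho_zero: "kgood 0" "\<rho> 0 = 0[K]" using rho_int[of 0] by(simp_all add: add_pow_def int_pow_def2)

lemma ki_hp: "ki a : hp K 0"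
proof -
 have n: "[(n::nat)] \<cdot>\<^bsub>K\<^esub> 1[K] : hp K 0" for n
  by(induction n) (simp_all add: K.add.nat_pow_Suc K.hp_add K.hpart_one)
 show ?thesis by(cases a rule: int_cases2) (use n in "simp_all add: K.add.int_pow_neg int_pow_int K.hp_neg add_pow_int_ge")
qed

text \<open>Since u and 1 are even, the even part of the inverse alone already multiplies u to 1, so
  it is the whole inverse.\<close>

lemma unit_even_inv: assumes u: "u : hp K 0" "u : Units K" shows "inv[K] u : hp K 0"
proof -
 note uc = K.hpc[OF u(1)]
 let ?v = "inv[K] u"
 have v: "?v <: K" "u *[K] ?v = 1[K]" "?v *[K] u = 1[K]" using u by simp_all
 let ?e = "hcomp K 0 ?v" and ?o = "hcomp K 1 ?v"
 have "u *[K] ?e : hp K 0" "u *[K] ?o : hp K (0 + 1)"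
  using K.hpart_mult[OF u(1) K.hcomp_h[OF v(1)], of 0] K.hpart_mult[OF u(1) K.hcomp_h[OF v(1)], of 1] by simp_all
 from K.hcomp_eq[OF this] have "hcomp K 0 (u *[K] ?e +[K] u *[K] ?o) = u *[K] ?e" .
 moreover have "u *[K] ?e +[K] u *[K] ?o = 1[K]" using uc v K.r_distr[of ?e ?o u] by(simp flip: K.hcomp_sum)
 ultimately have "u *[K] ?e = 1[K]" using K.hcomp_hom[OF K.hpart_one, of 0] by simp
 hence "?v *[K] (u *[K] ?e) = ?v" using v by simp
 hence "?e = ?v" using uc v by(simp add: K.m_assoc[symmetric])
 thus ?thesis using K.hcomp_h[OF v(1), of 0] by metis
qed

lemma rho_hp: "\<rho> q : hp K 0"
proof (cases "kgood q")
 case True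
 then obtain a b where ab: "b > 0" "ki b : Units K" "q = of_int a / of_int b" using kgood_cases by metis
 show ?thesis unfolding rho_eq(2)[OF ab] using K.hpart_mult[OF ki_hp unit_even_inv[OF ki_hp ab(2)]] by simp
next
 case False
 thus ?thesis by(simp add: of_rat_in_def kgood_def case_prod_unfold Let_def)
qed

lemma rho_closed [simp]: "\<rho> q <: K" using K.hpc[OF rho_hp] .

lemma rho_sum: assumes "finite I" "!!i. i : I ==> kgood (f i)"
 shows "kgood (\<Sum>i\<in>I. f i) & \<rho> (\<Sum>i\<in>I. f i) = (\<Oplus>\<^bsub>K\<^esub>i\<in>I. \<rho> (f i))" using assms
proof (induction I rule: finite_induct)
 case (insert x F)
 hence "(\<Oplus>\<^bsub>K\<^esub>i\<in>insert x F. \<rho> (f i)) = \<rho> (f x) +[K] (\<Oplus>\<^bsub>K\<^esub>i\<in>F. \<rho> (f i))"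
  by(intro K.finsum_insert) auto
 thus ?case using insert rho_add by simp
qed (simp add: rho_zero)

text \<open>By the recursion, c_n is an integral combination of 1 and the quotients c_k / (n + 1 -
  k)! with k < n, so only integers up to n + 1 have to be inverted.\<close>

lemma kgood_todd: assumes "!!m::nat. 2 <= m ==> m <= Suc n ==> [m] \<cdot>\<^bsub>K\<^esub> 1[K] : Units K" shows "kgood (td n)"
 using assms
proof (induction n rule: less_induct)
 case (less n)
 have u: "ki (int m) : Units K" if "1 <= m" "m <= Suc n" for m
  using less.prems[of m] that ki_one by(cases "m = 1") (auto simp: add_pow_int_ge int_pow_int)
 have f: "ki (int (fact m)) : Units K" if "m <= Suc n" for m using that proof (induction m)
  case 0 show ?case by(simp add: ki_one)
 next
  case (Suc m)
  thus ?case using ki_unit_mult[OF u[of "Suc m"] Suc.IH] unfolding fact_Suc of_nat_id of_nat_mult by simp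
 qed
 have g: "kgood (1 / fact m)" if "m <= Suc n" for m by(rule rho_eq(1)[OF _ f[OF that], of _ 1]) simp_all
 have "td n + (\<Sum>k<n. td k / fact (Suc n - k)) = (if n = 0 then 1 else 0)"
  using todd_rec[of n] by(simp add: lessThan_Suc_atMost[symmetric] add.commute)
 hence e: "td n = (if n = 0 then 1 else 0) + of_int (-1) * (\<Sum>k<n. td k * (1 / fact (Suc n - k)))" by(simp add: algebra_simps)
 have s: "kgood (\<Sum>k<n. td k * (1 / fact (Suc n - k)))"
  using less.IH less.prems by(intro conjunct1[OF rho_sum] rho_mult(1) g) auto
 show ?case unfolding e using rho_int(1)[of 1] rho_int(1)[of 0] by(intro rho_add(1) rho_mult(1)[OF rho_int(1) s]) auto
qed

end

section \<open>The generic point, constant functions and powers of ad x\<close>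

section \<open>The canonical element and its powers\<close>

context lsa begin

definition "is_epx e x \<longleftrightarrow> addmap SA K e & addmap SA L x & (ALL a:car K. e (kp a) = a & x (kp a) = \<zero>) &
  (ALL X:car L. ALL u:car SA. e (io X *[SA] u) = 0[K] & x (io X *[SA] u) = X \<bullet> e u)"

definition "epx = (SOME ex. is_epx (fst ex) (snd ex))"
definition "eps = fst epx"
definition "prL = snd epx"

lemma eps_prL: "is_epx eps prL"
proof -
 obtain e x where "is_epx e x" using ex_eps_prL unfolding is_epx_def by metis
 hence "is_epx (fst (e, x)) (snd (e, x))" by simp
 thus ?thesis unfolding eps_def prL_def epx_def by(rule someI)
qed

lemma eps_props: shows eps_addmap: "addmap SA K eps" and prL_addmap: "addmap SA L prL"
  and eps_scal: "!!a. a <: K ==> eps (kp a) = a" and prL_scal: "!!a. a <: K ==> prL (kp a) = \<zero>"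
  and eps_in: "!!X u. X <: L ==> u <: SA ==> eps (io X *[SA] u) = 0[K]"
  and prL_in: "!!X u. X <: L ==> u <: SA ==> prL (io X *[SA] u) = X \<bullet> eps u" using eps_prL unfolding is_epx_def by blast+

lemma eps_one: "eps 1[SA] = 1[K]" and prL_one: "prL 1[SA] = \<zero>"
 using eps_scal[OF K.one_closed] prL_scal[OF K.one_closed] by(simp_all add: S.qscal_one)

lemma eps_rs: assumes "u <: SA" "a <: K" shows "eps (u *[SA] kp a) = eps u *[K] a & prL (u *[SA] kp a) = prL u \<bullet> a"
 using assms(1)
proof (induction rule: S.Q_ind)
 case (scal b)
 thus ?case using assms(2) eps_scal[of "b *[K] a"] prL_scal[of "b *[K] a"] by(simp add: S.qscal_mult eps_scal prL_scal)
next
 case (mult X y)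
 thus ?case using assms(2) amD1[OF eps_addmap] by(simp add: S.Q.m_assoc eps_in prL_in rsmult_assoc)
next
 case (add x y)
 thus ?case using assms(2) amD1[OF eps_addmap] amD1[OF prL_addmap]
  by(simp add: S.Q.l_distr amD2[OF eps_addmap] amD2[OF prL_addmap] K.l_distr rsmult_add_left)
qed

lemma eps_hpart: "u : hp SA i ==> eps u : hp K i"
proof (induction rule: S.Q_hp_ind)
 case (zero i) thus ?case using am_zn(1)[OF S.Q.abx K.abx eps_addmap] by simp
qed (simp_all add: eps_scal K.hpc eps_in hpc S.Q.hpc amD2[OF eps_addmap] K.hp_add)

lemma prL_hpart: "u : hp SA i ==> prL u : hp L i"
proof (induction rule: S.Q_hp_ind)
 case (zero i) thus ?case using am_zn(1)[OF S.Q.abx abx prL_addmap] by simp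
qed (simp_all add: prL_scal K.hpc prL_in hpc S.Q.hpc amD2[OF prL_addmap] hp_add rsmult_hpart eps_hpart)

text \<open>As g-valued functions on g, \<open>xS\<close> is the identity, that is the generic point
  x, and \<open>cst a\<close> is constant with value a.\<close>

definition "xS = (\<lambda>u\<in>car SA. prL u)"
definition "cst a = (\<lambda>u\<in>car SA. a \<bullet> eps u)"
definition "Z0 = (\<lambda>u\<in>car SA. \<zero>)"

lemma xS: "xS : C 0" by(rule hHomI, rule HomI)
  (use addmapD[OF prL_addmap] eps_rs S.Q.rsc prL_hpart S.Q.hpc in
   "simp_all add: xS_def S.Q_rs")

lemma cst: "a : hp L p ==> cst a : C p" by(rule hHomI, rule HomI)
  (use addmapD[OF eps_addmap] eps_rs S.Q.rsc eps_hpart S.Q.hpc hpc in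
   "simp_all add: cst_def S.Q_rs rsc rsmult_add_right rsmult_assoc rsmult_hpart")

lemma Z0: "Z0 : C d" by(rule hHomI, rule HomI) (use S.Q.rsc S.Q.hpc in "simp_all add: Z0_def")

lemma dl_xS: "X : hp L p ==> dl X xS = cst X" unfolding dl_def cst_def by(rule restrict_ext) (simp add: xS_def prL_in hpc)

lemma dl_cst: "X : hp L p ==> a <: L ==> dl X (cst a) = Z0"
 unfolding dl_def Z0_def by(rule restrict_ext) (simp add: cst_def eps_in hpc)

lemma Z0_app [simp]: "u <: SA ==> Z0 u = \<zero>" by(simp add: Z0_def)

lemma br_zero: "x <: L ==> br \<zero> x = \<zero> & br x \<zero> = \<zero>" using am_zn(1)[OF abx abx bilD(4)[OF bil_br]]
  am_zn(1)[OF abx abx bilD(5)[OF bil_br]] by simp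

lemma cst_app [simp]: "u <: SA ==> cst a u = a \<bullet> eps u" by(simp add: cst_def)

lemma brc_Z0: assumes F: "F : C d" shows "brc d Z0 F = Z0" "brc e F Z0 = Z0"
proof -
 note Fc = hHom_c[OF F]
 have "brc d Z0 F u = Z0 u" if u: "u <: SA" for u using conv_eqI[OF bil_br Z0[of 0] F am_zero _ u] u Fc S.Q.hpc
  by(simp add: br_zero)
 moreover have "brc e F Z0 u = Z0 u" if u: "u <: SA" for u using conv_eqI[OF bil_br F Z0[of e] am_zero _ u] u Fc S.Q.hpc
  by(simp add: br_zero)
 ultimately show "brc d Z0 F = Z0" "brc e F Z0 = Z0" by(auto simp: fun_eq_iff conv_def Z0_def)
qed

lemma eps_Ph: assumes "S.hmono n p m" "Y : C y" shows "eps (Ph y Y m) = 0[K]" using assms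
proof (induction arbitrary: y Y rule: S.hmono.induct)
 case one
 thus ?case using eps_in[of "Y 1[SA]" "1[SA]"] hHom_c[OF one] by(simp add: Ph_one)
next
 case (mult n p m X q)
 note mc = S.hmonoc[OF mult(1)] and Xc = hpc[OF mult(2)]
 note Pc = hHom_c[OF Ph_hHom[OF mult(4)] mc] hHom_c[OF Ph_hHom[OF dl_hHom[OF mult(2,4)]] mc]
 show ?case using Xc Pc mult(3)[OF dl_hHom[OF mult(2,4)]]
   am_zn(3)[OF S.Q.abx K.abx eps_addmap] by(simp add: Ph_in[OF mult(4,2) mc] amD2[OF eps_addmap] eps_in)
qed

text \<open>Differentiating the identity function along Y returns Y. Removing a letter leaves a
  constant function to be differentiated, which \<open>eps_Ph\<close> disposes of.\<close>

lemma xS_Ph_mono: assumes "S.hmono n p m" "Y : C y" shows "xS (Ph y Y m) = Y m" using assms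
proof (induction arbitrary: y Y rule: S.hmono.induct)
 case one
 thus ?case using prL_in[of "Y 1[SA]" "1[SA]"] hHom_c[OF one] by(simp add: Ph_one xS_def eps_one rsmult_one)
next
 case (mult n p m X q)
 note mc = S.hmonoc[OF mult(1)] and Xc = hpc[OF mult(2)]
 note Pc = hHom_c[OF Ph_hHom[OF mult(4)] mc]
 show ?case using Xc Pc mult(3)[OF dl_hHom[OF mult(2,4)]] eps_Ph[OF mult(1,4)] mc hHom_c[OF mult(4), of "io X *[SA] m"]
  by(simp add: dl_cmp_Ph[OF xS mult(4,2) mc] dl_xS[OF mult(2)] cst_def)
qed

lemma cst_Ph: "a : hp L p ==> Y : C y ==> cmp (cst a) (Ph y Y) = Z0" by(rule C_ext[OF cmp_hHom[OF cst Ph_hHom] Z0 abx])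
  (use S.hmonoc eps_Ph hHom_c[OF Ph_hHom] hpc in "simp_all")

lemma xS_Ph: "Y : C y ==> cmp xS (Ph y Y) = Y" by(rule C_ext[OF cmp_hHom[OF xS Ph_hHom] _ abx])
  (use S.hmonoc xS_Ph_mono in simp_all)

lemma cst_brc: assumes "S.hmono n p m" "X : hp L q" "F : C d" shows "brc d (cst X) F m = br X (F m)" using assms
proof (induction arbitrary: d F rule: S.hmono.induct)
 case one
 thus ?case by(simp add: conv_one[OF bil_br cst one(2)] eps_one rsmult_one hpc)
next
 case (mult n p m Y r)
 note mc = S.hmonoc[OF mult(1)] and Xc = hpc[OF mult(4)] hpc[OF mult(2)]
 show ?case using mc Xc brc_Z0(1)[OF mult(5)] mult(3)[OF mult(4) dl_hHom[OF mult(2,5)]] hHom_c[OF mult(5), of "io Y *[SA] m"]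
  by(simp add: conv_in[OF bil_br cst[OF mult(4)] mult(5,2) mc] dl_cst[OF mult(2)] lbr_closed)
qed

lemma brc_cst: assumes a: "a : hp L p" and b: "b : hp L q" shows "brc q (cst a) (cst b) = cst (br a b)"
proof (rule C_ext[OF brc_hHom[OF cst[OF a] cst[OF b]] cst[OF lbr_hpart[OF a b]] abx])
 fix n r m assume m: "S.hmono n r m"
 note mc = S.hmonoc[OF m]
 show "brc q (cst a) (cst b) m = cst (br a b) m" using mc hpc[OF a] hpc[OF b] amD1[OF eps_addmap mc]
  unfolding cst_brc[OF m a cst[OF b]] by(simp add: lbr_rsmult)
qed

text \<open>Homogeneity of degree k for F as a polynomial function, counted in letters of the
  argument.\<close>

definition "Ln k F \<longleftrightarrow> (ALL n p m. S.hmono n p m --> n ~= k --> F m = \<zero>)"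

lemma Ln_dl: assumes "k ~= 0" "Ln k F" "X : hp L p" shows "Ln (k - 1) (dl X F)" unfolding Ln_def
proof (intro allI impI)
 fix n q m assume "S.hmono n q m" "n ~= k - 1"
 thus "dl X F m = \<zero>" using assms S.hmono.mult[of n q m X p] S.hmonoc[of n q m] unfolding Ln_def by fastforce
qed

lemma Ln_dl0: assumes "Ln 0 F" "X : hp L p" shows "Ln k (dl X F)" unfolding Ln_def
proof (intro allI impI)
 fix n q m assume "S.hmono n q m"
 thus "dl X F m = \<zero>" using assms S.hmono.mult[of n q m X p] S.hmonoc[of n q m] unfolding Ln_def by fastforce
qed

text \<open>Degrees add under the bracket, since a derivative lowers the degree of one factor by one
  while the monomial loses one letter.\<close>

lemma Ln_brc_mono: assumes "S.hmono n p m" "F : C d" "G : C e" "Ln j F" "Ln k G" "n ~= j + k" shows "brc e F G m = \<zero>"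
 using assms
proof (induction arbitrary: d e F G j k rule: S.hmono.induct)
 case one
 hence "F 1[SA] = \<zero> \<or> G 1[SA] = \<zero>" using S.hmono.one unfolding Ln_def by(metis add_is_0)
 thus ?case using hHom_c[OF one(1)] hHom_c[OF one(2)] by(auto simp: conv_one[OF bil_br one(1,2)] br_zero)
next
 case (mult n p m X q)
 note mc = S.hmonoc[OF mult(1)]
 have "brc e (dl X F) G m = \<zero>" proof (cases "j = 0")
  case True
  \<comment> \<open>The derivative of a constant is zero and so homogeneous of every degree; the
    choice \<open>Suc n\<close> makes the required inequality automatic.\<close>
  show ?thesis using Ln_dl0[of F X q "Suc n"] mult(2,6) True
   by(intro mult(3)[OF dl_hHom[OF mult(2,4)] mult(5) _ mult(7), of "Suc n"]) auto
 next
  case False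
  thus ?thesis by(intro mult(3)[OF dl_hHom[OF mult(2,4)] mult(5) Ln_dl[OF False mult(6,2)] mult(7)]) (use mult(8) in auto)
 qed
 moreover have "brc (e + q) F (dl X G) m = \<zero>" proof (cases "k = 0")
  case True
  show ?thesis using Ln_dl0[of G X q "Suc n"] mult(2,7) True
   by(intro mult(3)[OF mult(4) dl_hHom[OF mult(2,5)] mult(6), of "Suc n"]) auto
 next
  case False
  thus ?thesis by(intro mult(3)[OF mult(4) dl_hHom[OF mult(2,5)] mult(6) Ln_dl[OF False mult(7,2)]]) (use mult(8) in auto)
 qed
 ultimately show ?case by(simp add: conv_in[OF bil_br mult(4,5,2) mc])
qed

lemma Ln_brc: "F : C d ==> G : C e ==> Ln j F ==> Ln k G ==> Ln (j + k) (brc e F G)"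
 unfolding Ln_def[of "j + k"] using Ln_brc_mono by blast

lemma eps_mono: "S.hmono n p m ==> n ~= 0 ==> eps m = 0[K]" by(induction rule: S.hmono.induct) (use eps_in hpc S.hmonoc in blast)+

lemma Ln_cst: "a <: L ==> Ln 0 (cst a)" by(simp add: Ln_def S.hmonoc eps_mono)

lemma Ln_xS: "Ln 1 xS" unfolding Ln_def
proof (intro allI impI)
 fix n p m assume m: "S.hmono n p m" "n ~= 1"
 from m(1) show "xS m = \<zero>" proof (cases rule: S.hmono.cases)
  case one thus ?thesis by(simp add: xS_def prL_one)
 next
  case (mult n' p' m' X q)
  thus ?thesis using m(2) by(simp add: xS_def prL_in hpc S.hmonoc eps_mono)
 qed
qed

text \<open>The n-th power of ad \<open>xS\<close> for the convolution bracket, where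
  \<open>d\<close> is the parity of F.\<close>

definition "Tp d n F = ((brc d xS) ^^ n) F"

lemma Tp_0 [simp]: "Tp d 0 F = F" and Tp_Suc: "Tp d (Suc n) F = brc d xS (Tp d n F)" by(simp_all add: Tp_def)

lemma Tp_hHom: "F : C d ==> Tp d n F : C d"
proof (induction n)
 case (Suc n)
 thus ?case using brc_hHom[OF xS, of "Tp d n F" d] by(simp add: Tp_Suc)
qed simp

lemma Ln_Tp: "F : C d ==> Ln k F ==> Ln (n + k) (Tp d n F)"
proof (induction n)
 case (Suc n)
 thus ?case using Ln_brc[OF xS Tp_hHom[OF Suc.prems(1)] Ln_xS Suc.IH[OF Suc.prems]] by(simp add: Tp_Suc)
qed simp

text \<open>The product rule for [x, F] along Y gives [Y, F] plus the bracket of x with the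
  derivative of F; skew symmetry turns the former into -[F, Y].\<close>

lemma T_Ph: assumes F: "F : C d" and Y: "Y : C y"
 shows "cmp (brc d xS F) (Ph y Y) = lin2 L 0 (brc (d + y) xS (cmp F (Ph y Y))) 1 (brc y F Y)"
proof (rule C_ext[OF cmp_hHom[OF brc_hHom[OF xS F] Ph_hHom[OF Y]] lin2_hHom[OF smodule_axioms] abx])
 show "brc (d + y) xS (cmp F (Ph y Y)) : C (d + y)" using brc_hHom[OF xS cmp_hHom[OF F Ph_hHom[OF Y]]] by simp
 show "brc y F Y : C (d + y)" by(rule brc_hHom[OF F Y])
 fix n p m assume m: "S.hmono n p m"
 note mc = S.hmonoc[OF m]
 note bc = brc_c[OF F Y mc] brc_c[OF xS cmp_hHom[OF F Ph_hHom[OF Y]] mc]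
 have "sg L (y * d) (brc d Y F m) = sg L 1 (brc y F Y m)"
  unfolding brc_skew_mono[OF m Y F] sg_sg[OF bc(1)] by(cases "y"; cases d) simp_all
 thus "cmp (brc d xS F) (Ph y Y) m = lin2 L 0 (brc (d + y) xS (cmp F (Ph y Y))) 1 (brc y F Y) m"
  using mc bc brc_Ph_mono[OF m xS F Y] a_comm[OF sg_c[OF bc(1)] bc(2)] by(simp add: xS_Ph[OF Y] lin2_def)
qed

text \<open>By the Jacobi identity ad x is a derivation, without signs because x is even.\<close>

lemma T_der: assumes F: "F : C d" and G: "G : C e"
 shows "brc (d + e) xS (brc e F G) = lin2 L 0 (brc e (brc d xS F) G) 0 (brc e F (brc e xS G))"
proof (rule C_ext[OF brc_hHom[OF xS brc_hHom[OF F G]] lin2_hHom[OF smodule_axioms] abx])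
 show "brc e (brc d xS F) G : C (d + e)" using brc_hHom[OF brc_hHom[OF xS F] G] by simp
 show "brc e F (brc e xS G) : C (d + e)" using brc_hHom[OF F brc_hHom[OF xS G]] by simp
 fix n p m assume m: "S.hmono n p m"
 show "brc (d + e) xS (brc e F G) m = lin2 L 0 (brc e (brc d xS F) G) 0 (brc e F (brc e xS G)) m"
  unfolding brc_jacobi_mono[OF m xS F G] lin2_def restrict_apply'[OF S.hmonoc[OF m]] by simp
qed

end

section \<open>Leibniz formulas for powers of ad x and their derivatives\<close>

section \<open>Binomial formulas\<close>

lemma (in abelian_monoid) finsum_swap: assumes "finite I" "finite J" "!!i j. i : I ==> j : J ==> f i j <: G"
 shows "(\<Oplus>i\<in>I. \<Oplus>j\<in>J. f i j) = (\<Oplus>j\<in>J. \<Oplus>i\<in>I. f i j)" using assms(1,3)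
proof (induction I rule: finite_induct)
 case (insert x F)
 have "(\<Oplus>i\<in>insert x F. \<Oplus>j\<in>J. f i j) = (\<Oplus>j\<in>J. f x j) \<oplus> (\<Oplus>j\<in>J. \<Oplus>i\<in>F. f i j)"
  using insert by(subst finsum_insert) (auto intro!: finsum_closed)
 also have "... = (\<Oplus>j\<in>J. f x j \<oplus> (\<Oplus>i\<in>F. f i j))"
  using insert by(intro finsum_addf[symmetric]) (auto intro!: finsum_closed)
 also have "... = (\<Oplus>j\<in>J. \<Oplus>i\<in>insert x F. f i j)"
  using insert by(intro finsum_cong') (auto intro!: finsum_closed)
 finally show ?case .
qed (use assms(2) in simp)

lemma (in abelian_monoid) fs_single: assumes "finite I" "i : I" "f i <: G" "!!j. j : I ==> j ~= i ==> f j = \<zero>"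
 shows "(\<Oplus>j\<in>I. f j) = f i"
proof -
 have "(\<Oplus>j\<in>I. f j) = (\<Oplus>j\<in>I. if i = j then f j else \<zero>)" using assms by(intro finsum_cong') auto
 thus ?thesis using finsum_singleton[OF assms(2,1), of f] assms(3,4) by(metis (no_types, lifting) Pi_I zero_closed)
qed

context lsa begin

lemma rs_fs_left: assumes "finite I" "!!i. i : I ==> g i <: L" "a <: K"
 shows "(\<Oplus>i\<in>I. g i) \<bullet> a = (\<Oplus>i\<in>I. g i \<bullet> a)"
proof -
 have "addmap L L (%x. x \<bullet> a)" by(rule addmapI) (simp_all add: assms(3) rsc rsmult_add_left)
 from am_fs[OF abx abx this, of g I] show ?thesis using assms(2) by simp
qed

lemma rs_fs_right: assumes "finite I" "!!i. i : I ==> c i <: K" "x <: L"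
 shows "x \<bullet> (\<Oplus>\<^bsub>K\<^esub>i\<in>I. c i) = (\<Oplus>i\<in>I. x \<bullet> c i)"
proof -
 have "addmap K L (%a. x \<bullet> a)" by(rule addmapI) (simp_all add: assms(3) rsc rsmult_add_right)
 from am_fs[OF K.abx abx this, of c I] show ?thesis using assms(2) by simp
qed

lemma ki_0: "ki 0 = 0[K]" using rho_zero rho_int[of 0] by simp

abbreviation "kb s n k == ki (s * int (n choose k))"

text \<open>Pascal's rule summed against \<open>g\<close>. The factor \<open>s\<close> is 1 in
  \<open>T_binom\<close> and -1 in \<open>T_Ph_binom\<close>.\<close>

lemma pascal: assumes g: "!!j. g j <: L"
 shows "(\<Oplus>j\<in>{..r}. (g (Suc j) \<oplus> g j) \<bullet> kb s r j) = (\<Oplus>j\<in>{..Suc r}. g j \<bullet> kb s (Suc r) j)"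
proof -
 note c = rsc[OF g ki_c]
 let ?h = "%j. g j \<bullet> kb s r j"
 have z: "?h (Suc r) = \<zero>" using g by(simp add: ki_0 binomial_eq_0)
 have "(\<Oplus>j\<in>{..Suc r}. g j \<bullet> kb s (Suc r) j) = (\<Oplus>j\<in>{..r}. g (Suc j) \<bullet> kb s (Suc r) (Suc j)) \<oplus> ?h 0"
  using c by(subst finsum_Suc2) simp_all
 also have "(\<Oplus>j\<in>{..r}. g (Suc j) \<bullet> kb s (Suc r) (Suc j)) = (\<Oplus>j\<in>{..r}. g (Suc j) \<bullet> kb s r j \<oplus> ?h (Suc j))"
  using c g by(intro finsum_cong') (simp_all add: distrib_left ki_add rsmult_add_right)
 also have "... = (\<Oplus>j\<in>{..r}. g (Suc j) \<bullet> kb s r j) \<oplus> (\<Oplus>j\<in>{..r}. ?h (Suc j))"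
  using c by(intro finsum_addf) auto
 also have "... \<oplus> ?h 0 = (\<Oplus>j\<in>{..r}. g (Suc j) \<bullet> kb s r j) \<oplus> ((\<Oplus>j\<in>{..r}. ?h (Suc j)) \<oplus> ?h 0)"
  using c by(intro a_assoc finsum_closed) auto
 also have "(\<Oplus>j\<in>{..r}. ?h (Suc j)) \<oplus> ?h 0 = (\<Oplus>j\<in>{..Suc r}. ?h j)"
  using c by(subst finsum_Suc2) simp_all
 also have "... = (\<Oplus>j\<in>{..r}. ?h j)" using c z by(subst finsum_Suc) (simp_all add: finsum_closed)
 also have "(\<Oplus>j\<in>{..r}. g (Suc j) \<bullet> kb s r j) \<oplus> (\<Oplus>j\<in>{..r}. ?h j) = (\<Oplus>j\<in>{..r}. g (Suc j) \<bullet> kb s r j \<oplus> ?h j)"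
  using c by(intro finsum_addf[symmetric]) auto
 also have "... = (\<Oplus>j\<in>{..r}. (g (Suc j) \<oplus> g j) \<bullet> kb s r j)"
  using c g by(intro finsum_cong') (simp_all add: rsmult_add_left)
 finally show ?thesis ..
qed

text \<open>Pascal's rule for a row without its last entry: the missing summand is supplied as
  \<open>g (Suc n)\<close> times s. Replacing g by zero beyond \<open>Suc n\<close> reduces it to
  \<open>pascal\<close>.\<close>

lemma pascal2: assumes g: "!!j. g j <: L"
 shows "(\<Oplus>j\<in>{..n}. (g (Suc j) \<oplus> g j) \<bullet> kb s (Suc n) j) \<oplus> g (Suc n) \<bullet> ki s = (\<Oplus>j\<in>{..Suc n}. g j \<bullet> kb s (Suc (Suc n)) j)"
proof -
 define h where "h j = (if j <= Suc n then g j else \<zero>)" for j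
 have h: "h j <: L" for j using g by(simp add: h_def)
 note c = rsc[OF h ki_c] rsc[OF g ki_c]
 have "(\<Oplus>j\<in>{..Suc n}. (h (Suc j) \<oplus> h j) \<bullet> kb s (Suc n) j) = (\<Oplus>j\<in>{..Suc (Suc n)}. h j \<bullet> kb s (Suc (Suc n)) j)"
  by(rule pascal[OF h])
 also have "... = (\<Oplus>j\<in>{..Suc n}. h j \<bullet> kb s (Suc (Suc n)) j)"
  using c by(subst finsum_Suc) (simp_all add: finsum_closed h_def)
 also have "... = (\<Oplus>j\<in>{..Suc n}. g j \<bullet> kb s (Suc (Suc n)) j)" using c by(intro finsum_cong') (auto simp: h_def)
 finally have 1: "(\<Oplus>j\<in>{..Suc n}. (h (Suc j) \<oplus> h j) \<bullet> kb s (Suc n) j) = (\<Oplus>j\<in>{..Suc n}. g j \<bullet> kb s (Suc (Suc n)) j)" .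
 have "(\<Oplus>j\<in>{..Suc n}. (h (Suc j) \<oplus> h j) \<bullet> kb s (Suc n) j) =
   (h (Suc (Suc n)) \<oplus> h (Suc n)) \<bullet> kb s (Suc n) (Suc n) \<oplus> (\<Oplus>j\<in>{..n}. (h (Suc j) \<oplus> h j) \<bullet> kb s (Suc n) j)"
  using c h by(subst finsum_Suc) (simp_all add: rsc)
 also have "(h (Suc (Suc n)) \<oplus> h (Suc n)) \<bullet> kb s (Suc n) (Suc n) = g (Suc n) \<bullet> ki s"
  using g by(simp add: h_def)
 also have "(\<Oplus>j\<in>{..n}. (h (Suc j) \<oplus> h j) \<bullet> kb s (Suc n) j) = (\<Oplus>j\<in>{..n}. (g (Suc j) \<oplus> g j) \<bullet> kb s (Suc n) j)"
  using g by(intro finsum_cong') (auto simp: h_def rsc)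
 finally show ?thesis using 1 g by(simp add: a_comm finsum_closed rsc)
qed

lemma rs_ki_neg: "x <: L ==> x \<bullet> ki (- 1) = sg L 1 x"
 using rsmult_add_right[of x "ki (-1)" "ki 1"] ki_add[of "-1" 1, symmetric] minus_equality[of "x \<bullet> ki (-1)" x]
 by(simp add: ki_one ki_0 rsmult_one rsc sg_def)


text \<open>Since ad x is an even derivation, this is the Leibniz formula for its powers.\<close>

lemma T_binom: assumes F: "F : C d" and G: "G : C e"
 shows "Tp (d + e) r (brc e F G) = lc L {..r} (%j. kb 1 r j) (%j. brc e (Tp d j F) (Tp e (r - j) G))"
proof (induction r)
 case 0
 have B: "Tp (d + e) 0 (brc e F G) : C (d + e)" using brc_hHom[OF F G] by simp
 show ?case proof (rule C_ext[OF B lc_hHom[OF smodule_axioms] abx])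
  fix n p m assume "S.hmono n p m"
  note mc = S.hmonoc[OF this]
  show "Tp (d + e) 0 (brc e F G) m = lc L {..0} (%j. kb 1 0 j) (%j. brc e (Tp d j F) (Tp e (0 - j) G)) m"
   using mc brc_c[OF F G mc] by(simp add: lc_def ki_one rsmult_one)
 qed (use brc_hHom[OF F G] ki_hp K.hpart_one in auto)
next
 case (Suc r)
 note TF = Tp_hHom[OF F] and TG = Tp_hHom[OF G]
 note B = brc_hHom[OF TF TG]
 have "Tp (d + e) (Suc r) (brc e F G) = lc L {..r} (%j. kb 1 r j) (%j. brc (d + e) xS (brc e (Tp d j F) (Tp e (r - j) G)))"
  unfolding Tp_Suc Suc by(rule conv_lc_right[OF bil_br xS]) (use B ki_hp in auto)
 also have "... = lc L {..Suc r} (%j. kb 1 (Suc r) j) (%j. brc e (Tp d j F) (Tp e (Suc r - j) G))"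
 proof (rule C_ext[OF lc_hHom[OF smodule_axioms] lc_hHom[OF smodule_axioms] abx])
  show "brc (d + e) xS (brc e (Tp d j F) (Tp e (r - j) G)) : C (d + e)" for j using brc_hHom[OF xS B] by simp
  fix n p m assume m: "S.hmono n p m"
  note mc = S.hmonoc[OF m]
  let ?g = "%j. brc e (Tp d j F) (Tp e (Suc r - j) G) m"
  have "(\<Oplus>j\<in>{..r}. brc (d + e) xS (brc e (Tp d j F) (Tp e (r - j) G)) m \<bullet> kb 1 r j) = (\<Oplus>j\<in>{..r}. (?g (Suc j) \<oplus> ?g j) \<bullet> kb 1 r j)"
   using mc brc_c[OF TF TG mc] by(intro finsum_cong') (simp_all add: T_der[OF TF TG] lin2_def Tp_Suc[symmetric] Suc_diff_le rsc)
  thus "lc L {..r} (%j. kb 1 r j) (%j. brc (d + e) xS (brc e (Tp d j F) (Tp e (r - j) G))) m =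
    lc L {..Suc r} (%j. kb 1 (Suc r) j) (%j. brc e (Tp d j F) (Tp e (Suc r - j) G)) m"
   using pascal[of ?g 1 r, OF brc_c[OF TF TG mc]] mc by(simp only: lc_def restrict_apply')
 qed (use B ki_hp in auto)
 finally show ?case .
qed

text \<open>Each further power of ad x acts on the brackets found so far and, by
  \<open>T_Ph\<close>, contributes one new bracket -[(ad x)^(n+1) A, Y]. Pascal's rule collects the
  coefficients; the last entry of each row is absent, hence \<open>pascal2\<close>.\<close>

lemma T_Ph_binom: assumes A: "A : C d" and Y: "Y : C y" and Z: "cmp A (Ph y Y) = Z0"
 shows "cmp (Tp d (Suc n) A) (Ph y Y) = lc L {..n} (%j. kb (-1) (Suc n) j) (%j. brc y (Tp d j A) (Tp y (n - j) Y))"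
proof (induction n)
 case 0
 have b: "brc y A Y : C (d + y)" by(rule brc_hHom[OF A Y])
 show ?case proof (rule C_ext[OF cmp_hHom[OF Tp_hHom[OF A] Ph_hHom[OF Y]] lc_hHom[OF smodule_axioms] abx])
  fix n p m assume m: "S.hmono n p m"
  note mc = S.hmonoc[OF m]
  show "cmp (Tp d (Suc 0) A) (Ph y Y) m = lc L {..0} (%j. kb (-1) (Suc 0) j) (%j. brc y (Tp d j A) (Tp y (0 - j) Y)) m"
   using mc brc_c[OF A Y mc] ki_hp by(simp add: Tp_Suc T_Ph[OF A Y] Z brc_Z0(2)[OF xS] lin2_def lc_def rs_ki_neg)
 qed (use b ki_hp in auto)
next
 case (Suc n)
 note TA = Tp_hHom[OF A] and TY = Tp_hHom[OF Y]
 note B = brc_hHom[OF TA TY]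
 note B0 = brc_hHom[OF TA Y]
 let ?G = "%j. brc y (Tp d j A) (Tp y (n - j) Y)"
 let ?H = "%j. brc (d + y) xS (?G j)"
 have H: "?H j : C (d + y)" for j using brc_hHom[OF xS B] by simp
 have 1: "cmp (Tp d (Suc (Suc n)) A) (Ph y Y) = lin2 L 0 (lc L {..n} (%j. kb (-1) (Suc n) j) ?H) 1 (brc y (Tp d (Suc n) A) Y)"
  unfolding Tp_Suc[of d "Suc n"] T_Ph[OF TA Y] Suc by(subst conv_lc_right[OF bil_br xS]) (use B ki_hp in auto)
 show ?case proof (rule C_ext[OF cmp_hHom[OF TA Ph_hHom[OF Y]] lc_hHom[OF smodule_axioms] abx])
  fix k p m assume m: "S.hmono k p m"
  note mc = S.hmonoc[OF m]
  let ?g = "%j. brc y (Tp d j A) (Tp y (Suc n - j) Y) m"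
  have "(\<Oplus>j\<in>{..n}. ?H j m \<bullet> kb (-1) (Suc n) j) = (\<Oplus>j\<in>{..n}. (?g (Suc j) \<oplus> ?g j) \<bullet> kb (-1) (Suc n) j)"
   using mc brc_c[OF TA TY mc] by(intro finsum_cong') (simp_all add: T_der[OF TA TY] lin2_def Tp_Suc[symmetric] Suc_diff_le rsc)
  thus "cmp (Tp d (Suc (Suc n)) A) (Ph y Y) m =
    lc L {..Suc n} (%j. kb (-1) (Suc (Suc n)) j) (%j. brc y (Tp d j A) (Tp y (Suc n - j) Y)) m"
   unfolding 1 using mc brc_c[OF TA Y mc] pascal2[of ?g "-1" n, OF brc_c[OF TA TY mc]] by(simp add: lin2_def lc_def rs_ki_neg)
 qed (use B ki_hp in auto)
qed

end

section \<open>The functions c(ad x)(a), and how nilpotency limits the brackets\<close>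

section \<open>The canonical solutions\<close>

context lsa begin

lemma Fl_eqI: assumes N: "smodule K N" and F: "F : hHom K SA N d" and G: "G : hHom K SA N e"
  and eq: "!!n p m. S.hmono n p m ==> n : A ==> F m = G m" and u: "u : S.Fl A" shows "F u = G u" using u
proof (induction rule: S.Fl.induct)
 case zero
 interpret N: smodule K N by fact
 show ?case using am_zn(1)[OF S.Q.abx N.abx hHom_am[OF F]]
   am_zn(1)[OF S.Q.abx N.abx hHom_am[OF G]] by simp
next
 case (gen n p m a j)
 hence "F (m .[SA] a) = G (m .[SA] a)" using S.hmonoc[OF gen(1)] K.hpc[OF gen(3)] hHom_rs[OF F] hHom_rs[OF G] eq by simp
 thus ?case using S.Q_rs[OF S.hmonoc[OF gen(1)] K.hpc[OF gen(3)]] by simp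
next
 case (add x y)
 thus ?case using S.Fl_c hHom_add[OF F] hHom_add[OF G] by metis
qed

lemma Ln_Fl: "Ln n F ==> F : C d ==> u : S.Fl A ==> n ~: A ==> F u = \<zero>"
 using Fl_eqI[OF smodule_axioms _ Z0[of 0], of F d A u] S.hmonoc S.Fl_c unfolding Ln_def by(metis Z0_app)

abbreviation "tc n == \<rho> (td n)"
text \<open>This is c(ad x)(a) for c(t) = t/(e^t - 1). The series is infinite, but on a given u only
  finitely many terms are nonzero; \<open>LEAST\<close> selects a bound that suffices.\<close>

definition "psih p a = (\<lambda>u\<in>car SA. lc L {..LEAST M. u : S.Fl {..M}} tc (%n. Tp p n (cst a)) u)"

context fixes p a assumes a: "a : hp L p"
begin

lemma lc_cst: "lc L {..M} tc (%n. Tp p n (cst a)) : C p"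
 by(rule lc_hHom[OF smodule_axioms]) (simp_all add: rho_hp Tp_hHom[OF cst[OF a]])

lemma Ln_Tp_cst: "Ln n (Tp p n (cst a))" using Ln_Tp[OF cst[OF a] Ln_cst, of n] hpc[OF a] by simp

text \<open>The n-th term is homogeneous of degree n and vanishes on words of other lengths, so any
  bound on the length of u gives the same value.\<close>

lemma psih_eq: assumes u: "u : S.Fl {..M}" shows "psih p a u = lc L {..M} tc (%n. Tp p n (cst a)) u"
proof -
 let ?l = "LEAST M. u : S.Fl {..M}"
 have l: "u : S.Fl {..?l}" "?l <= M" using u by(auto intro: LeastI Least_le)
 note uc = S.Fl_c[OF u]
 have c: "Tp p n (cst a) u \<bullet> tc n <: L" for n using hHom_c[OF Tp_hHom[OF cst[OF a]] uc] by(simp add: rsc)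
 have "(\<Oplus>n\<in>{..?l}. Tp p n (cst a) u \<bullet> tc n) = (\<Oplus>n\<in>{..M}. Tp p n (cst a) u \<bullet> tc n)"
  by(rule add.finprod_mono_neutral_cong_left)
   (use l c Ln_Fl[OF Ln_Tp_cst Tp_hHom[OF cst[OF a]] l(1)] in auto)
 thus ?thesis using uc by(simp add: psih_def lc_def)
qed

lemma psih: "psih p a : C p"
proof (rule hHomI, rule HomI)
 have ex: "EX M. u : S.Fl {..M}" if "u <: SA" for u using S.Fl_finite[OF that] .
 show "psih p a u : hp L (p + i)" if u: "u : hp SA i" for i u using ex[OF S.Q.hpc[OF u]] psih_eq hHomD(2)[OF lc_cst u] by metis
 show "psih p a u <: L" if u: "u <: SA" for u using ex[OF u] psih_eq hHom_c[OF lc_cst u] by metis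
 show "psih p a (u +[SA] v) = psih p a u \<oplus> psih p a v" if uv: "u <: SA" "v <: SA" for u v proof -
  obtain M1 M2 where "u : S.Fl {..M1}" "v : S.Fl {..M2}" using ex uv by blast
  hence "u : S.Fl {..max M1 M2}" "v : S.Fl {..max M1 M2}" by(auto elim!: S.Fl_mono)
  thus ?thesis using psih_eq hHom_add[OF lc_cst uv] S.Fl.add by metis
 qed
 show "psih p a (u .[SA] c) = psih p a u \<bullet> c" if u: "u <: SA" "c <: K" for u c proof -
  obtain M where M: "u : S.Fl {..M}" using ex u by blast
  have "u .[SA] c : S.Fl {..M}" unfolding S.Q_rs[OF u] by(rule S.Fl_sc[OF M u(2)])
  thus ?thesis using psih_eq M hHom_rs[OF lc_cst u] by metis
 qed
qed (simp add: psih_def)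

text \<open>At 1 only the term n = 0 is left, and c_0 = 1.\<close>

lemma psih_one: "psih p a 1[SA] = a"
proof -
 have o: "1[SA] : S.Fl {..0}" using S.Fl.gen[OF S.hmono.one _ K.hpart_one, of "{..0}"] S.Q.one_closed by(simp add: S.qscal_one)
 thus ?thesis using hpc[OF a] rho_int[of 1] todd_rec[of 0] by(simp add: psih_eq[OF o] lc_def eps_one rsmult_one ki_one)
qed

end

text \<open>Equality in degrees up to r, used to replace a series by a finite truncation inside
  brackets.\<close>

definition "Agree r F G \<longleftrightarrow> (ALL n p m. S.hmono n p m --> n <= r --> F m = G m)"

lemma brc_agree_mono: assumes "S.hmono n p m" "F : C d" "G : C e" "G' : C e" "Agree r G G'" "n <= r"
 shows "brc e F G m = brc e F G' m" using assms
proof (induction arbitrary: d e r F G G' rule: S.hmono.induct)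
 case one
 hence "G 1[SA] = G' 1[SA]" using S.hmono.one unfolding Agree_def by blast
 thus ?case by(simp add: conv_one[OF bil_br one(1,2)] conv_one[OF bil_br one(1,3)])
next
 case (mult n p m X q)
 note mc = S.hmonoc[OF mult(1)]
 have ag: "Agree n (dl X G) (dl X G')" unfolding Agree_def proof (intro allI impI)
  fix n' p' m' assume h: "S.hmono n' p' m'" "n' <= n"
  have "G (io X *[SA] m') = G' (io X *[SA] m')"
   by(rule mult(7)[unfolded Agree_def, rule_format, OF S.hmono.mult[OF h(1) mult(2)]]) (use h(2) mult(8) in simp)
  thus "dl X G m' = dl X G' m'" using S.hmonoc[OF h(1)] by simp
 qed
 show ?case using mult(3)[OF dl_hHom[OF mult(2,4)] mult(5,6,7)] mult(8)
   mult(3)[OF mult(4) dl_hHom[OF mult(2,5)] dl_hHom[OF mult(2,6)] ag]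
  by(simp add: conv_in[OF bil_br mult(4,5,2) mc] conv_in[OF bil_br mult(4,6,2) mc])
qed

lemma Tp_agree: "G : C e ==> G' : C e ==> Agree r G G' ==> Agree r (Tp e n G) (Tp e n G')"
proof (induction n)
 case (Suc n)
 note IH = Suc.IH[OF Suc.prems]
 show ?case unfolding Tp_Suc Agree_def using brc_agree_mono[OF _ xS Tp_hHom[OF Suc.prems(1)] Tp_hHom[OF Suc.prems(2)] IH] by blast
qed simp

lemma Tp_add: "Tp d i (Tp d j F) = Tp d (i + j) F" by(simp add: Tp_def funpow_add)

lemma Tp_lc: assumes "finite I" "!!i. i : I ==> c i : hp K 0" "!!i. i : I ==> G i : C e"
 shows "Tp e n (lc L I c G) = lc L I c (%i. Tp e n (G i))"
proof (induction n)
 case (Suc n)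
 show ?case unfolding Tp_Suc Suc by(rule conv_lc_right[OF bil_br xS assms(1,2)]) (use assms Tp_hHom in auto)
qed simp

subsection \<open>Nilpotency\<close>

text \<open>\<open>ZN k\<close> consists of the elements annihilated by all products of k operators
  ad X, and \<open>ON j\<close> of those y for which ad y lowers this index by j + 1. Nilpotency
  says that some \<open>ZN N\<close> is everything, while \<open>ZN 0\<close> is zero.\<close>

definition "ZN k = {z:car L. ALL Xs. set Xs <= car L & length Xs = k --> foldr br Xs z = \<zero>}"
definition "ON j = {y:car L. ALL k. ALL z:ZN (k + Suc j). br y z : ZN k}"

lemma foldr_am: "set Xs <= car L ==> addmap L L (foldr br Xs)"
proof (induction Xs)
 case (Cons X Xs)
 hence 1: "addmap L L (foldr br Xs)" and X: "X <: L" by auto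
 show ?case using am_o[OF 1 bilD(5)[OF bil_br X]] by(simp add: comp_def)
qed (simp add: addmap_def)

lemma ZN_add: "x : ZN k ==> y : ZN k ==> x \<oplus> y : ZN k" using amD2[OF foldr_am] by(auto simp: ZN_def)

lemma ZN_sg: "x : ZN k ==> sg L l x : ZN k" using am_zn(3)[OF abx abx foldr_am] by(auto simp: ZN_def)

lemma ZN_zero: "\<zero> : ZN k" using am_zn(1)[OF abx abx foldr_am] by(auto simp: ZN_def)

lemma ZN_br: assumes "X <: L" "z : ZN (Suc k)" shows "br X z : ZN k"
proof -
 have "foldr br Xs (br X z) = \<zero>" if "set Xs <= car L" "length Xs = k" for Xs
  using assms that unfolding ZN_def by(auto dest!: spec[of _ "Xs @ [X]"])
 thus ?thesis using assms by(auto simp: ZN_def lbr_closed)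
qed

lemma ZN_mono: "z : ZN k ==> k <= l ==> z : ZN l"
proof (induction l)
 case (Suc l)
 show ?case proof (cases "k = Suc l")
  case False
  hence z: "z : ZN l" using Suc by simp
  have "foldr br Xs z = \<zero>" if Xs: "set Xs <= car L" "length Xs = Suc l" for Xs
   using z Xs by(cases Xs) (auto simp: ZN_def br_zero)
  thus ?thesis using z by(simp add: ZN_def)
 qed (use Suc in simp)
qed simp

lemma ZN_0: "ZN 0 = {\<zero>}" using ZN_zero[of 0] by(auto simp: ZN_def)

lemma ON_0: "X <: L ==> X : ON 0" using ZN_br by(simp add: ON_def)

lemma ON_add: assumes "x : ON j" "y : ON j" shows "x \<oplus> y : ON j"
proof -
 have "br (x \<oplus> y) z = br x z \<oplus> br y z" if "z : ZN k" for k z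
  using assms that by(simp add: ON_def ZN_def lbr_add_left)
 thus ?thesis using assms ZN_add by(auto simp: ON_def)
qed

lemma ON_sg: assumes "x : ON j" shows "sg L l x : ON j"
proof -
 have "br (sg L l x) z = sg L l (br x z)" if "z : ZN k" for k z using assms that bil_sg(2)[OF bil_br] by(simp add: ON_def ZN_def)
 thus ?thesis using assms ZN_sg by(auto simp: ON_def)
qed

lemma ON_zero: "\<zero> : ON j" using br_zero ZN_zero by(auto simp: ON_def ZN_def)

text \<open>By the Jacobi identity ad [X, y] is a signed sum of ad X ad y and ad y ad X, and each
  product lowers the index by one more than ad y does.\<close>

lemma ON_br: assumes X: "X : hp L p" and y: "y : hp L q" "y : ON j" shows "br X y : ON (Suc j)"
proof -
 note c = hpc[OF X] hpc[OF y(1)]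
 have "br (br X y) z : ZN k" if z: "z : ZN (k + Suc (Suc j))" for k z proof -
  have zc: "z <: L" using z by(simp add: ZN_def)
  have "br X (br y z) : ZN k" using z y(2) by(intro ZN_br[OF c(1)]) (auto simp: ON_def dest: spec[of _ "Suc k"])
  moreover have "br X z : ZN (k + Suc j)" using z by(intro ZN_br[OF c(1)]) simp
  hence "br y (br X z) : ZN k" using y(2) by(simp add: ON_def)
  ultimately show ?thesis unfolding lbr_jacobi[OF X y(1) zc] a_minus_def neg_eq_sg by(intro ZN_add ZN_sg)
 qed
 thus ?thesis using c by(simp add: ON_def lbr_closed)
qed

definition "vals V F \<longleftrightarrow> (ALL n p m. S.hmono n p m --> F m : V)"

lemma vals_dl: "vals V F ==> X : hp L q ==> vals V (dl X F)" unfolding vals_def using S.hmono.mult S.hmonoc by(metis dl_app)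

text \<open>One application of ad x brackets values of F with letters of the argument, so an
  additive set of values only has to absorb brackets of this kind.\<close>

lemma vals_T_mono: assumes V: "!!x y. x : V ==> y : V ==> x \<oplus> y : V" "!!x k. x : V ==> sg L k x : V" "\<zero> : V"
  and br: "!!X y p q. X : hp L p ==> y : hp L q ==> y : V2 ==> br X y : V"
 shows "S.hmono n p m ==> F : C d ==> vals V2 F ==> brc d xS F m : V"
proof (induction arbitrary: d F rule: S.hmono.induct)
 case one
 have "xS 1[SA] = \<zero>" by(simp add: xS_def prL_one)
 thus ?case using hHom_c[OF one(1) S.Q.one_closed] by(simp add: conv_one[OF bil_br xS one(1)] br_zero V)
next
 case (mult n p m X q)
 have "br X (F m) : V" using mult br[OF mult(2) hHomD(2)[OF mult(4) S.hmono_hp[OF mult(1)]]] by(auto simp: vals_def)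
 thus ?case using mult(3)[OF dl_hHom[OF mult(2,4)] vals_dl[OF mult(5,2)]]
  by(simp add: conv_in[OF bil_br xS mult(4,2) S.hmonoc[OF mult(1)]] dl_xS[OF mult(2)] cst_brc[OF mult(1,2,4)] V)
qed

lemma vals_Tp_ON: "F : C d ==> vals (ON 0) F ==> vals (ON n) (Tp d n F)"
proof (induction n)
 case (Suc n)
 have "brc d xS (Tp d n F) m : ON (Suc n)" if "S.hmono k p m" for k p m
  by(rule vals_T_mono[where ?V2.0 = "ON n", OF _ _ _ _ that Tp_hHom[OF Suc.prems(1)] Suc.IH[OF Suc.prems]])
   (blast intro: ON_add ON_sg ON_zero ON_br)+
 thus ?case unfolding Tp_Suc vals_def by blast
qed simp

lemma vals_Tp_ZN: "F : C d ==> vals (ZN (k + n)) F ==> vals (ZN k) (Tp d n F)"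
proof (induction n arbitrary: k)
 case (Suc n)
 hence "vals (ZN (Suc k)) (Tp d n F)" by simp
 hence "brc d xS (Tp d n F) m : ZN k" if "S.hmono l p m" for l p m
  by(intro vals_T_mono[where ?V2.0 = "ZN (Suc k)", OF _ _ _ _ that Tp_hHom[OF Suc.prems(1)]])
   (blast intro: ZN_add ZN_sg ZN_zero ZN_br hpc)+
 thus ?case unfolding Tp_Suc vals_def by blast
qed simp

lemma vals_brc_mono:
 "S.hmono n p m ==> F : C d ==> G : C e ==> vals (ON j) F ==> vals (ZN (Suc j)) G ==> brc e F G m = \<zero>"
proof (induction arbitrary: d e F G rule: S.hmono.induct)
 case one
 have "F 1[SA] : ON j" "G 1[SA] : ZN (Suc j)" using one S.hmono.one unfolding vals_def by blast+
 hence "br (F 1[SA]) (G 1[SA]) : ZN 0" by(auto simp: ON_def dest: spec[of _ 0])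
 thus ?case by(simp add: conv_one[OF bil_br one(1,2)] ZN_0)
next
 case (mult n p m X q)
 show ?case using mult(3)[OF dl_hHom[OF mult(2,4)] mult(5) vals_dl[OF mult(6,2)] mult(7)]
   mult(3)[OF mult(4) dl_hHom[OF mult(2,5)] mult(6) vals_dl[OF mult(7,2)]]
  by(simp add: conv_in[OF bil_br mult(4,5,2) S.hmonoc[OF mult(1)]])
qed

text \<open>The bracket involves r + 1 operators ad in front of b: the factor (ad x)^k a counts for
  k + 1 of them, and r - k are contained in (ad x)^(r-k) b.\<close>

lemma nil_D: assumes nil: "car L <= ZN (Suc r)" and a: "a : hp L p" and b: "b : hp L q" and m: "S.hmono n s m" and k: "k <= r"
 shows "brc q (Tp p k (cst a)) (Tp q (r - k) (cst b)) m = \<zero>"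
proof -
 have v: "vals (car L) (cst x)" if "x : hp L p'" for x p' using hHom_c[OF cst[OF that]] S.hmonoc unfolding vals_def by blast
 have "vals (ON k) (Tp p k (cst a))" by(rule vals_Tp_ON[OF cst[OF a]]) (use v[OF a] ON_0 in "auto simp: vals_def")
 moreover have "vals (ZN (Suc k)) (Tp q (r - k) (cst b))"
  by(rule vals_Tp_ZN[OF cst[OF b]]) (use v[OF b] nil k in "auto simp: vals_def")
 ultimately show ?thesis using vals_brc_mono[OF m Tp_hHom[OF cst[OF a]] Tp_hHom[OF cst[OF b]]] by blast
qed

end

section \<open>The commutator of the fields of a and b is the field of [a, b]\<close>

section \<open>The bracket of canonical solutions\<close>

context lsa begin

text \<open>On a monomial of length r only the term l of the series for b with j + (n - j + l) = r
  survives, that is l = r - n.\<close>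

lemma brc_psih: assumes a: "a : hp L p" and b: "b : hp L q" and m: "S.hmono r s m" and j: "j <= n" "n <= r"
 shows "brc q (Tp p j (cst a)) (Tp q (n - j) (psih q b)) m = brc q (Tp p j (cst a)) (Tp q (r - j) (cst b)) m \<bullet> tc (r - n)"
proof -
 note mc = S.hmonoc[OF m]
 let ?F = "Tp p j (cst a)"
 have F: "?F : C p" by(rule Tp_hHom[OF cst[OF a]])
 have G: "Tp q l (cst b) : C q" for l by(rule Tp_hHom[OF cst[OF b]])
 have fl: "m' : S.Fl {..r}" if "S.hmono n' p' m'" "n' <= r" for n' p' m'
  using S.Fl.gen[OF that(1) _ K.hpart_one, of "{..r}"] that S.hmonoc[OF that(1)] by(simp add: S.qscal_one)
 \<comment> \<open>Finite combinations can be moved through the bracket, so the series is first cut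
   at r, which changes nothing on monomials of length at most r.\<close>
 have "Agree r (psih q b) (lc L {..r} tc (%l. Tp q l (cst b)))" unfolding Agree_def using psih_eq[OF b fl] by blast
 hence "brc q ?F (Tp q (n - j) (psih q b)) m = brc q ?F (Tp q (n - j) (lc L {..r} tc (%l. Tp q l (cst b)))) m"
  using brc_agree_mono[OF m F Tp_hHom[OF psih[OF b]] Tp_hHom[OF lc_cst[OF b]] Tp_agree[OF psih[OF b] lc_cst[OF b]]] by blast
 also have "Tp q (n - j) (lc L {..r} tc (%l. Tp q l (cst b))) = lc L {..r} tc (%l. Tp q (n - j + l) (cst b))"
  unfolding Tp_add[symmetric] by(rule Tp_lc) (simp_all add: rho_hp G)
 also have "brc q ?F ... = lc L {..r} tc (%l. brc q ?F (Tp q (n - j + l) (cst b)))"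
  by(rule conv_lc_right[OF bil_br F]) (simp_all add: rho_hp G)
 also have "... m = (\<Oplus>l\<in>{..r}. brc q ?F (Tp q (n - j + l) (cst b)) m \<bullet> tc l)" using mc by(simp add: lc_def)
 also have "... = brc q ?F (Tp q (n - j + (r - n)) (cst b)) m \<bullet> tc (r - n)" proof (rule fs_single)
  fix l assume l: "l : {..r}" "l ~= r - n"
  have "brc q ?F (Tp q (n - j + l) (cst b)) m = \<zero>"
   by(rule Ln_brc_mono[OF m F G Ln_Tp_cst[OF a] Ln_Tp_cst[OF b]]) (use l j in auto)
  thus "brc q ?F (Tp q (n - j + l) (cst b)) m \<bullet> tc l = \<zero>" by simp
 qed (use brc_c[OF F G mc] rsc in auto)
 also have "n - j + (r - n) = r - j" using j by simp
 finally show ?thesis .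
qed

text \<open>The coefficient of [(ad x)^k a, (ad x)^(r-k) b] when \<open>psih\<close> of a is
  differentiated along the field of b in degree r: n + 1 is the power of ad x taken from the first
  series, r - n the one taken from the second, and the signed binomial comes from
  \<open>T_Ph_binom\<close>.\<close>

definition "EC r k = (\<Oplus>\<^bsub>K\<^esub>n\<in>{..r}. if k <= n then tc (r - n) *[K] kb (-1) (Suc n) k *[K] tc (Suc n) else 0[K])"

lemma EC_closed [simp]: "EC r k <: K" unfolding EC_def by(rule K.finsum_closed) auto

lemma Fl_of_mono: "S.hmono n p m ==> n : A ==> m : S.Fl A"
 using S.Fl.gen[OF _ _ K.hpart_one, of n p m A] S.hmonoc[of n p m] by(simp add: S.qscal_one)

text \<open>The constant term of Y adds a letter; the other terms of Y do not increase the
  length.\<close>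

lemma Ph_Fl_mono: "S.hmono n p m ==> Y : C y ==> Ph y Y m : S.Fl {..Suc n}"
proof (induction arbitrary: y Y rule: S.hmono.induct)
 case one
 have "io (Y 1[SA]) *[SA] 1[SA] : S.Fl (Suc ` {0})"
  using hHom_c[OF one S.Q.one_closed] Fl_of_mono[OF S.hmono.one] by(intro S.Fl_in) auto
 thus ?case using hHom_c[OF one S.Q.one_closed] by(auto simp: Ph_one[OF one] elim!: S.Fl_mono)
next
 case (mult n p m X q)
 note mc = S.hmonoc[OF mult(1)]
 have "io X *[SA] Ph y Y m : S.Fl (Suc ` {..Suc n})" by(rule S.Fl_in[OF mult(3)[OF mult(4)] hpc[OF mult(2)]])
 hence "io X *[SA] Ph y Y m : S.Fl {..Suc (Suc n)}" by(auto elim!: S.Fl_mono)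
 moreover have "Ph (y + q) (dl X Y) m : S.Fl {..Suc (Suc n)}" using mult(3)[OF dl_hHom[OF mult(2,4)]] by(auto elim!: S.Fl_mono)
 ultimately show ?case unfolding Ph_in[OF mult(4,2) mc] by(intro S.Fl.add S.Fl_sg)
qed

lemma psih_Ph: assumes a: "a : hp L p" and b: "b : hp L q" and m: "S.hmono r s m"
 shows "psih p a (Ph q (psih q b) m) = (\<Oplus>k\<in>{..r}. brc q (Tp p k (cst a)) (Tp q (r - k) (cst b)) m \<bullet> EC r k)"
proof -
 note mc = S.hmonoc[OF m]
 let ?D = "%k. brc q (Tp p k (cst a)) (Tp q (r - k) (cst b)) m"
 let ?e = "%n k. if k <= n then tc (r - n) *[K] kb (-1) (Suc n) k *[K] tc (Suc n) else 0[K]"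
 let ?P = "Ph q (psih q b)"
 have D: "?D k <: L" for k by(rule brc_c[OF Tp_hHom[OF cst[OF a]] Tp_hHom[OF cst[OF b]] mc])
 have e: "?e n k <: K" for n k by simp
 have P: "?P m <: SA" by(rule hHom_c[OF Ph_hHom[OF psih[OF b]] mc])
 have T: "Tp p n (cst a) (?P m) \<bullet> tc n' <: L" for n n' by(intro rsc hHom_c[OF Tp_hHom[OF cst[OF a]] P] rho_closed)
 have t: "Tp p (Suc n) (cst a) (?P m) \<bullet> tc (Suc n) = (\<Oplus>k\<in>{..r}. ?D k \<bullet> ?e n k)" if n: "n : {..r}" for n
 proof -
  have "Tp p (Suc n) (cst a) (?P m) = cmp (Tp p (Suc n) (cst a)) ?P m" using mc by simp
  also have "... = (\<Oplus>k\<in>{..n}. brc q (Tp p k (cst a)) (Tp q (n - k) (psih q b)) m \<bullet> kb (-1) (Suc n) k)"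
   unfolding T_Ph_binom[OF cst[OF a] psih[OF b] cst_Ph[OF a psih[OF b]]] lc_def using mc by simp
  also have "... = (\<Oplus>k\<in>{..n}. (?D k \<bullet> tc (r - n)) \<bullet> kb (-1) (Suc n) k)"
   using n D brc_psih[OF a b m] by(intro finsum_cong') (simp_all add: rsc)
  finally have "Tp p (Suc n) (cst a) (?P m) \<bullet> tc (Suc n) = (\<Oplus>k\<in>{..n}. ((?D k \<bullet> tc (r - n)) \<bullet> kb (-1) (Suc n) k) \<bullet> tc (Suc n))"
   using D by(simp add: rs_fs_left rsc)
  also have "... = (\<Oplus>k\<in>{..r}. ?D k \<bullet> ?e n k)"
   by(rule add.finprod_mono_neutral_cong_left) (use n D in "auto simp: rsc rsmult_assoc")
  finally show ?thesis .
 qed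
 have "psih p a (?P m) = (\<Oplus>n\<in>{..Suc r}. Tp p n (cst a) (?P m) \<bullet> tc n)"
  unfolding psih_eq[OF a Ph_Fl_mono[OF m psih[OF b]]] using P by(simp add: lc_def)
 \<comment> \<open>The term n = 0 is split off: it is a constant and has zero derivative, so the
   remaining powers are indexed by \<open>Suc n\<close>.\<close>
 also have "... = (\<Oplus>n\<in>{..r}. Tp p (Suc n) (cst a) (?P m) \<bullet> tc (Suc n)) \<oplus> cst a (?P m) \<bullet> tc 0"
  using T T[of 0] by(subst finsum_Suc2) simp_all
 also have "cst a (?P m) = \<zero>" using fun_cong[OF cst_Ph[OF a psih[OF b]], of m] mc by simp
 also have "(\<Oplus>n\<in>{..r}. Tp p (Suc n) (cst a) (?P m) \<bullet> tc (Suc n)) \<oplus> \<zero> \<bullet> tc 0 = (\<Oplus>n\<in>{..r}. Tp p (Suc n) (cst a) (?P m) \<bullet> tc (Suc n))"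
  using T by(simp add: finsum_closed)
 also have "... = (\<Oplus>n\<in>{..r}. \<Oplus>k\<in>{..r}. ?D k \<bullet> ?e n k)"
  using t rsc[OF D e] by(intro finsum_cong') (auto intro!: finsum_closed)
 also have "... = (\<Oplus>k\<in>{..r}. \<Oplus>n\<in>{..r}. ?D k \<bullet> ?e n k)" using rsc[OF D e] by(intro finsum_swap) auto
 also have "... = (\<Oplus>k\<in>{..r}. ?D k \<bullet> EC r k)"
  unfolding EC_def using D e by(intro finsum_cong') (auto intro!: rs_fs_right[symmetric] rsc K.finsum_closed)
 finally show ?thesis .
qed

text \<open>The image of \<open>todd_identity'\<close> in \<open>K\<close>. The bound r + 1 on the
  coefficients is attained in the summand n = r of \<open>EC\<close>.\<close>

lemma EC_identity: assumes good: "!!n. n <= Suc r ==> kgood (td n)" and k: "k <= r"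
 shows "EC r k +[K] EC r (r - k) = kb 1 r k *[K] tc r"
proof -
 let ?f = "%k n. if k <= n then td (Suc n) * td (r - n) * of_nat (Suc n choose k) else 0"
 have bin: "kgood (of_nat j)" "\<rho> (of_nat j) = ki (int j)" for j using rho_int[of "int j"] by simp_all
 have m1: "kgood (-1)" "\<rho> (-1) = ki (-1)" using rho_int[of "-1"] by simp_all
 have g: "kgood (?f k n)" if "n : {..r}" for k n using that good by(auto intro!: rho_mult(1) bin rho_zero)
 have E: "EC r k = ki (-1) *[K] \<rho> (\<Sum>n\<le>r. ?f k n) & kgood (\<Sum>n\<le>r. ?f k n)" for k proof -
  have "EC r k = (\<Oplus>\<^bsub>K\<^esub>n\<in>{..r}. ki (-1) *[K] \<rho> (?f k n))" unfolding EC_def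
  proof (intro K.finsum_cong')
   fix n assume n: "n : {..r}"
   hence gg: "kgood (td (Suc n))" "kgood (td (r - n))" using good by auto
   have "tc (r - n) *[K] kb (-1) (Suc n) k *[K] tc (Suc n) = \<rho> (td (r - n) * (-1 * of_nat (Suc n choose k)) * td (Suc n))"
    using gg bin m1 by(simp only: rho_mult ki_mult)
   also have "td (r - n) * (-1 * of_nat (Suc n choose k)) * td (Suc n) =
     (-1) * (td (Suc n) * td (r - n) * of_nat (Suc n choose k))" by(simp only: mult_ac)
   also have "\<rho> ... = ki (-1) *[K] \<rho> (td (Suc n) * td (r - n) * of_nat (Suc n choose k))"
    using gg bin m1 by(simp only: rho_mult)
   finally show "(if k <= n then tc (r - n) *[K] kb (-1) (Suc n) k *[K] tc (Suc n) else 0[K]) = ki (-1) *[K] \<rho> (?f k n)"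
    by(simp add: rho_zero)
  qed auto
  also have "... = ki (-1) *[K] (\<Oplus>\<^bsub>K\<^esub>n\<in>{..r}. \<rho> (?f k n))" by(rule K.finsum_rdistr[symmetric]) auto
  finally show ?thesis using rho_sum[of "{..r}" "?f k"] g by auto
 qed
 let ?A = "\<Sum>n\<le>r. ?f k n" and ?B = "\<Sum>n\<le>r. ?f (r - k) n"
 note gA = conjunct2[OF E[of k]] and gB = conjunct2[OF E[of "r - k"]]
 have "EC r k +[K] EC r (r - k) = \<rho> ((-1) * (?A + ?B))"
  unfolding rho_mult(2)[OF m1(1) rho_add(1)[OF gA gB]] rho_add(2)[OF gA gB] m1(2)
   conjunct1[OF E[of k]] conjunct1[OF E[of "r - k"]] by(simp add: K.r_distr)
 also have "(-1) * (?A + ?B) = of_nat (r choose k) * td r" using todd_identity'[OF k] by(simp add: algebra_simps)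
 also have "\<rho> ... = kb 1 r k *[K] tc r" using bin good by(simp add: rho_mult)
 finally show ?thesis .
qed

text \<open>The condition on a single degree r under which the comparison of coefficients works:
  either all coefficients up to c_(r+1) have invertible denominators, or products of r + 1 operators
  ad vanish on g. For an N-nilpotent g the first alternative covers r + 1 < N and the second one the
  rest.\<close>

definition "todd_ok \<longleftrightarrow> (ALL r. (ALL n<=Suc r. kgood (td n)) \<or> car L <= ZN (Suc r))"

text \<open>On monomials of length r the left side is the sum of D_k (EC r k + EC r (r - k)) with
  D_k = [(ad x)^k a, (ad x)^(r-k) b]; the reversal of k comes from exchanging a and b in the second
  half of the commutator. The Leibniz formula for (ad x)^r [a, b] gives the coefficients binomial(r,
  k) c_r on the right.\<close>

theorem cmt_psih: assumes ok: todd_ok and a: "a : hp L p" and b: "b : hp L q"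
 shows "cmt p q (psih p a) (psih q b) = psih (p + q) (br a b)"
proof (rule C_ext[OF cmt_hHom[OF psih[OF a] psih[OF b]] psih[OF lbr_hpart[OF a b]] abx])
 fix r s m assume m: "S.hmono r s m"
 note mc = S.hmonoc[OF m]
 let ?D = "%k. brc q (Tp p k (cst a)) (Tp q (r - k) (cst b)) m"
 have D: "?D k <: L" for k by(rule brc_c[OF Tp_hHom[OF cst[OF a]] Tp_hHom[OF cst[OF b]] mc])
 have De: "?D k \<bullet> EC r l <: L" for k l by(rule rsc[OF D EC_closed])
 have D': "brc p (Tp q (r - k) (cst b)) (Tp p k (cst a)) m \<bullet> EC r (r - k) = sg L (p * q + 1) (?D k \<bullet> EC r (r - k))" for k
  using D by(simp add: brc_skew_mono[OF m Tp_hHom[OF cst[OF b]] Tp_hHom[OF cst[OF a]]] mult.commute[of q p] rs_sg)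
 have "psih q b (Ph p (psih p a) m) = (\<Oplus>k\<in>{..r}. brc p (Tp q k (cst b)) (Tp p (r - k) (cst a)) m \<bullet> EC r k)"
  by(rule psih_Ph[OF b a m])
 also have "... = (\<Oplus>k\<in>(%k. r - k) ` {..r}. brc p (Tp q k (cst b)) (Tp p (r - k) (cst a)) m \<bullet> EC r k)" proof -
  have "k : (%k. r - k) ` {..r}" if "k <= r" for k using that by(intro image_eqI[of _ _ "r - k"]) auto
  hence "(%k. r - k) ` {..r} = {..r}" by auto
  thus ?thesis by simp
 qed
 also have "... = (\<Oplus>k\<in>{..r}. brc p (Tp q (r - k) (cst b)) (Tp p (r - (r - k)) (cst a)) m \<bullet> EC r (r - k))"
  by(rule finsum_reindex)
   (auto simp: inj_on_def intro!: rsc brc_c[OF Tp_hHom[OF cst[OF b]] Tp_hHom[OF cst[OF a]] mc])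
 also have "... = (\<Oplus>k\<in>{..r}. sg L (p * q + 1) (?D k \<bullet> EC r (r - k)))"
  using De by(intro finsum_cong') (simp_all add: D')
 also have "... = sg L (p * q + 1) (\<Oplus>k\<in>{..r}. ?D k \<bullet> EC r (r - k))"
  using De by(intro am_fs[OF abx abx sg_am, symmetric]) auto
 finally have "sg L (p * q + 1) (psih q b (Ph p (psih p a) m)) = (\<Oplus>k\<in>{..r}. ?D k \<bullet> EC r (r - k))"
  using De by(simp add: sg_sg finsum_closed)
 hence "cmt p q (psih p a) (psih q b) m = (\<Oplus>k\<in>{..r}. ?D k \<bullet> EC r k) \<oplus> (\<Oplus>k\<in>{..r}. ?D k \<bullet> EC r (r - k))"
  using mc by(simp add: cmt_def lin2_def psih_Ph[OF a b m])
 also have "... = (\<Oplus>k\<in>{..r}. ?D k \<bullet> EC r k \<oplus> ?D k \<bullet> EC r (r - k))"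
  using De by(intro finsum_addf[symmetric]) auto
 also have "... = (\<Oplus>k\<in>{..r}. ?D k \<bullet> kb 1 r k \<bullet> tc r)" proof (intro finsum_cong')
  fix k assume k: "k : {..r}"
  from ok consider "ALL n<=Suc r. kgood (td n)" | "car L <= ZN (Suc r)" unfolding todd_ok_def by blast
  thus "?D k \<bullet> EC r k \<oplus> ?D k \<bullet> EC r (r - k) = ?D k \<bullet> kb 1 r k \<bullet> tc r" proof cases
   case 1
   thus ?thesis using EC_identity[of r k] k D by(simp flip: rsmult_add_right rsmult_assoc)
  next
   case 2
   thus ?thesis using nil_D[OF 2 a b m, of k] k by simp
  qed
 qed (use D rsc in auto)
 also have "... = (\<Oplus>k\<in>{..r}. ?D k \<bullet> kb 1 r k) \<bullet> tc r"
  using D by(intro rs_fs_left[symmetric]) (auto intro: rsc)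
 also have "(\<Oplus>k\<in>{..r}. ?D k \<bullet> kb 1 r k) = Tp (p + q) r (cst (br a b)) m"
  using mc by(simp only: brc_cst[OF a b, symmetric] T_binom[OF cst[OF a] cst[OF b]] lc_def restrict_apply')
 also have "... \<bullet> tc r = (\<Oplus>n\<in>{..r}. Tp (p + q) n (cst (br a b)) m \<bullet> tc n)"
  by(rule fs_single[symmetric])
   (use Ln_Tp_cst[OF lbr_hpart[OF a b]] m hHom_c[OF Tp_hHom[OF cst[OF lbr_hpart[OF a b]]] mc] in "auto simp: Ln_def intro!: rsc")
 also have "... = psih (p + q) (br a b) m"
  using psih_eq[OF lbr_hpart[OF a b] Fl_of_mono[OF m, of "{..r}"]] mc by(simp add: lc_def)
 finally show "cmt p q (psih p a) (psih q b) m = psih (p + q) (br a b) m" .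
qed

theorem Ph_psih_comm: assumes "todd_ok" "a : hp L p" "b : hp L q" "S.hmono n r m"
 shows "Ph p (psih p a) (Ph q (psih q b) m) = sg SA (p * q) (Ph q (psih q b) (Ph p (psih p a) m)) +[SA] Ph (p + q) (psih (p + q) (br a b)) m"
 using Ph_comm_mono[OF assms(4) psih[OF assms(2)] psih[OF assms(3)]] cmt_psih[OF assms(1-3)] by simp

end

section \<open>Agreement with the sum over permutations that defines phi_1^a\<close>

section \<open>The explicit formula\<close>

text \<open>The Koszul exponent of a list of indices in recursive form, adapted to removing the
  first entry.\<close>

fun inversions :: "(nat => bit) => nat list => bit" where
 "inversions P [] = 0"
| "inversions P (i # zs) = (\<Sum>j\<in>set zs. if j < i then P i * P j else 0) + inversions P zs"

lemma inversions_nth: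
 "distinct zs ==> inversions P zs = (\<Sum>(a, b)\<in>{(a, b). a < b & b < length zs & zs ! b < zs ! a}. P (zs ! a) * P (zs ! b))"
proof (induction zs)
 case (Cons i zs)
 let ?S = "%zs::nat list. {(a, b). a < b & b < length zs & zs ! b < zs ! a}"
 let ?A = "(%b. (0::nat, Suc b)) ` {b. b < length zs & zs ! b < i}" and ?B = "map_prod Suc Suc ` ?S zs"
 let ?f = "%(a, b). P ((i # zs) ! a) * P ((i # zs) ! b)"
 have "finite (?S zs)" by(rule finite_subset[of _ "{..<length zs} \<times> {..<length zs}"]) auto
 hence fin: "finite ?A" "finite ?B" by auto
 have "x : ?S (i # zs) \<longleftrightarrow> x : ?A Un ?B" for x proof (cases x)
  case (Pair a b)
  show ?thesis proof (cases a)
   case 0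
   thus ?thesis using Pair by(cases b) auto
  next
   case (Suc a')
   thus ?thesis using Pair by(cases b) (auto simp: image_iff)
  qed
 qed
 hence "?S (i # zs) = ?A Un ?B" by blast
 hence "sum ?f (?S (i # zs)) = sum ?f ?A + sum ?f ?B" using sum.union_disjoint[OF fin, of ?f] by auto
 also have "sum ?f ?A = (\<Sum>b\<in>{b. b < length zs & zs ! b < i}. P i * P (zs ! b))"
  by(subst sum.reindex) (auto simp: inj_on_def)
 also have "... = (\<Sum>b<length zs. if zs ! b < i then P i * P (zs ! b) else 0)" by(rule sum.mono_neutral_cong_left) auto
 also have "... = (\<Sum>j\<in>set zs. if j < i then P i * P j else 0)"
  using bij_betw_nth[of zs "{..<length zs}" "set zs"] Cons.prems by(intro sum.reindex_bij_betw) auto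
 also have "sum ?f ?B = (\<Sum>(a, b)\<in>?S zs. P (zs ! a) * P (zs ! b))"
  by(subst sum.reindex) (auto simp: inj_on_def intro!: sum.cong)
 finally show ?case using Cons by simp
qed simp

lemma koszul_inversions: assumes "s permutes {..<length ps}" shows "koszul ps s = inversions ((!) ps) (map s [0..<length ps])"
proof -
 have d: "distinct (map s [0..<length ps])" using permutes_inj_on[OF assms] by(simp add: distinct_map)
 show ?thesis unfolding koszul_def inversions_nth[OF d] by(rule sum.cong) auto
qed

text \<open>Permutations become lists, over which a sum can be split by the first entry.\<close>

lemma perms_lessThan: "permutations_of_set {..<n} = (%s. map s [0..<n]) ` {s. s permutes {..<n}}"
proof (intro equalityI subsetI)
 fix zs assume zs: "zs : permutations_of_set {..<n}"
 let ?s = "%i. if i < n then zs ! i else i"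
 note z = permutations_of_setD[OF zs] length_finite_permutations_of_set[OF zs]
 have "bij_betw ((!) zs) {..<n} {..<n}" using z by(intro bij_betw_nth) auto
 hence "bij_betw ?s {..<n} {..<n}" by(subst bij_betw_cong[of _ _ "(!) zs"]) auto
 hence "?s permutes {..<n}" by(rule bij_imp_permutes) simp
 moreover have "zs = map ?s [0..<n]" using z by(intro nth_equalityI) auto
 ultimately show "zs : (%s. map s [0..<n]) ` {s. s permutes {..<n}}" by blast
next
 fix zs assume "zs : (%s. map s [0..<n]) ` {s. s permutes {..<n}}"
 then obtain s where s: "s permutes {..<n}" "zs = map s [0..<n]" by blast
 show "zs : permutations_of_set {..<n}" using permutes_inj_on[OF s(1)] permutes_image[OF s(1)] unfolding s(2)
  by(intro permutations_of_setI) (simp_all add: distinct_map atLeast0LessThan)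
qed

lemma inj_on_permutes_map: "inj_on (%s. map s [0..<n]) {s. s permutes {..<n}}"
proof (rule inj_onI)
 fix s t assume h: "s : {s. s permutes {..<n}}" "t : {s. s permutes {..<n}}" "map s [0..<n] = map t [0..<n]"
 have "s i = t i" for i using h by(cases "i < n") (auto simp: permutes_def)
 thus "s = t" by blast
qed

context lsa begin

text \<open>Letters are indexed by a finite set of numbers and multiplied in increasing order, so a
  word with an inner letter removed is again of this form.\<close>

definition "word X A = foldr (%i u. io (X i) *[SA] u) (sorted_list_of_set A) 1[SA]"

lemma word_empty [simp]: "word X {} = 1[SA]" by(simp add: word_def)

lemma word_insert: assumes "finite A" "ALL a:A. b < a" shows "word X (insert b A) = io (X b) *[SA] word X A"
proof -
 have "b ~: A" using assms by blast
 moreover have "insort b (sorted_list_of_set A) = b # sorted_list_of_set A"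
  using assms by(intro insort_is_Cons) (auto intro: less_imp_le)
 ultimately show ?thesis using assms by(simp add: word_def)
qed

lemma word_hmono: "finite A ==> (!!i. i : A ==> X i : hp L (P i)) ==> S.hmono (card A) (sum P A) (word X A)"
proof (induction A rule: finite_linorder_min_induct)
 case (insert b A)
 have nb: "b ~: A" using insert by blast
 have "S.hmono (Suc (card A)) (P b + sum P A) (io (X b) *[SA] word X A)" using insert by(intro S.hmono.mult) auto
 thus ?case using insert nb word_insert[of A b X] by simp
qed (simp add: S.hmono.one)

text \<open>Each summand extracts one letter X_i. The inner sum in the exponent is the sign for
  moving it in front of the earlier letters, and \<open>P i * d\<close> the sign for moving it past
  F.\<close>

lemma T_word:
 "finite A ==> (!!i. i : A ==> X i : hp L (P i)) ==> F : C d ==>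
 brc d xS F (word X A) = (\<Oplus>i\<in>A. sg L (P i * d + (\<Sum>j\<in>A. if j < i then P i * P j else 0)) (br (X i) (F (word X (A - {i})))))"
proof (induction A arbitrary: d F rule: finite_linorder_min_induct)
 case empty
 have "xS 1[SA] = \<zero>" by(simp add: xS_def prL_one)
 thus ?case using hHom_c[OF empty(2) S.Q.one_closed] by(simp add: conv_one[OF bil_br xS empty(2)] br_zero)
next
 case (insert b A)
 have nb: "b ~: A" using insert(2) by blast
 have XA: "!!i. i : A ==> X i : hp L (P i)" and Xb: "X b : hp L (P b)" using insert(4) by auto
 note F = insert(5)
 have hm: "S.hmono (card B) (sum P B) (word X B)" if "B <= A" for B
  using that insert(1) XA by(intro word_hmono) (auto intro: finite_subset)
 note wc = S.hmonoc[OF hm]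
 have wd: "word X B <: SA" if "B <= insert b A" for B
  using that insert(1,4) S.hmonoc[OF word_hmono[of B X P]] by(meson finite_insert finite_subset subsetD)
 have br_cl: "br (X i) (F (word X (insert b A - {i}))) <: L" if "i : insert b A" for i
  using hpc[OF insert(4)[OF that]] hHom_c[OF F wd[of "insert b A - {i}"]] lbr_closed by blast
 let ?c = "%B i. \<Sum>j\<in>B. if j < i then P i * P j else 0"
 have "brc d xS F (word X (insert b A)) = sg L (P b * d) (br (X b) (F (word X A))) \<oplus> brc (d + P b) xS (dl (X b) F) (word X A)"
  unfolding word_insert[OF insert(1,2)] conv_in[OF bil_br xS F Xb wc[OF subset_refl]] dl_xS[OF Xb] cst_brc[OF hm[OF subset_refl] Xb F] ..
 also have "br (X b) (F (word X A)) = br (X b) (F (word X (insert b A - {b})))" using nb by simp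
 \<comment> \<open>\<open>b\<close> is the smallest index, so the added sum is empty of nonzero
   terms.\<close>
 also have "P b * d = P b * d + ?c (insert b A) b" using insert(1,2) by(auto intro!: sum.neutral)
 also have "brc (d + P b) xS (dl (X b) F) (word X A) =
   (\<Oplus>i\<in>A. sg L (P i * (d + P b) + ?c A i) (br (X i) (dl (X b) F (word X (A - {i})))))"
  by(rule insert(3)[OF XA dl_hHom[OF Xb F]])
 also have "... = (\<Oplus>i\<in>A. sg L (P i * d + ?c (insert b A) i) (br (X i) (F (word X (insert b A - {i})))))"
 proof (intro finsum_cong')
  fix i assume i: "i : A"
  have "insert b A - {i} = insert b (A - {i})" using i nb by auto
  hence "word X (insert b A - {i}) = io (X b) *[SA] word X (A - {i})" using word_insert[of "A - {i}" b X] insert(1,2) by auto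
  moreover have "b < i" using i insert(2) by blast
  hence "P i * (d + P b) + ?c A i = P i * d + ?c (insert b A) i" using insert(1) nb by(simp add: algebra_simps)
  ultimately show "sg L (P i * (d + P b) + ?c A i) (br (X i) (dl (X b) F (word X (A - {i})))) =
    sg L (P i * d + ?c (insert b A) i) (br (X i) (F (word X (insert b A - {i}))))" using wc[of "A - {i}"] by auto
 qed (use br_cl in auto)
 finally have e: "brc d xS F (word X (insert b A)) = sg L (P b * d + ?c (insert b A) b) (br (X b) (F (word X (insert b A - {b})))) \<oplus>
   (\<Oplus>i\<in>A. sg L (P i * d + ?c (insert b A) i) (br (X i) (F (word X (insert b A - {i})))))" .
 show ?case unfolding e by(rule finsum_insert[symmetric]) (use insert(1) nb br_cl br_cl[of b] in auto)
qed

definition "psum X P A a = (\<Oplus>zs\<in>permutations_of_set A. sg L (inversions P zs) (foldr (%i. br (X i)) zs a))"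

lemma foldr_br_c: "(!!i. i : set zs ==> X i <: L) ==> a <: L ==> foldr (%i. br (X i)) zs a <: L"
 by(induction zs) (simp_all add: lbr_closed)

lemma psum_c: "(!!i. i : A ==> X i <: L) ==> a <: L ==> psum X P A a <: L"
 unfolding psum_def by(intro finsum_closed) (auto intro!: sg_c foldr_br_c dest: permutations_of_setD)

text \<open>Permutations are grouped by their first entry i; the sum over j < i counts the
  inversions in which this entry takes part.\<close>

lemma psum_rec: assumes fin: "finite A" and A: "A ~= {}" and X: "!!i. i : A ==> X i <: L" and a: "a <: L"
 shows "psum X P A a = (\<Oplus>i\<in>A. sg L (\<Sum>j\<in>A. if j < i then P i * P j else 0) (br (X i) (psum X P (A - {i}) a)))"
proof -
 let ?g = "%zs. sg L (inversions P zs) (foldr (%i. br (X i)) zs a)"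
 have g: "?g zs <: L" if "set zs <= A" for zs by(intro sg_c foldr_br_c) (use that X a in auto)
 have "psum X P A a = finsum L ?g (\<Union>i\<in>A. (#) i ` permutations_of_set (A - {i}))"
  unfolding psum_def permutations_of_set_nonempty[OF A] ..
 also have "... = (\<Oplus>i\<in>A. finsum L ?g ((#) i ` permutations_of_set (A - {i})))" by(rule add.finprod_UN_disjoint[OF fin])
   (auto simp: pairwise_def disjnt_def intro!: g dest: permutations_of_setD(1))
 also have "... = (\<Oplus>i\<in>A. sg L (\<Sum>j\<in>A. if j < i then P i * P j else 0) (br (X i) (psum X P (A - {i}) a)))"
 proof (intro finsum_cong')
  fix i assume i: "i : A"
  let ?k = "\<Sum>j\<in>A. if j < i then P i * P j else 0"
  note Xi = X[OF i]
  have gi: "?g zs <: L" if "zs : permutations_of_set (A - {i})" for zs using that by(intro g) (auto dest: permutations_of_setD)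
  have am: "addmap L L (%y. sg L ?k (br (X i) y))" using am_o[OF bilD(5)[OF bil_br Xi] sg_am[of ?k]] by(simp add: comp_def)
  have "finsum L ?g ((#) i ` permutations_of_set (A - {i})) = (\<Oplus>zs\<in>permutations_of_set (A - {i}). ?g (i # zs))"
   using i by(intro finsum_reindex) (auto intro!: g dest: permutations_of_setD(1) simp: inj_on_def)
  also have "... = (\<Oplus>zs\<in>permutations_of_set (A - {i}). sg L ?k (br (X i) (?g zs)))" proof (intro finsum_cong')
   fix zs assume zs: "zs : permutations_of_set (A - {i})"
   have fc: "foldr (%i. br (X i)) zs a <: L" using permutations_of_setD(1)[OF zs] X a by(intro foldr_br_c) auto
   have "?k = (\<Sum>j\<in>set zs. if j < i then P i * P j else 0)"
    unfolding permutations_of_setD(1)[OF zs] using fin i by(subst sum.remove[OF fin i]) simp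
   thus "?g (i # zs) = sg L ?k (br (X i) (?g zs))" using Xi fc by(simp add: bil_sg(1)[OF bil_br] sg_sg lbr_closed)
  qed (use gi Xi lbr_closed in auto)
  also have "... = sg L ?k (br (X i) (psum X P (A - {i}) a))"
   unfolding psum_def by(rule am_fs[OF abx abx am, symmetric]) (use gi in auto)
  finally show "finsum L ?g ((#) i ` permutations_of_set (A - {i})) = sg L ?k (br (X i) (psum X P (A - {i}) a))" .
 qed (use X a in "auto intro!: sg_c lbr_closed psum_c")
 finally show ?thesis .
qed

text \<open>\<open>T_word\<close> and \<open>psum_rec\<close> are the same recursion, up to the sign
  for moving a past all letters.\<close>

lemma Tp_word: assumes a: "a : hp L q" shows "finite A ==> card A = n ==> (!!i. i : A ==> X i : hp L (P i)) ==>
  Tp q n (cst a) (word X A) = sg L (q * sum P A) (psum X P A a)"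
proof (induction n arbitrary: A)
 case 0
 thus ?case using hpc[OF a] by(simp add: psum_def eps_one rsmult_one)
next
 case (Suc n)
 note fin = Suc.prems(1) and X = Suc.prems(3)
 note ac = hpc[OF a]
 have ne: "A ~= {}" using Suc.prems by auto
 let ?c = "%i. \<Sum>j\<in>A. if j < i then P i * P j else 0"
 have Xc: "X i <: L" if "i : A" for i using hpc[OF X[OF that]] .
 have pc: "br (X i) (psum X P (A - {i}) a) <: L" if "i : A" for i using that Xc ac by(intro lbr_closed psum_c) auto
 have "Tp q (Suc n) (cst a) (word X A) = (\<Oplus>i\<in>A. sg L (P i * q + ?c i) (br (X i) (Tp q n (cst a) (word X (A - {i})))))"
  unfolding Tp_Suc by(rule T_word[OF fin X Tp_hHom[OF cst[OF a]]])
 also have "... = (\<Oplus>i\<in>A. sg L (q * sum P A) (sg L (?c i) (br (X i) (psum X P (A - {i}) a))))"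
 proof (intro finsum_cong')
  fix i assume i: "i : A"
  have T: "Tp q n (cst a) (word X (A - {i})) = sg L (q * sum P (A - {i})) (psum X P (A - {i}) a)"
   using Suc i by(intro Suc.IH) auto
  have e: "P i * q + ?c i + q * sum P (A - {i}) = q * sum P A + ?c i" using sum.remove[OF fin i, of P] by(simp add: algebra_simps)
  have pi: "psum X P (A - {i}) a <: L" using Xc ac by(intro psum_c) auto
  show "sg L (P i * q + ?c i) (br (X i) (Tp q n (cst a) (word X (A - {i})))) =
    sg L (q * sum P A) (sg L (?c i) (br (X i) (psum X P (A - {i}) a)))"
   by(simp only: T bil_sg(1)[OF bil_br Xc[OF i] pi] sg_sg[OF pc[OF i]] e)
 qed (use pc in auto)
 also have "... = sg L (q * sum P A) (psum X P A a)" proof -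
  have "psum X P A a = (\<Oplus>i\<in>A. sg L (?c i) (br (X i) (psum X P (A - {i}) a)))" by(rule psum_rec[OF fin ne Xc ac])
  thus ?thesis using am_fs[OF abx abx sg_am, of "%i. sg L (?c i) (br (X i) (psum X P (A - {i}) a))" A "q * sum P A"] pc by auto
 qed
 finally show ?case .
qed

lemma psih_mono: assumes a: "a : hp L p" and m: "S.hmono n r m" shows "psih p a m = Tp p n (cst a) m \<bullet> tc n"
proof -
 note mc = S.hmonoc[OF m]
 have "psih p a m = (\<Oplus>k\<in>{..n}. Tp p k (cst a) m \<bullet> tc k)"
  using psih_eq[OF a Fl_of_mono[OF m, of "{..n}"]] mc by(simp add: lc_def)
 also have "... = Tp p n (cst a) m \<bullet> tc n" by(rule fs_single)
   (use Ln_Tp_cst[OF a] m hHom_c[OF Tp_hHom[OF cst[OF a]] mc] in "auto simp: Ln_def intro!: rsc")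
 finally show ?thesis .
qed

lemma hmono_wordE: assumes "S.hmono n p m"
 obtains Xs ps where "hps L Xs ps" "m = mprod SA (map io Xs)" using assms
proof (induction arbitrary: thesis rule: S.hmono.induct)
 case one
 thus ?case using one[of "[]" "[]"] by(simp add: mprod_def)
next
 case (mult n p m X q)
 obtain Xs ps where "hps L Xs ps" "m = mprod SA (map io Xs)" using mult.IH by blast
 thus ?case using mult.prems[of "X # Xs" "q # ps"] mult.hyps by(simp add: mprod_def)
qed

definition "psi a = (\<lambda>u\<in>car SA. psih 0 (hcomp L 0 a) u \<oplus> psih 1 (hcomp L 1 a) u)"

lemma psi_Hom: assumes a: "a <: L" shows "psi a : Hom K SA L"
proof (rule HomI)
 have h: "psih i (hcomp L i a) : C i" for i by(rule psih[OF hcomp_h[OF a]])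
 note c = hHom_c[OF h]
 show "psi a (x +[SA] y) = psi a x \<oplus> psi a y" if "x <: SA" "y <: SA" for x y
  using that c by(simp add: psi_def hHom_add[OF h] a_ac)
 show "psi a (x .[SA] b) = psi a x \<bullet> b" if "x <: SA" "b <: K" for x b
  using that c hHom_rs[OF h that] S.Q.rsc[OF that] by(simp add: psi_def rsmult_add_left)
qed (use hHom_c[OF psih[OF hcomp_h[OF a]]] in "simp_all add: psi_def")

lemma psih_word: assumes a: "a : hp L q" and Xs: "hps L Xs ps" shows "psih q a (mprod SA (map io Xs)) = sg L (q * sum_list ps)
  ((\<Oplus>s\<in>{s. s permutes {..<length Xs}}. sg L (koszul ps s) (foldr (%i Y. br (Xs ! s i) Y) [0..<length Xs] a))
   \<bullet> tc (length Xs))"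
proof -
 let ?n = "length Xs"
 have len: "length ps = ?n" using Xs by(simp add: list_all2_lengthD)
 have X: "Xs ! i : hp L (ps ! i)" if "i : {..<?n}" for i using list_all2_nthD[OF Xs] that by simp
 have Xc: "Xs ! i <: L" if "i : {..<?n}" for i using hpc[OF X[OF that]] .
 have w: "mprod SA (map io Xs) = word ((!) Xs) {..<?n}" proof -
  have "mprod SA (map io Xs) = mprod SA (map (%i. io (Xs ! i)) [0..<?n])"
   by(rule arg_cong[of _ _ "mprod SA"], rule nth_equalityI) simp_all
  thus ?thesis by(simp add: word_def mprod_def foldr_map comp_def lessThan_atLeast0)
 qed
 have p: "psum ((!) Xs) ((!) ps) {..<?n} a =
   (\<Oplus>s\<in>{s. s permutes {..<?n}}. sg L (koszul ps s) (foldr (%i Y. br (Xs ! s i) Y) [0..<?n] a))" (is "_ = ?R") proof -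
  let ?g = "%zs. sg L (inversions ((!) ps) zs) (foldr (%i. br (Xs ! i)) zs a)"
  have gc: "?g zs <: L" if "zs : permutations_of_set {..<?n}" for zs
   by(intro sg_c foldr_br_c) (use permutations_of_setD(1)[OF that] Xc hpc[OF a] in auto)
  have "psum ((!) Xs) ((!) ps) {..<?n} a = (\<Oplus>s\<in>{s. s permutes {..<?n}}. ?g (map s [0..<?n]))"
   unfolding psum_def perms_lessThan by(rule finsum_reindex) (use gc[unfolded perms_lessThan] inj_on_permutes_map in auto)
  also have "... = ?R" proof (rule finsum_cong')
   fix s assume "s : {s. s permutes {..<?n}}"
   thus "?g (map s [0..<?n]) = sg L (koszul ps s) (foldr (%i Y. br (Xs ! s i) Y) [0..<?n] a)"
    using koszul_inversions[of s ps] len by(simp add: foldr_map comp_def)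
  next
   show "(%s. sg L (koszul ps s) (foldr (%i Y. br (Xs ! s i) Y) [0..<?n] a)) : {s. s permutes {..<?n}} \<rightarrow> car L"
    using permutes_in_image Xc hpc[OF a] by(fastforce intro!: sg_c foldr_br_c)
  qed simp
  finally show ?thesis .
 qed
 have pc: "psum ((!) Xs) ((!) ps) {..<?n} a <: L" using Xc hpc[OF a] by(intro psum_c) auto
 have "psih q a (word ((!) Xs) {..<?n}) = sg L (q * sum ((!) ps) {..<?n}) (psum ((!) Xs) ((!) ps) {..<?n} a) \<bullet> tc ?n"
  using psih_mono[OF a word_hmono[of "{..<?n}", OF _ X]] Tp_word[OF a, of "{..<?n}" ?n, OF _ _ X] by simp
 moreover have "sum ((!) ps) {..<?n} = sum_list ps" by(simp add: sum_list_sum_nth len lessThan_atLeast0)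
 ultimately show ?thesis using pc unfolding w p[symmetric] by(simp add: rs_sg)
qed

text \<open>\<open>psih_word\<close> shows that \<open>psi a\<close> satisfies the defining formula,
  and a linear map on S(g) is determined by homogeneous words; so the description in
  \<open>phi1\<close> is met by \<open>psi a\<close> alone.\<close>

lemma phi1_eq: assumes a: "a <: L" shows "phi1 K L a = psi a" unfolding phi1_def
proof (rule the_equality)
 let ?R = "%Xs ps q. sg L (q * sum_list ps) ((\<Oplus>s\<in>{s. s permutes {..<length Xs}}. sg L (koszul ps s) (foldr (%i Y. br (Xs ! s i) Y) [0..<length Xs] (hcomp L q a))) \<bullet> tc (length Xs))"
 have h: "psi a (mprod SA (map io Xs)) = (\<Oplus>q\<in>{0,1}. ?R Xs ps q)" if Xs: "hps L Xs ps" for Xs ps proof -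
  note m = S.hmono_word[OF Xs]
  note c = hHom_c[OF psih[OF hcomp_h[OF a]] S.hmonoc[OF m]]
  note e = psih_word[OF hcomp_h[OF a] Xs]
  show ?thesis using S.hmonoc[OF m] c[of 0] c[of 1] unfolding e by(simp add: psi_def e)
 qed
 show "psi a : Hom K SA L & (ALL Xs ps. hps L Xs ps --> psi a (mprod SA (map io Xs)) = (\<Oplus>q\<in>{0,1}. ?R Xs ps q))"
  using psi_Hom[OF a] h by blast
 fix f assume f: "f : Hom K SA L & (ALL Xs ps. hps L Xs ps --> f (mprod SA (map io Xs)) = (\<Oplus>q\<in>{0,1}. ?R Xs ps q))"
 show "f = psi a" proof (rule S.Q_Hom_eqI[OF conjunct1[OF f] psi_Hom[OF a] abx])
  fix n p m assume "S.hmono n p m"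
  then obtain Xs ps where "hps L Xs ps" "m = mprod SA (map io Xs)" by(rule hmono_wordE)
  thus "f m = psi a m" using f h by simp
 qed
qed

end

section \<open>The operators Phi_1^a and their dependence on the generator\<close>

section \<open>The representation on the symmetric algebra\<close>

context lsa begin

lemma PA_Hom_eqI: assumes "f : Hom K PA N" "g : Hom K PA N" "!!i j v w. v : hp SA i ==> w : hp SA j ==> f (pt v w) = g (pt v w)"
 shows "f = g" by(rule Hom_eqI[OF assms(1,2)]) (rule P_eqI[OF HomD(1)[OF assms(1)] HomD(1)[OF assms(2)] assms(3)])

lemma PA_rs_c: "z <: PA ==> a <: K ==> z .[PA] a <: PA" using amD1[OF pt_rs(1)] .

lemma mult_map: shows "mult_map K SA : Hom K PA SA" "!!x y. x <: SA ==> y <: SA ==> mult_map K SA (pt x y) = x *[SA] y"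
proof -
 obtain H where H: "addmap PA SA H" "!!v w. v <: SA ==> w <: SA ==> H (pt v w) = v *[SA] w"
  by(rule P_lift[OF S.Q.abx, of "(\<otimes>\<^bsub>SA\<^esub>)"])
   (simp_all add: S.Q.l_distr S.Q.r_distr S.Q.m_assoc)
 let ?H = "restrict H (car PA)"
 have hom: "?H : Hom K PA SA" proof (rule HomI)
  show "?H (z .[PA] a) = ?H z .[SA] a" if z: "z <: PA" and a: "a <: K" for z a proof -
   have r: "addmap SA SA (%x. x *[SA] kp a)" by(rule addmapI) (simp_all add: a S.Q.l_distr)
   have "H (z .[PA] a) = H z *[SA] kp a" by(rule P_eqI[OF am_o[OF pt_rs(1)[OF a] H(1)] am_o[OF H(1) r] _ z])
     (use a S.Q.hpc in "simp add: pt_rs(2) H(2) S.Q.m_assoc")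
   thus ?thesis using z a amD1[OF H(1)] by(simp add: PA_rs_c S.Q_rs)
  qed
 qed (simp_all add: addmapD[OF H(1)])
 have "mult_map K SA = ?H" unfolding mult_map_def proof (rule the_equality)
  show "?H : Hom K PA SA & (ALL x:car SA. ALL y:car SA. ?H (pt x y) = x *[SA] y)" using hom H(2) by simp
  fix G assume G: "G : Hom K PA SA & (ALL x:car SA. ALL y:car SA. G (pt x y) = x *[SA] y)"
  show "G = ?H" by(rule PA_Hom_eqI[OF conjunct1[OF G] hom]) (use G H(2) S.Q.hpc in simp)
 qed
 thus "mult_map K SA : Hom K PA SA" "!!x y. x <: SA ==> y <: SA ==> mult_map K SA (pt x y) = x *[SA] y" using hom H(2) by simp_all
qed

text \<open>Evaluates the description \<open>tensor_map\<close> for the identity tensored with F,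
  where \<open>G 0\<close> and \<open>G 1\<close> are the even and odd parts of F; only the odd part
  produces a sign.\<close>

lemma tensor_map_id: assumes G: "!!d. G d : EE d" and F: "F : Hom K SA SA" "!!x. x <: SA ==> F x = G 0 x +[SA] G 1 x"
 defines "H == tensor_map K SA SA SA SA (\<lambda>y\<in>car SA. y) F" shows "H : Hom K PA PA"
  "!!i v w. v : hp SA i ==> w <: SA ==> H (pt v w) = pt v (G 0 w) +[PA] sg PA i (pt v (G 1 w))"
proof -
 note hc = S.Q.hpc
 note Gc = hHom_c[OF G]
 have hcm: "hom_comp SA SA d F = G d" for d by(rule hom_comp_eq[OF S.Q.smodule_axioms S.Q.smodule_axioms F(1) G F(2)])
 obtain M where M: "addmap PA PA M" "!!i j v w. v : hp SA i ==> w : hp SA j ==> M (pt v w) = pt v (G 0 w) +[PA] sg PA i (pt v (G 1 w))"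
 proof (rule P_lift_hom[OF PA_ab, of "%i j v w. pt v (G 0 w) +[PA] sg PA i (pt v (G 1 w))"])
  fix i j l v w a assume h: "v : hp SA i" "w : hp SA j" "a : hp K l"
  note c = hc[OF h(1)] hc[OF h(2)] K.hpc[OF h(3)]
  have "G d (kp a *[SA] w) = sg SA (d * l) (kp a *[SA] G d w)" for d
   using hHom_ls[OF S.Q.smodule_axioms S.Q.smodule_axioms G h(3) c(2), of d] c Gc by(simp add: S.Q_ls)
  thus "pt (v *[SA] kp a) (G 0 w) +[PA] sg PA (i + l) (pt (v *[SA] kp a) (G 1 w)) =
    pt v (G 0 (kp a *[SA] w)) +[PA] sg PA i (pt v (G 1 (kp a *[SA] w)))" using c Gc by(simp add: pt_neg pt_bal PA.sg_sg)
 qed (use hc Gc that in "simp_all add: hHom_add[OF G] pt_add_left pt_add_right PA.sg_add PA.a_ac")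
 have M2: "M (pt v w) = pt v (G 0 w) +[PA] sg PA i (pt v (G 1 w))" if v: "v : hp SA i" and w: "w <: SA" for i v w using w
 proof (induction rule: S.Q.hom_ind)
  case (hom j w) thus ?case using M(2)[OF v] by blast
 next
  case (add x y)
  thus ?case using hc[OF v] Gc amD2[OF M(1)] by(simp add: pt_add_right hHom_add[OF G] PA.sg_add PA.a_ac)
 qed
 let ?M = "restrict M (car PA)"
 have hom: "?M : Hom K PA PA" proof (rule HomI)
  show "?M (z .[PA] a) = ?M z .[PA] a" if z: "z <: PA" and a: "a <: K" for z a proof -
   have "M (z .[PA] a) = M z .[PA] a" proof (rule P_eqI[OF am_o[OF pt_rs(1)[OF a] M(1)] am_o[OF M(1) pt_rs(1)[OF a]] _ z])
    fix i j v w assume vw: "v : hp SA i" "w : hp SA j"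
    note c = hc[OF vw(1)] hc[OF vw(2)]
    have "G d (w *[SA] kp a) = G d w *[SA] kp a" for d using hHom_rs[OF G c(2) a, of d] c a Gc by(simp add: S.Q_rs)
    thus "M (pt v w .[PA] a) = M (pt v w) .[PA] a" using c a Gc M2[OF vw(1)] am_zn(3)[OF PA_ab PA_ab pt_rs(1)[OF a]]
     by(simp add: pt_rs(2)[OF a] amD2[OF pt_rs(1)[OF a]])
   qed
   thus ?thesis using z a by(simp add: PA_rs_c)
  qed
 qed (simp_all add: addmapD[OF M(1)])
 have eq: "(\<Oplus>\<^bsub>PA\<^esub>d\<in>{0,1}. sg PA (d * k) (pt ((\<lambda>y\<in>car SA. y) v) (hom_comp SA SA d F w))) = pt v (G 0 w) +[PA] sg PA k (pt v (G 1 w))"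
  if "v : hp SA k" "w <: SA" for k v w using hc[OF that(1)] that(2) Gc by(simp add: hcm)
 have "H = ?M" unfolding H_def tensor_map_def proof (rule the_equality)
  show "?M : Hom K PA PA & (ALL k. ALL v:hp SA k. ALL w:car SA. ?M (pt v w) =
    (\<Oplus>\<^bsub>PA\<^esub>d\<in>{0,1}. sg PA (d * k) (pt ((\<lambda>y\<in>car SA. y) v) (hom_comp SA SA d F w))))"
   using hom M2 eq hc by simp
  fix N assume N: "N : Hom K PA PA & (ALL k. ALL v:hp SA k. ALL w:car SA. N (pt v w) =
    (\<Oplus>\<^bsub>PA\<^esub>d\<in>{0,1}. sg PA (d * k) (pt ((\<lambda>y\<in>car SA. y) v) (hom_comp SA SA d F w))))"
  show "N = ?M" by(rule PA_Hom_eqI[OF conjunct1[OF N] hom]) (use N M2 eq hc in simp)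
 qed
 thus "H : Hom K PA PA"
  "!!i v w. v : hp SA i ==> w <: SA ==> H (pt v w) = pt v (G 0 w) +[PA] sg PA i (pt v (G 1 w))" using hom M2 hc by simp_all
qed

text \<open>\<open>Ph\<close> carries a parity index, so the generator is split into its even and
  odd part.\<close>

lemma Phi1_eq: assumes a: "a <: L" and u: "u <: SA"
 shows "Phi1 K L a u = Ph 0 (psih 0 (hcomp L 0 a)) u +[SA] Ph 1 (psih 1 (hcomp L 1 a)) u"
proof -
 let ?p = "%d. psih d (hcomp L d a)"
 let ?G = "%d. \<lambda>u\<in>car SA. io (?p d u)"
 let ?F = "\<lambda>y\<in>car SA. io (phi1 K L a y)"
 have p: "?p d : C d" for d by(rule psih[OF hcomp_h[OF a]])
 note pc = hHom_c[OF p]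
 have G: "?G d : EE d" for d by(rule in_comp[OF p])
 note Gc = hHom_c[OF G]
 have F2: "?F x = ?G 0 x +[SA] ?G 1 x" if "x <: SA" for x using that pc by(simp add: phi1_eq[OF a] psi_def S.qin_add)
 have F: "?F : Hom K SA SA" proof (rule HomI)
  show "?F (x +[SA] y) = ?F x +[SA] ?F y" if "x <: SA" "y <: SA" for x y
   using that HomD(4)[OF psi_Hom[OF a] that] HomD(2)[OF psi_Hom[OF a]] by(simp add: phi1_eq[OF a] S.qin_add)
  show "?F (x .[SA] c) = ?F x .[SA] c" if "x <: SA" "c <: K" for x c
   using that HomD(5)[OF psi_Hom[OF a] that] HomD(2)[OF psi_Hom[OF a]] S.Q.rsc[OF that]
   by(simp add: phi1_eq[OF a] S.qin_rs S.Q_rs)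
 qed (use HomD(2)[OF psi_Hom[OF a]] in "simp_all add: phi1_eq[OF a]")
 let ?H = "tensor_map K SA SA SA SA (\<lambda>y\<in>car SA. y) ?F"
 have t: "?H : Hom K PA PA"
  "!!i v w. v : hp SA i ==> w <: SA ==> ?H (pt v w) = pt v (?G 0 w) +[PA] sg PA i (pt v (?G 1 w))"
  by((rule tensor_map_id[of ?G, OF G F], (rule F2, assumption)?, assumption?, assumption?)+)
 note m = mult_map
 let ?cv = "%d. cv SA (\<otimes>\<^bsub>SA\<^esub>) d (\<lambda>u\<in>car SA. u) (?G d)"
 note cvs = cv[OF bil_mult idS G]
 have "mult_map K SA (tensor_map K SA SA SA SA (\<lambda>y\<in>car SA. y) ?F z) = ?cv 0 z +[SA] ?cv 1 z" if z: "z <: PA" for z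
 proof (rule P_eqI[OF am_o[OF HomD(1)[OF t(1)] HomD(1)[OF m(1)]] S.Q.am_add[OF cvs(1) cvs(1)] _ z])
  fix i j v w assume vw: "v : hp SA i" "w : hp SA j"
  note c = S.Q.hpc[OF vw(1)] S.Q.hpc[OF vw(2)]
  show "mult_map K SA (tensor_map K SA SA SA SA (\<lambda>y\<in>car SA. y) ?F (pt v w)) = ?cv 0 (pt v w) +[SA] ?cv 1 (pt v w)"
   using c Gc[OF c(2), of 0] Gc[OF c(2), of 1] am_zn(3)[OF PA_ab S.Q.abx HomD(1)[OF m(1)]]
    cvs(2)[OF vw(1) c(2), of 0] cvs(2)[OF vw(1) c(2), of 1] t(2)[OF vw(1) c(2)] by(simp add: HomD(4)[OF m(1)] m(2) pc)
 qed
 thus ?thesis using coprod_c[OF u] u by(simp add: Phi1_def Let_def Ph_def conv_def)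
qed

subsection \<open>Linearity in the generator\<close>

text \<open>A version of \<open>Q_Hom_eqI\<close> for additive maps that commute with right scalars,
  so that composites need not be made members of \<open>Hom\<close> first.\<close>

lemma lin_eqI: assumes f: "addmap SA SA f" and g: "addmap SA SA g"
  and fr: "!!u a. u <: SA ==> a <: K ==> f (u *[SA] kp a) = f u *[SA] kp a"
  and gr: "!!u a. u <: SA ==> a <: K ==> g (u *[SA] kp a) = g u *[SA] kp a"
  and eq: "!!n p m. S.hmono n p m ==> f m = g m" and u: "u <: SA" shows "f u = g u" by(rule S.Q_am_eqI[OF f g S.Q.abx _ u])
  (use fr gr eq S.hmonoc K.hpc in metis)

lemma EE_rs: "F : EE d ==> u <: SA ==> a <: K ==> F (u *[SA] kp a) = F u *[SA] kp a"
 using hHom_rs[of F K SA SA d u a] hHom_c[of F K SA SA d u] by(simp add: S.Q_rs)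

lemma Tp_lin2: "F : C d ==> G : C d ==> Tp d n (lin2 L k F l G) = lin2 L k (Tp d n F) l (Tp d n G)"
proof (induction n)
 case (Suc n)
 note h = Tp_hHom[OF Suc.prems(1), of n] Tp_hHom[OF Suc.prems(2), of n]
 have "brc d xS (lin2 L k (Tp d n F) l (Tp d n G)) u = lin2 L k (brc d xS (Tp d n F)) l (brc d xS (Tp d n G)) u"
  if "u <: SA" for u using conv_lin2_right[OF bil_br xS h that] that by(simp add: lin2_def)
 thus ?case unfolding Tp_Suc Suc.IH[OF Suc.prems] by(auto simp: fun_eq_iff conv_def lin2_def)
qed simp

lemma psih_add: assumes "a : hp L p" "b : hp L p" shows "psih p (a \<oplus> b) = lin2 L 0 (psih p a) 0 (psih p b)"
proof (rule C_ext[OF psih lin2_hHom[OF smodule_axioms psih psih] abx])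
 fix n r m assume m: "S.hmono n r m"
 note mc = S.hmonoc[OF m]
 have "cst (a \<oplus> b) = lin2 L 0 (cst a) 0 (cst b)"
  using assms amD1[OF eps_addmap] hpc by(auto simp: cst_def lin2_def rsmult_add_left fun_eq_iff)
 hence "Tp p n (cst (a \<oplus> b)) m = Tp p n (cst a) m \<oplus> Tp p n (cst b) m"
  using mc by(simp add: Tp_lin2[OF cst cst] assms) (simp add: lin2_def)
 thus "psih p (a \<oplus> b) m = lin2 L 0 (psih p a) 0 (psih p b) m"
  using assms m mc hHom_c[OF Tp_hHom[OF cst] mc] by(simp add: psih_mono[of _ _ n r] hp_add lin2_def rsmult_add_left)
qed (use assms in "simp_all add: hp_add")

text \<open>\<open>Y'\<close> is the composition of \<open>Y\<close> with the left multiplication by \<open>c\<close>, up to sign.\<close>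

definition "twist c j k Y' Y \<longleftrightarrow> (ALL n r m. S.hmono n r m --> Y' m = sg L (j * r + k) (Y m \<bullet> c))"

lemma twist_dl: assumes t: "twist c j k Y' Y" and X: "X : hp L q" shows "twist c j (k + j * q) (dl X Y') (dl X Y)"
 unfolding twist_def
proof (intro allI impI)
 fix n r m assume m: "S.hmono n r m"
 have "Y' (io X *[SA] m) = sg L (j * (q + r) + k) (Y (io X *[SA] m) \<bullet> c)"
  using t S.hmono.mult[OF m X] unfolding twist_def by blast
 thus "dl X Y' m = sg L (j * r + (k + j * q)) (dl X Y m \<bullet> c)" using S.hmonoc[OF m] by(simp add: algebra_simps)
qed

context fixes c j assumes c: "c : hp K j"
begin

text \<open>The parity of the whole monomial enters the exponent, so removing a letter of parity q
  shifts the offset from k to k + jq; the offset is therefore generalised in the induction.\<close>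

lemma brc_twist: assumes "S.hmono n r m" "Y : C y" "Y' : C (y + j)" "twist c j k Y' Y"
 shows "brc (y + j) xS Y' m = sg L (j * r + k) (brc y xS Y m \<bullet> c)" using assms
proof (induction arbitrary: y k Y Y' rule: S.hmono.induct)
 case one
 have "xS 1[SA] = \<zero>" by(simp add: xS_def prL_one)
 thus ?case using hHom_c[OF one(1) S.Q.one_closed] hHom_c[OF one(2) S.Q.one_closed] K.hpc[OF c]
  by(simp add: conv_one[OF bil_br xS one(1)] conv_one[OF bil_br xS one(2)] br_zero)
next
 case (mult n r m X q)
 note mc = S.hmonoc[OF mult(1)] and cc = K.hpc[OF c] and Xc = hpc[OF mult(2)]
 note Yc = hHom_c[OF mult(4) mc]
 have d': "dl X Y' : C ((y + q) + j)" using dl_hHom[OF mult(2,5)] by(simp add: add_ac)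
 have IH: "brc ((y + q) + j) xS (dl X Y') m = sg L (j * r + (k + j * q)) (brc (y + q) xS (dl X Y) m \<bullet> c)"
  by(rule mult(3)[OF dl_hHom[OF mult(2,4)] d' twist_dl[OF mult(6,2)]])
 have Y': "Y' m = sg L (j * r + k) (Y m \<bullet> c)" using mult(6,1) unfolding twist_def by blast
 have B: "brc (y + q) xS (dl X Y) m <: L" by(rule brc_c[OF xS dl_hHom[OF mult(2,4)] mc])
 have e: "y + j + q = (y + q) + j" by(simp add: add_ac)
 note s = rs_sg[OF _ cc]
 have "brc (y + j) xS Y' (io X *[SA] m) = sg L (q * (y + j)) (br X (sg L (j * r + k) (Y m \<bullet> c))) \<oplus> sg L (j * r + (k + j * q)) (brc (y + q) xS (dl X Y) m \<bullet> c)"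
  unfolding conv_in[OF bil_br xS mult(5,2) mc] dl_xS[OF mult(2)] cst_brc[OF mult(1,2,5)] Y' e IH ..
 also have "br X (sg L (j * r + k) (Y m \<bullet> c)) = sg L (j * r + k) (br X (Y m) \<bullet> c)"
  using Xc Yc cc by(simp add: bil_sg(1)[OF bil_br] rsc lbr_rsmult)
 also have "sg L (q * (y + j)) (sg L (j * r + k) (br X (Y m) \<bullet> c)) = sg L (j * (q + r) + k) (sg L (q * y) (br X (Y m)) \<bullet> c)"
  using Xc Yc cc by(simp add: s lbr_closed sg_sg rsc algebra_simps)
 also have "sg L (j * r + (k + j * q)) (brc (y + q) xS (dl X Y) m \<bullet> c) = sg L (j * (q + r) + k) (brc (y + q) xS (dl X Y) m \<bullet> c)"
  by(simp add: algebra_simps)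
 also have "sg L (j * (q + r) + k) (sg L (q * y) (br X (Y m)) \<bullet> c) \<oplus> ... = sg L (j * (q + r) + k) ((sg L (q * y) (br X (Y m)) \<oplus> brc (y + q) xS (dl X Y) m) \<bullet> c)"
  using Xc Yc cc B by(simp add: rsmult_add_left lbr_closed sg_add rsc)
 also have "sg L (q * y) (br X (Y m)) \<oplus> brc (y + q) xS (dl X Y) m = brc y xS Y (io X *[SA] m)"
  unfolding conv_in[OF bil_br xS mult(4,2) mc] dl_xS[OF mult(2)] cst_brc[OF mult(1,2,4)] ..
 finally show ?case .
qed

lemma Tp_twist: assumes "Y : C y" "Y' : C (y + j)" "twist c j k Y' Y" shows "twist c j k (Tp (y + j) n Y') (Tp y n Y)"
proof (induction n)
 case (Suc n)
 show ?case unfolding twist_def Tp_Suc using brc_twist[OF _ Tp_hHom[OF assms(1)] Tp_hHom[OF assms(2)] Suc] by blast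
qed (use assms in simp)

lemma Ph_twist: assumes "S.hmono n r m" "Y : C y" "Y' : C (y + j)" "twist c j k Y' Y"
 shows "Ph (y + j) Y' m = sg SA (j * r + k) (Ph y Y m *[SA] kp c)" using assms
proof (induction arbitrary: y k Y Y' rule: S.hmono.induct)
 case one
 have "Y' 1[SA] = sg L (j * 0 + k) (Y 1[SA] \<bullet> c)" using one(3) S.hmono.one unfolding twist_def by blast
 thus ?case using hHom_c[OF one(1) S.Q.one_closed] K.hpc[OF c]
  by(simp add: Ph_one[OF one(1)] Ph_one[OF one(2)] S.qin_neg(2) S.qin_rs rsc)
next
 case (mult n r m X q)
 note mc = S.hmonoc[OF mult(1)] and cc = K.hpc[OF c] and Xc = hpc[OF mult(2)]
 note Pc = hHom_c[OF Ph_hHom[OF mult(4)] mc] hHom_c[OF Ph_hHom[OF dl_hHom[OF mult(2,4)]] mc]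
 have d': "dl X Y' : C ((y + q) + j)" using dl_hHom[OF mult(2,5)] by(simp add: add_ac)
 have IH: "Ph ((y + q) + j) (dl X Y') m = sg SA (j * r + (k + j * q)) (Ph (y + q) (dl X Y) m *[SA] kp c)"
  by(rule mult(3)[OF dl_hHom[OF mult(2,4)] d' twist_dl[OF mult(6,2)]])
 have e: "y + j + q = (y + q) + j" by(simp add: add_ac)
 let ?A = "io X *[SA] Ph y Y m"
 have A: "?A <: SA" using Xc Pc by simp
 have sl: "sg SA l x *[SA] kp c = sg SA l (x *[SA] kp c)" if "x <: SA" for l x using that cc by(simp add: sg_def S.Q.l_minus)
 have "Ph (y + j) Y' (io X *[SA] m) = sg SA (q * (y + j)) (io X *[SA] sg SA (j * r + k) (Ph y Y m *[SA] kp c)) +[SA] sg SA (j * r + (k + j * q)) (Ph (y + q) (dl X Y) m *[SA] kp c)"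
  unfolding Ph_in[OF mult(5,2) mc] e IH mult(3)[OF mult(4,5,6)] ..
 also have "io X *[SA] sg SA (j * r + k) (Ph y Y m *[SA] kp c) = sg SA (j * r + k) (?A *[SA] kp c)"
  using Xc Pc cc by(simp add: sg_def S.Q.r_minus S.Q.m_assoc)
 also have "sg SA (q * (y + j)) (sg SA (j * r + k) (?A *[SA] kp c)) = sg SA (j * (q + r) + k) (sg SA (q * y) ?A *[SA] kp c)"
  using A cc by(simp add: sl S.Q.sg_sg algebra_simps)
 also have "sg SA (j * r + (k + j * q)) (Ph (y + q) (dl X Y) m *[SA] kp c) = sg SA (j * (q + r) + k) (Ph (y + q) (dl X Y) m *[SA] kp c)"
  by(simp add: algebra_simps)
 also have "sg SA (j * (q + r) + k) (sg SA (q * y) ?A *[SA] kp c) +[SA] ... =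
   sg SA (j * (q + r) + k) ((sg SA (q * y) ?A +[SA] Ph (y + q) (dl X Y) m) *[SA] kp c)"
  using A Pc cc by(simp add: S.Q.l_distr S.Q.sg_add)
 also have "sg SA (q * y) ?A +[SA] Ph (y + q) (dl X Y) m = Ph y Y (io X *[SA] m)" unfolding Ph_in[OF mult(4,2) mc] ..
 finally show ?case .
qed

lemma psih_twist: assumes a: "a : hp L p" and b: "b = sg L k (a \<bullet> c)" shows "twist c j k (psih (p + j) b) (psih p a)"
 unfolding twist_def
proof (intro allI impI)
 fix n r m assume m: "S.hmono n r m"
 note ac = hpc[OF a] and cc = K.hpc[OF c] and mc = S.hmonoc[OF m]
 have bh: "b : hp L (p + j)" unfolding b by(intro hp_sg rsmult_hpart a c)
 have "twist c j k (cst b) (cst a)" unfolding twist_def proof (intro allI impI)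
  fix n r m assume m: "S.hmono n r m"
  from m show "cst b m = sg L (j * r + k) (cst a m \<bullet> c)" proof (cases rule: S.hmono.cases)
   case one
   thus ?thesis using ac cc unfolding b by(simp add: eps_one rsmult_one rsc)
  next
   case (mult n' r' m' X q)
   thus ?thesis using ac cc eps_mono[OF m] S.hmonoc[OF m] hpc[OF bh] by simp
  qed
 qed
 from Tp_twist[OF cst[OF a] cst[OF bh] this, of n] m
 have T: "Tp (p + j) n (cst b) m = sg L (j * r + k) (Tp p n (cst a) m \<bullet> c)" unfolding twist_def by blast
 have Tc: "Tp p n (cst a) m <: L" by(rule hHom_c[OF Tp_hHom[OF cst[OF a]] mc])
 have comm: "c *[K] tc n = tc n *[K] c" using K.supercomm[OF c rho_hp] by simp
 show "psih (p + j) b m = sg L (j * r + k) (psih p a m \<bullet> c)"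
  unfolding psih_mono[OF bh m] psih_mono[OF a m] T using Tc cc by(simp add: rs_sg rsc comm flip: rsmult_assoc)
qed

text \<open>These are the two compatibilities with scalars that \<open>env_action\<close> asks of
  the operators attached to homogeneous generators.\<close>

lemma Ph_psih_scal: assumes a: "a : hp L p" and u: "u <: SA"
 shows "Ph (p + j) (psih (p + j) (a \<bullet> c)) u = Ph p (psih p a) (kp c *[SA] u)"
  "Ph (j + p) (psih (j + p) (lsmult K L c a)) u = kp c *[SA] Ph p (psih p a) u"
proof -
 note ac = hpc[OF a] and cc = K.hpc[OF c]
 note ch = rsmult_hpart[OF a c]
 have kc: "addmap SA SA (%u. kp c *[SA] u)" by(rule addmapI) (simp_all add: cc S.Q.r_distr)
 have P: "Ph p (psih p a) : EE p" by(rule Ph_hHom[OF psih[OF a]])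
 have P': "Ph (p + j) (psih (p + j) (a \<bullet> c)) : EE (p + j)" by(rule Ph_hHom[OF psih[OF ch]])
 show "Ph (p + j) (psih (p + j) (a \<bullet> c)) u = Ph p (psih p a) (kp c *[SA] u)"
 proof (rule lin_eqI[OF hHom_am[OF P'] am_o[OF kc hHom_am[OF P]] EE_rs[OF P'] _ _ u])
  show "Ph p (psih p a) (kp c *[SA] (u *[SA] kp b)) = Ph p (psih p a) (kp c *[SA] u) *[SA] kp b" if "u <: SA" "b <: K" for u b
   using that cc EE_rs[OF P, of "kp c *[SA] u" b] by(simp add: S.Q.m_assoc)
  fix n r m assume m: "S.hmono n r m"
  note mc = S.hmonoc[OF m]
  have "Ph p (psih p a) (kp c *[SA] m) = sg SA (j * r) (Ph p (psih p a) m *[SA] kp c)"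
   using mc cc EE_rs[OF P mc cc] am_zn(3)[OF S.Q.abx S.Q.abx hHom_am[OF P]] by(simp add: S.qs_comm[OF c S.hmono_hp[OF m]])
  thus "Ph (p + j) (psih (p + j) (a \<bullet> c)) m = Ph p (psih p a) (kp c *[SA] m)"
   using Ph_twist[OF m psih[OF a] psih[OF ch] psih_twist[OF a, of "a \<bullet> c" 0]] by simp
 qed
 have l: "lsmult K L c a = sg L (j * p) (a \<bullet> c)" by(rule ls_hom[OF a c])
 have lh: "lsmult K L c a : hp L (p + j)" unfolding l by(intro hp_sg ch)
 have P2: "Ph (p + j) (psih (p + j) (lsmult K L c a)) : EE (p + j)" by(rule Ph_hHom[OF psih[OF lh]])
 have "Ph (p + j) (psih (p + j) (lsmult K L c a)) u = kp c *[SA] Ph p (psih p a) u"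
 proof (rule lin_eqI[OF hHom_am[OF P2] am_o[OF hHom_am[OF P] kc] EE_rs[OF P2] _ _ u])
  show "kp c *[SA] Ph p (psih p a) (u *[SA] kp b) = kp c *[SA] Ph p (psih p a) u *[SA] kp b" if "u <: SA" "b <: K" for u b
   using that cc EE_rs[OF P] hHom_c[OF P] by(simp add: S.Q.m_assoc)
  fix n r m assume m: "S.hmono n r m"
  note mc = S.hmonoc[OF m]
  have "kp c *[SA] Ph p (psih p a) m = sg SA (j * r + j * p) (Ph p (psih p a) m *[SA] kp c)"
   using S.qs_comm[OF c hHomD(2)[OF P S.hmono_hp[OF m]]] by(simp add: distrib_left add.commute)
  thus "Ph (p + j) (psih (p + j) (lsmult K L c a)) m = kp c *[SA] Ph p (psih p a) m"
   using Ph_twist[OF m psih[OF a] psih[OF lh] psih_twist[OF a l]] by simp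
 qed
 thus "Ph (j + p) (psih (j + p) (lsmult K L c a)) u = kp c *[SA] Ph p (psih p a) u" by(simp add: add.commute)
qed

end

end

section \<open>The representation of U(g) on S(g), leading terms and surjectivity\<close>

section \<open>The symbol map\<close>

text \<open>\<open>todd_ok\<close> makes the operators on S(g) a representation. \<open>half\<close>
  concerns the relation u u = 0 of S(g) for odd u, whose counterpart in U(g) is 2 u u =
  [u, u].\<close>

locale pbw = lsa K L for K :: "'k sring" and L :: "('k, 'g) lie_sring" (structure) + assumes ok: "todd_ok"
  and half: "[(2::nat)] \<cdot>\<^bsub>K\<^esub> 1[K] : Units K \<or> car L = hp L 0"
begin

definition "is_act A \<longleftrightarrow> is_action UA SA A & (ALL p X v. X : hp L p --> v <: SA --> A (jm X) v = Ph p (psih p X) v) &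
  (ALL a v. a <: K --> v <: SA --> A (U.qscal a) v = kp a *[SA] v)"
definition "act = (SOME A. is_act A)"

text \<open>\<open>Ph_psih_comm\<close>, extended from monomials by linearity, is the commutation
  rule that \<open>env_action\<close> demands.\<close>

lemma act: shows act_action: "is_action UA SA act"
  and act_in0: "!!p X v. X : hp L p ==> v <: SA ==> act (jm X) v = Ph p (psih p X) v"
  and act_scal: "!!a v. a <: K ==> v <: SA ==> act (U.qscal a) v = kp a *[SA] v"
proof -
 have P: "Ph p (psih p X) : EE p" if "X : hp L p" for p X by(rule Ph_hHom[OF psih[OF that]])
 note Pa = hHom_am[OF P]
 note Pc = amD1[OF Pa]
 have k: "addmap SA SA (%u. kp a *[SA] u)" if "a <: K" for a by(rule addmapI) (simp_all add: that S.Q.r_distr)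
 obtain A where "is_action UA SA A" "!!p X v. X : hp L p ==> v <: SA ==> A (jm X) v = Ph p (psih p X) v"
  "!!a v. a <: K ==> v <: SA ==> A (U.qscal a) v = kp a *[SA] v"
 proof (rule env_action[OF S.Q.abx, of "%p X. Ph p (psih p X)" "%a u. kp a *[SA] u"])
  show "Ph p (psih p (X \<oplus> Y)) v = Ph p (psih p X) v +[SA] Ph p (psih p Y) v"
   if "X : hp L p" "Y : hp L p" "v <: SA" for p X Y v
   using Ph_lin2[OF psih[OF that(1)] psih[OF that(2)] that(3), of 0 0] by(simp add: psih_add[OF that(1,2)])
 next
  fix v w i j z assume h: "v : hp L i" "w : hp L j" "z <: SA"
  note hh = lbr_hpart[OF h(1,2)]
  have c1: "addmap SA SA (%z. Ph i (psih i v) (Ph j (psih j w) z))" by(rule am_o[OF Pa[OF h(2)] Pa[OF h(1)]])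
  have c2: "addmap SA SA (%z. sg SA (i * j) (Ph j (psih j w) (Ph i (psih i v) z)))"
   by(rule am_o[OF am_o[OF Pa[OF h(1)] Pa[OF h(2)]] S.Q.sg_am])
  show "Ph i (psih i v) (Ph j (psih j w) z) = sg SA (i * j) (Ph j (psih j w) (Ph i (psih i v) z)) +[SA] Ph (i + j) (psih (i + j) (br v w)) z"
  proof (rule lin_eqI[OF c1 S.Q.am_add[OF c2 Pa[OF hh]] _ _ Ph_psih_comm[OF ok h(1,2)] h(3)])
   fix u a assume ua: "u <: SA" "a <: K"
   show "Ph i (psih i v) (Ph j (psih j w) (u *[SA] kp a)) = Ph i (psih i v) (Ph j (psih j w) u) *[SA] kp a"
    using ua h Pc by(simp add: EE_rs[OF P])
   show "sg SA (i * j) (Ph j (psih j w) (Ph i (psih i v) (u *[SA] kp a))) +[SA] Ph (i + j) (psih (i + j) (br v w)) (u *[SA] kp a) =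
    (sg SA (i * j) (Ph j (psih j w) (Ph i (psih i v) u)) +[SA] Ph (i + j) (psih (i + j) (br v w)) u) *[SA] kp a"
    using ua h Pc hh by(simp add: EE_rs[OF P] S.Q.l_distr) (simp add: sg_def S.Q.l_minus)
  qed
 qed (use Pa k Ph_psih_scal that in "simp_all add: S.qscal_add S.qscal_mult S.qscal_one S.Q.l_distr S.Q.m_assoc K.hpc")
 hence "is_act A" unfolding is_act_def by blast
 hence "is_act act" unfolding act_def by(rule someI[of is_act A])
 thus "is_action UA SA act" "!!p X v. X : hp L p ==> v <: SA ==> act (jm X) v = Ph p (psih p X) v"
  "!!a v. a <: K ==> v <: SA ==> act (U.qscal a) v = kp a *[SA] v" unfolding is_act_def by blast+
qed

lemmas actD = is_actD[OF act_action]

lemma act_in: assumes X: "X <: L" and v: "v <: SA" shows "act (jm X) v = Phi1 K L X v"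
proof -
 have "jm X = jm (hcomp L 0 X) +[UA] jm (hcomp L 1 X)"
  using U.qin_add[of "hcomp L 0 X" "hcomp L 1 X"] hcomp_sum[OF X] hpc[OF hcomp_h[OF X]] by metis
 thus ?thesis using X v hpc[OF hcomp_h[OF X]] actD(4)[of "jm (hcomp L 0 X)" "jm (hcomp L 1 X)" v]
  by(simp add: Phi1_eq act_in0[OF hcomp_h[OF X] v])
qed

lemma act_rlin: "u <: UA ==> v <: SA ==> a <: K ==> act u (v *[SA] kp a) = act u v *[SA] kp a"
proof (induction arbitrary: v rule: U.Q_ind)
 case (mult X y)
 have "act (jm X) (w *[SA] kp a) = act (jm X) w *[SA] kp a" if w: "w <: SA" for w using mult(1) proof (induction rule: hom_ind)
  case (hom p X)
  thus ?case using w mult(5) EE_rs[OF Ph_hHom[OF psih]] by(simp add: act_in0)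
 next
  case (add X Y)
  thus ?case using w mult(5) by(simp add: U.qin_add actD S.Q.l_distr)
 qed
 thus ?case using mult by(simp add: actD)
qed (simp_all add: act_scal S.Q.m_assoc actD S.Q.l_distr)

lemma act_hpart: "u : hp UA i ==> v : hp SA j ==> act u v : hp SA (i + j)"
proof (induction arbitrary: v j rule: U.Q_hp_ind)
 case (zero i)
 have "addmap UA SA (%u. act u v)" by(rule addmapI) (use zero S.Q.hpc in "simp_all add: actD")
 from am_zn(1)[OF U.Q.abx S.Q.abx this] show ?case by simp
next
 case (scal j' a)
 thus ?case using S.Q_hp_mult[OF S.qscal_hp] by(simp add: act_scal K.hpc S.Q.hpc)
next
 case (mult p X j' y)
 note yc = U.Q.hpc[OF mult(2)] and vc = S.Q.hpc[OF mult(4)]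
 show ?case using hHomD(2)[OF Ph_hHom[OF psih[OF mult(1)]] mult(3)[OF mult(4)]] yc vc hpc[OF mult(1)]
  by(simp add: actD act_in0[OF mult(1)] add_ac)
next
 case (add j' x y)
 thus ?case by(simp add: actD S.Q.hpc S.Q.hp_add)
qed

lemma act_Hom: "u <: UA ==> restrict (act u) (car SA) : Hom K SA SA" by(rule HomI) (simp_all add: actD act_rlin S.Q_rs)

text \<open>Gives existence and uniqueness for the description in \<open>Phi\<close>: U(g) is
  generated by letters and scalars, and the values on scalars are forced by linearity.\<close>

lemma Phi_eq: "Phi K L = (\<lambda>u\<in>car UA. restrict (act u) (car SA))" unfolding Phi_def
proof (rule the_equality)
 let ?F = "\<lambda>u\<in>car UA. restrict (act u) (car SA)"
 let ?E = "End_alg K SA"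
 have Phi1: "restrict (act (jm a)) (car SA) = Phi1 K L a" if a: "a <: L" for a
  by(auto simp: fun_eq_iff act_in[OF a] Phi1_def Let_def)
 have "?F : superalg_hom K UA ?E" unfolding superalg_hom_def proof (intro CollectI conjI)
  show "?F : Hom K UA ?E" proof (rule HomI)
   show "?F (x .[UA] a) = ?F x .[?E] a" if "x <: UA" "a <: K" for x a
    using that by(auto simp: fun_eq_iff U.Q_rs End_alg_sel S.Q_ls actD act_scal)
  qed (use act_Hom in "auto simp: fun_eq_iff End_alg_sel actD")
  show "?F : ring_hom UA ?E" by(rule ring_hom_memI) (use act_Hom in "auto simp: fun_eq_iff End_alg_sel compose_def actD")
  show "preserves_parity UA ?E ?F"
   unfolding preserves_parity_def using act_hpart act_Hom U.Q.hpc S.Q.hpc by(fastforce simp: End_alg_sel)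
 qed
 moreover have "ALL a:car L. ?F (jm a) = Phi1 K L a" using Phi1 by simp
 ultimately show "?F : superalg_hom K UA ?E & (ALL a:car L. ?F (jm a) = Phi1 K L a)" by blast
 fix F assume F: "F : superalg_hom K UA ?E & (ALL a:car L. F (jm a) = Phi1 K L a)"
 hence h: "F : Hom K UA ?E" "F : ring_hom UA ?E" "!!a. a <: L ==> F (jm a) = Phi1 K L a" unfolding superalg_hom_def by auto
 note Fr = ring_homD[OF h(2)]
 have "F u = ?F u" if "u <: UA" for u using that proof (induction rule: U.Q_ind)
  case (scal a)
  have "F (1[UA] .[UA] a) = F 1[UA] .[?E] a" by(rule HomD(5)[OF h(1) U.Q.one_closed scal])
  thus ?case using scal by(auto simp: fun_eq_iff Fr U.Q_rs End_alg_sel S.Q_ls act_scal)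
 next
  case (mult X y)
  thus ?case using Phi1[OF mult(1)] h(3)[OF mult(1)] by(auto simp: fun_eq_iff Fr End_alg_sel compose_def actD act_in)
 next
  case (add x y)
  thus ?case by(auto simp: fun_eq_iff Fr End_alg_sel actD)
 qed
 thus "F = ?F" by(intro extensionalityI[OF HomD(3)[OF h(1)] restrict_extensional])
qed

abbreviation "\<sigma> == symbol_map K L"

lemma sig_eq: "u <: UA ==> \<sigma> u = act u 1[SA]" by(simp add: symbol_map_def Phi_eq)

lemma sig_c [simp]: "u <: UA ==> \<sigma> u <: SA" by(simp add: sig_eq actD)

lemma sig_am: "addmap UA SA \<sigma>" by(rule addmapI) (simp_all add: sig_eq actD)

lemma sig_mult: "u <: UA ==> v <: UA ==> \<sigma> (u *[UA] v) = act u (\<sigma> v)" by(simp add: sig_eq actD)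

lemma sig_scal: "a <: K ==> \<sigma> (U.qscal a) = kp a" by(simp add: sig_eq act_scal)

lemma sig_one: "\<sigma> 1[UA] = 1[SA]" by(simp add: sig_eq actD)

lemma sig_rs: "u <: UA ==> a <: K ==> \<sigma> (u *[UA] U.qscal a) = \<sigma> u *[SA] kp a"
 using act_rlin[of u "1[SA]" a] by(simp add: sig_mult sig_scal) (simp add: sig_eq)

lemma sig_hp: "u : hp UA i ==> \<sigma> u : hp SA i" using act_hpart[OF _ S.Q_one_hp] U.Q.hpc by(fastforce simp: sig_eq)

text \<open>The leading term of a vector field operator is multiplication by the value of the field
  at the origin. Removing a letter adds the field of a derivative, which stays within the bound by
  \<open>Ph_Fl_mono\<close>.\<close>

lemma Ph_top_mono: assumes "S.hmono n r m" "Y : C y" shows "Ph y Y m -[SA] io (Y 1[SA]) *[SA] m : S.Fl {..n}" using assms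
proof (induction arbitrary: y Y rule: S.hmono.induct)
 case one
 have "Ph y Y 1[SA] -[SA] io (Y 1[SA]) *[SA] 1[SA] = 0[SA]"
  using hHom_c[OF one S.Q.one_closed] by(simp add: Ph_one[OF one] S.Q.mn_zero_iff)
 thus ?case by(simp add: S.Fl.zero)
next
 case (mult n r m X q)
 note mc = S.hmonoc[OF mult(1)] and Xc = hpc[OF mult(2)]
 note Pc = hHom_c[OF Ph_hHom[OF mult(4)] mc] hHom_c[OF Ph_hHom[OF dl_hHom[OF mult(2,4)]] mc]
 have Y1: "Y 1[SA] : hp L y" by(rule one_hp[OF mult(4)])
 note Y1c = hpc[OF Y1]
 let ?A = "io X *[SA] Ph y Y m" and ?B = "Ph (y + q) (dl X Y) m" and ?D = "io X *[SA] (io (Y 1[SA]) *[SA] m)"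
 have c: "?A <: SA" "?B <: SA" "?D <: SA" using Xc Pc mc Y1c by simp_all
 have e: "io (Y 1[SA]) *[SA] (io X *[SA] m) = sg SA (q * y) ?D"
  using sym_comm[OF Y1 mult(2)] Xc Y1c mc by(simp add: sg_def S.Q.l_minus S.Q.m_assoc[symmetric] mult.commute[of q y])
 have "io X *[SA] (Ph y Y m -[SA] io (Y 1[SA]) *[SA] m) : S.Fl (Suc ` {..n})" by(rule S.Fl_in[OF mult(3)[OF mult(4)] Xc])
 hence f: "?A -[SA] ?D : S.Fl {..Suc n}" using Xc Pc mc Y1c by(auto simp: a_minus_def S.Q.r_distr S.Q.r_minus elim!: S.Fl_mono)
 have "Ph y Y (io X *[SA] m) -[SA] io (Y 1[SA]) *[SA] (io X *[SA] m) = sg SA (q * y) (?A -[SA] ?D) +[SA] ?B"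
  unfolding Ph_in[OF mult(4,2) mc] e using c by(simp add: sg_def a_minus_def S.Q.minus_add S.Q.a_ac)
 thus ?case using S.Fl.add[OF S.Fl_sg[OF f] Ph_Fl_mono[OF mult(1) dl_hHom[OF mult(2,4)]]] by simp
qed

lemma Ph_top: assumes X: "X : hp L p" and u: "u : S.Fl {..n}" shows "Ph p (psih p X) u -[SA] io X *[SA] u : S.Fl {..n}" using u
proof (induction rule: S.Fl.induct)
 note P = Ph_hHom[OF psih[OF X]]
 note Xc = hpc[OF X]
 {
  case zero
  thus ?case using Xc am_zn(1)[OF S.Q.abx S.Q.abx hHom_am[OF P]] S.Fl.zero by(simp add: a_minus_def)
 next
  case (gen k r m a j)
  note mc = S.hmonoc[OF gen(1)] and ac = K.hpc[OF gen(3)]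
  have "Ph p (psih p X) m -[SA] io X *[SA] m : S.Fl {..k}" using Ph_top_mono[OF gen(1) psih[OF X]] psih_one[OF X] by simp
  hence "(Ph p (psih p X) m -[SA] io X *[SA] m) *[SA] kp a : S.Fl {..n}"
   by(rule S.Fl_mono[OF S.Fl_sc[OF _ ac]]) (use gen(2) in auto)
  thus ?case using mc ac Xc hHom_c[OF P mc] EE_rs[OF P mc ac] by(simp add: a_minus_def S.Q.l_distr S.Q.l_minus S.Q.m_assoc)
 next
  case (add x y)
  note c = S.Fl_c[OF add(1)] S.Fl_c[OF add(2)]
  have "Ph p (psih p X) (x +[SA] y) -[SA] io X *[SA] (x +[SA] y) =
   (Ph p (psih p X) x -[SA] io X *[SA] x) +[SA] (Ph p (psih p X) y -[SA] io X *[SA] y)"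
   using c Xc hHom_c[OF P] by(simp add: hHom_add[OF P] a_minus_def S.Q.r_distr S.Q.minus_add S.Q.a_ac)
  thus ?case using S.Fl.add[OF add(3,4)] by simp
 }
qed

lemma act_top: assumes X: "X <: L" and u: "u : S.Fl {..n}" shows "act (jm X) u -[SA] io X *[SA] u : S.Fl {..n}" using X
proof (induction rule: hom_ind)
 case (hom p X)
 thus ?case using Ph_top[OF hom u] S.Fl_c[OF u] by(simp add: act_in0)
next
 case (add X Y)
 note uc = S.Fl_c[OF u]
 have "act (jm (X \<oplus> Y)) u -[SA] io (X \<oplus> Y) *[SA] u =
   (act (jm X) u -[SA] io X *[SA] u) +[SA] (act (jm Y) u -[SA] io Y *[SA] u)"
  using add uc by(simp add: U.qin_add S.qin_add actD a_minus_def S.Q.l_distr S.Q.minus_add S.Q.a_ac)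
 thus ?case using S.Fl.add[OF add(3,4)] by simp
qed

definition "wU Xs = mprod UA (map jm Xs)"
definition "wS Xs = mprod SA (map io Xs)"

lemma w_simps [simp]: "wU [] = 1[UA]" "wS [] = 1[SA]"
  "wU (X # Xs) = jm X *[UA] wU Xs" "wS (X # Xs) = io X *[SA] wS Xs" by(simp_all add: wU_def wS_def mprod_def)

lemma w_closed: "set Xs <= car L ==> wU Xs <: UA" "set Xs <= car L ==> wS Xs <: SA" by(induction Xs) simp_all

lemma w_Fl: "set Xs <= car L ==> wU Xs : U.Fl {length Xs}" "set Xs <= car L ==> wS Xs : S.Fl {length Xs}"
 using U.Fl_word S.Fl_word by(simp_all add: wU_def wS_def)

text \<open>By \<open>psih_one\<close> the leading term of the operator of X is multiplication by X.
  The error made on the shorter word gains one letter and so remains below the new top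
  degree.\<close>

lemma sig_word: "set Xs <= car L ==> \<sigma> (wU Xs) -[SA] wS Xs : S.Fl {..<length Xs}"
proof (induction Xs)
 case Nil
 thus ?case using S.Fl.zero S.Q.mn_zero_iff[of "1[SA]" "1[SA]"] by(simp add: sig_one)
next
 case (Cons X Xs)
 let ?n = "length Xs"
 have X: "X <: L" and Xs: "set Xs <= car L" using Cons.prems by auto
 note c = w_closed[OF Xs]
 let ?e = "\<sigma> (wU Xs) -[SA] wS Xs"
 have e: "?e : S.Fl {..<?n}" using Cons Xs by simp
 have s: "\<sigma> (wU Xs) = ?e +[SA] wS Xs" using c by(simp add: S.Q.mn_cancel)
 have "?e : S.Fl {..?n}" "wS Xs : S.Fl {..?n}" using e w_Fl(2)[OF Xs] by(auto elim!: S.Fl_mono)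
 hence u: "\<sigma> (wU Xs) : S.Fl {..?n}" by(subst s) (rule S.Fl.add)
 have 1: "act (jm X) (\<sigma> (wU Xs)) -[SA] io X *[SA] \<sigma> (wU Xs) : S.Fl {..?n}" by(rule act_top[OF X u])
 have 2: "io X *[SA] ?e : S.Fl {..?n}" using S.Fl_in[OF e X] by(auto elim!: S.Fl_mono)
 have ac: "act (jm X) (\<sigma> (wU Xs)) <: SA" using X c by(simp add: actD)
 have "\<sigma> (wU (X # Xs)) -[SA] wS (X # Xs) = (act (jm X) (\<sigma> (wU Xs)) -[SA] io X *[SA] \<sigma> (wU Xs)) +[SA] io X *[SA] ?e"
  using c X ac by(simp add: sig_mult a_minus_def S.Q.r_distr S.Q.r_minus S.Q.a_assoc S.Q.l_neg S.Q.r_neg2 S.Q.r_neg1)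
 thus ?case using S.Fl.add[OF 1 2] by(simp add: lessThan_Suc_atMost)
qed

lemma Fl_hword: assumes "S.hmono n p m" obtains Xs where "set Xs <= car L" "length Xs = n" "m = wS Xs"
 using S.hmono_mprod[OF assms] unfolding wS_def by blast

lemma Fl_hword_U: assumes "U.hmono n p m" obtains Xs where "set Xs <= car L" "length Xs = n" "m = wU Xs"
 using U.hmono_mprod[OF assms] unfolding wU_def by blast

text \<open>The preimage is found within the same step of the filtration of U(g); this is what makes
  the inverse of the symbol map a filtered map.\<close>

lemma sig_surj: "s : S.Fl {..<n} ==> EX u:U.Fl {..<n}. \<sigma> u = s"
proof (induction n arbitrary: s)
 case 0
 have "s = 0[SA]" using 0 by(induction rule: S.Fl.induct) simp_all
 thus ?case using am_zn(1)[OF U.Q.abx S.Q.abx sig_am] U.Fl.zero by blast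
next
 case (Suc n)
 from Suc.prems show ?case proof (induction rule: S.Fl.induct)
  case zero
  thus ?case using am_zn(1)[OF U.Q.abx S.Q.abx sig_am] U.Fl.zero by blast
 next
  case (gen k r m a j)
  note ac = K.hpc[OF gen(3)]
  obtain Xs where Xs: "set Xs <= car L" "length Xs = k" "m = wS Xs" using Fl_hword[OF gen(1)] .
  note c = w_closed[OF Xs(1)]
  have "\<sigma> (wU Xs) -[SA] wS Xs : S.Fl {..<n}" using sig_word[OF Xs(1)] Xs(2) gen(2) by(auto elim!: S.Fl_mono)
  then obtain v where v: "v : U.Fl {..<n}" "\<sigma> v = (\<sigma> (wU Xs) -[SA] wS Xs) *[SA] kp a"
   using Suc.IH[OF S.Fl_sc[OF _ ac]] by blast
  let ?u = "wU Xs *[UA] U.qscal a"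
  have "?u : U.Fl {..<Suc n}" using U.Fl_sc[OF w_Fl(1)[OF Xs(1)] ac] Xs(2) gen(2) by(auto elim!: U.Fl_mono)
  moreover have "v : U.Fl {..<Suc n}" using v(1) by(auto elim!: U.Fl_mono)
  moreover have "\<sigma> (?u -[UA] v) = m *[SA] kp a" using am_zn(4)[OF U.Q.abx S.Q.abx sig_am] U.Fl_c[OF v(1)] c ac
   by(simp add: v(2) sig_rs Xs(3) a_minus_def S.Q.l_distr S.Q.l_minus S.Q.minus_add S.Q.r_neg2 S.Q.r_neg1)
  ultimately show ?case using U.Fl_mn by blast
 next
  case (add x y)
  thus ?case using amD2[OF sig_am] U.Fl_c U.Fl.add by metis
 qed
qed

end

section \<open>Homogeneous parts of tensors and their images in a quotient\<close>

section \<open>Separating tensor degrees\<close>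

context tmodule begin

definition "wT Xs = mprod T (map tin Xs)"

lemma wT_simps [simp]: "wT [] = 1[T]" "wT (X # Xs) = tin X *[T] wT Xs" by(simp_all add: wT_def mprod_def)

lemma wT_closed [simp]: "set Xs <= car M ==> wT Xs <: T" by(induction Xs) simp_all

end

context talg begin

lemma UP_ring_Q: "UP_ring Q" by(simp add: UP_ring_def Q.ring_axioms)

text \<open>The value at \<open>t\<close> of the family of the homogeneous parts of \<open>t\<close>, read as a polynomial
 with coefficients in "Q".\<close>

definition "cfhom = (SOME h. h : ring_hom T (UP Q) & (ALL X:car M. h (tin X) = monom (UP Q) (qin X) 1) &
  (ALL a:car K. h (tscal a) = monom (UP Q) (qscal a) 0))"

definition "cf t n = coeff (UP Q) (cfhom t) n"

text \<open>The variable of the polynomial ring is central and counts letters: with X sent to X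
  times the variable, the n-th coefficient is the image of the part of degree n.\<close>

lemma cfhom:
 "cfhom : ring_hom T (UP Q) & (ALL X:car M. cfhom (tin X) = monom (UP Q) (qin X) 1) &
  (ALL a:car K. cfhom (tscal a) = monom (UP Q) (qscal a) 0)"
proof -
 interpret P: UP_ring Q "UP Q" by(rule UP_ring_Q)
 have "EX h. h : ring_hom T (UP Q) & (ALL X:car M. h (tin X) = monom (UP Q) (qin X) 1) &
  (ALL a:car K. h (tscal a) = monom (UP Q) (qscal a) 0)"
 proof (rule tensor_univ[OF P.UP_ring, of "%X. monom (UP Q) (qin X) 1" "%a. monom (UP Q) (qscal a) 0"])
  show "addmap M (UP Q) (%X. monom (UP Q) (qin X) 1)" by(rule addmapI) (simp_all add: qin_add)
  show "addmap K (UP Q) (%a. monom (UP Q) (qscal a) 0)" by(rule addmapI) (simp_all add: qscal_add)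
  show "monom (UP Q) (qin (X \<bullet> a)) 1 = monom (UP Q) (qin X) 1 *[UP Q] monom (UP Q) (qscal a) 0"
   if "X <: M" "a <: K" for X a using that P.monom_mult[of "qin X" "qscal a" 1 0] by(simp add: qin_rs)
  show "monom (UP Q) (qin (lsmult K M a X)) 1 = monom (UP Q) (qscal a) 0 *[UP Q] monom (UP Q) (qin X) 1"
   if "X <: M" "a <: K" for X a using that P.monom_mult[of "qscal a" "qin X" 0 1] by(simp add: qin_ls)
  show "monom (UP Q) (qscal (a *[K] b)) 0 = monom (UP Q) (qscal a) 0 *[UP Q] monom (UP Q) (qscal b) 0"
   if "a <: K" "b <: K" for a b using that P.monom_mult[of "qscal a" "qscal b" 0 0] by(simp add: qscal_mult)
 qed (auto simp: qscal_one)
 thus ?thesis unfolding cfhom_def by(rule someI_ex)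
qed

lemma cf_closed [simp]: "t <: T ==> cf t n <: Q"
proof -
 interpret P: UP_ring Q "UP Q" by(rule UP_ring_Q)
 show "t <: T ==> cf t n <: Q" using ring_homD[OF conjunct1[OF cfhom]] by(simp add: cf_def)
qed

lemma cf_add: "s <: T ==> t <: T ==> cf (s +[T] t) n = cf s n +[Q] cf t n"
proof -
 interpret P: UP_ring Q "UP Q" by(rule UP_ring_Q)
 show "s <: T ==> t <: T ==> cf (s +[T] t) n = cf s n +[Q] cf t n" using ring_homD[OF conjunct1[OF cfhom]] by(simp add: cf_def)
qed

lemma cf_mult: "s <: T ==> t <: T ==> cf (s *[T] t) n = (\<Oplus>\<^bsub>Q\<^esub>i\<in>{..n}. cf s i *[Q] cf t (n - i))"
proof -
 interpret P: UP_ring Q "UP Q" by(rule UP_ring_Q)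
 show "s <: T ==> t <: T ==> cf (s *[T] t) n = (\<Oplus>\<^bsub>Q\<^esub>i\<in>{..n}. cf s i *[Q] cf t (n - i))"
  using ring_homD[OF conjunct1[OF cfhom]] by(simp add: cf_def)
qed

lemma cf_tin: "X <: M ==> cf (tin X) n = (if n = 1 then qin X else 0[Q])"
 and cf_tscal: "a <: K ==> cf (tscal a) n = (if n = 0 then qscal a else 0[Q])"
proof -
 interpret P: UP_ring Q "UP Q" by(rule UP_ring_Q)
 show "X <: M ==> cf (tin X) n = (if n = 1 then qin X else 0[Q])"
  "a <: K ==> cf (tscal a) n = (if n = 0 then qscal a else 0[Q])" using cfhom by(auto simp: cf_def)
qed

lemma cf_finite: assumes "t <: T" shows "finite {n. cf t n ~= 0[Q]}"
proof -
 interpret P: UP_ring Q "UP Q" by(rule UP_ring_Q)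
 have "cfhom t : car (UP Q)" using ring_homD(2)[OF conjunct1[OF cfhom] assms] .
 hence "{n. cf t n ~= 0[Q]} <= {..deg Q (cfhom t)}" using P.deg_aboveD by(force simp: cf_def not_le[symmetric])
 thus ?thesis by(rule finite_subset) simp
qed

lemma cf_am: "addmap T Q (%t. cf t n)" by(rule addmapI) (simp_all add: cf_add)

lemma cf_in_mult: assumes "X <: M" "t <: T" shows "cf (tin X *[T] t) n = (if n = 0 then 0[Q] else qin X *[Q] cf t (n - 1))"
proof (cases "n = 0")
 case True
 thus ?thesis using assms by(simp add: cf_mult cf_tin)
next
 case False
 have "cf (tin X *[T] t) n = (\<Oplus>\<^bsub>Q\<^esub>i\<in>{..n}. cf (tin X) i *[Q] cf t (n - i))" using assms by(simp add: cf_mult)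
 also have "... = cf (tin X) 1 *[Q] cf t (n - 1)" by(rule Q.fs_single) (use assms False in "auto simp: cf_tin")
 finally show ?thesis using False assms by(simp add: cf_tin)
qed

lemma cf_mult_scal: assumes "a <: K" "t <: T" shows "cf (t *[T] tscal a) n = cf t n *[Q] qscal a"
proof -
 have "cf (t *[T] tscal a) n = (\<Oplus>\<^bsub>Q\<^esub>i\<in>{..n}. cf t i *[Q] cf (tscal a) (n - i))" using assms by(simp add: cf_mult)
 also have "... = cf t n *[Q] cf (tscal a) (n - n)" by(rule Q.fs_single) (use assms in "auto simp: cf_tscal")
 finally show ?thesis using assms by(simp add: cf_tscal)
qed

lemma cf_Fl: "t <: T ==> cf t n : Fl {n}"
proof (induction arbitrary: n rule: T_induct)
 case (scal a)
 have "qscal a : Fl {0}" using Fl_sc[OF Fl.gen[OF hmono.one _ K.hpart_one, of "{0}"] scal] scal by(simp add: qscal_one)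
 thus ?case using scal Fl.zero by(simp add: cf_tscal)
next
 case (mult X y)
 have "qin X *[Q] cf y (n - 1) : Fl (Suc ` {n - 1})" by(rule Fl_in[OF mult(3,1)])
 thus ?case using mult(1,2) Fl.zero by(cases n) (simp_all add: cf_in_mult)
qed (simp add: cf_add Fl.add)

lemma cf_hpart: "t : hp T i ==> cf t n : hp Q i"
proof (induction arbitrary: n rule: T_hp_ind)
 case (zero i)
 thus ?case using am_zn(1)[OF T.abx Q.abx cf_am] by simp
next
 case (scal j a)
 thus ?case by(simp add: cf_tscal K.hpc qscal_hp)
next
 case (mult p X j y)
 have "y <: T" using mult(2) T_hp_c by blast
 thus ?case using mult by(simp add: cf_in_mult hpc Q_hp_mult qin_hp)
qed (simp add: cf_add Q.hp_add)

text \<open>The tensors whose part of degree n has its image in V n, for every n, form an ideal,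
  because multiplying by words of length j moves V i into V (i + j).\<close>

lemma cf_ideal: assumes V: "!!n. subgroup (V n) (add_monoid Q)"
  and r: "!!i j x y. x : V i ==> y : Fl {j} ==> x *[Q] y : V (i + j) & y *[Q] x : V (j + i)"
  and G: "G <= car T" "!!g n. g : G ==> cf g n : V n" and t: "t : genideal T G" shows "cf t n : V n"
proof -
 let ?I = "{t:car T. ALL n. cf t n : V n}"
 have V0: "0[Q] : V n" and Va: "!!x y. x : V n ==> y : V n ==> x +[Q] y : V n" for n
  using subgroup.one_closed[OF V, of n] subgroup.m_closed[OF V, of _ n] by simp_all
 have Vn: "-[Q] x : V n" if "x : V n" for n x using subgroup.m_inv_closed[OF V that] by(simp add: a_inv_def)
 have Vc: "x <: Q" if "x : V n" for n x using subgroup.mem_carrier[OF V that] by simp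
 have Vs: "finite J ==> (!!i. i : J ==> f i : V n) ==> (\<Oplus>\<^bsub>Q\<^esub>i\<in>J. f i) : V n" for J :: "nat set" and f n
 proof (induction J rule: finite_induct)
  case (insert x F)
  thus ?case using Vc by(subst Q.finsum_insert) (auto intro!: Va)
 qed (simp add: V0)
 have sg: "subgroup ?I (add_monoid T)" proof (rule group.subgroupI[OF abelian_group.a_group[OF T.abx]])
  have "0[T] : ?I" using V0 am_zn(1)[OF T.abx Q.abx cf_am] by simp
  thus "?I ~= {}" by blast
  show "inv[add_monoid T] s : ?I" if "s : ?I" for s using that Vn am_zn(2)[OF T.abx Q.abx cf_am] by(simp flip: a_inv_def)
 qed (use Va in "auto simp: cf_add")
 have "ideal ?I T" proof (rule idealI[OF T.ring_axioms sg])
  fix a x assume a: "a : ?I" and x: "x <: T"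
  show "x *[T] a : ?I" "a *[T] x : ?I"
   using a x r[OF _ cf_Fl[OF x]] by(auto simp: cf_mult intro!: Vs) (metis le_add_diff_inverse le_add_diff_inverse2)+
 qed
 moreover have "G <= ?I" using G by auto
 ultimately have "genideal T G <= ?I" by(rule T.genideal_minimal)
 thus ?thesis using t by blast
qed

lemma cf_wT: "set Xs <= car M ==> cf (wT Xs) n = (if n = length Xs then mprod Q (map qin Xs) else 0[Q])"
proof (induction Xs arbitrary: n)
 case Nil
 show ?case using cf_tscal[OF K.one_closed, of n] by(simp add: tscal_one qscal_one mprod_def)
next
 case (Cons X Xs)
 thus ?case by(cases n) (auto simp: cf_in_mult mprod_def)
qed

lemma pq_wT: "set Xs <= car M ==> pq (wT Xs) = mprod Q (map qin Xs)"
 by(induction Xs) (simp_all add: pq_one pq_mult pq_tin mprod_def)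

end

section \<open>Comparison of S(g) and U(g) through common tensors; injectivity\<close>

context pbw begin

text \<open>The criterion \<open>cf_ideal\<close> with V n spanned by words shorter than n. The
  relations of S(g) have degree 2, and U(g) sends them to [v, w], respectively to u u with u odd;
  both lie in the span of shorter words.\<close>

lemma cf_U_ideal: assumes t: "t : genideal T sym_gens" shows "U.cf t n : U.Fl {..<n}"
proof (rule U.cf_ideal[where V = "%n. U.Fl {..<n}", OF U.Fl_sub _ S.Gn_c _ t])
 show "x *[UA] y : U.Fl {..<i + j} & y *[UA] x : U.Fl {..<j + i}" if "x : U.Fl {..<i}" "y : U.Fl {j}" for i j x y
  using U.Fl_mult[OF that, of "{..<i + j}"] U.Fl_mult[OF that(2,1), of "{..<j + i}"] by auto
 have j1: "jm X : U.Fl {..<2}" if "X <: L" for X using w_Fl(1)[of "[X]"] that by(auto elim!: U.Fl_mono)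
 have cf2: "U.cf (tw K L [v, w]) n = (if n = 2 then jm v *[UA] jm w else 0[UA])" if "v <: L" "w <: L" for v w n
  using that U.cf_wT[of "[v, w]" n] by(simp add: tensor_word2 mprod_def)
 fix g n assume "g : sym_gens"
 then consider (1) v w i j where "g = tw K L [v, w] -[T] sg T (i * j) (tw K L [w, v])" "v : hp L i" "w : hp L j"
  | (2) u where "g = tw K L [u, u]" "u : hp L 1" unfolding sym_gens_def by blast
 thus "U.cf g n : U.Fl {..<n}" proof cases
  case 1
  note c = hpc[OF 1(2)] hpc[OF 1(3)] hpc[OF lbr_hpart[OF 1(2,3)]]
  have tc: "tw K L [v, w] <: T" "tw K L [w, v] <: T" using c by(simp_all add: tensor_word2)
  have "U.cf g n = U.cf (tw K L [v, w]) n -[UA] sg UA (i * j) (U.cf (tw K L [w, v]) n)"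
   unfolding 1(1) using tc am_zn(3,4)[OF T.abx U.Q.abx U.cf_am] by simp
  also have "... = (if n = 2 then jm (br v w) else 0[UA])"
   using c env_comm[OF 1(2,3)] by(simp add: cf2 a_minus_def U.Q.a_ac U.Q.r_neg)
  finally show ?thesis using j1[OF c(3)] U.Fl.zero by simp
 next
  case 2
  note c = hpc[OF 2(2)] hpc[OF lbr_hpart[OF 2(2,2)]]
  let ?y = "jm u *[UA] jm u"
  \<comment> \<open>From 2 u u = [u, u] the square is shorter once 2 is inverted; if g is even, then
    u is zero.\<close>
  have "?y : U.Fl {..<2}" using half proof
   assume h: "[(2::nat)] \<cdot>\<^bsub>K\<^esub> 1[K] : Units K"
   let ?h = "inv[K] ([(2::nat)] \<cdot>\<^bsub>K\<^esub> 1[K])"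
   have two: "[(2::nat)] \<cdot>\<^bsub>K\<^esub> 1[K] = 1[K] +[K] 1[K]" by(simp add: numeral_2_eq_2 K.add.nat_pow_Suc)
   have hc: "?h <: K" "(1[K] +[K] 1[K]) *[K] ?h = 1[K]" using h by(simp_all flip: two)
   have "?y +[UA] ?y = jm (br u u)"
    using env_comm[OF 2(2,2)] c by(simp add: sg_def U.Q.r_neg2) (metis U.Q.m_closed U.Q.r_neg2 U.qin_c)
   hence "?y *[UA] U.qscal ((1[K] +[K] 1[K]) *[K] ?h) = jm (br u u) *[UA] U.qscal ?h"
    using c hc(1) by(simp add: U.qscal_mult U.qscal_add U.qscal_one U.Q.r_distr flip: U.Q.m_assoc)
   hence "?y = jm (br u u) *[UA] U.qscal ?h" using c hc(2) by(simp add: U.qscal_one)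
   thus ?thesis using U.Fl_sc[OF j1[OF c(2)] hc(1)] by simp
  next
   assume "car L = hp L 0"
   hence "u : hp L 0 Int hp L 1" using c 2(2) by simp
   hence "u = \<zero>" using hpart_disjoint by simp
   thus ?thesis using U.Fl.zero by(simp add: U.qin_neg(3))
  qed
  thus ?thesis using c U.Fl.zero by(simp add: 2(1) cf2)
 qed
qed

text \<open>The relations of S(g) are homogeneous in length, so the criterion holds with V n = 0,
  and S(g) inherits the grading of the tensor algebra.\<close>

lemma cf_S_ideal: assumes t: "t : genideal T sym_gens" shows "S.cf t n = 0[SA]"
proof -
 have "S.cf t n : {0[SA]}" proof (rule S.cf_ideal[where V = "%n. {0[SA]}", OF _ _ S.Gn_c _ t])
  show "subgroup {0[SA]} (add_monoid SA)" using group.triv_subgroup[OF abelian_group.a_group[OF S.Q.abx]] by simp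
  show "x *[SA] y : {0[SA]} & y *[SA] x : {0[SA]}" if "x : {0[SA]}" "y : S.Fl {j}" for j x y using that S.Fl_c by simp
  have cf2: "S.cf (tw K L [v, w]) n = (if n = 2 then io v *[SA] io w else 0[SA])" if "v <: L" "w <: L" for v w n
   using that S.cf_wT[of "[v, w]" n] by(simp add: tensor_word2 mprod_def)
  fix g n assume "g : sym_gens"
  then consider (1) v w i j where "g = tw K L [v, w] -[T] sg T (i * j) (tw K L [w, v])" "v : hp L i" "w : hp L j"
   | (2) u where "g = tw K L [u, u]" "u : hp L 1" unfolding sym_gens_def by blast
  thus "S.cf g n : {0[SA]}" proof cases
   case 1
   note c = hpc[OF 1(2)] hpc[OF 1(3)]
   have tc: "tw K L [v, w] <: T" "tw K L [w, v] <: T" using c by(simp_all add: tensor_word2)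
   have "S.cf g n = S.cf (tw K L [v, w]) n -[SA] sg SA (i * j) (S.cf (tw K L [w, v]) n)"
    unfolding 1(1) using tc am_zn(3,4)[OF T.abx S.Q.abx S.cf_am] by simp
   also have "... = 0[SA]" using c sym_comm[OF 1(2,3)] by(simp add: cf2 a_minus_def S.Q.r_neg)
   finally show ?thesis by simp
  next
   case 2
   thus ?thesis using hpc[OF 2(2)] by(simp add: cf2 sym_odd)
  qed
 qed
 thus ?thesis by simp
qed

text \<open>Tensors that look purely of degree n in both quotients, and whose class in U(g) has
  their class in S(g) as leading symbol. They serve as common lifts of elements of U(g) and
  S(g).\<close>

definition "hten n = {t:car T. (ALL k. k ~= n --> U.cf t k = 0[UA] & S.cf t k = 0[SA]) &
  U.cf t n = U.pq t & S.cf t n = S.pq t & \<sigma> (U.pq t) -[SA] S.pq t : S.Fl {..<n}}"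

lemma hten_zero: "0[T] : hten n"
proof -
 have z: "U.cf 0[T] k = 0[UA]" "S.cf 0[T] k = 0[SA]" "U.pq 0[T] = 0[UA]" "S.pq 0[T] = 0[SA]" "\<sigma> 0[UA] = 0[SA]" for k
  using am_zn(1)[OF T.abx U.Q.abx] am_zn(1)[OF T.abx S.Q.abx]
   am_zn(1)[OF U.Q.abx S.Q.abx] U.cf_am S.cf_am U.pq_am S.pq_am sig_am by blast+
 have "0[SA] -[SA] 0[SA] = 0[SA]" using S.Q.mn_zero_iff[OF S.Q.zero_closed S.Q.zero_closed] by simp
 thus ?thesis using S.Fl.zero[of "{..<n}"] by(simp add: hten_def z)
qed

lemma hten_add: assumes "s : hten n" "t : hten n" shows "s +[T] t : hten n"
proof -
 have c: "s <: T" "t <: T" using assms by(simp_all add: hten_def)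
 have "\<sigma> (U.pq (s +[T] t)) -[SA] S.pq (s +[T] t) = (\<sigma> (U.pq s) -[SA] S.pq s) +[SA] (\<sigma> (U.pq t) -[SA] S.pq t)"
  using c by(simp add: U.pq_add S.pq_add amD2[OF sig_am] a_minus_def S.Q.minus_add S.Q.a_ac)
 hence "\<sigma> (U.pq (s +[T] t)) -[SA] S.pq (s +[T] t) : S.Fl {..<n}" using assms S.Fl.add unfolding hten_def by simp
 thus ?thesis using assms c by(simp add: hten_def U.cf_add S.cf_add U.pq_add S.pq_add)
qed

lemma hten_word: assumes Xs: "set Xs <= car L" and a: "a <: K" shows "wT Xs *[T] tscal a : hten (length Xs)"
proof -
 note c = w_closed[OF Xs]
 have U: "U.pq (wT Xs *[T] tscal a) = wU Xs *[UA] U.qscal a" and S: "S.pq (wT Xs *[T] tscal a) = wS Xs *[SA] kp a"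
  using Xs a by(simp_all add: U.pq_mult S.pq_mult U.pq_wT S.pq_wT U.pq_tscal S.pq_tscal wU_def wS_def)
 have "\<sigma> (wU Xs *[UA] U.qscal a) -[SA] wS Xs *[SA] kp a = (\<sigma> (wU Xs) -[SA] wS Xs) *[SA] kp a"
  using c a by(simp add: sig_rs a_minus_def S.Q.l_distr S.Q.l_minus)
 hence "\<sigma> (wU Xs *[UA] U.qscal a) -[SA] wS Xs *[SA] kp a : S.Fl {..<length Xs}" using S.Fl_sc[OF sig_word[OF Xs] a] by simp
 thus ?thesis
  using Xs a c by(simp add: hten_def U S U.cf_mult_scal S.cf_mult_scal U.cf_wT[OF Xs, folded wU_def] S.cf_wT[OF Xs, folded wS_def])
qed

lemma U_lift: "w : U.Fl {n} ==> EX t:hten n. U.pq t = w"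
proof (induction rule: U.Fl.induct)
 case zero
 thus ?case using hten_zero am_zn(1)[OF T.abx U.Q.abx U.pq_am] by blast
next
 case (gen k p m a j)
 obtain Xs where Xs: "set Xs <= car L" "length Xs = k" "m = wU Xs" using Fl_hword_U[OF gen(1)] .
 thus ?case using hten_word[OF Xs(1) K.hpc[OF gen(3)]] gen(2) K.hpc[OF gen(3)]
  by(intro bexI[of _ "wT Xs *[T] tscal a"]) (simp_all add: U.pq_mult U.pq_wT U.pq_tscal wU_def)
next
 case (add x y)
 then obtain s t where "s : hten n" "U.pq s = x" "t : hten n" "U.pq t = y" by blast
 thus ?case using hten_add[of s n t] by(intro bexI[of _ "s +[T] t"]) (auto simp: U.pq_add hten_def)
qed

lemma S_lift: "w : S.Fl {n} ==> EX t:hten n. S.pq t = w"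
proof (induction rule: S.Fl.induct)
 case zero
 thus ?case using hten_zero am_zn(1)[OF T.abx S.Q.abx S.pq_am] by blast
next
 case (gen k p m a j)
 obtain Xs where Xs: "set Xs <= car L" "length Xs = k" "m = wS Xs" using Fl_hword[OF gen(1)] .
 thus ?case using hten_word[OF Xs(1) K.hpc[OF gen(3)]] gen(2) K.hpc[OF gen(3)]
  by(intro bexI[of _ "wT Xs *[T] tscal a"]) (simp_all add: S.pq_mult S.pq_wT S.pq_tscal wS_def)
next
 case (add x y)
 then obtain s t where "s : hten n" "S.pq s = x" "t : hten n" "S.pq t = y" by blast
 thus ?case using hten_add[of s n t] by(intro bexI[of _ "s +[T] t"]) (auto simp: S.pq_add hten_def)
qed

lemma S_Fl_lift: "w : S.Fl A ==> EX t:car T. S.pq t = w & (ALL k. k ~: A --> S.cf t k = 0[SA])"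
proof (induction rule: S.Fl.induct)
 case zero
 thus ?case using hten_zero am_zn(1)[OF T.abx S.Q.abx S.pq_am]
  am_zn(1)[OF T.abx S.Q.abx S.cf_am] T.zero_closed by blast
next
 case (gen k p m a j)
 obtain t where "t : hten k" "S.pq t = m *[SA] kp a" using S_lift[OF S.Fl.gen[OF gen(1) _ gen(3), of "{k}"]] by blast
 hence "t <: T" "ALL l. l ~: A --> S.cf t l = 0[SA]" using gen(2) by(auto simp: hten_def)
 thus ?case using `S.pq t = _` by(intro bexI[of _ t] conjI)
next
 case (add x y)
 then obtain s t where "s <: T" "S.pq s = x" "ALL k. k ~: A --> S.cf s k = 0[SA]"
  "t <: T" "S.pq t = y" "ALL k. k ~: A --> S.cf t k = 0[SA]" by blast
 thus ?case by(intro bexI[of _ "s +[T] t"]) (auto simp: S.pq_add S.cf_add)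
qed

text \<open>Two lifts of x differ by an element of the ideal, whose parts all vanish in S(g). The
  part of degree n is x for the first lift and zero for the second.\<close>

lemma S_Fl_disjoint: assumes "x : S.Fl {n}" "x : S.Fl {..<n}" shows "x = 0[SA]"
proof -
 obtain s where s: "s <: T" "S.pq s = x" "S.cf s n = x" using S_lift[OF assms(1)] unfolding hten_def by auto
 obtain t where t: "t <: T" "S.pq t = x" "S.cf t n = 0[SA]" using S_Fl_lift[OF assms(2)] by blast
 have "s -[T] t : genideal T sym_gens" using S.pq_eq_iff[OF s(1) t(1)] s t by simp
 hence "S.cf (s -[T] t) n = 0[SA]" by(rule cf_S_ideal)
 thus ?thesis using s t am_zn(4)[OF T.abx S.Q.abx S.cf_am s(1) t(1), of n] S.Fl_c[OF assms(1)]
   S.Q.mn_zero_iff by simp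
qed

lemma sig_Fl: "u : U.Fl {..<n} ==> \<sigma> u : S.Fl {..<n}"
proof (induction rule: U.Fl.induct)
 case zero
 thus ?case using am_zn(1)[OF U.Q.abx S.Q.abx sig_am] S.Fl.zero by simp
next
 case (gen k p m a j)
 obtain Xs where Xs: "set Xs <= car L" "length Xs = k" "m = wU Xs" using Fl_hword_U[OF gen(1)] .
 note c = w_closed[OF Xs(1)]
 have "\<sigma> (wU Xs) -[SA] wS Xs : S.Fl {..<n}" "wS Xs : S.Fl {..<n}"
  using sig_word[OF Xs(1)] w_Fl(2)[OF Xs(1)] Xs(2) gen(2) by(auto elim!: S.Fl_mono)
 hence "\<sigma> (wU Xs) : S.Fl {..<n}" using S.Fl.add c S.Q.mn_cancel by(metis sig_c)
 thus ?case using S.Fl_sc K.hpc[OF gen(3)] c by(simp add: Xs(3) sig_rs)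
next
 case (add x y)
 thus ?case using amD2[OF sig_am] U.Fl_c S.Fl.add by metis
qed

lemma U_Fl_split: "u : U.Fl {..<Suc n} ==> EX w:U.Fl {n}. EX v:U.Fl {..<n}. u = w +[UA] v"
proof (induction rule: U.Fl.induct)
 case zero
 have "0[UA] = 0[UA] +[UA] 0[UA]" by simp
 thus ?case using U.Fl.zero by blast
next
 case (gen k p m a j)
 note g = U.Fl.gen[OF gen(1) _ gen(3)]
 have c: "m *[UA] U.qscal a <: UA" using U.hmonoc[OF gen(1)] K.hpc[OF gen(3)] by simp
 show ?case proof (cases "k = n")
  case True
  hence "m *[UA] U.qscal a : U.Fl {n}" by(intro g) simp
  thus ?thesis using U.Fl.zero[of "{..<n}"] U.Q.r_zero[OF c, symmetric] by blast
 next
  case False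
  hence "m *[UA] U.qscal a : U.Fl {..<n}" using gen(2) by(intro g) auto
  thus ?thesis using U.Fl.zero[of "{n}"] U.Q.l_zero[OF c, symmetric] by blast
 qed
next
 case (add x y)
 then obtain w v w' v' where h: "w : U.Fl {n}" "v : U.Fl {..<n}" "x = w +[UA] v" "w' : U.Fl {n}" "v' : U.Fl {..<n}" "y = w' +[UA] v'" by blast
 hence "x +[UA] y = (w +[UA] w') +[UA] (v +[UA] v')" using U.Fl_c by(simp add: U.Q.a_ac)
 thus ?case using U.Fl.add[OF h(1,4)] U.Fl.add[OF h(2,5)] by blast
qed

lemma sig_strict: assumes u: "u : U.Fl {..<Suc n}" "\<sigma> u : S.Fl {..<n}" shows "u : U.Fl {..<n}"
proof -
 obtain w v where wv: "w : U.Fl {n}" "v : U.Fl {..<n}" "u = w +[UA] v" using U_Fl_split[OF u(1)] by blast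
 obtain t where t: "t : hten n" "U.pq t = w" using U_lift[OF wv(1)] by blast
 have tc: "t <: T" "U.cf t n = w" "S.cf t n = S.pq t" and st: "\<sigma> w -[SA] S.pq t : S.Fl {..<n}"
  using t by(auto simp: hten_def)
 note c = U.Fl_c[OF wv(1)] U.Fl_c[OF wv(2)]
 have "\<sigma> u -[SA] \<sigma> v = \<sigma> w" using c by(simp add: wv(3) amD2[OF sig_am] a_minus_def S.Q.a_assoc S.Q.r_neg)
 hence "\<sigma> w : S.Fl {..<n}" using S.Fl_mn[OF u(2) sig_Fl[OF wv(2)]] by simp
 hence "\<sigma> w -[SA] (\<sigma> w -[SA] S.pq t) : S.Fl {..<n}" using S.Fl_mn st by blast
 moreover have "\<sigma> w -[SA] (\<sigma> w -[SA] S.pq t) = S.pq t" using c tc by(simp add: a_minus_def S.Q.minus_add S.Q.r_neg2)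
 ultimately have "S.pq t : S.Fl {..<n}" by simp
 moreover have "S.pq t : S.Fl {n}" using S.cf_Fl[OF tc(1), of n] tc(3) by simp
 ultimately have "S.pq t = 0[SA]" using S_Fl_disjoint by blast
 \<comment> \<open>Now t lies in the ideal of S(g), and its part of degree n in U(g) is w
   itself.\<close>
 hence "w : U.Fl {..<n}" using cf_U_ideal[of t n] S.pq_zero_iff[OF tc(1)] tc(2) by simp
 thus ?thesis using wv U.Fl.add by blast
qed

text \<open>\<open>sig_strict\<close> lowers the bound one step at a time until only zero
  remains.\<close>

lemma sig_inj0: "u : U.Fl {..<n} ==> \<sigma> u = 0[SA] ==> u = 0[UA]"
proof (induction n)
 case 0
 from 0(1) show ?case by(induction rule: U.Fl.induct) simp_all
next
 case (Suc n)
 thus ?case using sig_strict[OF Suc.prems(1)] S.Fl.zero by simp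
qed

lemma sig_bij: "bij_betw \<sigma> (car UA) (car SA)" unfolding bij_betw_def
proof
 show "inj_on \<sigma> (car UA)" proof (rule inj_onI)
  fix x y assume h: "x <: UA" "y <: UA" "\<sigma> x = \<sigma> y"
  have "\<sigma> (x -[UA] y) = 0[SA]" using am_zn(4)[OF U.Q.abx S.Q.abx sig_am h(1,2)] h S.Q.mn_zero_iff by simp
  moreover obtain n where "x -[UA] y : U.Fl {..n}" using U.Fl_finite[of "x -[UA] y"] h by auto
  ultimately have "x -[UA] y = 0[UA]" using sig_inj0[of _ "Suc n"] by(simp add: lessThan_Suc_atMost)
  thus "x = y" using U.Q.mn_zero_iff h by simp
 qed
 show "\<sigma> ` car UA = car SA" proof
  show "car SA <= \<sigma> ` car UA" proof
   fix s assume "s <: SA"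
   then obtain n where "s : S.Fl {..<Suc n}" using S.Fl_finite unfolding lessThan_Suc_atMost by blast
   then obtain u where "u : U.Fl {..<Suc n}" "\<sigma> u = s" using sig_surj by blast
   thus "s : \<sigma> ` car UA" using U.Fl_c[of u] by(intro image_eqI[of _ _ u]) simp_all
  qed
 qed (use sig_c in blast)
qed

end

section \<open>The inverse of the symbol map and the associated graded algebra\<close>

section \<open>The inverse of the symbol map and associated graded maps\<close>

text \<open>Product and scalar action in \<open>gr_alg\<close> are sums of a subgroup with a set of
  values; such a sum collapses to the coset of any one value.\<close>

lemma (in abelian_subgroup) set_add_absorb: assumes z: "z <: G" "z : Z" and Z: "Z <= H +> z"
 shows "H <+>\<^bsub>G\<^esub> Z = H +> z"
proof
 show "H +> z <= H <+>\<^bsub>G\<^esub> Z" using z by(auto simp: set_add_def' a_r_coset_def')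
 show "H <+>\<^bsub>G\<^esub> Z <= H +> z" proof
  fix w assume "w : H <+>\<^bsub>G\<^esub> Z"
  then obtain h y where h: "h : H" "y : Z" "w = h \<oplus> y" by(auto simp: set_add_def')
  then obtain h' where h': "h' : H" "y = h' \<oplus> z" using Z by(auto simp: a_r_coset_def')
  hence "w = (h \<oplus> h') \<oplus> z" using h z a_Hcarr by(simp add: a_assoc)
  thus "w : H +> z" using additive_subgroup.a_closed[OF additive_subgroup_axioms h(1) h'(1)] by(auto simp: a_r_coset_def')
 qed
qed

context pbw begin

definition "r = (\<lambda>x\<in>car SA. inv_into (car UA) \<sigma> x)"

lemma r_closed [simp]: "x <: SA ==> r x <: UA" using sig_bij by(simp add: r_def bij_betw_def inv_into_into)

lemma sig_r [simp]: "x <: SA ==> \<sigma> (r x) = x" using sig_bij by(simp add: r_def bij_betw_def f_inv_into_f)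

lemma r_sig [simp]: "u <: UA ==> r (\<sigma> u) = u" using sig_bij by(simp add: r_def bij_betw_def inv_into_f_f)

lemma r_eqI: "u <: UA ==> \<sigma> u = x ==> r x = u" using r_sig by blast

lemma r_add: "x <: SA ==> y <: SA ==> r (x +[SA] y) = r x +[UA] r y" by(rule r_eqI) (simp_all add: amD2[OF sig_am])

lemma r_addmap: "addmap SA UA r" by(rule addmapI) (simp_all add: r_add)

lemma r_rs: "x <: SA ==> a <: K ==> r (x *[SA] kp a) = r x *[UA] U.qscal a" by(rule r_eqI) (simp_all add: sig_rs)

lemma r_Hom: "r : Hom K SA UA"
proof (rule HomI)
 show "r (x .[SA] a) = r x .[UA] a" if "x <: SA" "a <: K" for x a using that by(simp add: S.Q_rs U.Q_rs r_rs)
qed (simp_all add: r_add, simp add: r_def)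

lemma r_bij: "bij_betw r (car SA) (car UA)" by(rule bij_betw_byWitness[of _ \<sigma>]) (use r_closed sig_c in auto)

text \<open>The symbol map preserves parity, so it maps the two components of r x to the components
  of x. The one of parity i already maps to x.\<close>

lemma r_hpart: assumes x: "x : hp SA i" shows "r x : hp UA i"
proof -
 note xc = S.Q.hpc[OF x]
 let ?u = "r x"
 let ?v = "hcomp UA i ?u" and ?w = "hcomp UA (i + 1) ?u"
 have h: "?v : hp UA i" "?w : hp UA (i + 1)" using U.Q.hcomp_h[OF r_closed[OF xc]] by blast+
 note hc = U.Q.hpc[OF h(1)] U.Q.hpc[OF h(2)]
 have "?u = ?v +[UA] ?w" using U.Q.hcomp_sum[OF r_closed[OF xc]] hc by(cases i) (simp_all add: U.Q.a_comm)
 hence "x = \<sigma> ?v +[SA] \<sigma> ?w" using sig_r[OF xc] amD2[OF sig_am hc] by metis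
 hence "hcomp SA i x = \<sigma> ?v" using S.Q.hcomp_eq[OF sig_hp[OF h(1)] sig_hp[OF h(2)]] by simp
 hence "\<sigma> ?v = x" using S.Q.hcomp_hom[OF x, of i] by simp
 hence "?u = ?v" using hc r_eqI by blast
 thus ?thesis using h(1) by metis
qed

lemma r_Fl: "x : S.Fl {..<n} ==> r x : U.Fl {..<n}" using sig_surj[of x n] U.Fl_c r_sig by metis

lemma env_fil_eq: "env_fil K L n = U.Fl {..n}" unfolding env_fil_def U.Fl_rspan[symmetric] by simp

lemma sym_pow_eq: "sym_pow K L n = S.Fl {n}" unfolding sym_pow_def S.Fl_rspan[symmetric] by simp

lemma U_Fl_empty: "U.Fl {} = {0[UA]}"
proof -
 have "u = 0[UA]" if "u : U.Fl {}" for u using that by(induction rule: U.Fl.induct) simp_all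
 thus ?thesis using U.Fl.zero by blast
qed

abbreviation "fb == %n. U.Fl {..<n}"

lemma fil_below_eq: "fil_below UA (env_fil K L) = fb"
 by(rule ext) (simp add: fil_below_def env_fil_eq U_Fl_empty lessThan_Suc_atMost split: nat.split)

lemma gr_sel [simp]:
 "car (gr_env K L) = {f. (ALL n. f n : (%x. fb n +>[UA] x) ` U.Fl {..n}) & finite {n. f n ~= fb n}}"
 "monoid.mult (gr_env K L) = (%f g n. fb n <+>\<^bsub>UA\<^esub>
  {\<Oplus>\<^bsub>UA\<^esub>i\<in>{..n}. x i *[UA] y (n - i) | x y. ALL i<=n. x i : f i & y i : g i})"
 "1[gr_env K L] = (%n. if n = 0 then fb 0 +>[UA] 1[UA] else fb n)"
 "add (gr_env K L) = (%f g n. f n <+>\<^bsub>UA\<^esub> g n)"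
 "hp (gr_env K L) i = {f:car (gr_env K L). ALL n. f n : (%x. fb n +>[UA] x) ` (U.Fl {..n} Int hp UA i)}"
 "rsmult (gr_env K L) = (%f a n. fb n <+>\<^bsub>UA\<^esub> {x .[UA] a | x. x : f n})"
 by(simp_all add: gr_env_def gr_alg_def Let_def fil_below_eq env_fil_eq)

lemma fb_qu: "smod_quot (fb n) UA" by(rule smod_quotI[OF U.Q.abx U.Fl_sub])

lemma fb_coset: "c <: UA ==> w : fb n +>[UA] c \<longleftrightarrow> (EX b:fb n. w = b +[UA] c)" by(auto simp: a_r_coset_def')

lemma fb_self: "c <: UA ==> c : fb n +>[UA] c" using U.Fl.zero[of "{..<n}"] U.Q.l_zero[of c] by(simp only: fb_coset) metis

lemma fb_absorb: "c <: UA ==> c : Z ==> Z <= fb n +>[UA] c ==> fb n <+>\<^bsub>UA\<^esub> Z = fb n +>[UA] c"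
 using abelian_subgroup.set_add_absorb[OF smod_quot.axioms[OF fb_qu]] .

lemma fb_zero: "fb n +>[UA] 0[UA] = fb n"
 using smod_quot.proj_zero_iff[OF fb_qu[of n] U.Q.zero_closed] smod_quot.quot_zero[OF fb_qu[of n]] U.Fl.zero[of "{..<n}"] by simp

text \<open>The algebra map from T to gr U(g) that takes the class of each homogeneous part. It
  factors through S(g) by \<open>cf_U_ideal\<close>.\<close>

definition "GF t = (%n. fb n +>[UA] U.cf t n)"

lemma GF_eq: assumes "s <: T" "t <: T" "S.pq s = S.pq t" shows "GF s = GF t"
proof
 fix n
 have "s -[T] t : genideal T sym_gens" using S.pq_eq_iff[OF assms(1,2)] assms(3) by simp
 hence "U.cf (s -[T] t) n : fb n" by(rule cf_U_ideal)
 hence "U.cf s n -[UA] U.cf t n : fb n" using am_zn(4)[OF T.abx U.Q.abx U.cf_am assms(1,2)] by simp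
 thus "GF s n = GF t n" using smod_quot.proj_eq_iff[OF fb_qu, of "U.cf s n" "U.cf t n" n] assms by(simp add: GF_def)
qed

lemma GF_c: "t <: T ==> GF t : car (gr_env K L)"
proof -
 assume t: "t <: T"
 have "GF t n : (%x. fb n +>[UA] x) ` U.Fl {..n}" for n
  unfolding GF_def using U.cf_Fl[OF t, of n] by(intro imageI) (auto elim!: U.Fl_mono)
 moreover have "{n. GF t n ~= fb n} <= {n. U.cf t n ~= 0[UA]}" using fb_zero by(auto simp: GF_def)
 hence "finite {n. GF t n ~= fb n}" using U.cf_finite[OF t] by(rule finite_subset)
 ultimately show ?thesis by simp
qed

lemma GF_add: "s <: T ==> t <: T ==> GF (s +[T] t) = GF s +[gr_env K L] GF t"
 using abelian_subgroup.a_rcos_sum[OF smod_quot.axioms[OF fb_qu]] by(simp add: GF_def U.cf_add fun_eq_iff)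

lemma GF_scal: assumes "t <: T" "a <: K" shows "GF (t *[T] tscal a) = GF t .[gr_env K L] a"
proof
 fix n
 let ?c = "U.cf t n"
 have c: "?c <: UA" "?c *[UA] U.qscal a <: UA" using assms by simp_all
 have "fb n <+>\<^bsub>UA\<^esub> {x .[UA] a | x. x : fb n +>[UA] ?c} = fb n +>[UA] (?c *[UA] U.qscal a)"
 proof (rule fb_absorb[OF c(2)])
  show "?c *[UA] U.qscal a : {x .[UA] a | x. x : fb n +>[UA] ?c}"
   using fb_self[OF c(1), of n] U.Q_rs[OF c(1) assms(2)] by(intro CollectI exI[of _ ?c]) simp
  show "{x .[UA] a | x. x : fb n +>[UA] ?c} <= fb n +>[UA] (?c *[UA] U.qscal a)" proof
   fix w assume "w : {x .[UA] a | x. x : fb n +>[UA] ?c}"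
   then obtain v where v: "v : fb n +>[UA] ?c" "w = v .[UA] a" by(elim CollectE exE conjE)
   from v(1) obtain b where "b : fb n" "v = b +[UA] ?c" unfolding fb_coset[OF c(1)] by(rule bexE)
   hence b: "b : fb n" "w = (b +[UA] ?c) .[UA] a" using v(2) by simp_all
   have "w = b *[UA] U.qscal a +[UA] ?c *[UA] U.qscal a" using b c assms U.Fl_c[OF b(1)] by(simp add: U.Q_rs U.Q.l_distr)
   thus "w : fb n +>[UA] (?c *[UA] U.qscal a)" using U.Fl_sc[OF b(1) assms(2)] fb_coset[OF c(2)] by blast
  qed
 qed
 thus "GF (t *[T] tscal a) n = (GF t .[gr_env K L] a) n" using assms by(simp add: GF_def U.cf_mult_scal)
qed

text \<open>Varying the factors within their cosets changes each product by shorter words, so the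
  sums that \<open>gr_alg\<close> collects all lie in one coset.\<close>

lemma GF_mult: assumes s: "s <: T" and t: "t <: T" shows "GF (s *[T] t) = GF s *[gr_env K L] GF t"
proof
 fix n
 let ?c = "U.cf s" and ?d = "U.cf t"
 let ?Z = "{\<Oplus>\<^bsub>UA\<^esub>i\<in>{..n}. x i *[UA] y (n - i) | x y. ALL i<=n. x i : GF s i & y i : GF t i}"
 let ?z = "\<Oplus>\<^bsub>UA\<^esub>i\<in>{..n}. ?c i *[UA] ?d (n - i)"
 have c: "?c i <: UA" "?d i <: UA" for i using s t by simp_all
 have zc: "?z <: UA" using c by(intro U.Q.finsum_closed) auto
 have "fb n <+>\<^bsub>UA\<^esub> ?Z = fb n +>[UA] ?z" proof (rule fb_absorb[OF zc])
  have "ALL i<=n. ?c i : GF s i & ?d i : GF t i" using fb_self c by(simp add: GF_def)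
  thus "?z : ?Z" by blast
  show "?Z <= fb n +>[UA] ?z" proof
   fix w assume "w : ?Z"
   then obtain x y where xy: "w = (\<Oplus>\<^bsub>UA\<^esub>i\<in>{..n}. x i *[UA] y (n - i))" "ALL i<=n. x i : GF s i & y i : GF t i" by blast
   have "EX b:fb n. x i *[UA] y (n - i) = b +[UA] ?c i *[UA] ?d (n - i)" if i: "i : {..n}" for i proof -
    let ?k = "n - i"
    obtain b b' where b: "b : fb i" "x i = b +[UA] ?c i" "b' : fb ?k" "y ?k = b' +[UA] ?d ?k"
     using xy(2) i fb_coset[OF c(1)] fb_coset[OF c(2)] unfolding GF_def by(metis atMost_iff diff_le_self)
    note bc = U.Fl_c[OF b(1)] U.Fl_c[OF b(3)]
    have "b' : U.Fl {..?k}" "?d ?k : U.Fl {..?k}" using b(3) U.cf_Fl[OF t, of ?k] by(auto elim!: U.Fl_mono)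
    hence y: "y ?k : U.Fl {..?k}" unfolding b(4) by(rule U.Fl.add)
    have 1: "b *[UA] y ?k : fb n" by(rule U.Fl_mult[OF b(1) y]) (use i in auto)
    have 2: "?c i *[UA] b' : fb n" by(rule U.Fl_mult[OF U.cf_Fl[OF s] b(3)]) (use i in auto)
    have "x i *[UA] y ?k = (b *[UA] y ?k +[UA] ?c i *[UA] b') +[UA] ?c i *[UA] ?d ?k"
     using bc c unfolding b(2,4) by(simp add: U.Q.l_distr U.Q.r_distr U.Q.a_ac)
    thus ?thesis using U.Fl.add[OF 1 2] by blast
   qed
   then obtain e where e: "!!i. i : {..n} ==> e i : fb n"
    "!!i. i : {..n} ==> x i *[UA] y (n - i) = e i +[UA] ?c i *[UA] ?d (n - i)" by metis
   note ec = U.Fl_c[OF e(1)]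
   have "w = (\<Oplus>\<^bsub>UA\<^esub>i\<in>{..n}. e i +[UA] ?c i *[UA] ?d (n - i))"
    unfolding xy(1) by(intro U.Q.finsum_cong') (use e(2) ec c in auto)
   also have "... = (\<Oplus>\<^bsub>UA\<^esub>i\<in>{..n}. e i) +[UA] ?z" using ec c by(intro U.Q.finsum_addf) auto
   finally show "w : fb n +>[UA] ?z" using U.Fl_finsum[of "{..n}" e] e(1) fb_coset[OF zc] by blast
  qed
 qed
 thus "GF (s *[T] t) n = (GF s *[gr_env K L] GF t) n" using U.cf_mult[OF s t, of n] by(simp add: GF_def)
qed

lemma GF_word: assumes Xs: "set Xs <= car L" shows "GF (wT Xs) = gr_class UA (env_fil K L) (length Xs) (wU Xs)"
 by(rule ext) (simp add: GF_def gr_class_def fil_below_eq U.cf_wT[OF Xs] fb_zero wU_def)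

text \<open>The canonical map from S(g) to gr U(g), computed on an arbitrary lift to T; by
  \<open>GF_eq\<close> the choice does not matter.\<close>

definition "jt = (\<lambda>x\<in>car SA. GF (SOME t. t <: T & S.pq t = x))"

lemma jt_pq: assumes "t <: T" shows "jt (S.pq t) = GF t"
proof -
 let ?s = "SOME s. s <: T & S.pq s = S.pq t"
 have "?s <: T & S.pq ?s = S.pq t" by(rule someI[of _ t]) (use assms in simp)
 thus ?thesis using GF_eq[of ?s t] assms by(simp add: jt_def)
qed

lemma jt_Hom: "jt : Hom K SA (gr_env K L)"
proof (rule HomI)
 show "jt x : car (gr_env K L)" if "x <: SA" for x using S.pq_cases[OF that] jt_pq GF_c by metis
 show "jt (x +[SA] y) = jt x +[gr_env K L] jt y" if "x <: SA" "y <: SA" for x y proof -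
  obtain s where s: "s <: T" "x = S.pq s" by(rule S.pq_cases[OF `x <: SA`])
  obtain t where t: "t <: T" "y = S.pq t" by(rule S.pq_cases[OF `y <: SA`])
  note h = s t
  show ?thesis using jt_pq[OF T.a_closed[OF h(1,3)]] unfolding h(2,4) jt_pq[OF h(1)] jt_pq[OF h(3)] S.pq_add[OF h(1,3)] GF_add[OF h(1,3)] .
 qed
 show "jt (x .[SA] a) = jt x .[gr_env K L] a" if "x <: SA" "a <: K" for x a proof -
  obtain t where t: "t <: T" "x = S.pq t" by(rule S.pq_cases[OF `x <: SA`])
  have "x .[SA] a = S.pq (t *[T] tscal a)" using t that by(simp add: S.Q_rs S.pq_mult S.pq_tscal)
  show ?thesis using jt_pq[OF T.m_closed[OF t(1) tscal_c[OF that(2)]]]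
   unfolding `x .[SA] a = _` GF_scal[OF t(1) that(2)] unfolding t(2) jt_pq[OF t(1)] .
 qed
qed (simp add: jt_def)

lemma jt_sahom: "jt : superalg_hom K SA (gr_env K L)" unfolding superalg_hom_def
proof (intro CollectI conjI)
 show "jt : Hom K SA (gr_env K L)" by(rule jt_Hom)
 show "jt : ring_hom SA (gr_env K L)" proof (rule ring_hom_memI)
  show "jt (x *[SA] y) = jt x *[gr_env K L] jt y" if "x <: SA" "y <: SA" for x y proof -
   obtain s where s: "s <: T" "x = S.pq s" by(rule S.pq_cases[OF `x <: SA`])
  obtain t where t: "t <: T" "y = S.pq t" by(rule S.pq_cases[OF `y <: SA`])
  note h = s t
   show ?thesis using jt_pq[OF T.m_closed[OF h(1,3)]] unfolding h(2,4) jt_pq[OF h(1)] jt_pq[OF h(3)] S.pq_mult[OF h(1,3)] GF_mult[OF h(1,3)] .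
  qed
  have "jt (S.pq 1[T]) = GF 1[T]" by(rule jt_pq) simp
  thus "jt 1[SA] = 1[gr_env K L]" using GF_word[of "[]"] by(simp add: S.pq_one gr_class_def fil_below_eq fun_eq_iff)
 qed (use HomD(2,4)[OF jt_Hom] in blast)+
 show "preserves_parity SA (gr_env K L) jt" unfolding preserves_parity_def proof (intro allI subsetI)
  fix i f assume "f : jt ` hp SA i"
  then obtain t where t: "t : hp T i" "f = jt (S.pq t)" unfolding S.Q_hp_eq by blast
  have tc: "t <: T" using T_hp_c t(1) by blast
  have "GF t n : (%x. fb n +>[UA] x) ` (U.Fl {..n} Int hp UA i)" for n
   unfolding GF_def using U.cf_Fl[OF tc, of n] U.cf_hpart[OF t(1)] by(intro imageI) (auto elim!: U.Fl_mono)
  thus "f : hp (gr_env K L) i" using GF_c[OF tc] unfolding t(2) jt_pq[OF tc] gr_sel(5) by blast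
 qed
qed

lemma jt_word: "set Xs <= car L ==> jt (wS Xs) = gr_class UA (env_fil K L) (length Xs) (wU Xs)"
 using jt_pq[of "wT Xs"] by(simp add: S.pq_wT GF_word flip: wS_def)

lemma gr_Hom_eqI: assumes f: "f : Hom K SA (gr_env K L)" and g: "g : Hom K SA (gr_env K L)"
  and eq: "!!Xs. set Xs <= car L ==> f (wS Xs) = g (wS Xs)" shows "f = g"
proof (rule Hom_eqI[OF f g])
 fix x assume "x <: SA"
 hence "x : S.Fl UNIV" by(simp add: S.Fl_UNIV)
 thus "f x = g x" proof (induction rule: S.Fl.induct)
  case zero
  \<comment> \<open>Zero is written as a scalar multiple of the empty word, so linearity of
    \<open>f\<close> and \<open>g\<close> settles this case as well.\<close>
  have "0[SA] = wS [] .[SA] 0[K]" by simp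
  thus ?case using HomD(5)[OF f, of "wS []" "0[K]"] HomD(5)[OF g, of "wS []" "0[K]"] eq[of "[]"] by simp
 next
  case (gen n p m a j)
  obtain Xs where Xs: "set Xs <= car L" "m = wS Xs" using Fl_hword[OF gen(1)] .
  note ac = K.hpc[OF gen(3)] and c = w_closed(2)[OF Xs(1)]
  have "f (wS Xs .[SA] a) = g (wS Xs .[SA] a)" unfolding HomD(5)[OF f c ac] HomD(5)[OF g c ac] eq[OF Xs(1)] ..
  thus ?case unfolding S.Q_rs[OF c ac] Xs(2) .
 next
  case (add x y)
  thus ?case using HomD(4)[OF f] HomD(4)[OF g] S.Fl_c by metis
 qed
qed

lemma j_tilde_eq: "j_tilde K L = jt" unfolding j_tilde_def wS_def[symmetric] wU_def[symmetric]
proof (rule the_equality)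
 show "jt : superalg_hom K SA (gr_env K L) & (ALL Xs. set Xs <= car L --> jt (wS Xs) = gr_class UA (env_fil K L) (length Xs) (wU Xs))"
  using jt_sahom jt_word by blast
 fix f assume f: "f : superalg_hom K SA (gr_env K L) & (ALL Xs. set Xs <= car L --> f (wS Xs) = gr_class UA (env_fil K L) (length Xs) (wU Xs))"
 show "f = jt" by(rule gr_Hom_eqI[OF _ jt_Hom]) (use f jt_word in "simp_all add: superalg_hom_def")
qed

text \<open>A lift of x of pure degree n has a class in U(g) whose symbol is x up to lower degree.
  Applying r shows that this class and r x agree modulo shorter words.\<close>

lemma jt_r: assumes x: "x : S.Fl {n}" shows "jt x = gr_class UA (env_fil K L) n (r x)"
proof -
 obtain t where t: "t : hten n" "S.pq t = x" using S_lift[OF x] by blast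
 have tc: "t <: T" "!!k. k ~= n ==> U.cf t k = 0[UA]" "U.cf t n = U.pq t"
  and st: "\<sigma> (U.pq t) -[SA] x : S.Fl {..<n}" using t by(auto simp: hten_def)
 note xc = S.Fl_c[OF x]
 have "r (\<sigma> (U.pq t) -[SA] x) = U.pq t -[UA] r x" using xc tc(1) am_zn(4)[OF S.Q.abx U.Q.abx r_addmap] by simp
 hence "U.pq t -[UA] r x : fb n" using r_Fl[OF st] by simp
 hence "fb n +>[UA] U.pq t = fb n +>[UA] r x" using smod_quot.proj_eq_iff[OF fb_qu, of "U.pq t" "r x" n] tc xc by simp
 moreover have "jt x = GF t" using jt_pq[OF tc(1)] t(2) by simp
 ultimately show ?thesis by(auto simp: fun_eq_iff GF_def gr_class_def fil_below_eq tc fb_zero)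
qed

lemma gr_map_eq: "gr_map K L r = jt" unfolding gr_map_def sym_pow_eq
proof (rule the_equality)
 show "jt : Hom K SA (gr_env K L) & (ALL n. ALL x:S.Fl {n}. jt x = gr_class UA (env_fil K L) n (r x))" using jt_Hom jt_r by blast
 fix f assume f: "f : Hom K SA (gr_env K L) & (ALL n. ALL x:S.Fl {n}. f x = gr_class UA (env_fil K L) n (r x))"
 show "f = jt" proof (rule gr_Hom_eqI[OF conjunct1[OF f] jt_Hom])
  fix Xs assume "set Xs <= car L"
  note x = w_Fl(2)[OF this]
  show "f (wS Xs) = jt (wS Xs)" unfolding jt_r[OF x] using conjunct2[OF f] x by blast
 qed
qed

lemma r_sym_pow: "r ` sym_pow K L n <= env_fil K L n"
 unfolding sym_pow_eq env_fil_eq lessThan_Suc_atMost[symmetric] using r_Fl[of _ "Suc n"] S.Fl_mono[of _ "{n}" "{..<Suc n}"] by auto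

end

section \<open>Extension of derivations and their compatibility with the symbol map\<close>

section \<open>Derivations\<close>

context talg begin

text \<open>The Leibniz rule for 1 = 1 1 makes each homogeneous component vanish at 1; on monomials
  it is then determined by its values on letters.\<close>

lemma der_uniq: assumes F: "superderivation K Q (monoid.mult Q) F" and G: "superderivation K Q (monoid.mult Q) G"
  and eq: "!!X. X <: M ==> F (qin X) = G (qin X)" shows "F = G"
proof -
 have H: "F : Hom K Q Q" "G : Hom K Q Q" using F G by(auto simp: superderivation_def)
 note hF = hom_comp_hHom[OF Q.smodule_axioms Q.smodule_axioms H(1)]
  and hG = hom_comp_hHom[OF Q.smodule_axioms Q.smodule_axioms H(2)]
 have der_one: "hom_comp Q Q d E 1[Q] = 0[Q]" if E: "superderivation K Q (monoid.mult Q) E" for E d proof -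
  have "E : Hom K Q Q" using E by(simp add: superderivation_def)
  hence c: "hom_comp Q Q d E 1[Q] <: Q" using hHom_c[OF hom_comp_hHom(1)[OF Q.smodule_axioms Q.smodule_axioms]] by blast
  have "hom_comp Q Q d E (1[Q] *[Q] 1[Q]) = hom_comp Q Q d E 1[Q] *[Q] 1[Q] +[Q] sg Q (d * 0) (1[Q] *[Q] hom_comp Q Q d E 1[Q])"
   using E Q_one_hp Q.one_closed unfolding superderivation_def by blast
  hence "hom_comp Q Q d E 1[Q] +[Q] 0[Q] = hom_comp Q Q d E 1[Q] +[Q] hom_comp Q Q d E 1[Q]" using c by simp
  thus ?thesis using c Q.r_neg1[OF c c] Q.l_neg[OF c] by simp
 qed
 have "hom_comp Q Q d F = hom_comp Q Q d G" for d proof (rule Q_Hom_eqI[OF hHomD(1)[OF hF(1)] hHomD(1)[OF hG(1)] Q.abx])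
  fix n p m assume "hmono n p m"
  thus "hom_comp Q Q d F m = hom_comp Q Q d G m" proof (induction rule: hmono.induct)
   case one
   thus ?case using der_one[OF F] der_one[OF G] by simp
  next
   case (mult n p m X q)
   have g: "hom_comp Q Q d F (qin X) = hom_comp Q Q d G (qin X)"
    unfolding hF(3)[OF qin_hp[OF mult(2)]] hG(3)[OF qin_hp[OF mult(2)]] eq[OF hpc[OF mult(2)]] ..
   show ?case using F G qin_hp[OF mult(2)] hmonoc[OF mult(1)] mult(3) g unfolding superderivation_def by simp
  qed
 qed
 hence "F x = G x" if "x <: Q" for x using hF(2)[OF that] hG(2)[OF that] by simp
 thus ?thesis by(rule Hom_eqI[OF H])
qed

lemma derI: assumes P: "!!d. P d : hHom K Q Q d"
  and L: "!!d i x y. x : hp Q i ==> y <: Q ==> P d (x *[Q] y) = P d x *[Q] y +[Q] sg Q (d * i) (x *[Q] P d y)"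
 shows "superderivation K Q (monoid.mult Q) (\<lambda>x\<in>car Q. P 0 x +[Q] P 1 x)" (is "superderivation K Q _ ?F")
proof -
 have F: "?F : Hom K Q Q" proof (rule HomI)
  show "?F (x .[Q] a) = ?F x .[Q] a" if "x <: Q" "a <: K" for x a
   using that hHom_rs[OF P that] hHom_c[OF P] Q.rsc[OF that] by(simp add: Q.rsmult_add_left del: Q_rs)
 qed (use hHom_c[OF P] in "simp_all add: hHom_add[OF P] Q.a_ac")
 have "hom_comp Q Q d ?F = P d" for d by(rule hom_comp_eq[OF Q.smodule_axioms Q.smodule_axioms F P]) simp
 thus ?thesis using F L unfolding superderivation_def by simp
qed

end

context lsa begin

lemma Ph_Z0: "u <: SA ==> Ph e Z0 u = 0[SA]" unfolding Ph_def by(subst conv_eqI[OF bil_mult idS in_comp[OF Z0] S.Q.am_zero])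
  (use S.Q.hpc S.qin_neg(3) in simp_all)

text \<open>The derivatives of a constant field vanish, so in the recursion of \<open>Ph\<close> the
  letter a only moves past the other letters, and the sign undoes itself by commutativity of
  S(g).\<close>

lemma Ph_cst: assumes a: "a : hp L e" and u: "u <: SA" shows "Ph e (cst a) u = io a *[SA] u"
proof -
 note ac = hpc[OF a] and P = Ph_hHom[OF cst[OF a]]
 have am: "addmap SA SA (%u. io a *[SA] u)" by(rule addmapI) (simp_all add: ac S.Q.r_distr)
 show ?thesis proof (rule lin_eqI[OF hHom_am[OF P] am EE_rs[OF P] _ _ u])
  fix n p m assume "S.hmono n p m"
  thus "Ph e (cst a) m = io a *[SA] m" proof (induction rule: S.hmono.induct)
   case one
   thus ?case using ac by(simp add: Ph_one[OF cst[OF a]] eps_one rsmult_one)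
  next
   case (mult n p m X q)
   note mc = S.hmonoc[OF mult(1)] and Xc = hpc[OF mult(2)]
   have "io a *[SA] (io X *[SA] m) = sg SA (q * e) (io X *[SA] (io a *[SA] m))"
    using sym_comm[OF a mult(2)] ac Xc mc by(simp add: sg_def S.Q.l_minus S.Q.m_assoc[symmetric] mult.commute[of q e])
   thus ?case using ac Xc mc by(simp add: Ph_in[OF cst[OF a] mult(2) mc] dl_cst[OF mult(2)] Ph_Z0 mult(3))
  qed
 qed (use ac in "simp_all add: S.Q.m_assoc")
qed

end

locale lie_der = pbw K L for K :: "'k sring" and L :: "('k, 'g) lie_sring" (structure) +
 fixes D assumes D: "superderivation K L br D"
begin

definition "dp d = hom_comp L L d D"

lemma D_Hom: "D : Hom K L L" using D by(simp add: superderivation_def)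

lemma dp: "dp d : hHom K L L d" and D_sum: "x <: L ==> D x = dp 0 x \<oplus> dp 1 x"
 using hom_comp_hHom(1,2)[OF smodule_axioms smodule_axioms D_Hom] by(simp_all add: dp_def)

lemmas dp_closed = hHom_c[OF dp] and dp_add = hHom_add[OF dp] and dp_rsmult = hHom_rs[OF dp]

lemma dp_sg: "x <: L ==> dp d (sg L k x) = sg L k (dp d x)" using am_zn(3)[OF abx abx hHom_am[OF dp]] .

lemma dp_zero: "dp d \<zero> = \<zero>" using am_zn(1)[OF abx abx hHom_am[OF dp]] .

lemma dp_br: "x : hp L i ==> y <: L ==> dp d (br x y) = br (dp d x) y \<oplus> sg L (d * i) (br x (dp d y))"
 using D unfolding superderivation_def dp_def by blast

definition "EF d F = (\<lambda>u\<in>car SA. dp d (F u))"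

lemma EF_app [simp]: "u <: SA ==> EF d F u = dp d (F u)" by(simp add: EF_def)

lemma EF: assumes F: "F : C e" shows "EF d F : C (d + e)"
proof (rule hHomI, rule HomI)
 note Fc = hHom_c[OF F]
 show "EF d F x : hp L (d + e + i)" if "x : hp SA i" for i x
  using hHomD(2)[OF dp hHomD(2)[OF F that]] S.Q.hpc[OF that] by(simp add: add.assoc)
 show "EF d F (x .[SA] a) = EF d F x \<bullet> a" if "x <: SA" "a <: K" for x a
  using that hHom_rs[OF F that] Fc S.Q.rsc[OF that] by(simp add: dp_rsmult)
qed (use hHom_c[OF F] dp_closed in "simp_all add: hHom_add[OF F] dp_add", simp add: EF_def)

text \<open>\<open>Y d\<close> is the linear vector field x |-> D x for the component of D of parity
  d; its operator \<open>P d\<close> extends that component to a derivation of S(g).\<close>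

definition "Y d = EF d xS"
definition "P d = Ph d (Y d)"

lemma Y: "Y d : C d" using EF[OF xS, of d] by(simp add: Y_def)

lemma Y_app: "u <: SA ==> Y d u = dp d (xS u)" by(simp add: Y_def)

lemma P: "P d : EE d" unfolding P_def by(rule Ph_hHom[OF Y])

lemmas P_closed = hHom_c[OF P] and P_add = hHom_add[OF P]

lemma P_one: "P d 1[SA] = 0[SA]"
proof -
 have "xS 1[SA] = \<zero>" by(simp add: xS_def prL_one)
 hence "Y d 1[SA] = \<zero>" by(simp add: Y_def dp_zero)
 thus ?thesis by(simp add: P_def Ph_one[OF Y] S.qin_neg(3))
qed

lemma P_in: assumes X: "X : hp L q" and u: "u <: SA"
 shows "P d (io X *[SA] u) = io (dp d X) *[SA] u +[SA] sg SA (d * q) (io X *[SA] P d u)"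
proof -
 note Xc = hpc[OF X]
 have "dl X (Y d) = cst (dp d X)"
  unfolding dl_def cst_def by(rule restrict_ext) (use Xc amD1[OF eps_addmap] in "simp add: Y_def xS_def prL_in dp_rsmult")
 thus ?thesis using Xc u P_closed dp_closed Ph_cst[OF hHomD(2)[OF dp X] u, of d]
  by(simp add: P_def Ph_in[OF Y X u] S.Q.a_comm mult.commute[of q d] hHom_c[OF Ph_hHom[OF Y]])
qed

lemma P_scal: "a : hp K l ==> u <: SA ==> P d (kp a *[SA] u) = sg SA (d * l) (kp a *[SA] P d u)"
 using hHom_ls[OF S.Q.smodule_axioms S.Q.smodule_axioms P] P_closed by(simp add: S.Q_ls K.hpc)

lemma P_zero: "P d 0[SA] = 0[SA]" by(rule am_zn(1)[OF S.Q.abx S.Q.abx hHom_am[OF P]])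


lemma sg_mult_right: "x <: SA ==> y <: SA ==> x *[SA] sg SA k y = sg SA k (x *[SA] y)"
 and sg_mult_left: "x <: SA ==> y <: SA ==> sg SA k x *[SA] y = sg SA k (x *[SA] y)"
 by(simp_all add: sg_def S.Q.r_minus S.Q.l_minus)

lemma P_leibniz: assumes y: "y <: SA" shows "x : hp SA i ==> P d (x *[SA] y) = P d x *[SA] y +[SA] sg SA (d * i) (x *[SA] P d y)"
proof (induction rule: S.Q_hp_ind)
 case (zero i)
 thus ?case using y P_closed by(simp add: P_zero)
next
 case (scal j a)
 have "P d (kp a *[SA] 1[SA]) = 0[SA]" using scal by(simp add: P_scal P_one K.hpc del: S.Q.r_one)
 hence "P d (kp a) = 0[SA]" using scal by(simp add: K.hpc)
 thus ?case using scal y P_closed by(simp add: P_scal K.hpc)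
next
 case (mult p X j x)
 note c = hpc[OF mult(1)] S.Q.hpc[OF mult(2)]
 show ?case using c y P_closed dp_closed
  by(simp add: S.Q.m_assoc P_in[OF mult(1)] mult(3) S.Q.l_distr S.Q.r_distr S.Q.sg_add sg_mult_right sg_mult_left S.Q.sg_sg S.Q.a_assoc distrib_left)
next
 case (add j x x')
 thus ?case using y P_closed by(simp add: P_add S.Q.l_distr S.Q.sg_add S.Q.a_ac)
qed

definition "DS = (\<lambda>x\<in>car SA. P 0 x +[SA] P 1 x)"

lemma DS: "superderivation K SA (monoid.mult SA) DS" unfolding DS_def by(rule S.derI[OF P]) (rule P_leibniz)

lemma DS_in: assumes X: "X <: L" shows "DS (io X) = io (D X)"
proof -
 have "P d (io X) = io (dp d X)" for d using X proof (induction rule: hom_ind)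
  case (hom p X)
  thus ?case using P_in[OF hom S.Q.one_closed, of d] dp_closed by(simp add: hpc P_one)
 next
  case (add X X')
  thus ?case using dp_closed by(simp add: S.qin_add P_add dp_add)
 qed
 thus ?thesis using X dp_closed by(simp add: DS_def D_sum S.qin_add)
qed

lemma ext_der_S: "ext_derivation K L SA (sym_in K L) D = DS" unfolding ext_derivation_def
 by(rule the_equality) (use DS DS_in S.der_uniq in "blast, metis")

lemma dp_brc: assumes F: "F : C e" and u: "u <: SA"
 shows "dp d (brc e xS F u) = brc e (Y d) F u \<oplus> brc (e + d) xS (EF d F) u"
proof -
 have EFd: "EF d F : C (e + d)" using EF[OF F, of d] by(simp add: add.commute)
 note a = cv(1)[OF bil_br xS F] and b = cv(1)[OF bil_br Y[of d] F] and c = cv(1)[OF bil_br xS EFd]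
 have "dp d (cv L br e xS F (\<Delta> u)) = cv L br e (Y d) F (\<Delta> u) \<oplus> cv L br (e + d) xS (EF d F) (\<Delta> u)"
 proof (rule P_eqI[OF am_o[OF a hHom_am[OF dp]] am_add[OF b c] _ coprod_c[OF u]])
  fix i j v w assume vw: "v : hp SA i" "w : hp SA j"
  note vc = S.Q.hpc[OF vw(1)] S.Q.hpc[OF vw(2)]
  have x: "xS v : hp L i" using hHomD(2)[OF xS vw(1)] by simp
  note cl = hpc[OF x] hHom_c[OF F vc(2)]
  show "dp d (cv L br e xS F (pt v w)) = cv L br e (Y d) F (pt v w) \<oplus> cv L br (e + d) xS (EF d F) (pt v w)"
   using vc cl dp_closed
   by(simp add: cv(2)[OF bil_br xS F vw(1) vc(2)] cv(2)[OF bil_br Y F vw(1) vc(2)] cv(2)[OF bil_br xS EFd vw(1) vc(2)]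
     dp_sg dp_br[OF x] lbr_closed Y_app sg_add sg_sg distrib_right)
 qed
 thus ?thesis using u by(simp add: conv_def)
qed

text \<open>Measures how far F is from commuting with D: D applied to the values, minus the
  derivative of F along the linear field of D, with signs.\<close>

definition "dd d e F = lin2 L 0 (EF d F) (d * e + 1) (cmp F (P d))"

lemma cmpP: "F : C e ==> cmp F (P d) : C (d + e)" using cmp_hHom[OF _ P, of F L e d] by(simp add: add.commute)

lemma dd: "F : C e ==> dd d e F : C (d + e)" unfolding dd_def by(rule lin2_hHom[OF smodule_axioms EF cmpP])

text \<open>From [x, F] both halves of \<open>dd\<close> produce the bracket of \<open>Y d\<close>
  with F. It cancels in the difference, so \<open>dd\<close> passes through ad x.\<close>

lemma dd_T: assumes F: "F : C e" shows "dd d e (brc e xS F) = brc (d + e) xS (dd d e F)"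
proof (rule C_ext[OF dd[OF brc_hHom[OF xS F, simplified]] brc_hHom[OF xS dd[OF F]] abx])
 fix n p m assume m: "S.hmono n p m"
 note mc = S.hmonoc[OF m]
 have TF: "brc e xS F : C e" using brc_hHom[OF xS F] by simp
 let ?A = "brc e (Y d) F m" and ?B = "brc (d + e) xS (EF d F) m" and ?G = "brc (d + e) xS (cmp F (P d)) m"
 have c: "?A <: L" "?B <: L" "?G <: L" using brc_c[OF Y F mc] brc_c[OF xS EF[OF F] mc] brc_c[OF xS cmpP[OF F] mc] by blast+
 have "brc e xS F (P d m) = sg L (d * e) ?A \<oplus> ?G"
  using brc_Ph_mono[OF m xS F Y[of d]] xS_Ph[OF Y[of d]] by(simp add: P_def add.commute)
 moreover have "dp d (brc e xS F m) = ?A \<oplus> ?B" using dp_brc[OF F mc, of d] by(simp add: add.commute)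
 moreover have "sg L (d * e + 1) (sg L (d * e) ?A \<oplus> ?G) = \<ominus> ?A \<oplus> sg L (d * e + 1) ?G"
  using c by(cases d; cases e) (simp_all add: sg_def minus_add)
 ultimately have "dd d e (brc e xS F) m = (?A \<oplus> ?B) \<oplus> (\<ominus> ?A \<oplus> sg L (d * e + 1) ?G)"
  using mc by(simp add: dd_def lin2_def)
 also have "... = ?B \<oplus> sg L (d * e + 1) ?G" using c by(simp add: a_ac r_neg1 r_neg2)
 also have "... = brc (d + e) xS (dd d e F) m" unfolding dd_def conv_lin2_right[OF bil_br xS EF[OF F] cmpP[OF F] mc] by simp
 finally show "dd d e (brc e xS F) m = brc (d + e) xS (dd d e F) m" .
qed

lemma dd_Tp: "F : C e ==> dd d e (Tp e n F) = Tp (d + e) n (dd d e F)" by(induction n) (simp_all add: Tp_Suc dd_T Tp_hHom)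

lemma dd_cst: assumes X: "X : hp L q" shows "dd d q (cst X) = cst (dp d X)"
 using hpc[OF X] amD1[OF eps_addmap] fun_cong[OF cst_Ph[OF X Y[of d]]]
 by(auto simp: fun_eq_iff dd_def lin2_def cst_def P_def cmp_def Z0_def dp_rsmult dp_closed rsc)

text \<open>\<open>dd\<close> passes through ad x and through the coefficients, and it sends the
  constant X to the constant D X; hence it does the same to the whole series.\<close>

lemma dd_psih: assumes X: "X : hp L q" shows "dd d q (psih q X) = psih (d + q) (dp d X)"
proof (rule C_ext[OF dd[OF psih[OF X]] psih[OF hHomD(2)[OF dp X]] abx])
 fix n p m assume m: "S.hmono n p m"
 note mc = S.hmonoc[OF m]
 \<comment> \<open>The length bound available for \<open>P d m\<close> is \<open>Suc n\<close>; one
   index set then serves both m and \<open>P d m\<close>.\<close>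
 let ?I = "{..Suc n}"
 have f: "m : S.Fl ?I" "P d m : S.Fl ?I" using Fl_of_mono[OF m, of ?I] Ph_Fl_mono[OF m Y] by(simp_all add: P_def)
 have Tc: "Tp q k (cst X) u <: L" if "u <: SA" for k u using hHom_c[OF Tp_hHom[OF cst[OF X]] that] .
 note Pm = P_closed[OF mc]
 have 1: "dp d (psih q X m) = (\<Oplus>k\<in>?I. dp d (Tp q k (cst X) m) \<bullet> tc k)" proof -
  have "dp d (psih q X m) = dp d (\<Oplus>k\<in>?I. Tp q k (cst X) m \<bullet> tc k)" using psih_eq[OF X f(1)] mc by(simp add: lc_def)
  also have "... = (\<Oplus>k\<in>?I. dp d (Tp q k (cst X) m \<bullet> tc k))"
   by(rule am_fs[OF abx abx hHom_am[OF dp]]) (use Tc mc in "auto intro: rsc")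
  finally show ?thesis using Tc[OF mc] by(simp add: dp_rsmult)
 qed
 have 2: "sg L (d * q + 1) (psih q X (P d m)) = (\<Oplus>k\<in>?I. sg L (d * q + 1) (Tp q k (cst X) (P d m)) \<bullet> tc k)"
 proof -
  have "sg L (d * q + 1) (psih q X (P d m)) = sg L (d * q + 1) (\<Oplus>k\<in>?I. Tp q k (cst X) (P d m) \<bullet> tc k)"
   using psih_eq[OF X f(2)] Pm by(simp add: lc_def)
  also have "... = (\<Oplus>k\<in>?I. sg L (d * q + 1) (Tp q k (cst X) (P d m) \<bullet> tc k))"
   by(rule am_fs[OF abx abx sg_am]) (use Tc Pm in "auto intro: rsc")
  finally show ?thesis using Tc[OF Pm] by(simp add: rs_sg)
 qed
 have "dd d q (psih q X) m = (\<Oplus>k\<in>?I. dp d (Tp q k (cst X) m) \<bullet> tc k) \<oplus> (\<Oplus>k\<in>?I. sg L (d * q + 1) (Tp q k (cst X) (P d m)) \<bullet> tc k)"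
  using mc 1 2 by(simp add: dd_def lin2_def)
 also have "... = (\<Oplus>k\<in>?I. dp d (Tp q k (cst X) m) \<bullet> tc k \<oplus> sg L (d * q + 1) (Tp q k (cst X) (P d m)) \<bullet> tc k)"
  using Tc mc Pm dp_closed by(intro finsum_addf[symmetric]) (auto intro!: rsc)
 also have "... = (\<Oplus>k\<in>?I. Tp (d + q) k (cst (dp d X)) m \<bullet> tc k)" proof (intro finsum_cong')
  fix k assume "k : ?I"
  have "Tp (d + q) k (cst (dp d X)) m = dp d (Tp q k (cst X) m) \<oplus> sg L (d * q + 1) (Tp q k (cst X) (P d m))"
   using fun_cong[OF dd_Tp[OF cst[OF X], of d k], of m] mc unfolding dd_cst[OF X] by(simp add: dd_def lin2_def)
  thus "dp d (Tp q k (cst X) m) \<bullet> tc k \<oplus> sg L (d * q + 1) (Tp q k (cst X) (P d m)) \<bullet> tc k = Tp (d + q) k (cst (dp d X)) m \<bullet> tc k"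
   using Tc mc Pm dp_closed by(simp add: rsmult_add_left)
 qed (use hHom_c[OF Tp_hHom[OF cst[OF hHomD(2)[OF dp X]]] mc] in "auto intro: rsc")
 also have "... = psih (d + q) (dp d X) m" using psih_eq[OF hHomD(2)[OF dp X] f(1)] mc by(simp add: lc_def)
 finally show "dd d q (psih q X) m = psih (d + q) (dp d X) m" .
qed

text \<open>By \<open>dd_psih\<close> the commutator of the linear field of D with the field of X is
  the field of D X; \<open>Ph_comm_mono\<close> turns this into a statement about operators.\<close>

lemma P_act_in: assumes X: "X : hp L q" and v: "v <: SA"
 shows "P d (act (jm X) v) = act (jm (dp d X)) v +[SA] sg SA (d * q) (act (jm X) (P d v))"
proof -
 let ?H = "Ph q (psih q X)" and ?G = "Ph (d + q) (psih (d + q) (dp d X))"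
 note dX = hHomD(2)[OF dp[of d] X]
 note H = Ph_hHom[OF psih[OF X]] and G = Ph_hHom[OF psih[OF dX]]
 have c1: "addmap SA SA (%v. P d (?H v))" by(rule am_o[OF hHom_am[OF H] hHom_am[OF P]])
 have c2: "addmap SA SA (%v. ?G v +[SA] sg SA (d * q) (?H (P d v)))"
  by(rule S.Q.am_add[OF hHom_am[OF G] am_o[OF am_o[OF hHom_am[OF P] hHom_am[OF H]] S.Q.sg_am]])
 have "P d (?H v) = ?G v +[SA] sg SA (d * q) (?H (P d v))" proof (rule lin_eqI[OF c1 c2 _ _ _ v])
  show "P d (?H (u *[SA] kp a)) = P d (?H u) *[SA] kp a" if "u <: SA" "a <: K" for u a
   using that hHom_c[OF H] by(simp add: EE_rs[OF H] EE_rs[OF P])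
  show "?G (u *[SA] kp a) +[SA] sg SA (d * q) (?H (P d (u *[SA] kp a))) = (?G u +[SA] sg SA (d * q) (?H (P d u))) *[SA] kp a"
   if "u <: SA" "a <: K" for u a using that hHom_c[OF H] hHom_c[OF G] P_closed
   by(simp add: EE_rs[OF H] EE_rs[OF P] EE_rs[OF G] S.Q.l_distr sg_mult_left)
  fix n p m assume m: "S.hmono n p m"
  note mc = S.hmonoc[OF m]
  have "xS (?H u) = psih q X u" if "u <: SA" for u using fun_cong[OF xS_Ph[OF psih[OF X]], of u] that by simp
  hence "cmp (Y d) ?H = EF d (psih q X)" using hHom_c[OF H] by(auto simp: fun_eq_iff cmp_def Y_app EF_def)
  hence "cmt d q (Y d) (psih q X) = psih (d + q) (dp d X)" unfolding dd_psih[OF X, symmetric] cmt_def dd_def P_def by simp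
  thus "P d (?H m) = ?G m +[SA] sg SA (d * q) (?H (P d m))"
   using Ph_comm_mono[OF m Y[of d] psih[OF X]] hHom_c[OF G mc] hHom_c[OF H P_closed[OF mc, of d]] by(simp add: P_def S.Q.a_comm)
 qed
 thus ?thesis using v P_closed by(simp add: act_in0[OF X] act_in0[OF dX])
qed

lemma act_add_zero: "v <: SA ==> act 0[UA] v = 0[SA]"
proof -
 assume v: "v <: SA"
 have "addmap UA SA (%u. act u v)" by(rule addmapI) (simp_all add: actD v)
 thus ?thesis by(rule am_zn(1)[OF U.Q.abx S.Q.abx])
qed

lemma act_sg: "u <: UA ==> v <: SA ==> act (sg UA k u) v = sg SA k (act u v)"
 "u <: UA ==> v <: SA ==> act u (sg SA k v) = sg SA k (act u v)" using is_act_sg(1)[OF U.Q.ring_axioms S.Q.abx act_action]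
  am_zn(3)[OF S.Q.abx S.Q.abx actD(1)] by blast+

text \<open>The supercommutator of \<open>P d\<close> with an operator from U(g) comes from U(g)
  again; the witness is assembled along the word by the Leibniz rule.\<close>

lemma act_der: "x : hp UA i ==> EX x':car UA. ALL v:car SA. P d (act x v) = act x' v +[SA] sg SA (d * i) (act x (P d v))"
proof (induction rule: U.Q_hp_ind)
 case (zero i)
 thus ?case by(intro bexI[of _ "0[UA]"]) (simp_all add: act_add_zero P_zero P_closed)
next
 case (scal j a)
 thus ?case using P_closed by(intro bexI[of _ "0[UA]"]) (simp_all add: act_add_zero act_scal P_scal K.hpc)
next
 case (mult p X j y)
 then obtain y' where y': "y' <: UA" "ALL v:car SA. P d (act y v) = act y' v +[SA] sg SA (d * j) (act y (P d v))" by blast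
 note c = hpc[OF mult(1)] U.Q.hpc[OF mult(2)]
 have dX: "jm (dp d X) <: UA" using dp_closed c by simp
 show ?case proof (intro bexI[of _ "jm (dp d X) *[UA] y +[UA] sg UA (d * p) (jm X *[UA] y')"] ballI)
  fix v assume v: "v <: SA"
  note ac = actD(2)[OF c(2) v] actD(2)[OF y'(1) v] actD(2)[OF c(2) P_closed[OF v, of d]]
  have "P d (act (jm X *[UA] y) v) = act (jm (dp d X)) (act y v) +[SA] sg SA (d * p) (act (jm X) (P d (act y v)))"
   using c v by(simp add: actD(5) P_act_in[OF mult(1) ac(1)])
  also have "P d (act y v) = act y' v +[SA] sg SA (d * j) (act y (P d v))" using y'(2) v by blast
  finally show "P d (act (jm X *[UA] y) v) = act (jm (dp d X) *[UA] y +[UA] sg UA (d * p) (jm X *[UA] y')) v +[SA]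
    sg SA (d * (p + j)) (act (jm X *[UA] y) (P d v))" using c v y'(1) ac dX P_closed[OF v, of d]
   by(simp add: actD(2,3,4,5) act_sg S.Q.sg_add S.Q.sg_sg S.Q.a_assoc distrib_left)
 qed (use c dX y' in simp)
next
 case (add j x y)
 then obtain x' y' where h: "x' <: UA" "ALL v:car SA. P d (act x v) = act x' v +[SA] sg SA (d * j) (act x (P d v))"
  "y' <: UA" "ALL v:car SA. P d (act y v) = act y' v +[SA] sg SA (d * j) (act y (P d v))" by blast
 show ?case by(rule bexI[of _ "x' +[UA] y'"]) (use add(1,2) h P_closed in "simp_all add: actD(2,4) P_add S.Q.sg_add S.Q.a_ac")
qed

text \<open>The derivation is carried from S(g) to U(g) through the symbol map, so compatibility
  with its inverse is built in and the Leibniz rule is what has to be proved.\<close>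

definition "PU d = (\<lambda>u\<in>car UA. r (P d (\<sigma> u)))"

lemma PU: "PU d : hHom K UA UA d"
proof (rule hHomI, rule HomI)
 show "PU d (x .[UA] a) = PU d x .[UA] a" if "x <: UA" "a <: K" for x a
  using that P_closed by(simp add: PU_def U.Q_rs sig_rs EE_rs[OF P] r_rs)
 show "PU d x : hp UA (d + i)" if "x : hp UA i" for i x
  using r_hpart[OF hHomD(2)[OF P sig_hp[OF that]]] U.Q.hpc[OF that] by(simp add: PU_def)
qed (use P_closed in "simp_all add: PU_def amD2[OF sig_am] P_add r_add")

text \<open>\<open>P d\<close> kills 1, so evaluating \<open>act_der\<close> at 1 shows that its
  witness has the symbol P d (\<sigma> x). By injectivity of the symbol map the witness is
  \<open>PU d x\<close>.\<close>

lemma PU_act: assumes x: "x : hp UA i" and v: "v <: SA" shows "P d (act x v) = act (PU d x) v +[SA] sg SA (d * i) (act x (P d v))"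
proof -
 note xc = U.Q.hpc[OF x]
 obtain x' where x': "x' <: UA" "!!v. v <: SA ==> P d (act x v) = act x' v +[SA] sg SA (d * i) (act x (P d v))"
  using act_der[OF x, of d] by blast
 have "act x 0[SA] = 0[SA]" by(rule am_zn(1)[OF S.Q.abx S.Q.abx actD(1)[OF xc]])
 hence "P d (\<sigma> x) = \<sigma> x'" using x'(2)[OF S.Q.one_closed] x'(1) xc by(simp add: sig_eq P_one actD(2))
 hence "PU d x = x'" using x'(1) xc by(simp add: PU_def)
 thus ?thesis using x'(2)[OF v] by simp
qed

definition "DU = (\<lambda>x\<in>car UA. PU 0 x +[UA] PU 1 x)"

lemma DU: "superderivation K UA (monoid.mult UA) DU" unfolding DU_def
proof (rule U.derI[OF PU])
 fix d i x y assume x: "x : hp UA i" and y: "y <: UA"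
 note xc = U.Q.hpc[OF x]
 note Pc = hHom_c[OF PU]
 have sP: "\<sigma> (PU d u) = P d (\<sigma> u)" if "u <: UA" for u using that P_closed by(simp add: PU_def)
 have ss: "\<sigma> (sg UA k u) = sg SA k (\<sigma> u)" if "u <: UA" for k u using am_zn(3)[OF U.Q.abx S.Q.abx sig_am that] .
 have "\<sigma> (PU d (x *[UA] y)) = \<sigma> (PU d x *[UA] y +[UA] sg UA (d * i) (x *[UA] PU d y))"
  using xc y Pc by(simp add: sP sig_mult PU_act[OF x] amD2[OF sig_am] ss)
 thus "PU d (x *[UA] y) = PU d x *[UA] y +[UA] sg UA (d * i) (x *[UA] PU d y)"
  using xc y Pc r_sig by(metis U.Q.m_closed U.Q.a_closed U.Q.sg_c)
qed

lemma sig_gen: assumes X: "X <: L" shows "\<sigma> (jm X) = io X" using X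
proof (induction rule: hom_ind)
 case (hom p X)
 thus ?case by(simp add: sig_eq hpc act_in0[OF hom] Ph_one[OF psih[OF hom]] psih_one[OF hom])
qed (simp add: U.qin_add S.qin_add amD2[OF sig_am])

lemma DU_eq: "u <: UA ==> DU u = r (DS (\<sigma> u))" using P_closed by(simp add: DU_def DS_def PU_def r_add)

lemma ext_der_U: "ext_derivation K L UA (env_in K L) D = DU" unfolding ext_derivation_def
proof (rule the_equality)
 have "DU (jm X) = jm (D X)" if X: "X <: L" for X using X HomD(2)[OF D_Hom X] by(simp add: DU_eq sig_gen DS_in r_eqI)
 thus d: "superderivation K UA (monoid.mult UA) DU & (ALL X:car L. DU (jm X) = jm (D X))" using DU by blast
 show "E = DU" if "superderivation K UA (monoid.mult UA) E & (ALL X:car L. E (jm X) = jm (D X))" for E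
  by(rule U.der_uniq) (use that d in auto)
qed

theorem ext_der_comm:
 "x <: SA ==> r (ext_derivation K L SA (sym_in K L) D x) = ext_derivation K L UA (env_in K L) D (r x)"
 by(simp add: ext_der_S ext_der_U DU_eq)

end

section \<open>Extension of automorphisms and their compatibility with the symbol map\<close>

section \<open>Automorphisms\<close>

lemma inv_par: assumes M: "smodule K M" and N: "smodule K N" and f: "addmap M N f" "bij_betw f (car M) (car N)"
  and p: "!!i x. x : hp M i ==> f x : hp N i" and x: "x <: M" "f x : hp N i" shows "x : hp M i"
proof -
 interpret M: smodule K M by fact
 interpret N: smodule K N by fact
 let ?v = "hcomp M i x" and ?w = "hcomp M (i + 1) x"
 have h: "?v : hp M i" "?w : hp M (i + 1)" using M.hcomp_h[OF x(1)] by blast+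
 note c = M.hpc[OF h(1)] M.hpc[OF h(2)]
 have "x = ?v +[M] ?w" using M.hcomp_sum[OF x(1)] c by(cases i) (simp_all add: M.a_comm)
 hence "f x = f ?v +[N] f ?w" using amD2[OF f(1) c] by simp
 hence "hcomp N i (f x) = f ?v" using N.hcomp_eq[OF p[OF h(1)] p[OF h(2)]] by simp
 hence "f ?v = f x" using N.hcomp_hom[OF x(2), of i] by simp
 hence "?v = x" using f(2) c x(1) by(auto simp: bij_betw_def inj_on_def)
 thus ?thesis using h(1) by simp
qed

context talg begin

lemma sahom_uniq:
 assumes F: "F : superalg_hom K Q Q" and G: "G : superalg_hom K Q Q" and eq: "!!X. X <: M ==> F (qin X) = G (qin X)" shows "F = G"
proof -
 have h: "F : Hom K Q Q" "F : ring_hom Q Q" "G : Hom K Q Q" "G : ring_hom Q Q" using F G by(auto simp: superalg_hom_def)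
 note Fr = ring_homD[OF h(2)] and Gr = ring_homD[OF h(4)]
 show ?thesis proof (rule Q_Hom_eqI[OF h(1,3) Q.abx])
  fix n p m assume "hmono n p m"
  thus "F m = G m" by(induction rule: hmono.induct) (simp_all add: Fr Gr eq hpc hmonoc)
 qed
qed

lemma sahom_ex: assumes f: "f : Hom K M M" "!!i x. x : hp M i ==> f x : hp M i"
  and z: "!!h r. h : ring_hom T Q ==> (!!X. X <: M ==> h (tin X) = qin (f X)) ==> r : Gn ==> h r = 0[Q]"
 obtains F where "F : superalg_hom K Q Q" "!!X. X <: M ==> F (qin X) = qin (f X)" "!!a. a <: K ==> F (qscal a) = qscal a"
proof -
 note fc = HomD(2)[OF f(1)]
 have fl: "f (lsmult K M a X) = lsmult K M a (f X)" if "X <: M" "a <: K" for X a proof -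
  have F: "f : hHom K M M 0" by(rule hHomI[OF f(1)]) (use f(2) in simp)
  show ?thesis using that(2) proof (induction rule: K.hom_ind)
   case (hom i a)
   thus ?case using hHom_ls[OF smodule_axioms smodule_axioms F hom that(1)] by simp
  next
   case (add a b)
   thus ?case using that(1) fc by(simp add: lsm_addl HomD(4)[OF f(1)])
  qed
 qed
 obtain h where h: "h : ring_hom T Q" "!!X. X <: M ==> h (tin X) = qin (f X)" "!!a. a <: K ==> h (tscal a) = qscal a"
 proof (rule tensor_univ[OF Q_ring _ qscal_am qscal_one, of "%X. qin (f X)"])
  show "addmap M Q (%X. qin (f X))" by(rule am_o[OF HomD(1)[OF f(1)] qin_am])
 qed (use fc HomD(5)[OF f(1)] fl in "simp_all add: qscal_mult qin_rs qin_ls")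
 obtain F where F: "F : ring_hom Q Q" "!!t. t <: T ==> F (pq t) = h t" using Q_univ[OF Q_ring h(1) z[OF h(1,2)]] by blast
 note Fr = ring_homD[OF F(1)]
 have g: "F (qin X) = qin (f X)" if "X <: M" for X using F(2)[of "tin X"] h(2) that by(simp add: pq_tin)
 have k: "F (qscal a) = qscal a" if "a <: K" for a using F(2)[of "tscal a"] h(3) that by(simp add: pq_tscal)
 let ?F = "restrict F (car Q)"
 have "?F : Hom K Q Q" by(rule HomI) (simp_all add: Fr Q_rs k)
 moreover have "?F : ring_hom Q Q" by(rule ring_hom_memI) (simp_all add: Fr)
 moreover have "F u : hp Q i" if "u : hp Q i" for u i using that proof (induction rule: Q_hp_ind)
  case (zero i)
  have "addmap Q Q F" by(rule addmapI) (simp_all add: Fr)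
  from am_zn(1)[OF Q.abx Q.abx this] show ?case by simp
 next
  case (scal j a) thus ?case using qscal_hp by(simp add: k K.hpc)
 next
  case (mult p X j y)
  thus ?case using Q_hp_mult[OF qin_hp[OF f(2)[OF mult(1)]] mult(3)] by(simp add: Fr g hpc Q.hpc)
 qed (simp add: Fr Q.hp_add)
 hence "preserves_parity Q Q ?F" using Q.hpc by(auto simp: preserves_parity_def)
 ultimately show thesis using that[of ?F] g k by(simp add: superalg_hom_def)
qed

lemma sahom_id: "(\<lambda>x\<in>car Q. x) : superalg_hom K Q Q"
 using Q.hpc by(auto simp: superalg_hom_def preserves_parity_def ring_hom_def Q.rsc intro!: HomI simp del: Q_rs)

lemma sahom_o: assumes "F : superalg_hom K Q Q" "G : superalg_hom K Q Q" shows "compose (car Q) F G : superalg_hom K Q Q"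
proof -
 have h: "F : Hom K Q Q" "F : ring_hom Q Q" "G : Hom K Q Q" "G : ring_hom Q Q"
  "!!i x. x : hp Q i ==> F x : hp Q i" "!!i x. x : hp Q i ==> G x : hp Q i"
  using assms by(auto simp: superalg_hom_def preserves_parity_def image_subset_iff)
 note Fr = ring_homD[OF h(2)] and Gr = ring_homD[OF h(4)]
 show ?thesis unfolding superalg_hom_def proof (intro CollectI conjI)
  show "compose (car Q) F G : Hom K Q Q"
   by(rule HomI) (use HomD(5)[OF h(1)] HomD(5)[OF h(3)] in "simp_all add: compose_def Fr Gr Q.rsc del: Q_rs")
  show "compose (car Q) F G : ring_hom Q Q" by(rule ring_hom_memI) (simp_all add: compose_def Fr Gr)
  show "preserves_parity Q Q (compose (car Q) F G)" using h(5,6) Q.hpc by(auto simp: preserves_parity_def compose_def)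
 qed
qed

end

locale lie_aut = pbw K L for K :: "'k sring" and L :: "('k, 'g) lie_sring" (structure) +
 fixes f assumes f: "lie_automorphism K L f"
begin

lemma f_Hom: "f : Hom K L L" and f_bij: "bij_betw f (car L) (car L)" and f_hpart: "x : hp L i ==> f x : hp L i"
 and f_br: "x <: L ==> y <: L ==> f (br x y) = br (f x) (f y)" using f by(auto simp: lie_automorphism_def preserves_parity_def)

lemmas f_closed [simp] = HomD(2)[OF f_Hom] and f_add = HomD(4)[OF f_Hom] and f_rsmult = HomD(5)[OF f_Hom]

lemma f_sg: "x <: L ==> f (sg L k x) = sg L k (f x)" using am_zn(3)[OF abx abx HomD(1)[OF f_Hom]] .

lemma f_zero: "f \<zero> = \<zero>" using am_zn(1)[OF abx abx HomD(1)[OF f_Hom]] .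

lemma ex_fS: "EX F. F : superalg_hom K SA SA & (ALL X:car L. F (io X) = io (f X)) & (ALL a:car K. F (kp a) = kp a)"
proof (rule S.sahom_ex[OF f_Hom f_hpart])
 fix h g assume h: "h : ring_hom T SA" "!!X. X <: L ==> h (tin X) = io (f X)" and g: "g : sym_gens"
 note hr = ring_homD[OF h(1)]
 have ha: "addmap T SA h" by(rule addmapI) (simp_all add: hr)
 note hm = am_zn(3,4)[OF T.abx S.Q.abx ha]
 from g consider (1) v w i j where "g = tw K L [v, w] -[T] sg T (i * j) (tw K L [w, v])" "v : hp L i" "w : hp L j"
  | (2) u where "g = tw K L [u, u]" "u : hp L 1" unfolding sym_gens_def by blast
 thus "h g = 0[SA]" proof cases
  case 1
  note c = hpc[OF 1(2)] hpc[OF 1(3)]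
  have "h g = io (f v) *[SA] io (f w) -[SA] sg SA (i * j) (io (f w) *[SA] io (f v))"
   using c by(simp add: 1(1) tensor_word2 hm hr h(2))
  thus ?thesis using c sym_comm[OF f_hpart[OF 1(2)] f_hpart[OF 1(3)]] by(simp add: a_minus_def S.Q.r_neg)
 next
  case 2
  thus ?thesis using hpc[OF 2(2)] sym_odd[OF f_hpart[OF 2(2)]] by(simp add: tensor_word2 hr h(2))
 qed
qed auto

lemma ex_fU: "EX F. F : superalg_hom K UA UA & (ALL X:car L. F (jm X) = jm (f X)) & (ALL a:car K. F (U.qscal a) = U.qscal a)"
proof (rule U.sahom_ex[OF f_Hom f_hpart])
 fix h g assume h: "h : ring_hom T UA" "!!X. X <: L ==> h (tin X) = jm (f X)" and g: "g : env_gens"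
 note hr = ring_homD[OF h(1)]
 have ha: "addmap T UA h" by(rule addmapI) (simp_all add: hr)
 note hm = am_zn(3,4)[OF T.abx U.Q.abx ha]
 obtain v w i j where g: "g = tw K L [v, w] -[T] sg T (i * j) (tw K L [w, v]) -[T] tin (br v w)"
  and vw: "v : hp L i" "w : hp L j" using g unfolding env_gens_def by blast
 note c = hpc[OF vw(1)] hpc[OF vw(2)] hpc[OF lbr_hpart[OF vw]]
 have "h g = jm (f v) *[UA] jm (f w) -[UA] sg UA (i * j) (jm (f w) *[UA] jm (f v)) -[UA] jm (br (f v) (f w))"
  using c by(simp add: g tensor_word2 hm hr h(2) f_br)
 also have "... = 0[UA]" unfolding env_comm[OF f_hpart[OF vw(1)] f_hpart[OF vw(2)]]
  using c lbr_closed by(simp add: a_minus_def U.Q.a_ac U.Q.r_neg U.Q.r_neg1 U.Q.r_neg2)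
 finally show "h g = 0[UA]" .
qed auto

definition "fS = (SOME F. F : superalg_hom K SA SA & (ALL X:car L. F (io X) = io (f X)) & (ALL a:car K. F (kp a) = kp a))"
definition "fU = (SOME F. F : superalg_hom K UA UA & (ALL X:car L. F (jm X) = jm (f X)) & (ALL a:car K. F (U.qscal a) = U.qscal a))"

lemma fS: "fS : superalg_hom K SA SA" "X <: L ==> fS (io X) = io (f X)" "a <: K ==> fS (kp a) = kp a"
 using someI_ex[OF ex_fS, folded fS_def] by blast+

lemma fU: "fU : superalg_hom K UA UA" "X <: L ==> fU (jm X) = jm (f X)" "a <: K ==> fU (U.qscal a) = U.qscal a"
 using someI_ex[OF ex_fU, folded fU_def] by blast+

lemma fS_ring: "fS : ring_hom SA SA" and fU_ring: "fU : ring_hom UA UA" and fS_hpart: "x : hp SA i ==> fS x : hp SA i"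
 using fS(1) fU(1) by(auto simp: superalg_hom_def preserves_parity_def)

lemmas fSr = ring_homD[OF fS_ring] and fUr = ring_homD[OF fU_ring]

lemma fS_mono: "S.hmono n p m ==> S.hmono n p (fS m)"
proof (induction rule: S.hmono.induct)
 case one show ?case using S.hmono.one by(simp add: fSr)
next
 case (mult n p m X q)
 thus ?case using S.hmono.mult[OF mult(3) f_hpart[OF mult(2)]] by(simp add: fSr fS hpc S.hmonoc)
qed

text \<open>Equivariance is a relation between two maps because differentiation changes both:
  \<open>dl X F\<close> corresponds to the derivative of F' in the direction f X.\<close>

definition "rel F F' \<longleftrightarrow> (ALL n p m. S.hmono n p m --> F' (fS m) = f (F m))"

lemma relD: "rel F F' ==> S.hmono n p m ==> F' (fS m) = f (F m)" unfolding rel_def by blast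

lemma rel_one: "rel F F' ==> F' 1[SA] = f (F 1[SA])" using relD[OF _ S.hmono.one] by(simp add: fSr)

lemma rel_dl: assumes "rel F F'" "X : hp L q" shows "rel (dl X F) (dl (f X) F')" unfolding rel_def
proof (intro allI impI)
 fix n p m assume m: "S.hmono n p m"
 note mc = S.hmonoc[OF m]
 have "fS (io X *[SA] m) = io (f X) *[SA] fS m" using hpc[OF assms(2)] mc by(simp add: fSr fS)
 thus "dl (f X) F' (fS m) = f (dl X F m)" using relD[OF assms(1) S.hmono.mult[OF m assms(2)]] mc by(simp add: fSr)
qed

lemma rel_brc_mono: assumes "S.hmono n p m" "F : C d" "G : C e" "F' : C d" "G' : C e" "rel F F'" "rel G G'"
 shows "brc e F' G' (fS m) = f (brc e F G m)" using assms
proof (induction arbitrary: d e F G F' G' rule: S.hmono.induct)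
 case one
 have "F' 1[SA] = f (F 1[SA])" "G' 1[SA] = f (G 1[SA])" using rel_one one(5,6) by blast+
 thus ?case using f_br[OF hHom_c[OF one(1) S.Q.one_closed] hHom_c[OF one(2) S.Q.one_closed]]
  by(simp add: fSr conv_one[OF bil_br one(1,2)] conv_one[OF bil_br one(3,4)])
next
 case (mult n p m X q)
 note mc = S.hmonoc[OF mult(1)] and Xc = hpc[OF mult(2)] and fX = f_hpart[OF mult(2)]
 note dF = dl_hHom[OF mult(2,4)] and dG = dl_hHom[OF mult(2,5)] and dF' = dl_hHom[OF fX mult(6)] and dG' = dl_hHom[OF fX mult(7)]
 have e: "fS (io X *[SA] m) = io (f X) *[SA] fS m" using Xc mc by(simp add: fSr fS)
 have c: "brc e (dl X F) G m <: L" "brc (e + q) F (dl X G) m <: L" using brc_c[OF dF mult(5) mc] brc_c[OF mult(4) dG mc] by blast+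
 show ?case unfolding e conv_in[OF bil_br mult(6,7) fX fSr(2)[OF mc]] conv_in[OF bil_br mult(4,5,2) mc]
   mult(3)[OF dF mult(5) dF' mult(7) rel_dl[OF mult(8,2)] mult(9)] mult(3)[OF mult(4) dG mult(6) dG' mult(8) rel_dl[OF mult(9,2)]]
  using c by(simp add: f_add f_sg)
qed

lemma eps_fS: "S.hmono n p m ==> eps (fS m) = eps m"
proof (induction rule: S.hmono.induct)
 case one show ?case by(simp add: fSr)
next
 case (mult n p m X q)
 thus ?case by(simp add: fSr fS eps_in hpc S.hmonoc)
qed

lemma rel_xS: "rel xS xS" unfolding rel_def
proof (intro allI impI)
 fix n p m assume "S.hmono n p m"
 thus "xS (fS m) = f (xS m)" proof (cases rule: S.hmono.cases)
  case one
  thus ?thesis by(simp add: fSr xS_def prL_one f_zero)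
 next
  case (mult n' p' m' X q)
  thus ?thesis using hpc[of X q] S.hmonoc[of n' p' m'] amD1[OF eps_addmap, of m'] eps_fS[of n' p' m']
   by(simp add: fSr fS xS_def prL_in f_rsmult)
 qed
qed

lemma rel_cst: "a <: L ==> rel (cst a) (cst (f a))" unfolding rel_def
proof (intro allI impI)
 fix n p m assume a: "a <: L" and m: "S.hmono n p m"
 show "cst (f a) (fS m) = f (cst a m)" using S.hmonoc[OF m] amD1[OF eps_addmap, of m] a by(simp add: fSr eps_fS[OF m] f_rsmult)
qed

lemma rel_Tp: "F : C d ==> F' : C d ==> rel F F' ==> rel (Tp d n F) (Tp d n F')"
proof (induction n)
 case (Suc n)
 note r = Suc.IH[OF Suc.prems]
 show ?case unfolding rel_def Tp_Suc
  using rel_brc_mono[OF _ xS Tp_hHom[OF Suc.prems(1)] xS Tp_hHom[OF Suc.prems(2)] rel_xS r] by blast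
qed simp

text \<open>The generic point is fixed, the constant a goes to the constant f a, and the bracket is
  natural; so c(ad x)(a) goes to c(ad x)(f a).\<close>

lemma rel_psih: assumes a: "a : hp L p" shows "rel (psih p a) (psih p (f a))" unfolding rel_def
proof (intro allI impI)
 fix n q m assume m: "S.hmono n q m"
 note mc = S.hmonoc[OF m]
 have "Tp p n (cst (f a)) (fS m) = f (Tp p n (cst a) m)"
  by(rule relD[OF rel_Tp[OF cst[OF a] cst[OF f_hpart[OF a]] rel_cst[OF hpc[OF a]]] m])
 thus "psih p (f a) (fS m) = f (psih p a m)"
  using hHom_c[OF Tp_hHom[OF cst[OF a]] mc] by(simp add: psih_mono[OF a m] psih_mono[OF f_hpart[OF a] fS_mono[OF m]] f_rsmult)
qed

lemma rel_Ph: assumes "S.hmono n p m" "F : C e" "F' : C e" "rel F F'" shows "Ph e F' (fS m) = fS (Ph e F m)" using assms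
proof (induction arbitrary: e F F' rule: S.hmono.induct)
 case one
 have "F' 1[SA] = f (F 1[SA])" using rel_one one(3) by blast
 thus ?case using hHom_c[OF one(1) S.Q.one_closed] by(simp add: fSr Ph_one[OF one(1)] Ph_one[OF one(2)] fS)
next
 case (mult n p m X q)
 note mc = S.hmonoc[OF mult(1)] and Xc = hpc[OF mult(2)] and fX = f_hpart[OF mult(2)]
 have e: "fS (io X *[SA] m) = io (f X) *[SA] fS m" using Xc mc by(simp add: fSr fS)
 note Pc = hHom_c[OF Ph_hHom[OF mult(4)] mc] hHom_c[OF Ph_hHom[OF dl_hHom[OF mult(2,4)]] mc]
 have "addmap SA SA fS" by(rule addmapI) (simp_all add: fSr)
 note s = am_zn(3)[OF S.Q.abx S.Q.abx this]
 show ?case unfolding e Ph_in[OF mult(5) fX fSr(2)[OF mc]] Ph_in[OF mult(4,2) mc] mult(3)[OF mult(4,5,6)]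
   mult(3)[OF dl_hHom[OF mult(2,4)] dl_hHom[OF fX mult(5)] rel_dl[OF mult(6,2)]] using Pc Xc by(simp add: fSr fS s)
qed

lemma fS_rlin: "u <: SA ==> a <: K ==> fS (u *[SA] kp a) = fS u *[SA] kp a" by(simp add: fSr fS)

text \<open>On a letter this is \<open>rel_Ph\<close> for \<open>psih\<close>, and products follow
  by induction. At v = 1 it says that the symbol map intertwines the two extensions of f.\<close>

lemma fS_act: "u <: UA ==> v <: SA ==> fS (act u v) = act (fU u) (fS v)"
proof (induction arbitrary: v rule: U.Q_ind)
 case (scal a)
 thus ?case by(simp add: act_scal fSr fS fU)
next
 case (mult X y)
 have g: "fS (act (jm X) w) = act (jm (f X)) (fS w)" if w: "w <: SA" for w using mult(1) proof (induction rule: hom_ind)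
  case (hom p X)
  note fX = f_hpart[OF hom]
  note H = Ph_hHom[OF psih[OF hom]] and H' = Ph_hHom[OF psih[OF fX]]
  have fa: "addmap SA SA fS" by(rule addmapI) (simp_all add: fSr)
  have "fS (Ph p (psih p X) w) = Ph p (psih p (f X)) (fS w)"
  proof (rule lin_eqI[OF am_o[OF hHom_am[OF H] fa] am_o[OF fa hHom_am[OF H']] _ _ _ w])
   show "fS (Ph p (psih p X) (u *[SA] kp a)) = fS (Ph p (psih p X) u) *[SA] kp a" if "u <: SA" "a <: K" for u a
    using that hHom_c[OF H] by(simp add: EE_rs[OF H] fS_rlin)
   show "Ph p (psih p (f X)) (fS (u *[SA] kp a)) = Ph p (psih p (f X)) (fS u) *[SA] kp a" if "u <: SA" "a <: K" for u a
    using that by(simp add: fS_rlin EE_rs[OF H'] fSr(2))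
   show "fS (Ph p (psih p X) m) = Ph p (psih p (f X)) (fS m)" if "S.hmono n q m" for n q m
    using rel_Ph[OF that psih[OF hom] psih[OF fX] rel_psih[OF hom]] by simp
  qed
  thus ?case using w by(simp add: act_in0[OF hom] act_in0[OF fX] fSr)
 next
  case (add X X')
  thus ?case using w by(simp add: U.qin_add actD fSr f_add)
 qed
 thus ?case using mult by(simp add: actD fUr fU fSr)
next
 case (add x y)
 thus ?case by(simp add: actD fUr fSr)
qed

lemma sig_fU: "u <: UA ==> \<sigma> (fU u) = fS (\<sigma> u)" using fS_act[of u "1[SA]"] by(simp add: sig_eq fUr fSr)

text \<open>Makes the results on extensions available for the inverse automorphism, whose extensions
  invert \<open>fS\<close> and \<open>fU\<close>.\<close>

lemma aut_inv: "lie_aut K L (restrict (inv_into (car L) f) (car L))"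
proof -
 let ?g = "restrict (inv_into (car L) f) (car L)"
 have gc: "?g x <: L" and fg: "f (?g x) = x" if "x <: L" for x
  using f_bij that by(simp_all add: bij_betw_def inv_into_into f_inv_into_f)
 have gf: "?g (f x) = x" if "x <: L" for x using f_bij that by(simp add: bij_betw_def inv_into_f_f)
 have inj: "x = y" if "x <: L" "y <: L" "f x = f y" for x y using gf that by metis
 have "lie_automorphism K L ?g" unfolding lie_automorphism_def proof (intro conjI ballI)
  show "?g : Hom K L L" proof (rule HomI)
   show "?g (x \<oplus> y) = ?g x \<oplus> ?g y" if "x <: L" "y <: L" for x y
    by(rule inj) (use that gc fg in "simp_all add: f_add del: restrict_apply'")
   show "?g (x \<bullet> a) = ?g x \<bullet> a" if "x <: L" "a <: K" for x a
    by(rule inj) (use that gc fg rsc in "simp_all add: f_rsmult del: restrict_apply'")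
  qed (use gc in simp_all)
  show "bij_betw ?g (car L) (car L)" by(rule bij_betw_byWitness[of _ f]) (use gc fg gf in auto)
  show "preserves_parity L L ?g" unfolding preserves_parity_def proof (intro allI subsetI)
   fix i y assume "y : ?g ` hp L i"
   then obtain x where x: "x : hp L i" "y = ?g x" by blast
   note xc = hpc[OF x(1)]
   show "y : hp L i"
    unfolding x(2) by(rule inv_par[OF smodule_axioms smodule_axioms HomD(1)[OF f_Hom] f_bij f_hpart gc[OF xc]]) (simp_all only: fg[OF xc] x(1))
  qed
  show "?g (br x y) = br (?g x) (?g y)" if "x <: L" "y <: L" for x y
   by(rule inj) (use that gc fg lbr_closed in "simp_all add: f_br del: restrict_apply'")
 qed
 thus ?thesis by(simp add: lie_aut_def lie_aut_axioms_def pbw_axioms)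
qed

text \<open>Both composites of F and G extend the identity of g, so they are identities by the
  uniqueness of extensions.\<close>

lemma bij_lift: assumes Q: "talg K L Gn Q qin" and F: "F : superalg_hom K Q Q" "!!X. X <: L ==> F (qin X) = qin (f X)"
  and G: "G : superalg_hom K Q Q" "!!X. X <: L ==> G (qin X) = qin (restrict (inv_into (car L) f) (car L) X)"
 shows "bij_betw F (car Q) (car Q)"
proof -
 interpret Q: talg K L Gn Q qin by fact
 let ?g = "restrict (inv_into (car L) f) (car L)"
 have gc: "?g x <: L" "f (?g x) = x" "?g (f x) = x" if "x <: L" for x
  using f_bij that by(simp_all add: bij_betw_def inv_into_into f_inv_into_f inv_into_f_f)
 have "compose (car Q) F G = (\<lambda>x\<in>car Q. x)" "compose (car Q) G F = (\<lambda>x\<in>car Q. x)"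
  by(rule Q.sahom_uniq[OF Q.sahom_o[OF F(1) G(1)] Q.sahom_id],
    use F(2) G(2) gc in "simp add: compose_def",
    rule Q.sahom_uniq[OF Q.sahom_o[OF G(1) F(1)] Q.sahom_id],
    use F(2) G(2) gc in "simp add: compose_def")
 hence "F (G x) = x" "G (F x) = x" if "x <: Q" for x using that by(auto simp: fun_eq_iff compose_def split: if_splits)
 moreover have "F x <: Q" "G x <: Q" if "x <: Q" for x using F(1) G(1) that by(auto simp: superalg_hom_def ring_hom_def)
 ultimately show ?thesis by(intro bij_betw_byWitness[of _ G]) auto
qed

lemma ext_aut_S: "ext_automorphism K L SA (sym_in K L) f = fS" unfolding ext_automorphism_def
proof (rule the_equality)
 interpret G: lie_aut K L "restrict (inv_into (car L) f) (car L)" by(rule aut_inv)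
 show "fS : superalg_hom K SA SA & bij_betw fS (car SA) (car SA) & (ALL X:car L. fS (io X) = io (f X))"
  using fS bij_lift[OF S.talg_axioms fS(1,2) G.fS(1,2)] by blast
 show "E = fS" if "E : superalg_hom K SA SA & bij_betw E (car SA) (car SA) & (ALL X:car L. E (io X) = io (f X))" for E
  by(rule S.sahom_uniq[OF _ fS(1)]) (use that fS(2) in auto)
qed

lemma ext_aut_U: "ext_automorphism K L UA (env_in K L) f = fU" unfolding ext_automorphism_def
proof (rule the_equality)
 interpret G: lie_aut K L "restrict (inv_into (car L) f) (car L)" by(rule aut_inv)
 show "fU : superalg_hom K UA UA & bij_betw fU (car UA) (car UA) & (ALL X:car L. fU (jm X) = jm (f X))"
  using fU bij_lift[OF U.talg_axioms fU(1,2) G.fU(1,2)] by blast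
 show "E = fU" if "E : superalg_hom K UA UA & bij_betw E (car UA) (car UA) & (ALL X:car L. E (jm X) = jm (f X))" for E
  by(rule U.sahom_uniq[OF _ fU(1)]) (use that fU(2) in auto)
qed

theorem ext_aut_comm:
 "x <: SA ==> r (ext_automorphism K L SA (sym_in K L) f x) = ext_automorphism K L UA (env_in K L) f (r x)"
 unfolding ext_aut_S ext_aut_U by(rule r_eqI) (simp_all add: sig_fU fUr)

end

section \<open>Assembly of the theorem\<close>

context pbw begin

theorem strong_PBW: "strong_PBW K L r" unfolding strong_PBW_def
proof (intro conjI allI impI ballI)
 show "preserves_parity SA UA r" using r_hpart by(auto simp: preserves_parity_def)
 show "gr_map K L r = j_tilde K L" by(simp add: gr_map_eq j_tilde_eq)
 show "r (ext_derivation K L SA (sym_in K L) D x) = ext_derivation K L UA (env_in K L) D (r x)"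
  if "lie_derivation K L D" "x <: SA" for D x proof -
  interpret lie_der K L D by unfold_locales (use that(1) in "simp add: lie_derivation_def")
  show ?thesis by(rule ext_der_comm[OF that(2)])
 qed
 show "r (ext_automorphism K L SA (sym_in K L) f x) = ext_automorphism K L UA (env_in K L) f (r x)"
  if "lie_automorphism K L f" "x <: SA" for f x proof -
  interpret lie_aut K L f by unfold_locales (rule that(1))
  show ?thesis by(rule ext_aut_comm[OF that(2)])
 qed
qed (use r_Hom r_bij r_sym_pow in blast)+

end

theorem theorem8p1:
  fixes K :: "'k sring" and L :: "('k, 'g) lie_sring"
  assumes "lie_superalgebra K L"
    and "[(2::nat)] \<cdot>\<^bsub>K\<^esub> \<one>\<^bsub>K\<^esub> \<in> Units K \<or> carrier K = hpart K 0 \<and> carrier L = hpart L 0"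
    and "(\<forall>n::nat. n > 0 \<longrightarrow> [n] \<cdot>\<^bsub>K\<^esub> \<one>\<^bsub>K\<^esub> \<in> Units K) \<or>
         (\<exists>N\<ge>2. lie_nilpotent L N \<and> (\<forall>n\<in>{2..N}. [n] \<cdot>\<^bsub>K\<^esub> \<one>\<^bsub>K\<^esub> \<in> Units K))"
  shows "bij_betw (symbol_map K L) (carrier (env_alg K L)) (carrier (sym_alg K L)) \<and>
         strong_PBW K L
           (\<lambda>x\<in>carrier (sym_alg K L). inv_into (carrier (env_alg K L)) (symbol_map K L) x)"
proof -
 interpret lie_superalgebra K L by(rule assms(1))
 interpret lsa K L by unfold_locales
 have todd_ok unfolding todd_ok_def proof
  fix n
  from assms(3) show "(ALL k<=Suc n. kgood (td k)) \<or> car L <= ZN (Suc n)" proof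
   assume "ALL n::nat. n > 0 --> [n] \<cdot>\<^bsub>K\<^esub> 1[K] : Units K"
   thus ?thesis by(simp add: kgood_todd)
  next
   assume "EX N>=2. lie_nilpotent L N & (ALL n:{2..N}. [n] \<cdot>\<^bsub>K\<^esub> 1[K] : Units K)"
   then obtain N where N: "lie_nilpotent L N" "!!n. n : {2..N} ==> [n] \<cdot>\<^bsub>K\<^esub> 1[K] : Units K" by blast
   \<comment> \<open>The coefficients up to c_(n+1) need the integers up to n + 2 inverted, which is
     granted while n + 2 <= N; from n + 1 >= N on, nilpotency takes over.\<close>
   show ?thesis proof (cases "Suc n < N")
    case True
    hence "kgood (td k)" if "k <= Suc n" for k using that by(intro kgood_todd N(2)) auto
    thus ?thesis by blast
   next
    case False
    have "car L <= ZN N" using N(1) by(auto simp: ZN_def lie_nilpotent_def)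
    thus ?thesis using ZN_mono[of _ N "Suc n"] False by auto
   qed
  qed
 qed
 then interpret pbw K L by unfold_locales (use assms(2) in auto)
 show ?thesis using sig_bij strong_PBW unfolding r_def by blast
qed

end
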